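(* Let $A=(a_{ij})_{1\le i,j\le n}$ satisfy $a_{ij}=a_{ji}\ge0$ for $1\le i,j\le n$, and let $\vec cU=(c_1,\dots,c_n)U\in\mathbb{R}^nU$ be a positive vector solution of the system $-\Delta u_i+\lambda u_i=\sum_{j=1}^na_{ij}u_iu_j^2$ in $\Omega$, $u_i\in H$, $1\le i\le n$. Assume that $A$ is nonsingular and that $U$ is a nondegenerate solution of $\Delta u-\lambda u+u^3=0$ in $\Omega$, $u=0$ on $\partial\Omega$, in $H$. Then an open neighborhood $V$ of $(c_1,\dots,c_n)U$ in $M_n$ is a smooth manifold of codimension $n$ (in $\mathbf{H}$), and $(c_1,\dots,c_n)U$ is a strict local minimum point of $I$ on $V\subset M_n$.
   Context: $\Omega\subset\mathbb{R}^N$ is a domain, $N\le 3$, $\lambda>0$. $H=H^1_0(\Omega)$, except that if $\Omega=\mathbb{R}^N$ then $H$ is the subspace of radially symmetric functions in $H^1(\mathbb{R}^N)$; $\mathbf{H}=H^n$. $U\in H$ is a least energy positive solution of the scalar equation; it is nondegenerate in $H$ if $\psi=0$ is the only $\psi\in H$ with $\Delta\psi-\lambda\psi+3U^2\psi=0$. $\mathbb{R}^nU=\{\vec cU\mid\vec c\in\mathbb{R}^n\}$. A positive vector solution is a solution with $u_i>0$ in $\Omega$ for every $i$. $I(\vec u)=\frac12\sum_{i=1}^n\int_\Omega(|\nabla u_i|^2+\lambda u_i^2)\,dx-\frac14\int_\Omega\sum_{i,j=1}^na_{ij}u_i^2u_j^2\,dx$ on $\mathbf{H}$. For $l\in\{1,\dots,n\}$,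 $J_l(\vec u)=I'(\vec u)(0,\dots,0,u_l,0,\dots,0)$ ($u_l$ in the $l$-th slot), and $$M_n=\{\vec u=(u_1,\dots,u_n)\in\mathbf{H}\mid J_i(\vec u)=0,\ u_j\ne0\text{ for }1\le i,j\le n\}.$$ *)

theory Defs
  imports "HOL-Analysis.Analysis"
begin

section \<open>Square integrable functions modulo equality almost everywhere\<close>

definition square_integrable :: "('a::euclidean_space \<Rightarrow> 'b::euclidean_space) \<Rightarrow> bool" where
  "square_integrable f \<longleftrightarrow> f \<in> borel_measurable lborel \<and> integrable lborel (\<lambda>x. (norm (f x))\<^sup>2)"

definition L2_eq :: "('a::euclidean_space \<Rightarrow> 'b::euclidean_space) \<Rightarrow> ('a \<Rightarrow> 'b) \<Rightarrow> bool" where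
  "L2_eq f g \<longleftrightarrow> square_integrable f \<and> square_integrable g \<and> (AE x in lborel. f x = g x)"

lemma square_integrable_zero: "square_integrable (\<lambda>x. 0)"
  by (simp add: square_integrable_def)

lemma square_integrable_scaleR:
  "square_integrable f \<Longrightarrow> square_integrable (\<lambda>x. r *\<^sub>R f x)"
  by (auto simp: square_integrable_def power_mult_distrib)

lemma square_integrable_add:
  assumes "square_integrable f" "square_integrable g"
  shows "square_integrable (\<lambda>x. f x + g x)"
proof -
  have [measurable]: "f \<in> borel_measurable lborel" "g \<in> borel_measurable lborel"
    using assms by (auto simp: square_integrable_def)
  have "integrable lborel (\<lambda>x. 2 * (norm (f x))\<^sup>2 + 2 * (norm (g x))\<^sup>2)"
    using assms by (auto simp: square_integrable_def)
  then have "integrable lborel (\<lambda>x. (norm (f x + g x))\<^sup>2)"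
  proof (rule Bochner_Integration.integrable_bound)
    show "AE x in lborel. norm ((norm (f x + g x))\<^sup>2)
        \<le> norm (2 * (norm (f x))\<^sup>2 + 2 * (norm (g x))\<^sup>2)"
    proof (rule AE_I2)
      fix x
      have "(norm (f x + g x))\<^sup>2 \<le> (norm (f x) + norm (g x))\<^sup>2"
        by (intro power_mono norm_triangle_ineq) simp
      also have "\<dots> \<le> 2 * (norm (f x))\<^sup>2 + 2 * (norm (g x))\<^sup>2"
        using zero_le_power2[of "norm (f x) - norm (g x)"]
        by (simp add: power2_eq_square algebra_simps)
      finally show "norm ((norm (f x + g x))\<^sup>2)
          \<le> norm (2 * (norm (f x))\<^sup>2 + 2 * (norm (g x))\<^sup>2)" by simp
    qed
  qed simp
  then show ?thesis by (simp add: square_integrable_def)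
qed

lemma square_integrable_uminus: "square_integrable f \<Longrightarrow> square_integrable (\<lambda>x. - f x)"
  by (auto simp: square_integrable_def)

lemma square_integrable_diff:
  "square_integrable f \<Longrightarrow> square_integrable g \<Longrightarrow> square_integrable (\<lambda>x. f x - g x)"
  using square_integrable_add[of f "\<lambda>x. - g x"] square_integrable_uminus[of g] by simp

lemma integrable_inner_square_integrable:
  assumes "square_integrable f" "square_integrable g"
  shows "integrable lborel (\<lambda>x. f x \<bullet> g x)"
proof -
  have [measurable]: "f \<in> borel_measurable lborel" "g \<in> borel_measurable lborel"
    using assms by (auto simp: square_integrable_def)
  have "integrable lborel (\<lambda>x. (norm (f x))\<^sup>2 + (norm (g x))\<^sup>2)"
    using assms by (auto simp: square_integrable_def)
  then show ?thesis
  proof (rule Bochner_Integration.integrable_bound)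
    show "AE x in lborel. norm (f x \<bullet> g x) \<le> norm ((norm (f x))\<^sup>2 + (norm (g x))\<^sup>2)"
    proof (rule AE_I2)
      fix x
      have "norm (f x \<bullet> g x) \<le> norm (f x) * norm (g x)"
        by (simp add: Cauchy_Schwarz_ineq2)
      also have "\<dots> \<le> (norm (f x))\<^sup>2 + (norm (g x))\<^sup>2"
      proof -
        have "0 \<le> norm (f x) * norm (g x)" by simp
        then show ?thesis
          using zero_le_power2[of "norm (f x) - norm (g x)"]
          unfolding power2_diff by linarith
      qed
      finally show "norm (f x \<bullet> g x) \<le> norm ((norm (f x))\<^sup>2 + (norm (g x))\<^sup>2)" by simp
    qed
  qed simp
qed

quotient_type (overloaded) ('a, 'b) L2 =
  "'a::euclidean_space \<Rightarrow> 'b::euclidean_space" / partial: L2_eq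
  morphisms fun_of class_of
proof (rule part_equivpI)
  show "\<exists>f. L2_eq f f"
    using square_integrable_zero by (auto simp: L2_eq_def)
  show "symp L2_eq"
    by (auto simp: symp_def L2_eq_def)
  show "transp L2_eq"
    by (auto simp: transp_def L2_eq_def)
qed

instantiation L2 :: (euclidean_space, euclidean_space) real_vector
begin

lift_definition zero_L2 :: "('a, 'b) L2" is "\<lambda>x. 0"
  by (simp add: L2_eq_def square_integrable_zero)

lift_definition plus_L2 :: "('a, 'b) L2 \<Rightarrow> ('a, 'b) L2 \<Rightarrow> ('a, 'b) L2"
  is "\<lambda>f g x. f x + g x"
  by (auto simp: L2_eq_def intro: square_integrable_add)

lift_definition minus_L2 :: "('a, 'b) L2 \<Rightarrow> ('a, 'b) L2 \<Rightarrow> ('a, 'b) L2"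
  is "\<lambda>f g x. f x - g x"
  by (auto simp: L2_eq_def intro: square_integrable_diff)

lift_definition uminus_L2 :: "('a, 'b) L2 \<Rightarrow> ('a, 'b) L2" is "\<lambda>f x. - f x"
  by (auto simp: L2_eq_def intro: square_integrable_uminus)

lift_definition scaleR_L2 :: "real \<Rightarrow> ('a, 'b) L2 \<Rightarrow> ('a, 'b) L2" is "\<lambda>r f x. r *\<^sub>R f x"
  by (auto simp: L2_eq_def intro: square_integrable_scaleR)

instance
proof
  fix u v w :: "('a, 'b) L2" and r s :: real
  show "u + v + w = u + (v + w)"
    by transfer (auto simp: L2_eq_def add.assoc intro: square_integrable_add)
  show "u + v = v + u"
    by transfer (auto simp: L2_eq_def add.commute intro: square_integrable_add)
  show "0 + u = u"
    by transfer (auto simp: L2_eq_def)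
  show "- u + u = 0"
    by transfer (auto simp: L2_eq_def square_integrable_zero)
  show "u - v = u + - v"
    by transfer (auto simp: L2_eq_def intro: square_integrable_diff)
  show "r *\<^sub>R (u + v) = r *\<^sub>R u + r *\<^sub>R v"
    by transfer (auto simp: L2_eq_def scaleR_add_right
        intro!: square_integrable_add square_integrable_scaleR)
  show "(r + s) *\<^sub>R u = r *\<^sub>R u + s *\<^sub>R u"
    by transfer (auto simp: L2_eq_def scaleR_add_left
        intro!: square_integrable_add square_integrable_scaleR)
  show "r *\<^sub>R s *\<^sub>R u = (r * s) *\<^sub>R u"
    by transfer (auto simp: L2_eq_def intro: square_integrable_scaleR)
  show "1 *\<^sub>R u = u"
    by transfer (auto simp: L2_eq_def)
qed

end

instantiation L2 :: (euclidean_space, euclidean_space) real_inner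
begin

lift_definition inner_L2 :: "('a, 'b) L2 \<Rightarrow> ('a, 'b) L2 \<Rightarrow> real"
  is "\<lambda>f g. LINT x|lborel. f x \<bullet> g x"
  by (rule integral_cong_AE) (auto simp: L2_eq_def square_integrable_def)

definition norm_L2 :: "('a, 'b) L2 \<Rightarrow> real" where "norm_L2 u = sqrt (inner u u)"
definition dist_L2 :: "('a, 'b) L2 \<Rightarrow> ('a, 'b) L2 \<Rightarrow> real" where "dist_L2 u v = norm (u - v)"
definition sgn_L2 :: "('a, 'b) L2 \<Rightarrow> ('a, 'b) L2" where "sgn_L2 u = u /\<^sub>R norm u"
definition uniformity_L2 :: "(('a, 'b) L2 \<times> ('a, 'b) L2) filter" where
  "uniformity_L2 = (INF e\<in>{0<..}. principal {(u, v). dist u v < e})"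
definition open_L2 :: "('a, 'b) L2 set \<Rightarrow> bool" where
  "open_L2 S \<longleftrightarrow> (\<forall>u\<in>S. \<forall>\<^sub>F (u', v) in uniformity. u' = u \<longrightarrow> v \<in> S)"

instance
proof
  fix u v w :: "('a, 'b) L2" and r :: real
  show "inner u v = inner v u"
    by transfer (simp add: inner_commute)
  show "inner (u + v) w = inner u w + inner v w"
    by transfer (auto simp: L2_eq_def inner_add_left
        intro!: Bochner_Integration.integral_add integrable_inner_square_integrable)
  show "inner (r *\<^sub>R u) v = r * inner u v"
    by transfer simp
  show "0 \<le> inner u u"
    by transfer (simp add: integral_nonneg_AE)
  show "inner u u = 0 \<longleftrightarrow> u = 0"
  proof transfer
    fix f :: "'a \<Rightarrow> 'b"
    assume "L2_eq f f"
    then have f: "square_integrable f" by (simp add: L2_eq_def)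
    have "((LINT x|lborel. f x \<bullet> f x) = 0) \<longleftrightarrow> (AE x in lborel. f x \<bullet> f x = 0)"
      by (rule integral_nonneg_eq_0_iff_AE)
        (auto intro: integrable_inner_square_integrable f)
    then show "((LINT x|lborel. f x \<bullet> f x) = 0) = L2_eq f (\<lambda>x. 0)"
      by (simp add: L2_eq_def f square_integrable_zero)
  qed
  show "norm u = sqrt (inner u u)" by (rule norm_L2_def)
  show "dist u v = norm (u - v)" by (rule dist_L2_def)
  show "sgn u = u /\<^sub>R norm u" by (rule sgn_L2_def)
  show "(uniformity :: (('a, 'b) L2 \<times> ('a, 'b) L2) filter)
      = (INF e\<in>{0<..}. principal {(u, v). dist u v < e})"
    by (rule uniformity_L2_def)
  show "open S \<longleftrightarrow> (\<forall>u\<in>S. \<forall>\<^sub>F (u', v) in uniformity. u' = u \<longrightarrow> v \<in> S)"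
    for S :: "('a, 'b) L2 set"
    by (rule open_L2_def)
qed

end

lemma square_integrable_fun_of: "square_integrable (fun_of u)"
  using Quotient_rep_reflp[OF Quotient_L2] by (simp add: L2_eq_def)

section \<open>Smooth maps and submanifolds\<close>

text \<open>
  Throughout, X is a linear subspace of a normed space, regarded as a normed space of its own.
  Elements of \<open>X\<^sup>k\<close> are lists of length k.
\<close>

definition bounded_multilinear_on ::
    "'e::real_normed_vector set \<Rightarrow> nat \<Rightarrow> ('e list \<Rightarrow> 'f::real_normed_vector) \<Rightarrow> bool" where
  "bounded_multilinear_on X k m \<longleftrightarrow>
     (\<exists>C. \<forall>vs\<in>lists X. length vs = k \<longrightarrow> norm (m vs) \<le> C * prod_list (map norm vs)) \<and>
     (\<forall>vs\<in>lists X. length vs = k \<longrightarrow> (\<forall>i<k. \<forall>x\<in>X. \<forall>y\<in>X. \<forall>a b.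
        m (vs[i := a *\<^sub>R x + b *\<^sub>R y]) = a *\<^sub>R m (vs[i := x]) + b *\<^sub>R m (vs[i := y])))"

text \<open>
  \<open>C\<^sup>\<infinity>\<close> in the sense of Frechet on a relatively open subset S of X: the restriction of \<open>D x\<close> to
  lists of length k is the k-th derivative at x, and each \<open>D\<^sup>k\<close> is Frechet differentiable, as a
  map into the bounded k-linear maps with the operator norm, with derivative \<open>D\<^sup>k\<^sup>+\<^sup>1\<close>.
\<close>

definition smooth_on ::
    "'e::real_normed_vector set \<Rightarrow> 'e set \<Rightarrow> ('e \<Rightarrow> 'f::real_normed_vector) \<Rightarrow> bool" where
  "smooth_on X S f \<longleftrightarrow>
     (\<exists>D :: 'e \<Rightarrow> 'e list \<Rightarrow> 'f. \<forall>x\<in>S. D x [] = f x \<and>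
        (\<forall>k. bounded_multilinear_on X k (D x) \<and>
           (\<forall>\<epsilon>>0. \<exists>\<delta>>0. \<forall>y\<in>S. norm (y - x) < \<delta> \<longrightarrow>
              (\<forall>vs\<in>lists X. length vs = k \<longrightarrow>
                 norm (D y vs - D x vs - D x ((y - x) # vs))
                   \<le> \<epsilon> * norm (y - x) * prod_list (map norm vs)))))"

definition closed_subspace_of_codim :: "nat \<Rightarrow> 'e::real_normed_vector set \<Rightarrow> 'e set \<Rightarrow> bool" where
  "closed_subspace_of_codim n X F \<longleftrightarrow>
     subspace F \<and> F \<subseteq> X \<and> closedin (top_of_set X) F \<and>
     (\<exists>B\<subseteq>X. independent B \<and> finite B \<and> card B = n \<and>
        F \<inter> span B = {0} \<and> X = (\<lambda>(f, b). f + b) ` (F \<times> span B))"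

definition smooth_submanifold_of_codim :: "nat \<Rightarrow> 'e::real_normed_vector set \<Rightarrow> 'e set \<Rightarrow> bool" where
  "smooth_submanifold_of_codim n X V \<longleftrightarrow> V \<subseteq> X \<and>
     (\<forall>p\<in>V. \<exists>W W' \<Phi> \<Psi> F.
        openin (top_of_set X) W \<and> p \<in> W \<and> openin (top_of_set X) W' \<and>
        homeomorphism W W' \<Phi> \<Psi> \<and> smooth_on X W \<Phi> \<and> smooth_on X W' \<Psi> \<and>
        closed_subspace_of_codim n X F \<and> \<Phi> ` (W \<inter> V) = W' \<inter> F)"

section \<open>Sobolev spaces\<close>

definition test_functions :: "'a::euclidean_space set \<Rightarrow> ('a \<Rightarrow> real) set" where
  "test_functions \<Omega> = {\<phi>. smooth_on UNIV UNIV \<phi> \<and>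
     compact (closure {x. \<phi> x \<noteq> 0}) \<and> closure {x. \<phi> x \<noteq> 0} \<subseteq> \<Omega>}"

definition gradient :: "('a::euclidean_space \<Rightarrow> real) \<Rightarrow> 'a \<Rightarrow> 'a" where
  "gradient \<phi> x = (\<Sum>b\<in>Basis. frechet_derivative \<phi> (at x) b *\<^sub>R b)"

text \<open>
  A Sobolev function is carried together with its weak gradient. The norm inherited from
  the product is the usual one of \<open>H\<^sup>1\<close>, which is equivalent to the one with weight \<open>lam\<close>.
\<close>

type_synonym 'a sobolev = "('a, real) L2 \<times> ('a, 'a) L2"

definition val :: "'a::euclidean_space sobolev \<Rightarrow> 'a \<Rightarrow> real" where
  "val u = fun_of (fst u)"

definition wgrad :: "'a::euclidean_space sobolev \<Rightarrow> 'a \<Rightarrow> 'a" where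
  "wgrad u = fun_of (snd u)"

definition H1 :: "'a::euclidean_space sobolev set" where
  "H1 = {u. \<forall>\<phi>\<in>test_functions UNIV.
     (LINT x|lborel. val u x *\<^sub>R gradient \<phi> x) = - (LINT x|lborel. \<phi> x *\<^sub>R wgrad u x)}"

text \<open>
  \<open>H\<^sup>1\<^sub>0(\<Omega>)\<close> is the closure of the test functions on \<open>\<Omega>\<close>; its elements are extended by 0 to the
  whole space, so that it is a subspace of \<open>H\<^sup>1(\<real>\<^sup>N)\<close>.
\<close>

definition H10 :: "'a::euclidean_space set \<Rightarrow> 'a sobolev set" where
  "H10 \<Omega> = closure {u. \<exists>\<phi>\<in>test_functions \<Omega>.
     (AE x in lborel. val u x = \<phi> x) \<and> (AE x in lborel. wgrad u x = gradient \<phi> x)}"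

text \<open>Radial symmetry is invariance under the orthogonal group; in dimension 1 this means even.\<close>

definition H1_radial :: "'a::euclidean_space sobolev set" where
  "H1_radial = {u\<in>H1. \<forall>T. orthogonal_transformation T \<longrightarrow>
     (AE x in lborel. val u (T x) = val u x)}"

definition H_space :: "'a::euclidean_space set \<Rightarrow> 'a sobolev set" where
  "H_space \<Omega> = (if \<Omega> = UNIV then H1_radial else H10 \<Omega>)"

definition H_vec :: "'a::euclidean_space set \<Rightarrow> ('a sobolev ^ 'n) set" where
  "H_vec \<Omega> = {u. \<forall>i. u $ i \<in> H_space \<Omega>}"

section \<open>The equations\<close>

definition pos_on :: "'a::euclidean_space set \<Rightarrow> 'a sobolev \<Rightarrow> bool" where
  "pos_on \<Omega> u \<longleftrightarrow> (AE x in lborel. x \<in> \<Omega> \<longrightarrow> val u x > 0)"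

text \<open>
  Solutions of \<open>- \<Delta> u + lam u = f\<close> in \<open>\<Omega>\<close> are understood in the sense of distributions. The boundary
  condition is part of \<open>u \<in> H\<close>.
\<close>

definition weak_solution ::
    "'a::euclidean_space set \<Rightarrow> real \<Rightarrow> 'a sobolev \<Rightarrow> ('a \<Rightarrow> real) \<Rightarrow> bool" where
  "weak_solution \<Omega> lam u f \<longleftrightarrow> (\<forall>\<phi>\<in>test_functions \<Omega>.
     (LINT x:\<Omega>|lborel. (wgrad u x \<bullet> gradient \<phi> x + lam * val u x * \<phi> x))
       = (LINT x:\<Omega>|lborel. f x * \<phi> x))"

definition scalar_solution :: "'a::euclidean_space set \<Rightarrow> real \<Rightarrow> 'a sobolev \<Rightarrow> bool" where
  "scalar_solution \<Omega> lam u \<longleftrightarrow> u \<in> H_space \<Omega> \<and> weak_solution \<Omega> lam u (\<lambda>x. (val u x) ^ 3)"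

definition scalar_energy :: "'a::euclidean_space set \<Rightarrow> real \<Rightarrow> 'a sobolev \<Rightarrow> real" where
  "scalar_energy \<Omega> lam u =
     1/2 * (LINT x:\<Omega>|lborel. ((norm (wgrad u x))\<^sup>2 + lam * (val u x)\<^sup>2))
     - 1/4 * (LINT x:\<Omega>|lborel. (val u x) ^ 4)"

definition nehari_set :: "'a::euclidean_space set \<Rightarrow> real \<Rightarrow> 'a sobolev set" where
  "nehari_set \<Omega> lam = {u\<in>H_space \<Omega>. u \<noteq> 0 \<and>
     (LINT x:\<Omega>|lborel. ((norm (wgrad u x))\<^sup>2 + lam * (val u x)\<^sup>2))
       = (LINT x:\<Omega>|lborel. (val u x) ^ 4)}"

text \<open>
  As usual for ground states, ``least energy'' refers to the minimum of the energy on the Nehari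
  manifold, which contains all nontrivial solutions in H. On domains without compactness a minimum
  over the solutions alone would not give this.
\<close>

definition least_energy_positive_solution ::
    "'a::euclidean_space set \<Rightarrow> real \<Rightarrow> 'a sobolev \<Rightarrow> bool" where
  "least_energy_positive_solution \<Omega> lam U \<longleftrightarrow>
     scalar_solution \<Omega> lam U \<and> pos_on \<Omega> U \<and>
     (\<forall>v\<in>nehari_set \<Omega> lam. scalar_energy \<Omega> lam U \<le> scalar_energy \<Omega> lam v)"

definition nondegenerate :: "'a::euclidean_space set \<Rightarrow> real \<Rightarrow> 'a sobolev \<Rightarrow> bool" where
  "nondegenerate \<Omega> lam U \<longleftrightarrow>
     (\<forall>\<psi>\<in>H_space \<Omega>. weak_solution \<Omega> lam \<psi> (\<lambda>x. 3 * (val U x)\<^sup>2 * val \<psi> x) \<longrightarrow> \<psi> = 0)"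

definition positive_vector_solution ::
    "'a::euclidean_space set \<Rightarrow> real \<Rightarrow> real ^ 'n ^ 'n \<Rightarrow> 'a sobolev ^ 'n \<Rightarrow> bool" where
  "positive_vector_solution \<Omega> lam A u \<longleftrightarrow> u \<in> H_vec \<Omega> \<and>
     (\<forall>i. weak_solution \<Omega> lam (u $ i) (\<lambda>x. \<Sum>j\<in>UNIV. A $ i $ j * val (u $ i) x * (val (u $ j) x)\<^sup>2)) \<and>
     (\<forall>i. pos_on \<Omega> (u $ i))"

definition vec_mult :: "real ^ 'n \<Rightarrow> 'a::euclidean_space sobolev \<Rightarrow> 'a sobolev ^ 'n" where
  "vec_mult c U = (\<chi> i. c $ i *\<^sub>R U)"

section \<open>The functional and the constraint set\<close>

definition I_fun ::
    "'a::euclidean_space set \<Rightarrow> real \<Rightarrow> real ^ 'n ^ 'n \<Rightarrow> 'a sobolev ^ 'n \<Rightarrow> real" where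
  "I_fun \<Omega> lam A u =
     1/2 * (\<Sum>i\<in>UNIV. LINT x:\<Omega>|lborel. ((norm (wgrad (u $ i) x))\<^sup>2 + lam * (val (u $ i) x)\<^sup>2))
     - 1/4 * (LINT x:\<Omega>|lborel.
         (\<Sum>i\<in>UNIV. \<Sum>j\<in>UNIV. A $ i $ j * (val (u $ i) x)\<^sup>2 * (val (u $ j) x)\<^sup>2))"

text \<open>
  The Frechet derivative of the functional on the vector space \<open>H\<^sup>n\<close>; on directions in \<open>H\<^sup>n\<close>,
  the only ones used, it is uniquely determined.
\<close>

definition J_fun ::
    "'a::euclidean_space set \<Rightarrow> real \<Rightarrow> real ^ 'n ^ 'n \<Rightarrow> 'n \<Rightarrow> 'a sobolev ^ 'n \<Rightarrow> real" where
  "J_fun \<Omega> lam A l u =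
     frechet_derivative (I_fun \<Omega> lam A) (at u within H_vec \<Omega>) (axis l (u $ l))"

definition M_set ::
    "'a::euclidean_space set \<Rightarrow> real \<Rightarrow> real ^ 'n ^ 'n \<Rightarrow> ('a sobolev ^ 'n) set" where
  "M_set \<Omega> lam A = {u\<in>H_vec \<Omega>. \<forall>i j. J_fun \<Omega> lam A i u = 0 \<and> u $ j \<noteq> 0}"

definition strict_local_min_on :: "('e::metric_space \<Rightarrow> real) \<Rightarrow> 'e set \<Rightarrow> 'e \<Rightarrow> bool" where
  "strict_local_min_on f V p \<longleftrightarrow> p \<in> V \<and>
     (\<exists>\<epsilon>>0. \<forall>u\<in>V. u \<noteq> p \<and> dist u p < \<epsilon> \<longrightarrow> f p < f u)"

end

theory Submission
  imports Defs
begin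

text \<open>
  For fixed directions of the components, the constraints are linear equations for the squares of
  the scaling factors, and their matrix is nonsingular near \<open>cU\<close> because A is. Solving them by Cramer's
  rule straightens the constraint set to the set of u whose components are orthogonal to U with
  respect to the form \<open>B u v = \<integral> \<nabla>u \<cdot> \<nabla>v + lam u v\<close>, which has codimension n.

  The components of c satisfy \<open>\<Sum>\<^sub>j a\<^sub>i\<^sub>j c\<^sub>j\<^sup>2 = 1\<close>. With \<open>a\<^sub>i\<^sub>j \<ge> 0\<close> this bounds the second variation of the
  functional at \<open>cU\<close> from below by the sum of \<open>Q v\<^sub>i = B v\<^sub>i v\<^sub>i - 3 \<integral> U\<^sup>2 v\<^sub>i\<^sup>2\<close>. Minimality of U on the Nehari
  manifold gives \<open>Q \<ge> 0\<close> on the orthogonal complement of U, and since the potential term is a compact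
  quadratic form, nondegeneracy makes Q coercive there. If the domain is the whole space, critical
  points among radial functions are critical points, by symmetric criticality.

  The embedding of \<open>H\<^sup>1\<close> into \<open>L\<^sup>4\<close> and local compactness both come from comparing a function with its
  averages over dyadic cubes, using only that a translation by z moves it by at most \<open>|z| \<parallel>\<nabla>u\<parallel>\<close> in \<open>L\<^sup>2\<close>.
\<close>

section \<open>Calculus of smooth maps\<close>

text \<open>The chart is explicit, so smoothness only needs closure of smooth maps under bounded
  bilinear maps, square roots and inverses. Simple coefficients decide the second variation: the
  quartic part contributes 1/2 of
  \<open>\<Sum>\<^sub>i \<integral> U\<^sup>2 v\<^sub>i\<^sup>2\<close> from the terms in which both
  v belong to one factor and, by the arithmetic-geometric inequality, at most 1 more from the mixed
  terms. Together this is 3/2, exactly half of the 3 in Q. Q is negative on U itself; this is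
  harmless because on the constraint set the U-components of a displacement are quadratic in its
  norm and cost the energy bound only a term of fourth order. Two mismatches cause the longer
  detours. The translation estimate is immediate for test functions only, whereas the radial space
  is defined by weak gradients: hence mollification and cutoff, which show that test functions are
  dense in \<open>H\<^sup>1\<close>. And nondegeneracy concerns solutions tested with all test
  functions, whereas the minimum is taken among radial functions: hence the passage from radial to
  general directions.\<close>

definition family_derivative ::
    "'e::real_normed_vector set \<Rightarrow> 'e set \<Rightarrow> nat \<Rightarrow> ('e \<Rightarrow> 'e list \<Rightarrow> 'f::real_normed_vector)
      \<Rightarrow> ('e \<Rightarrow> 'e list \<Rightarrow> 'f) \<Rightarrow> bool" where
  "family_derivative X S j m m' \<longleftrightarrow>
     (\<forall>x\<in>S. \<forall>\<epsilon>>0. \<exists>\<delta>>0. \<forall>y\<in>S. norm (y - x) < \<delta> \<longrightarrow>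
        (\<forall>vs\<in>lists X. length vs = j \<longrightarrow>
           norm (m y vs - m x vs - m' x ((y - x) # vs))
             \<le> \<epsilon> * norm (y - x) * prod_list (map norm vs)))"

text \<open>The derivative at each level is only asserted to exist, which lets closure properties be
  proved by induction on the order r, without formulas for higher derivatives. Level
  \<open>0\<close> still asks for a bounded multilinear value at every point.\<close>

primrec smooth_family ::
    "nat \<Rightarrow> 'e::real_normed_vector set \<Rightarrow> 'e set \<Rightarrow> nat \<Rightarrow> ('e \<Rightarrow> 'e list \<Rightarrow> 'f::real_normed_vector) \<Rightarrow> bool"
  where
  "smooth_family 0 X S j m = (\<forall>x\<in>S. bounded_multilinear_on X j (m x))"
| "smooth_family (Suc r) X S j m = ((\<forall>x\<in>S. bounded_multilinear_on X j (m x)) \<and>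
     (\<exists>m'. family_derivative X S j m m' \<and> smooth_family r X S (Suc j) m'))"

text \<open>Each order comes with a tower of its own; \<open>family_derivative_unique\<close> glues
  the towers together afterwards.\<close>

definition smooth_at_all_orders ::
    "'e::real_normed_vector set \<Rightarrow> 'e set \<Rightarrow> ('e \<Rightarrow> 'f::real_normed_vector) \<Rightarrow> bool" where
  "smooth_at_all_orders X S f \<longleftrightarrow> (\<forall>r. smooth_family r X S 0 (\<lambda>x vs. f x))"

lemma family_derivativeE:
  assumes "family_derivative X S j m m'" "x \<in> S" "\<epsilon> > 0"
  obtains \<delta> where "\<delta> > 0" "\<And>y vs. y \<in> S \<Longrightarrow> norm (y - x) < \<delta> \<Longrightarrow> vs \<in> lists X \<Longrightarrow> length vs = j \<Longrightarrow>
    norm (m y vs - m x vs - m' x ((y - x) # vs)) \<le> \<epsilon> * norm (y - x) * prod_list (map norm vs)"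
proof -
  note assms(1)[unfolded family_derivative_def, rule_format, OF assms(2,3)]
  then obtain \<delta> where "\<delta> > 0" and d: "\<forall>y\<in>S. norm (y - x) < \<delta> \<longrightarrow> (\<forall>vs\<in>lists X. length vs = j \<longrightarrow>
    norm (m y vs - m x vs - m' x ((y - x) # vs)) \<le> \<epsilon> * norm (y - x) * prod_list (map norm vs))"
    by (elim exE conjE)
  then show ?thesis using that[OF \<open>\<delta> > 0\<close>] d by simp
qed

lemma prod_list_norm_nonneg [simp]: "0 \<le> prod_list (map norm (vs :: 'a::real_normed_vector list))"
  by (induction vs) auto

lemma smooth_family_multilinear:
  "smooth_family r X S j m \<Longrightarrow> x \<in> S \<Longrightarrow> bounded_multilinear_on X j (m x)"
  by (cases r) auto

lemma smooth_family_mono: "smooth_family (Suc r) X S j m \<Longrightarrow> smooth_family r X S j m"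
proof (induction r arbitrary: j m)
  case (Suc r)
  then show ?case by (metis smooth_family.simps(2))
qed simp

lemma bounded_multilinear_on_bound:
  assumes "bounded_multilinear_on X j m"
  obtains C where "C \<ge> 0" "\<And>vs. vs \<in> lists X \<Longrightarrow> length vs = j \<Longrightarrow> norm (m vs) \<le> C * prod_list (map norm vs)"
proof -
  obtain C where C: "\<And>vs. vs \<in> lists X \<Longrightarrow> length vs = j \<Longrightarrow> norm (m vs) \<le> C * prod_list (map norm vs)"
    using assms unfolding bounded_multilinear_on_def by blast
  have "norm (m vs) \<le> max C 0 * prod_list (map norm vs)" if "vs \<in> lists X" "length vs = j" for vs
    using C[OF that] mult_right_mono[of C "max C 0" "prod_list (map norm vs)"] by simp
  then show ?thesis using that[of "max C 0"] by auto
qed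

lemma bounded_multilinear_on_update:
  assumes "bounded_multilinear_on X k m" "vs \<in> lists X" "length vs = k" "i < k" "x \<in> X" "y \<in> X"
  shows "m (vs[i := a *\<^sub>R x + b *\<^sub>R y]) = a *\<^sub>R m (vs[i := x]) + b *\<^sub>R m (vs[i := y])"
  using assms unfolding bounded_multilinear_on_def by blast

lemma bounded_multilinear_on_Cons:
  assumes "bounded_multilinear_on X (Suc k) m" "vs \<in> lists X" "length vs = k" "x \<in> X" "y \<in> X"
  shows "m ((a *\<^sub>R x + b *\<^sub>R y) # vs) = a *\<^sub>R m (x # vs) + b *\<^sub>R m (y # vs)"
  using bounded_multilinear_on_update[OF assms(1), of "x # vs" 0 x y a b] assms by simp

lemma bounded_multilinear_on_cong:
  assumes "\<And>vs. vs \<in> lists X \<Longrightarrow> length vs = k \<Longrightarrow> m vs = m' vs" "subspace X"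
    "bounded_multilinear_on X k m"
  shows "bounded_multilinear_on X k m'"
  unfolding bounded_multilinear_on_def
proof (intro conjI ballI impI allI)
  show "\<exists>C. \<forall>vs\<in>lists X. length vs = k \<longrightarrow> norm (m' vs) \<le> C * prod_list (map norm vs)"
    using assms unfolding bounded_multilinear_on_def by metis
next
  fix vs i x y and a b :: real
  assume h: "vs \<in> lists X" "length vs = k" "i < k" "x \<in> X" "y \<in> X"
  then have l: "vs[i := z] \<in> lists X" if "z \<in> X" for z
    using that set_update_subset_insert[of vs i z] by (auto simp: in_lists_conv_set)
  have ab: "a *\<^sub>R x + b *\<^sub>R y \<in> X" using h assms(2) by (simp add: subspace_def)
  show "m' (vs[i := a *\<^sub>R x + b *\<^sub>R y]) = a *\<^sub>R m' (vs[i := x]) + b *\<^sub>R m' (vs[i := y])"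
    using bounded_multilinear_on_update[OF assms(3) h, of a b] assms(1)[OF l] ab h
    by (simp del: in_lists_conv_set)
qed

lemma bounded_multilinear_on_add:
  assumes "bounded_multilinear_on X k m" "bounded_multilinear_on X k m'"
  shows "bounded_multilinear_on X k (\<lambda>vs. m vs + m' vs)"
proof -
  obtain C where C: "\<And>vs. vs \<in> lists X \<Longrightarrow> length vs = k \<Longrightarrow> norm (m vs) \<le> C * prod_list (map norm vs)"
    using bounded_multilinear_on_bound[OF assms(1)] by metis
  obtain C' where C': "\<And>vs. vs \<in> lists X \<Longrightarrow> length vs = k \<Longrightarrow> norm (m' vs) \<le> C' * prod_list (map norm vs)"
    using bounded_multilinear_on_bound[OF assms(2)] by metis
  have "norm (m vs + m' vs) \<le> (C + C') * prod_list (map norm vs)" if "vs \<in> lists X" "length vs = k" for vs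
    using norm_triangle_ineq[of "m vs" "m' vs"] C[OF that] C'[OF that] by (simp add: algebra_simps)
  then have "\<exists>C. \<forall>vs\<in>lists X. length vs = k \<longrightarrow> norm (m vs + m' vs) \<le> C * prod_list (map norm vs)"
    by blast
  moreover have "m (vs[i := a *\<^sub>R x + b *\<^sub>R y]) + m' (vs[i := a *\<^sub>R x + b *\<^sub>R y])
      = a *\<^sub>R (m (vs[i := x]) + m' (vs[i := x])) + b *\<^sub>R (m (vs[i := y]) + m' (vs[i := y]))"
    if "vs \<in> lists X" "length vs = k" "i < k" "x \<in> X" "y \<in> X" for vs i x y a b
    using bounded_multilinear_on_update[OF assms(1) that] bounded_multilinear_on_update[OF assms(2) that]
    by (simp add: scaleR_add_right)
  ultimately show ?thesis
    unfolding bounded_multilinear_on_def by (intro conjI ballI impI allI) auto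
qed

lemma family_derivative_add:
  assumes "family_derivative X S j m m1" "family_derivative X S j n n1"
  shows "family_derivative X S j (\<lambda>x vs. m x vs + n x vs) (\<lambda>x vs. m1 x vs + n1 x vs)"
  unfolding family_derivative_def
proof (intro ballI allI impI)
  fix x and \<epsilon> :: real assume x: "x \<in> S" "\<epsilon> > 0"
  obtain d where d: "d > 0" "\<And>y vs. y \<in> S \<Longrightarrow> norm (y - x) < d \<Longrightarrow> vs \<in> lists X \<Longrightarrow> length vs = j \<Longrightarrow>
      norm (m y vs - m x vs - m1 x ((y - x) # vs)) \<le> \<epsilon>/2 * norm (y - x) * prod_list (map norm vs)"
    by (rule family_derivativeE[OF assms(1) x(1), of "\<epsilon>/2"]) (use x in auto)
  obtain e where e: "e > 0" "\<And>y vs. y \<in> S \<Longrightarrow> norm (y - x) < e \<Longrightarrow> vs \<in> lists X \<Longrightarrow> length vs = j \<Longrightarrow>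
      norm (n y vs - n x vs - n1 x ((y - x) # vs)) \<le> \<epsilon>/2 * norm (y - x) * prod_list (map norm vs)"
    by (rule family_derivativeE[OF assms(2) x(1), of "\<epsilon>/2"]) (use x in auto)
  show "\<exists>\<delta>>0. \<forall>y\<in>S. norm (y - x) < \<delta> \<longrightarrow> (\<forall>vs\<in>lists X. length vs = j \<longrightarrow>
      norm (m y vs + n y vs - (m x vs + n x vs) - (m1 x ((y - x) # vs) + n1 x ((y - x) # vs)))
        \<le> \<epsilon> * norm (y - x) * prod_list (map norm vs))"
  proof (intro exI[of _ "min d e"] conjI ballI impI)
    fix y vs assume y: "y \<in> S" "norm (y - x) < min d e" "vs \<in> lists X" "length vs = j"
    have "norm (m y vs + n y vs - (m x vs + n x vs) - (m1 x ((y - x) # vs) + n1 x ((y - x) # vs)))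
      = norm ((m y vs - m x vs - m1 x ((y - x) # vs)) + (n y vs - n x vs - n1 x ((y - x) # vs)))"
      by (simp add: algebra_simps)
    also have "\<dots> \<le> \<epsilon>/2 * norm (y - x) * prod_list (map norm vs) + \<epsilon>/2 * norm (y - x) * prod_list (map norm vs)"
      using y by (intro norm_triangle_le add_mono d(2) e(2)) auto
    finally show "norm (m y vs + n y vs - (m x vs + n x vs) - (m1 x ((y - x) # vs) + n1 x ((y - x) # vs)))
        \<le> \<epsilon> * norm (y - x) * prod_list (map norm vs)" by (simp add: mult_ac)
  qed (use d e in auto)
qed

lemma smooth_family_add:
  "smooth_family r X S j m \<Longrightarrow> smooth_family r X S j n \<Longrightarrow> smooth_family r X S j (\<lambda>x vs. m x vs + n x vs)"
proof (induction r arbitrary: j m n)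
  case 0
  then show ?case by (auto intro: bounded_multilinear_on_add)
next
  case (Suc r)
  obtain m' n' where m: "family_derivative X S j m m'" "smooth_family r X S (Suc j) m'"
    and n: "family_derivative X S j n n'" "smooth_family r X S (Suc j) n'" using Suc.prems by auto
  show ?case
    using Suc.prems family_derivative_add[OF m(1) n(1)] Suc.IH[OF m(2) n(2)]
    by (auto intro: bounded_multilinear_on_add)
qed

lemma bounded_multilinear_on_zero: "bounded_multilinear_on X k (\<lambda>vs. 0)"
  unfolding bounded_multilinear_on_def by (auto intro!: exI[of _ 0])

lemma smooth_family_zero: "smooth_family r X S j (\<lambda>x vs. 0)"
  by (induction r arbitrary: j)
    (auto simp: bounded_multilinear_on_zero family_derivative_def intro!: exI[of _ "\<lambda>x vs. 0"] exI[of _ 1])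

lemma bounded_multilinear_on_0: "bounded_multilinear_on X 0 (\<lambda>vs. c)"
  unfolding bounded_multilinear_on_def by (auto intro!: exI[of _ "norm c"])

text \<open>\<open>select\<close> distributes the arguments of a product of two multilinear maps over the factors.\<close>

definition select :: "bool list \<Rightarrow> 'a list \<Rightarrow> 'a list" where
  "select bs vs = map snd (filter fst (zip bs vs))"

lemma select_simps [simp]:
  "select [] vs = []" "select (True # bs) (v # vs) = v # select bs vs"
  "select (False # bs) (v # vs) = select bs vs"
  by (auto simp: select_def)

lemma select_lists: "vs \<in> lists X \<Longrightarrow> select bs vs \<in> lists X"
  by (auto simp: select_def in_lists_conv_set dest: set_zip_rightD)

lemma length_select: "length vs = length bs \<Longrightarrow> length (select bs vs) = count_list bs True"
  by (induction vs bs rule: list_induct2) (auto split: bool.splits)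

lemma count_list_map_Not: "count_list (map Not bs) True = count_list bs False"
  by (induction bs) auto

lemma prod_list_select:
  assumes "length vs = length bs"
  shows "prod_list (map norm (select bs vs)) * prod_list (map norm (select (map Not bs) vs))
    = prod_list (map norm (vs :: 'a::real_normed_vector list))"
  using assms
proof (induction vs bs rule: list_induct2)
  case (Cons v vs b bs)
  then show ?case by (cases b) (auto simp: algebra_simps)
qed simp

text \<open>Every position belongs to exactly one of the two sublists, so changing a single argument
  changes one factor of a product and leaves the other alone. Multilinearity of the product is
  inherited slot by slot from this.\<close>

lemma select_update:
  assumes "length vs = length bs" "i < length bs"
  shows "(bs ! i \<longrightarrow> (\<exists>k<count_list bs True. \<forall>x. select bs (vs[i := x]) = (select bs vs)[k := x])) \<and>
    (\<not> bs ! i \<longrightarrow> (\<forall>x. select bs (vs[i := x]) = select bs vs))"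
  using assms
proof (induction vs bs arbitrary: i rule: list_induct2)
  case (Cons v vs b bs)
  show ?case
  proof (cases i)
    case 0
    then show ?thesis by (cases b) (auto intro!: exI[of _ 0])
  next
    case (Suc i')
    then have IH: "(bs ! i' \<longrightarrow> (\<exists>k<count_list bs True. \<forall>x. select bs (vs[i' := x]) = (select bs vs)[k := x])) \<and>
      (\<not> bs ! i' \<longrightarrow> (\<forall>x. select bs (vs[i' := x]) = select bs vs))"
      using Cons by auto
    show ?thesis
    proof (cases "bs ! i'")
      case True
      then obtain k where k: "k<count_list bs True" "\<And>x. select bs (vs[i' := x]) = (select bs vs)[k := x]"
        using IH by auto
      show ?thesis
      proof (cases b)
        case b: True
        show ?thesis using k True Suc b by (auto intro!: exI[of _ "Suc k"])
      next
        case b: False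
        show ?thesis using k True Suc b by (auto intro!: exI[of _ k])
      qed
    next
      case False
      then show ?thesis using IH Suc by (cases b) auto
    qed
  qed
qed simp

lemma bounded_multilinear_on_product:
  fixes \<beta> :: "'f::real_normed_vector \<Rightarrow> 'g::real_normed_vector \<Rightarrow> 'h::real_normed_vector"
  assumes \<beta>: "bounded_bilinear \<beta>"
    and m: "bounded_multilinear_on X (count_list bs True) m"
    and n: "bounded_multilinear_on X (count_list bs False) n"
  shows "bounded_multilinear_on X (length bs) (\<lambda>vs. \<beta> (m (select bs vs)) (n (select (map Not bs) vs)))"
  unfolding bounded_multilinear_on_def
proof (intro conjI ballI impI allI)
  interpret bounded_bilinear \<beta> by fact
  obtain K where K: "K > 0" "\<And>a b. norm (\<beta> a b) \<le> norm a * norm b * K" using pos_bounded by auto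
  obtain C where C: "C \<ge> 0" "\<And>vs. vs \<in> lists X \<Longrightarrow> length vs = count_list bs True \<Longrightarrow> norm (m vs) \<le> C * prod_list (map norm vs)"
    using bounded_multilinear_on_bound[OF m] by metis
  obtain D where D: "D \<ge> 0" "\<And>vs. vs \<in> lists X \<Longrightarrow> length vs = count_list bs False \<Longrightarrow> norm (n vs) \<le> D * prod_list (map norm vs)"
    using bounded_multilinear_on_bound[OF n] by metis
  show "\<exists>C. \<forall>vs\<in>lists X. length vs = length bs \<longrightarrow>
      norm (\<beta> (m (select bs vs)) (n (select (map Not bs) vs))) \<le> C * prod_list (map norm vs)"
  proof (intro exI[of _ "C * D * K"] ballI impI)
    fix vs assume vs: "vs \<in> lists X" "length vs = length bs"
    have "norm (\<beta> (m (select bs vs)) (n (select (map Not bs) vs)))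
      \<le> (C * prod_list (map norm (select bs vs))) * (D * prod_list (map norm (select (map Not bs) vs))) * K"
      using vs K(1) C(1) D(1)
      by (intro order_trans[OF K(2)] mult_mono mult_right_mono C(2) D(2))
        (auto simp: select_lists length_select count_list_map_Not)
    also have "\<dots> = C * D * K * prod_list (map norm vs)"
      using prod_list_select[OF vs(2)] by (simp add: algebra_simps)
    finally show "norm (\<beta> (m (select bs vs)) (n (select (map Not bs) vs))) \<le> C * D * K * prod_list (map norm vs)" .
  qed
  fix vs i x y and a b :: real
  assume h: "vs \<in> lists X" "length vs = length bs" "i < length bs" "x \<in> X" "y \<in> X"
  let ?w = "\<lambda>z. vs[i := z]"
  show "\<beta> (m (select bs (?w (a *\<^sub>R x + b *\<^sub>R y)))) (n (select (map Not bs) (?w (a *\<^sub>R x + b *\<^sub>R y)))) =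
    a *\<^sub>R \<beta> (m (select bs (?w x))) (n (select (map Not bs) (?w x))) +
    b *\<^sub>R \<beta> (m (select bs (?w y))) (n (select (map Not bs) (?w y)))"
  proof (cases "bs ! i")
    case True
    obtain k where k: "k < count_list bs True" "\<And>x. select bs (?w x) = (select bs vs)[k := x]"
      using select_update[OF h(2,3)] True by auto
    have l: "select (map Not bs) (?w x) = select (map Not bs) vs" for x
      using select_update[of vs "map Not bs" i] h True by auto
    show ?thesis unfolding k(2) l
      using h k by (subst bounded_multilinear_on_update[OF m])
        (auto simp: select_lists length_select add_left scaleR_left)
  next
    case False
    obtain k where k: "k < count_list bs False" "\<And>x. select (map Not bs) (?w x) = (select (map Not bs) vs)[k := x]"
      using select_update[of vs "map Not bs" i] h False by (auto simp: count_list_map_Not)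
    have l: "select bs (?w x) = select bs vs" for x
      using select_update[OF h(2,3)] False by auto
    show ?thesis unfolding k(2) l
      using h k by (subst bounded_multilinear_on_update[OF n])
        (auto simp: select_lists length_select count_list_map_Not add_right scaleR_right)
  qed
qed

text \<open>The defining estimate with \<epsilon> = 1 plus the operator bound of \<open>m'\<close>
  at x. Only increments from the fixed centre x are controlled, which is all that the product and
  chain rules ask for.\<close>

lemma family_derivative_lipschitz:
  assumes "family_derivative X S j m m'" "x \<in> S" "bounded_multilinear_on X (Suc j) (m' x)"
    "S \<subseteq> X" "subspace X"
  obtains \<delta> L where "\<delta> > 0" "L \<ge> 0" "\<And>y vs. y \<in> S \<Longrightarrow> norm (y - x) < \<delta> \<Longrightarrow> vs \<in> lists X \<Longrightarrow> length vs = j \<Longrightarrow>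
    norm (m y vs - m x vs) \<le> L * norm (y - x) * prod_list (map norm vs)"
proof -
  obtain \<delta> where d: "\<delta> > 0" "\<And>y vs. y \<in> S \<Longrightarrow> norm (y - x) < \<delta> \<Longrightarrow> vs \<in> lists X \<Longrightarrow> length vs = j \<Longrightarrow>
      norm (m y vs - m x vs - m' x ((y - x) # vs)) \<le> 1 * norm (y - x) * prod_list (map norm vs)"
    by (rule family_derivativeE[OF assms(1,2) zero_less_one]) auto
  obtain C where C: "C \<ge> 0" "\<And>vs. vs \<in> lists X \<Longrightarrow> length vs = Suc j \<Longrightarrow> norm (m' x vs) \<le> C * prod_list (map norm vs)"
    using bounded_multilinear_on_bound[OF assms(3)] by metis
  show ?thesis
  proof (rule that[of \<delta> "1 + C"])
    fix y vs assume h: "y \<in> S" "norm (y - x) < \<delta>" "vs \<in> lists X" "length vs = j"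
    have "y - x \<in> X" using h assms by (auto intro: subspace_diff)
    then have "norm (m' x ((y - x) # vs)) \<le> C * (norm (y - x) * prod_list (map norm vs))"
      using C(2)[of "(y - x) # vs"] h by simp
    then show "norm (m y vs - m x vs) \<le> (1 + C) * norm (y - x) * prod_list (map norm vs)"
      using d(2)[OF h] norm_triangle_ineq[of "m y vs - m x vs - m' x ((y - x) # vs)" "m' x ((y - x) # vs)"]
      by (simp add: algebra_simps)
  qed (use d C in auto)
qed

text \<open>Leibniz rule: the increment heads the argument list, so \<open>True # bs\<close> hands
  it to the first factor and \<open>False # bs\<close> to the second.\<close>

lemma family_derivative_product:
  fixes \<beta> :: "'f::real_normed_vector \<Rightarrow> 'g::real_normed_vector \<Rightarrow> 'h::real_normed_vector"
  assumes \<beta>: "bounded_bilinear \<beta>" and X: "subspace X" "S \<subseteq> X"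
    and m: "family_derivative X S (count_list bs True) m m'"
    and n: "family_derivative X S (count_list bs False) n n'"
    and ml: "\<And>x. x \<in> S \<Longrightarrow> bounded_multilinear_on X (count_list bs True) (m x)"
    and nl: "\<And>x. x \<in> S \<Longrightarrow> bounded_multilinear_on X (count_list bs False) (n x)"
    and ml': "\<And>x. x \<in> S \<Longrightarrow> bounded_multilinear_on X (Suc (count_list bs True)) (m' x)"
    and nl': "\<And>x. x \<in> S \<Longrightarrow> bounded_multilinear_on X (Suc (count_list bs False)) (n' x)"
  shows "family_derivative X S (length bs) (\<lambda>x vs. \<beta> (m x (select bs vs)) (n x (select (map Not bs) vs)))
    (\<lambda>x vs. \<beta> (m' x (select (True # bs) vs)) (n x (select (map Not (True # bs)) vs))
      + \<beta> (m x (select (False # bs) vs)) (n' x (select (map Not (False # bs)) vs)))"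
  unfolding family_derivative_def
proof (intro ballI allI impI)
  fix x and \<epsilon> :: real assume x: "x \<in> S" "\<epsilon> > 0"
  interpret bounded_bilinear \<beta> by fact
  let ?a = "count_list bs True" and ?b = "count_list bs False"
  let ?p = "\<lambda>vs :: 'a list. prod_list (map norm vs)"
  obtain K where K: "K > 0" "\<And>a b. norm (\<beta> a b) \<le> norm a * norm b * K" using pos_bounded by auto
  obtain C where C: "C \<ge> 0" "\<And>vs. vs \<in> lists X \<Longrightarrow> length vs = ?a \<Longrightarrow> norm (m x vs) \<le> C * ?p vs"
    using bounded_multilinear_on_bound[OF ml[OF x(1)]] by metis
  obtain D where D: "D \<ge> 0" "\<And>vs. vs \<in> lists X \<Longrightarrow> length vs = ?b \<Longrightarrow> norm (n x vs) \<le> D * ?p vs"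
    using bounded_multilinear_on_bound[OF nl[OF x(1)]] by metis
  obtain d1 L1 where d1: "d1 > 0" "L1 \<ge> 0" "\<And>y vs. y \<in> S \<Longrightarrow> norm (y - x) < d1 \<Longrightarrow> vs \<in> lists X \<Longrightarrow> length vs = ?a \<Longrightarrow>
      norm (m y vs - m x vs) \<le> L1 * norm (y - x) * ?p vs"
    using family_derivative_lipschitz[OF m x(1) ml'[OF x(1)] X(2,1)] by blast
  obtain d2 L2 where d2: "d2 > 0" "L2 \<ge> 0" "\<And>y vs. y \<in> S \<Longrightarrow> norm (y - x) < d2 \<Longrightarrow> vs \<in> lists X \<Longrightarrow> length vs = ?b \<Longrightarrow>
      norm (n y vs - n x vs) \<le> L2 * norm (y - x) * ?p vs"
    using family_derivative_lipschitz[OF n x(1) nl'[OF x(1)] X(2,1)] by blast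
  \<comment> \<open>Three error terms occur, two first-order remainders and one product of
    increments; \<open>e\<close> and \<open>d5\<close> make each at most \<epsilon> / 3. The 1 in
    both denominators excludes division by zero.\<close>
  define e where "e = \<epsilon> / (3 * K * (C + D + 1))"
  have e: "e > 0" using x K C D by (auto simp: e_def intro!: divide_pos_pos mult_pos_pos)
  obtain d3 where d3: "d3 > 0" "\<And>y vs. y \<in> S \<Longrightarrow> norm (y - x) < d3 \<Longrightarrow> vs \<in> lists X \<Longrightarrow> length vs = ?a \<Longrightarrow>
      norm (m y vs - m x vs - m' x ((y - x) # vs)) \<le> e * norm (y - x) * ?p vs"
    by (rule family_derivativeE[OF m x(1) e]) auto
  obtain d4 where d4: "d4 > 0" "\<And>y vs. y \<in> S \<Longrightarrow> norm (y - x) < d4 \<Longrightarrow> vs \<in> lists X \<Longrightarrow> length vs = ?b \<Longrightarrow>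
      norm (n y vs - n x vs - n' x ((y - x) # vs)) \<le> e * norm (y - x) * ?p vs"
    by (rule family_derivativeE[OF n x(1) e]) auto
  define d5 where "d5 = \<epsilon> / (3 * K * (L1 * L2 + 1))"
  have LL: "L1 * L2 \<ge> 0" using d1 d2 by simp
  have d5: "d5 > 0" using x K LL by (auto simp: d5_def intro!: divide_pos_pos mult_pos_pos)
  have CD: "C + D + 1 > 0" using C D by simp
  have e1: "e * D * K \<le> \<epsilon> / 3" "C * e * K \<le> \<epsilon> / 3"
  proof -
    have "e * (C + D + 1) * K = \<epsilon> / 3" using K CD unfolding e_def by simp
    moreover have "e * D * K \<le> e * (C + D + 1) * K" "C * e * K \<le> e * (C + D + 1) * K"
      using e K C D by (auto simp: algebra_simps)
    ultimately show "e * D * K \<le> \<epsilon> / 3" "C * e * K \<le> \<epsilon> / 3" by simp_all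
  qed
  have e2: "L1 * L2 * K * t \<le> \<epsilon> / 3" if "t < d5" "t \<ge> 0" for t
  proof -
    have "L1 * L2 * K * t \<le> (L1 * L2 + 1) * K * t" using that K by (simp add: distrib_right)
    also have "\<dots> \<le> (L1 * L2 + 1) * K * d5" using that K LL by (auto intro!: mult_left_mono)
    also have "\<dots> = \<epsilon> / 3"
    proof -
      have "L1 * L2 + 1 > 0" using LL by simp
      then show ?thesis using K unfolding d5_def by simp
    qed
    finally show ?thesis .
  qed
  let ?F = "\<lambda>x vs. \<beta> (m x (select bs vs)) (n x (select (map Not bs) vs))"
  let ?F' = "(\<lambda>x vs. \<beta> (m' x (select (True # bs) vs)) (n x (select (map Not (True # bs)) vs))
      + \<beta> (m x (select (False # bs) vs)) (n' x (select (map Not (False # bs)) vs)))"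
  show "\<exists>\<delta>>0. \<forall>y\<in>S. norm (y - x) < \<delta> \<longrightarrow> (\<forall>vs\<in>lists X. length vs = length bs \<longrightarrow>
      norm (?F y vs - ?F x vs - ?F' x ((y - x) # vs)) \<le> \<epsilon> * norm (y - x) * ?p vs)"
  proof (intro exI[of _ "min (min (min d1 d2) (min d3 d4)) d5"] conjI ballI impI)
    fix y vs assume y: "y \<in> S" "norm (y - x) < min (min (min d1 d2) (min d3 d4)) d5"
      "vs \<in> lists X" "length vs = length bs"
    define v w where "v = select bs vs" and "w = select (map Not bs) vs"
    have v: "v \<in> lists X" "length v = ?a" and w: "w \<in> lists X" "length w = ?b"
      using y by (auto simp: v_def w_def select_lists length_select count_list_map_Not)
    define h where "h = y - x"
    have hs: "norm h < d1" "norm h < d2" "norm h < d3" "norm h < d4" "norm h < d5"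
      using y by (auto simp: h_def)
    have vw: "?p v * ?p w = ?p vs" using prod_list_select[OF y(4)] by (simp add: v_def w_def)
    \<comment> \<open>Remainder of a bilinear expression: remainder times value, value times
      remainder, and increment times increment, the last being quadratic in
      \<open>norm h\<close>.\<close>
    have "?F y vs - ?F x vs - ?F' x ((y - x) # vs) =
       \<beta> (m y v - m x v - m' x (h # v)) (n x w) + \<beta> (m x v) (n y w - n x w - n' x (h # w))
       + \<beta> (m y v - m x v) (n y w - n x w)"
      by (simp add: v_def w_def h_def diff_left diff_right add_left add_right algebra_simps)
    also have "norm \<dots> \<le> (e * norm h * ?p v) * (D * ?p w) * K + (C * ?p v) * (e * norm h * ?p w) * K
       + (L1 * norm h * ?p v) * (L2 * norm h * ?p w) * K"
    proof (intro norm_triangle_le add_mono)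
      show "norm (\<beta> (m y v - m x v - m' x (h # v)) (n x w)) \<le> (e * norm h * ?p v) * (D * ?p w) * K"
        using K(1) D(1) e d3(2)[OF y(1) _ v] hs v w
        by (intro order_trans[OF K(2)] mult_right_mono[of _ _ K] mult_mono D(2)) (auto simp: h_def)
      show "norm (\<beta> (m x v) (n y w - n x w - n' x (h # w))) \<le> (C * ?p v) * (e * norm h * ?p w) * K"
        using K(1) C(1) e d4(2)[OF y(1) _ w] hs v w
        by (intro order_trans[OF K(2)] mult_right_mono[of _ _ K] mult_mono C(2)) (auto simp: h_def)
      show "norm (\<beta> (m y v - m x v) (n y w - n x w)) \<le> (L1 * norm h * ?p v) * (L2 * norm h * ?p w) * K"
        using K(1) d1(2,3) d2(2,3) y(1) hs v w
        by (intro order_trans[OF K(2)] mult_right_mono[of _ _ K] mult_mono) (auto simp: h_def)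
    qed
    also have "\<dots> = (e * D * K + C * e * K + L1 * L2 * K * norm h) * (norm h * ?p vs)"
      unfolding vw[symmetric] by (simp add: algebra_simps)
    also have "\<dots> \<le> \<epsilon> * (norm h * ?p vs)"
      using e1 e2[OF hs(5)] by (intro mult_right_mono) auto
    finally show "norm (?F y vs - ?F x vs - ?F' x ((y - x) # vs)) \<le> \<epsilon> * norm (y - x) * ?p vs"
      by (simp add: h_def)
  qed (use d1 d2 d3 d4 d5 in auto)
qed

text \<open>The Leibniz rule produces two families of the same kind with one more entry in
  \<open>bs\<close>, so the induction on the order needs the statement for every distribution
  \<open>bs\<close>. Plain products of functions are the case \<open>bs = []\<close>.\<close>

lemma smooth_family_product:
  fixes \<beta> :: "'f::real_normed_vector \<Rightarrow> 'g::real_normed_vector \<Rightarrow> 'h::real_normed_vector"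
  assumes \<beta>: "bounded_bilinear \<beta>" and X: "subspace X" "S \<subseteq> X"
    and "smooth_family r X S (count_list bs True) m" "smooth_family r X S (count_list bs False) n"
  shows "smooth_family r X S (length bs) (\<lambda>x vs. \<beta> (m x (select bs vs)) (n x (select (map Not bs) vs)))"
  using assms(4,5)
proof (induction r arbitrary: bs m n)
  case 0
  then show ?case by (auto intro!: bounded_multilinear_on_product[OF \<beta>])
next
  case (Suc r)
  obtain m' n' where m: "family_derivative X S (count_list bs True) m m'" "smooth_family r X S (Suc (count_list bs True)) m'"
    and n: "family_derivative X S (count_list bs False) n n'" "smooth_family r X S (Suc (count_list bs False)) n'"
    using Suc.prems by auto
  note ml = smooth_family_multilinear[OF Suc.prems(1)] smooth_family_multilinear[OF Suc.prems(2)]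
    smooth_family_multilinear[OF m(2)] smooth_family_multilinear[OF n(2)]
  have 1: "smooth_family r X S (length (True # bs))
      (\<lambda>x vs. \<beta> (m' x (select (True # bs) vs)) (n x (select (map Not (True # bs)) vs)))"
    by (rule Suc.IH) (use m n smooth_family_mono[OF Suc.prems(1)] smooth_family_mono[OF Suc.prems(2)] in auto)
  have 2: "smooth_family r X S (length (False # bs))
      (\<lambda>x vs. \<beta> (m x (select (False # bs) vs)) (n' x (select (map Not (False # bs)) vs)))"
    by (rule Suc.IH) (use m n smooth_family_mono[OF Suc.prems(1)] smooth_family_mono[OF Suc.prems(2)] in auto)
  show ?case
    using family_derivative_product[OF \<beta> X m(1) n(1) ml] smooth_family_add[OF 1[simplified] 2[simplified]]
      bounded_multilinear_on_product[OF \<beta> ml(1,2)]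
    by (auto simp del: select_simps)
qed

text \<open>Both derivatives are compared at the point \<open>x + t h\<close>, where homogeneity
  cancels t. Relative openness of S keeps this point in S for small t.\<close>

lemma family_derivative_unique:
  assumes 1: "family_derivative X S j m m1" and 2: "family_derivative X S j m m2" and x: "x \<in> S"
    and ml1: "bounded_multilinear_on X (Suc j) (m1 x)" and ml2: "bounded_multilinear_on X (Suc j) (m2 x)"
    and S: "openin (top_of_set X) S" and X: "subspace X"
    and h: "h \<in> X" and vs: "vs \<in> lists X" "length vs = j"
  shows "m1 x (h # vs) = m2 x (h # vs)"
proof -
  let ?D = "norm (m1 x (h # vs) - m2 x (h # vs))" and ?P = "norm h * prod_list (map norm vs)"
  have P: "?P \<ge> 0" by simp
  have bound: "?D \<le> 2 * \<epsilon> * ?P" if \<epsilon>: "\<epsilon> > 0" for \<epsilon>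
  proof -
    obtain d where d: "d > 0" "\<And>y vs. y \<in> S \<Longrightarrow> norm (y - x) < d \<Longrightarrow> vs \<in> lists X \<Longrightarrow> length vs = j \<Longrightarrow>
      norm (m y vs - m x vs - m1 x ((y - x) # vs)) \<le> \<epsilon> * norm (y - x) * prod_list (map norm vs)"
      by (rule family_derivativeE[OF 1 x \<epsilon>]) auto
    obtain e where e: "e > 0" "\<And>y vs. y \<in> S \<Longrightarrow> norm (y - x) < e \<Longrightarrow> vs \<in> lists X \<Longrightarrow> length vs = j \<Longrightarrow>
      norm (m y vs - m x vs - m2 x ((y - x) # vs)) \<le> \<epsilon> * norm (y - x) * prod_list (map norm vs)"
      by (rule family_derivativeE[OF 2 x \<epsilon>]) auto
    obtain \<rho> where \<rho>: "\<rho> > 0" "ball x \<rho> \<inter> X \<subseteq> S"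
      using S x unfolding openin_contains_ball by auto
    \<comment> \<open>Adding 1 keeps the denominator of \<open>t\<close> positive for
      \<open>h = 0\<close>; the factor 2 there makes \<open>t * norm h\<close> strictly smaller than
      all three radii.\<close>
    define q where "q = norm h + 1"
    define t where "t = min (min d e) \<rho> / (2 * q)"
    have n1: "q > 0" by (simp add: q_def add_nonneg_pos)
    have t: "t > 0" using d e \<rho> n1 by (auto simp: t_def)
    have "t * norm h \<le> t * q" using t by (simp add: q_def)
    also have "\<dots> = min (min d e) \<rho> / 2" using n1 by (simp add: t_def)
    also have "\<dots> < min (min d e) \<rho>" using d e \<rho> by auto
    finally have th: "t * norm h < d" "t * norm h < e" "t * norm h < \<rho>" by auto
    have xX: "x \<in> X" using S x openin_imp_subset by blast
    have y: "x + t *\<^sub>R h \<in> S"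
      using \<rho> th t h xX X by (auto intro!: subsetD[OF \<rho>(2)] simp: dist_norm subspace_add subspace_scale)
    have c: "n x ((t *\<^sub>R h) # vs) = t *\<^sub>R n x (h # vs)" if "bounded_multilinear_on X (Suc j) (n x)" for n :: "'a \<Rightarrow> 'a list \<Rightarrow> 'b"
      using bounded_multilinear_on_Cons[OF that vs h h, of t 0] by simp
    let ?y = "x + t *\<^sub>R h"
    have "norm (m ?y vs - m x vs - t *\<^sub>R m1 x (h # vs)) \<le> \<epsilon> * (t * ?P)"
      using d(2)[OF y _ vs] th t c[of m1, OF ml1] by (simp add: mult_ac)
    moreover have "norm (m ?y vs - m x vs - t *\<^sub>R m2 x (h # vs)) \<le> \<epsilon> * (t * ?P)"
      using e(2)[OF y _ vs] th t c[of m2, OF ml2] by (simp add: mult_ac)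
    ultimately have "norm ((m ?y vs - m x vs - t *\<^sub>R m2 x (h # vs)) - (m ?y vs - m x vs - t *\<^sub>R m1 x (h # vs)))
        \<le> \<epsilon> * (t * ?P) + \<epsilon> * (t * ?P)"
      using norm_triangle_ineq4[of "m ?y vs - m x vs - t *\<^sub>R m2 x (h # vs)" "m ?y vs - m x vs - t *\<^sub>R m1 x (h # vs)"]
      by linarith
    also have "(m ?y vs - m x vs - t *\<^sub>R m2 x (h # vs)) - (m ?y vs - m x vs - t *\<^sub>R m1 x (h # vs))
        = t *\<^sub>R (m1 x (h # vs) - m2 x (h # vs))" by (simp add: algebra_simps)
    also have "norm \<dots> = t * ?D" using t by simp
    also have "\<epsilon> * (t * ?P) + \<epsilon> * (t * ?P) = t * (2 * \<epsilon> * ?P)" by simp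
    finally show ?thesis using t by simp
  qed
  have "?D \<le> 0"
  proof (rule field_le_epsilon)
    fix e :: real assume e: "e > 0"
    have P1: "2 * ?P + 1 > 0" using P by linarith
    have "?D \<le> 2 * (e / (2 * ?P + 1)) * ?P" using bound[of "e / (2 * ?P + 1)"] e P1 by simp
    also have "\<dots> = e * ((2 * ?P) / (2 * ?P + 1))" by simp
    also have "\<dots> \<le> e * 1" using e P1 by (intro mult_left_mono) auto
    finally show "?D \<le> 0 + e" by simp
  qed
  then show ?thesis by simp
qed

lemma smooth_family_cong:
  assumes "\<And>x vs. x \<in> S \<Longrightarrow> vs \<in> lists X \<Longrightarrow> length vs = j \<Longrightarrow> m x vs = n x vs"
    and X: "subspace X" and "smooth_family r X S j m"
  shows "smooth_family r X S j n"
proof -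
  have ml: "\<forall>x\<in>S. bounded_multilinear_on X j (n x)"
  proof
    fix x assume "x \<in> S"
    then show "bounded_multilinear_on X j (n x)"
      using bounded_multilinear_on_cong[of X j "m x" "n x"] assms smooth_family_multilinear[OF assms(3)] by auto
  qed
  show ?thesis
  proof (cases r)
    case (Suc r')
    then obtain m' where "family_derivative X S j m m'" "smooth_family r' X S (Suc j) m'"
      using assms(3) by auto
    moreover from this(1) have "family_derivative X S j n m'"
      unfolding family_derivative_def using assms(1) by simp
    ultimately show ?thesis using Suc ml by auto
  qed (use ml in auto)
qed

text \<open>Every tower of higher order provides a candidate for the next derivative, and by
  uniqueness all candidates agree on S. Hence one candidate, the one taken from order 0, is itself
  differentiable to every order, and dependent choice produces a single infinite tower.\<close>

lemma smooth_on_if_smooth_at_all_orders: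
  fixes f :: "'e::real_normed_vector \<Rightarrow> 'f::real_normed_vector"
  assumes S: "openin (top_of_set X) S" and X: "subspace X" and f: "smooth_at_all_orders X S f"
  shows "smooth_on X S f"
proof -
  define P where "P = (\<lambda>k (m :: 'e \<Rightarrow> 'e list \<Rightarrow> 'f). (\<forall>r. smooth_family r X S k m) \<and> (k = 0 \<longrightarrow> m = (\<lambda>x vs. f x)))"
  have step: "\<exists>m'. P (Suc k) m' \<and> family_derivative X S k m m'" if "P k m" for k m
  proof -
    have "\<exists>m'. family_derivative X S k m m' \<and> smooth_family r X S (Suc k) m'" for r
      using that smooth_family.simps(2)[of r X S k m] unfolding P_def by blast
    then obtain M where M: "\<And>r. family_derivative X S k m (M r)" "\<And>r. smooth_family r X S (Suc k) (M r)"
      by metis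
    have "smooth_family r X S (Suc k) (M 0)" for r
    proof (rule smooth_family_cong[OF _ X M(2)[of r]])
      fix x vs assume h: "x \<in> S" "vs \<in> lists X" "length vs = Suc k"
      then obtain h ws where "vs = h # ws" "h \<in> X" "ws \<in> lists X" "length ws = k"
        by (cases vs) auto
      then show "M r x vs = M 0 x vs"
        using family_derivative_unique[OF M(1)[of r] M(1)[of 0] h(1) smooth_family_multilinear[OF M(2) h(1)]
          smooth_family_multilinear[OF M(2) h(1)] S X] by simp
    qed
    then show ?thesis using M by (intro exI[of _ "M 0"]) (auto simp: P_def)
  qed
  have "\<exists>m. P 0 m" using f by (auto simp: P_def smooth_at_all_orders_def)
  from dependent_nat_choice[of P "family_derivative X S", OF this step]
  obtain M where M: "\<And>k. P k (M k)" "\<And>k. family_derivative X S k (M k) (M (Suc k))" by metis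
  have ml: "bounded_multilinear_on X k (M k x)" if "x \<in> S" for k x
    using M(1)[of k] that smooth_family_multilinear unfolding P_def by blast
  have "M 0 = (\<lambda>x vs. f x)" using M(1)[of 0] by (simp add: P_def)
  then show ?thesis unfolding smooth_on_def
  \<comment> \<open>\<open>smooth_on\<close> wants one function of lists of all lengths; the length
    selects the member of the tower.\<close>
  proof (intro exI[of _ "\<lambda>x vs. M (length vs) x vs"] ballI conjI allI impI)
    fix x k assume x: "x \<in> S"
    show "bounded_multilinear_on X k (\<lambda>vs. M (length vs) x vs)"
      by (rule bounded_multilinear_on_cong[OF _ X ml[OF x]]) auto
    fix \<epsilon> :: real assume "\<epsilon> > 0"
    from family_derivativeE[OF M(2)[of k] x this] obtain \<delta> where
      "\<delta> > 0" and d: "\<And>y vs. y \<in> S \<Longrightarrow> norm (y - x) < \<delta> \<Longrightarrow> vs \<in> lists X \<Longrightarrow> length vs = k \<Longrightarrow>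
       norm (M k y vs - M k x vs - M (Suc k) x ((y - x) # vs)) \<le> \<epsilon> * norm (y - x) * prod_list (map norm vs)"
      by auto
    show "\<exists>\<delta>>0. \<forall>y\<in>S. norm (y - x) < \<delta> \<longrightarrow> (\<forall>vs\<in>lists X. length vs = k \<longrightarrow>
      norm (M (length vs) y vs - M (length vs) x vs - M (length ((y - x) # vs)) x ((y - x) # vs))
      \<le> \<epsilon> * norm (y - x) * prod_list (map norm vs))"
      using d by (intro exI[of _ \<delta>]) (simp add: \<open>\<delta> > 0\<close>)
  qed simp
qed

lemma smooth_at_all_orders_if_smooth_on:
  assumes "smooth_on X S f" and X: "subspace X"
  shows "smooth_at_all_orders X S f"
proof -
  obtain D where D0: "\<And>x. x \<in> S \<Longrightarrow> D x [] = f x" and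
    ml: "\<And>x k. x \<in> S \<Longrightarrow> bounded_multilinear_on X k (D x)" and
    d: "\<And>k. family_derivative X S k D D"
    using assms(1) unfolding smooth_on_def family_derivative_def by metis
  have *: "smooth_family r X S k D" for r k
  proof (induction r arbitrary: k)
    case (Suc r)
    show ?case unfolding smooth_family.simps using Suc.IH[of "Suc k"] ml d by blast
  qed (use ml in auto)
  have "smooth_family r X S 0 (\<lambda>x vs. f x)" for r
    by (rule smooth_family_cong[OF _ X *[of r 0]]) (use D0 in auto)
  then show ?thesis by (simp add: smooth_at_all_orders_def)
qed

section \<open>Closure properties of smooth maps\<close>

lemma smooth_at_all_orders_cong:
  assumes "\<And>x. x \<in> S \<Longrightarrow> f x = g x" "subspace X" "smooth_at_all_orders X S f"
  shows "smooth_at_all_orders X S g"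
  unfolding smooth_at_all_orders_def
  by (intro allI smooth_family_cong[OF _ assms(2) assms(3)[unfolded smooth_at_all_orders_def, rule_format]])
    (use assms in auto)

lemma smooth_at_all_orders_continuous_on:
  assumes "smooth_at_all_orders X S f" "subspace X" "S \<subseteq> X"
  shows "continuous_on S f"
  unfolding continuous_on_iff
proof (intro ballI allI impI)
  fix x and e :: real assume x: "x \<in> S" and e: "e > 0"
  have "smooth_family (Suc 0) X S 0 (\<lambda>x vs. f x)" using assms by (simp add: smooth_at_all_orders_def)
  then obtain m' where m': "family_derivative X S 0 (\<lambda>x vs. f x) m'" "\<forall>x\<in>S. bounded_multilinear_on X (Suc 0) (m' x)"
    by auto
  obtain \<delta> L where L: "\<delta> > 0" "L \<ge> 0" "\<And>y vs. y \<in> S \<Longrightarrow> norm (y - x) < \<delta> \<Longrightarrow> vs \<in> lists X \<Longrightarrow> length vs = 0 \<Longrightarrow>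
    norm (f y - f x) \<le> L * norm (y - x) * prod_list (map norm vs)"
    by (rule family_derivative_lipschitz[OF m'(1) x m'(2)[rule_format, OF x] assms(3,2)]) auto
  show "\<exists>d>0. \<forall>x'\<in>S. dist x' x < d \<longrightarrow> dist (f x') (f x) < e"
  proof (intro exI[of _ "min \<delta> (e / (L + 1))"] conjI ballI impI)
    fix y assume y: "y \<in> S" "dist y x < min \<delta> (e / (L + 1))"
    have "norm (f y - f x) \<le> L * norm (y - x)" using L(3)[of y "[]"] y by (simp add: dist_norm)
    also have "\<dots> \<le> (L + 1) * norm (y - x)" by (simp add: mult_right_mono)
    also have "\<dots> < e" using y L by (simp add: dist_norm field_simps)
    finally show "dist (f y) (f x) < e" by (simp add: dist_norm)
  qed (use L e in auto)
qed

lemma smooth_family_independent: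
  assumes "bounded_multilinear_on X j m"
  shows "smooth_family r X S j (\<lambda>x. m)"
proof (cases r)
  case (Suc r')
  have "family_derivative X S j (\<lambda>x. m) (\<lambda>x vs. 0)"
    by (auto simp: family_derivative_def intro!: exI[of _ 1])
  then show ?thesis
    unfolding Suc smooth_family.simps using assms smooth_family_zero[of r' X S "Suc j"] by blast
qed (use assms in auto)

lemma smooth_at_all_orders_const: "smooth_at_all_orders X S (\<lambda>x. c)"
  by (auto simp: smooth_at_all_orders_def intro!: smooth_family_independent bounded_multilinear_on_0)

lemma smooth_at_all_orders_linear:
  assumes "bounded_linear L"
  shows "smooth_at_all_orders X S L"
proof -
  interpret bounded_linear L by fact
  obtain K where K: "\<And>x. norm (L x) \<le> norm x * K" using bounded by auto
  have ml: "bounded_multilinear_on X (Suc 0) (\<lambda>vs. L (hd vs))"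
    unfolding bounded_multilinear_on_def
  proof (intro conjI ballI impI allI)
    show "\<exists>C. \<forall>vs\<in>lists X. length vs = Suc 0 \<longrightarrow> norm (L (hd vs)) \<le> C * prod_list (map norm vs)"
      using K by (intro exI[of _ K]) (auto simp: length_Suc_conv mult.commute)
  qed (auto simp: length_Suc_conv add scaleR)
  have "family_derivative X S 0 (\<lambda>x vs. L x) (\<lambda>x vs. L (hd vs))"
    by (auto simp: family_derivative_def diff intro!: exI[of _ 1])
  then have "smooth_family r X S 0 (\<lambda>x vs. L x)" for r
    using smooth_family_independent[OF ml] by (cases r) (auto intro: bounded_multilinear_on_0)
  then show ?thesis by (simp add: smooth_at_all_orders_def)
qed

lemma smooth_at_all_orders_bilinear:
  assumes "bounded_bilinear \<beta>" "subspace X" "S \<subseteq> X"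
    "smooth_at_all_orders X S f" "smooth_at_all_orders X S g"
  shows "smooth_at_all_orders X S (\<lambda>x. \<beta> (f x) (g x))"
  unfolding smooth_at_all_orders_def
proof
  fix r
  show "smooth_family r X S 0 (\<lambda>x vs. \<beta> (f x) (g x))"
    using smooth_family_product[OF assms(1-3), of r "[]" "\<lambda>x vs. f x" "\<lambda>x vs. g x"] assms(4,5)
    by (simp add: smooth_at_all_orders_def)
qed

lemma smooth_at_all_orders_add:
  "smooth_at_all_orders X S f \<Longrightarrow> smooth_at_all_orders X S g \<Longrightarrow> smooth_at_all_orders X S (\<lambda>x. f x + g x)"
  by (auto simp: smooth_at_all_orders_def intro!: smooth_family_add)

lemma smooth_at_all_orders_sum:
  "(\<And>i. i \<in> I \<Longrightarrow> smooth_at_all_orders X S (f i)) \<Longrightarrow> smooth_at_all_orders X S (\<lambda>x. \<Sum>i\<in>I. f i x)"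
  by (induction I rule: infinite_finite_induct)
    (auto intro!: smooth_at_all_orders_add smooth_at_all_orders_const)

context
  fixes X S :: "'e::real_normed_vector set"
  assumes X: "subspace X" "S \<subseteq> X"
begin

lemmas smooth_at_all_orders_scaleR = smooth_at_all_orders_bilinear[OF bounded_bilinear_scaleR X]
lemmas smooth_at_all_orders_mult =
  smooth_at_all_orders_bilinear[OF bounded_bilinear_mult[where 'a = real] X]

lemma smooth_at_all_orders_diff:
  assumes "smooth_at_all_orders X S f" "smooth_at_all_orders X S g"
  shows "smooth_at_all_orders X S (\<lambda>x. f x - g x)"
  using smooth_at_all_orders_add[OF assms(1) smooth_at_all_orders_scaleR[OF smooth_at_all_orders_const[of _ _ "-1"] assms(2)]]
  by simp

lemma smooth_at_all_orders_prod:
  fixes f :: "'i \<Rightarrow> 'e \<Rightarrow> real"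
  shows "(\<And>i. i \<in> I \<Longrightarrow> smooth_at_all_orders X S (f i)) \<Longrightarrow> smooth_at_all_orders X S (\<lambda>x. \<Prod>i\<in>I. f i x)"
  by (induction I rule: infinite_finite_induct)
    (auto intro!: smooth_at_all_orders_mult smooth_at_all_orders_const)

text \<open>The remainder of the outer function is controlled by the Lipschitz bound of f, that of
  the inner one is multiplied by the slope \<open>\<phi>' (f x)\<close>; each is given half of
  \<epsilon>.\<close>

lemma family_derivative_real_comp:
  assumes \<phi>: "\<And>t. t \<in> T \<Longrightarrow> (\<phi> has_real_derivative \<phi>' t) (at t)" and T: "f ` S \<subseteq> T"
    and f: "family_derivative X S 0 (\<lambda>x vs. f x) m'" and ml: "\<And>x. x \<in> S \<Longrightarrow> bounded_multilinear_on X (Suc 0) (m' x)"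
  shows "family_derivative X S 0 (\<lambda>x vs. \<phi> (f x)) (\<lambda>x vs. \<phi>' (f x) * m' x vs)"
  unfolding family_derivative_def
proof (intro ballI allI impI)
  fix x and \<epsilon> :: real assume x: "x \<in> S" and \<epsilon>: "\<epsilon> > 0"
  obtain d L where L: "d > 0" "L \<ge> 0" "\<And>y vs. y \<in> S \<Longrightarrow> norm (y - x) < d \<Longrightarrow> vs \<in> lists X \<Longrightarrow> length vs = 0 \<Longrightarrow>
    norm (f y - f x) \<le> L * norm (y - x) * prod_list (map norm vs)"
    by (rule family_derivative_lipschitz[OF f x ml[OF x] X(2,1)]) auto
  let ?a = "\<phi>' (f x)"
  define q where "q = \<bar>?a\<bar> + 1"
  define e where "e = \<epsilon> / (2 * q)"
  have q: "q > 0" by (simp add: q_def add_nonneg_pos)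
  then have e: "e > 0" using \<epsilon> by (auto simp: e_def)
  have ea: "\<bar>?a\<bar> * e \<le> \<epsilon> / 2"
  proof -
    have "\<bar>?a\<bar> * e \<le> q * e" using e by (simp add: q_def)
    also have "\<dots> = \<epsilon> / 2" using q by (simp add: e_def)
    finally show ?thesis .
  qed
  obtain d1 where d1: "d1 > 0" "\<And>y vs. y \<in> S \<Longrightarrow> norm (y - x) < d1 \<Longrightarrow> vs \<in> lists X \<Longrightarrow> length vs = 0 \<Longrightarrow>
      norm (f y - f x - m' x ((y - x) # vs)) \<le> e * norm (y - x) * prod_list (map norm vs)"
    by (rule family_derivativeE[OF f x e]) auto
  define \<eta> where "\<eta> = \<epsilon> / (2 * (L + 1))"
  have \<eta>: "\<eta> > 0" "\<eta> * L \<le> \<epsilon> / 2"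
  proof -
    show "\<eta> > 0" using \<epsilon> L by (auto simp: \<eta>_def)
    then have "\<eta> * L \<le> \<eta> * (L + 1)" by simp
    also have "\<dots> = \<epsilon> / 2"
    proof -
      have "L + 1 \<noteq> 0" "2 * L + 2 \<noteq> 0" using L(2) by auto
      then show ?thesis unfolding \<eta>_def by (simp add: divide_simps)
    qed
    finally show "\<eta> * L \<le> \<epsilon> / 2" .
  qed
  have "(\<phi> has_derivative (*) ?a) (at (f x))"
    using \<phi>[of "f x"] T x by (auto simp: has_field_derivative_def)
  then obtain d2 where d2: "d2 > 0" "\<And>s. \<bar>s - f x\<bar> < d2 \<Longrightarrow> \<bar>\<phi> s - \<phi> (f x) - ?a * (s - f x)\<bar> \<le> \<eta> * \<bar>s - f x\<bar>"
    unfolding has_derivative_at_alt using \<eta>(1) by (auto simp: real_norm_def)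
  show "\<exists>\<delta>>0. \<forall>y\<in>S. norm (y - x) < \<delta> \<longrightarrow> (\<forall>vs\<in>lists X. length vs = 0 \<longrightarrow>
      norm (\<phi> (f y) - \<phi> (f x) - ?a * m' x ((y - x) # vs)) \<le> \<epsilon> * norm (y - x) * prod_list (map norm vs))"
  proof (intro exI[of _ "min (min d d1) (d2 / (L + 1))"] conjI ballI impI)
    fix y vs assume y: "y \<in> S" "norm (y - x) < min (min d d1) (d2 / (L + 1))" "vs \<in> lists X" "length vs = 0"
    have f1: "\<bar>f y - f x\<bar> \<le> L * norm (y - x)" using L(3)[of y "[]"] y by simp
    have "\<bar>f y - f x - m' x [y - x]\<bar> \<le> e * norm (y - x)" using d1(2)[of y "[]"] y by simp
    then have f2: "\<bar>?a * (f y - f x - m' x [y - x])\<bar> \<le> \<bar>?a\<bar> * (e * norm (y - x))"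
      unfolding abs_mult by (rule mult_left_mono) simp
    have "L * norm (y - x) \<le> (L + 1) * norm (y - x)" by (simp add: mult_right_mono)
    also have "\<dots> < d2" using y L by (simp add: field_simps)
    finally have "\<bar>\<phi> (f y) - \<phi> (f x) - ?a * (f y - f x)\<bar> \<le> \<eta> * \<bar>f y - f x\<bar>" using f1 by (intro d2) auto
    also have "\<dots> \<le> \<eta> * (L * norm (y - x))" using f1 \<eta> by (intro mult_left_mono) auto
    finally have f3: "\<bar>\<phi> (f y) - \<phi> (f x) - ?a * (f y - f x)\<bar> \<le> \<eta> * L * norm (y - x)" by simp
    have "\<phi> (f y) - \<phi> (f x) - ?a * m' x [y - x]
      = (\<phi> (f y) - \<phi> (f x) - ?a * (f y - f x)) + ?a * (f y - f x - m' x [y - x])" by (simp add: algebra_simps)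
    then have "\<bar>\<phi> (f y) - \<phi> (f x) - ?a * m' x [y - x]\<bar> \<le> \<eta> * L * norm (y - x) + \<bar>?a\<bar> * e * norm (y - x)"
      using f2 f3 abs_triangle_ineq[of "\<phi> (f y) - \<phi> (f x) - ?a * (f y - f x)" "?a * (f y - f x - m' x [y - x])"]
      by (simp add: mult.assoc)
    also have "\<dots> \<le> \<epsilon> / 2 * norm (y - x) + \<epsilon> / 2 * norm (y - x)"
      using \<eta>(2) ea by (intro add_mono mult_right_mono) auto
    finally show "norm (\<phi> (f y) - \<phi> (f x) - ?a * m' x ((y - x) # vs)) \<le> \<epsilon> * norm (y - x) * prod_list (map norm vs)"
      using y(4) by simp
  qed (use L d1 d2 in auto)
qed

text \<open>All members of the chain \<open>d 0, d 1, ...\<close> are treated at once: the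
  derivative of \<open>d k (f x)\<close> is \<open>d (Suc k) (f x)\<close> times the derivative of
  f, a product whose first factor is again of the form covered by the induction.\<close>

lemma smooth_at_all_orders_real_comp:
  assumes d: "\<And>k t. t \<in> T \<Longrightarrow> (d k has_real_derivative d (Suc k) t) (at t)" and T: "f ` S \<subseteq> T"
    and f: "smooth_at_all_orders X S f"
  shows "smooth_at_all_orders X S (\<lambda>x. d k (f x))"
proof -
  have "smooth_family r X S 0 (\<lambda>x vs. d k (f x))" for r
  proof (induction r arbitrary: k)
    case 0
    show ?case by (simp add: bounded_multilinear_on_0)
  next
    case (Suc r)
    obtain m' where m': "family_derivative X S 0 (\<lambda>x vs. f x) m'" "smooth_family r X S (Suc 0) m'"
      using f smooth_family.simps(2)[of r X S 0 "\<lambda>x vs. f x"] unfolding smooth_at_all_orders_def by blast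
    \<comment> \<open>With \<open>bs = [False]\<close> the scalar factor takes no argument and
      \<open>m'\<close> takes the only one.\<close>
    have *: "smooth_family r X S (length [False])
      (\<lambda>x vs. d (Suc k) (f x) * m' x (select (map Not [False]) vs))"
      by (rule smooth_family_product[OF bounded_bilinear_mult X, where m = "\<lambda>x vs. d (Suc k) (f x)"])
        (use Suc m' in auto)
    have "smooth_family r X S (length [False]) (\<lambda>x vs. d (Suc k) (f x) * m' x vs)"
      by (rule smooth_family_cong[OF _ X(1) *]) (auto simp: length_Suc_conv)
    moreover have "family_derivative X S 0 (\<lambda>x vs. d k (f x)) (\<lambda>x vs. d (Suc k) (f x) * m' x vs)"
      by (rule family_derivative_real_comp[OF d T m'(1)]) (use m' smooth_family_multilinear in auto)
    ultimately show ?case by (auto simp: bounded_multilinear_on_0)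
  qed
  then show ?thesis by (simp add: smooth_at_all_orders_def)
qed

lemma smooth_at_all_orders_powr:
  fixes f :: "'e \<Rightarrow> real"
  assumes "smooth_at_all_orders X S f" "\<And>x. x \<in> S \<Longrightarrow> f x > 0"
  shows "smooth_at_all_orders X S (\<lambda>x. f x powr a)"
proof -
  \<comment> \<open>The k-th derivative of \<open>t powr a\<close> on the positive half line; its
    coefficient is a falling factorial.\<close>
  let ?d = "\<lambda>k t. (\<Prod>i<k. a - real i) * t powr (a - real k)"
  have "smooth_at_all_orders X S (\<lambda>x. ?d 0 (f x))"
  proof (rule smooth_at_all_orders_real_comp[where d = ?d and T = "{0<..}"])
    fix k and t :: real assume "t \<in> {0<..}"
    then show "(?d k has_real_derivative ?d (Suc k) t) (at t)"
      by (auto intro!: derivative_eq_intros simp: algebra_simps)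
  qed (use assms in auto)
  then show ?thesis by simp
qed

lemma smooth_at_all_orders_sqrt:
  assumes "smooth_at_all_orders X S f" "\<And>x. x \<in> S \<Longrightarrow> f x > 0"
  shows "smooth_at_all_orders X S (\<lambda>x. sqrt (f x))"
  by (rule smooth_at_all_orders_cong[OF _ X(1) smooth_at_all_orders_powr[OF assms, of "1/2"]])
    (use assms(2) in \<open>auto simp: powr_half_sqrt less_imp_le\<close>)

lemma smooth_at_all_orders_inverse:
  fixes f :: "'e \<Rightarrow> real"
  assumes "smooth_at_all_orders X S f" "\<And>x. x \<in> S \<Longrightarrow> f x \<noteq> 0"
  shows "smooth_at_all_orders X S (\<lambda>x. inverse (f x))"
proof (rule smooth_at_all_orders_cong[OF _ X(1)])
  have "f x * f x > 0" if "x \<in> S" for x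
    using assms(2)[OF that] by (cases "f x > 0") (auto intro: mult_pos_pos mult_neg_neg)
  \<comment> \<open>Powers are available for positive functions only; squaring first covers negative
    values of f as well.\<close>
  then show "smooth_at_all_orders X S (\<lambda>x. f x * (f x * f x) powr - 1)"
    by (intro smooth_at_all_orders_mult smooth_at_all_orders_powr assms(1))
  show "f x * (f x * f x) powr - 1 = inverse (f x)" if "x \<in> S" for x
    using assms(2)[OF that] by (simp add: powr_minus field_simps)
qed

end

section \<open>Coupled quartic functionals on a Hilbert space\<close>

lemma smooth_at_all_orders_vec:
  fixes g :: "'n::finite \<Rightarrow> 'x::real_normed_vector \<Rightarrow> 'e::real_normed_vector"
  assumes "\<And>i. smooth_at_all_orders X S (g i)" "subspace X" "S \<subseteq> X"
  shows "smooth_at_all_orders X S (\<lambda>x. \<chi> i. g i x)"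
proof (rule smooth_at_all_orders_cong[OF _ assms(2)])
  have ax: "bounded_linear (axis i :: 'e \<Rightarrow> 'e ^ 'n)" for i
  proof (rule bounded_linear_intro[where K = 1])
    show "norm (axis i x) \<le> norm x * 1" for x :: 'e
      by (simp add: norm_vec_def axis_def L2_set_def if_distrib[of norm] if_distrib[of "\<lambda>x. x\<^sup>2"] cong: if_cong)
  qed (auto simp: axis_def vec_eq_iff)
  show "smooth_at_all_orders X S (\<lambda>x. \<Sum>i\<in>UNIV. axis i (g i x))"
  proof (intro smooth_at_all_orders_sum)
    fix i
    \<comment> \<open>Composition with the bounded linear map \<open>axis i\<close> is obtained as a
      bilinear operation whose first argument is the constant 1.\<close>
    have "bounded_bilinear (\<lambda>(r::real) y. r *\<^sub>R (axis i y :: 'e ^ 'n))"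
      by (rule bounded_bilinear.comp1[OF bounded_bilinear.comp[OF bounded_bilinear_scaleR bounded_linear_ident ax] bounded_linear_ident])
    from smooth_at_all_orders_bilinear[OF this assms(2,3) smooth_at_all_orders_const[of X S 1] assms(1)[of i]]
    show "smooth_at_all_orders X S (\<lambda>x. axis i (g i x))" by simp
  qed
  show "(\<Sum>i\<in>UNIV. axis i (g i x)) = (\<chi> i. g i x)" for x
    by (simp add: vec_eq_iff axis_def)
qed

text \<open>The set is the preimage of the open orthant under one continuous map. The domains of the
  charts are cut out by conditions of this kind.\<close>

lemma openin_positive:
  fixes g :: "'n::finite \<Rightarrow> 'x::topological_space \<Rightarrow> real"
  assumes S: "openin (top_of_set X) S" and g: "\<And>k. continuous_on S (g k)"
  shows "openin (top_of_set X) {u\<in>S. \<forall>k. 0 < g k u}"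
proof -
  have "open {x :: real ^ 'n. \<forall>k. 0 < x $ k}"
  proof -
    have "{x :: real ^ 'n. \<forall>k. 0 < x $ k} = (\<Inter>k\<in>UNIV. {x. 0 < x $ k})" by auto
    also have "open \<dots>" by (intro open_INT finite ballI open_Collect_less continuous_intros)
    finally show ?thesis .
  qed
  then have "openin (top_of_set S) (S \<inter> (\<lambda>u. \<chi> k. g k u) -` {x. \<forall>k. 0 < x $ k})"
    by (intro continuous_openin_preimage_gen continuous_on_vec_lambda g)
  also have "S \<inter> (\<lambda>u. \<chi> k. g k u) -` {x. \<forall>k. 0 < x $ k} = {u\<in>S. \<forall>k. 0 < g k u}" by auto
  finally show ?thesis using S by (rule openin_trans)
qed

text \<open>Abstract form of the problem: H is the Sobolev space, B the form with weight
  \<open>lam\<close>, and \<beta> the pointwise product with values in \<open>L\<^sup>2\<close>, so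
  that \<open>\<beta> u v \<bullet> \<beta> w z\<close> stands for
  \<open>\<integral> u v w z\<close> and \<open>\<beta>_inner_sym\<close> for its symmetry. Of the
  scalar equation only the Euler equation of U and the coercivity on the complement of U are
  retained.\<close>

locale coupled_ground_state =
  fixes H :: "'e::real_inner set" and B :: "'e \<Rightarrow> 'e \<Rightarrow> real"
    and \<beta> :: "'e \<Rightarrow> 'e \<Rightarrow> 'l::real_inner" and U :: 'e and \<kappa> :: real
    and A :: "real ^ 'n ^ 'n" and c :: "real ^ 'n"
  assumes H: "subspace H" and U_in: "U \<in> H"
    and B_bilinear: "bounded_bilinear B" and B_sym: "\<And>u v. B u v = B v u"
    and \<beta>_bilinear: "bounded_bilinear \<beta>" and \<beta>_sym: "\<And>u v. \<beta> u v = \<beta> v u"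
    and \<beta>_inner_sym: "\<And>u v w z. \<beta> u v \<bullet> \<beta> w z = \<beta> u w \<bullet> \<beta> v z"
    and B_U_pos: "B U U > 0"
    and euler: "\<And>w. w \<in> H \<Longrightarrow> B U w = \<beta> U U \<bullet> \<beta> U w"
    and \<kappa>_pos: "\<kappa> > 0"
    and coercive: "\<And>w. w \<in> H \<Longrightarrow> B U w = 0 \<Longrightarrow> B w w - 3 * (norm (\<beta> U w))\<^sup>2 \<ge> \<kappa> * (norm w)\<^sup>2"
    and A_sym: "\<And>i j. A $ i $ j = A $ j $ i" and A_nonneg: "\<And>i j. 0 \<le> A $ i $ j"
    and A_invertible: "invertible A"
    and c_pos: "\<And>i. c $ i > 0" and A_c: "\<And>i. (\<Sum>j\<in>UNIV. A $ i $ j * (c $ j)\<^sup>2) = 1"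
begin

sublocale B: bounded_bilinear B by (rule B_bilinear)
sublocale \<beta>: bounded_bilinear \<beta> by (rule \<beta>_bilinear)

definition Hn :: "('e ^ 'n) set" where "Hn = {u. \<forall>i. u $ i \<in> H}"

definition energy :: "'e ^ 'n \<Rightarrow> real" where
  "energy u = 1/2 * (\<Sum>i\<in>UNIV. B (u $ i) (u $ i))
    - 1/4 * (\<Sum>i\<in>UNIV. \<Sum>j\<in>UNIV. A $ i $ j * (\<beta> (u $ i) (u $ i) \<bullet> \<beta> (u $ j) (u $ j)))"

text \<open>The derivative of \<open>energy\<close> at u in the direction with \<open>u $ i\<close>
  in slot i and 0 elsewhere, that is, the abstract \<open>J_fun\<close>; see
  \<open>energy_has_derivative\<close>.\<close>

definition constraint :: "'n \<Rightarrow> 'e ^ 'n \<Rightarrow> real" where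
  "constraint i u = B (u $ i) (u $ i) - (\<Sum>j\<in>UNIV. A $ i $ j * (\<beta> (u $ i) (u $ i) \<bullet> \<beta> (u $ j) (u $ j)))"

definition M :: "('e ^ 'n) set" where
  "M = {u\<in>Hn. \<forall>i j. constraint i u = 0 \<and> u $ j \<noteq> 0}"

definition p :: "'e ^ 'n" where "p = (\<chi> i. c $ i *\<^sub>R U)"

section \<open>Expansion of the energy and of the constraints at \<open>p\<close>\<close>

lemma subspace_Hn: "subspace Hn"
  using H unfolding Hn_def subspace_def by auto

lemma B_U_U: "B U U = \<beta> U U \<bullet> \<beta> U U"
  using euler[OF U_in] .

lemma \<beta>_U_norm: "\<beta> U U \<bullet> \<beta> v v = (norm (\<beta> U v))\<^sup>2"
  using \<beta>_inner_sym[of U U v v] by (simp add: power2_norm_eq_inner)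

lemma A_c': "(\<Sum>i\<in>UNIV. A $ i $ j * (c $ i)\<^sup>2) = 1"
  using A_c[of j] A_sym by simp

lemma sum_A_left: "(\<Sum>i\<in>UNIV. \<Sum>j\<in>UNIV. A $ i $ j * ((c $ i)\<^sup>2 * f j)) = (\<Sum>j\<in>UNIV. f j)"
proof -
  have "(\<Sum>i\<in>UNIV. \<Sum>j\<in>UNIV. A $ i $ j * ((c $ i)\<^sup>2 * f j)) = (\<Sum>j\<in>UNIV. (\<Sum>i\<in>UNIV. A $ i $ j * (c $ i)\<^sup>2) * f j)"
    by (subst sum.swap) (simp add: sum_distrib_right mult.assoc)
  then show ?thesis by (simp add: A_c')
qed

lemma sum_A_right: "(\<Sum>i\<in>UNIV. \<Sum>j\<in>UNIV. A $ i $ j * ((c $ j)\<^sup>2 * f i)) = (\<Sum>i\<in>UNIV. f i)"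
proof -
  have "(\<Sum>i\<in>UNIV. \<Sum>j\<in>UNIV. A $ i $ j * ((c $ j)\<^sup>2 * f i)) = (\<Sum>i\<in>UNIV. (\<Sum>j\<in>UNIV. A $ i $ j * (c $ j)\<^sup>2) * f i)"
    by (simp add: sum_distrib_right mult.assoc)
  then show ?thesis by (simp add: A_c)
qed

lemma sum_A_swap: "(\<Sum>i\<in>UNIV. \<Sum>j\<in>UNIV. A $ i $ j * f j i) = (\<Sum>i\<in>UNIV. \<Sum>j\<in>UNIV. A $ i $ j * f i j)"
  by (subst sum.swap) (simp add: A_sym[of _ _])

text \<open>Multiplying out the two squares \<open>r\<^sup>2 U\<^sup>2 + 2 r U v + v\<^sup>2\<close>
  and \<open>s\<^sup>2 U\<^sup>2 + 2 s U w + w\<^sup>2\<close> in the calculus of products.\<close>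

lemma quartic_expand:
  "\<beta> (r *\<^sub>R U + v) (r *\<^sub>R U + v) \<bullet> \<beta> (s *\<^sub>R U + w) (s *\<^sub>R U + w) =
     r\<^sup>2 * s\<^sup>2 * B U U
     + 2 * r\<^sup>2 * s * (\<beta> U U \<bullet> \<beta> U w) + 2 * r * s\<^sup>2 * (\<beta> U U \<bullet> \<beta> U v)
     + r\<^sup>2 * (\<beta> U U \<bullet> \<beta> w w) + s\<^sup>2 * (\<beta> U U \<bullet> \<beta> v v) + 4 * r * s * (\<beta> U v \<bullet> \<beta> U w)
     + 2 * r * (\<beta> U v \<bullet> \<beta> w w) + 2 * s * (\<beta> U w \<bullet> \<beta> v v) + \<beta> v v \<bullet> \<beta> w w"
proof -
  have e: "\<beta> (r *\<^sub>R U + v) (r *\<^sub>R U + v) = r\<^sup>2 *\<^sub>R \<beta> U U + (2 * r) *\<^sub>R \<beta> U v + \<beta> v v" for r v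
    by (simp add: \<beta>.add_left \<beta>.add_right \<beta>.scaleR_left \<beta>.scaleR_right \<beta>_sym[of v U]
        power2_eq_square scaleR_2[symmetric] mult.commute flip: scaleR_left_distrib scaleR_scaleR)
      (simp add: algebra_simps scaleR_2)
  show ?thesis unfolding e B_U_U
    by (simp add: inner_add_left inner_add_right inner_commute[of "\<beta> U v" "\<beta> U U"]
        inner_commute[of "\<beta> v v" "\<beta> U U"] inner_commute[of "\<beta> v v" "\<beta> U w"] power2_eq_square algebra_simps)
qed

text \<open>The terms of first order cancel: the quadratic part gives
  \<open>\<Sum>\<^sub>i c\<^sub>i B U v\<^sub>i\<close>, and the quartic part, after the Euler
  equation for U and the unit sums of \<open>a\<^sub>i\<^sub>j c\<^sub>j\<^sup>2\<close>, gives
  twice one half of the same sum. What remains starts at second order.\<close>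

lemma energy_expand:
  assumes v: "v \<in> Hn"
  shows "energy (p + v) - energy p = 1/2 * (\<Sum>i\<in>UNIV. B (v $ i) (v $ i))
    - 1/2 * (\<Sum>i\<in>UNIV. (norm (\<beta> U (v $ i)))\<^sup>2)
    - (\<Sum>i\<in>UNIV. \<Sum>j\<in>UNIV. A $ i $ j * (c $ i * c $ j * (\<beta> U (v $ i) \<bullet> \<beta> U (v $ j))))
    - (\<Sum>i\<in>UNIV. \<Sum>j\<in>UNIV. A $ i $ j * (c $ i * (\<beta> U (v $ i) \<bullet> \<beta> (v $ j) (v $ j))))
    - 1/4 * (\<Sum>i\<in>UNIV. \<Sum>j\<in>UNIV. A $ i $ j * (\<beta> (v $ i) (v $ i) \<bullet> \<beta> (v $ j) (v $ j)))"
proof -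
  let ?S = "\<lambda>f. \<Sum>i\<in>UNIV. \<Sum>j\<in>UNIV. A $ i $ j * f i j"
  have S_add: "?S (\<lambda>i j. f i j + g i j) = ?S f + ?S g" for f g :: "'n \<Rightarrow> 'n \<Rightarrow> real"
    by (simp add: distrib_left sum.distrib)
  have S_scale: "?S (\<lambda>i j. k * f i j) = k * ?S f" for f :: "'n \<Rightarrow> 'n \<Rightarrow> real" and k
    by (simp add: sum_distrib_left mult.left_commute)
  have eu: "\<beta> U U \<bullet> \<beta> U (v $ i) = B U (v $ i)" for i
    using euler v by (auto simp: Hn_def)
  have "?S (\<lambda>i j. \<beta> ((p + v) $ i) ((p + v) $ i) \<bullet> \<beta> ((p + v) $ j) ((p + v) $ j))
     = ?S (\<lambda>i j. ((c $ i)\<^sup>2 * ((c $ j)\<^sup>2 * B U U)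
     + (2 * ((c $ i)\<^sup>2 * (c $ j * B U (v $ j))) + (2 * ((c $ j)\<^sup>2 * (c $ i * B U (v $ i)))
     + ((c $ i)\<^sup>2 * (norm (\<beta> U (v $ j)))\<^sup>2 + ((c $ j)\<^sup>2 * (norm (\<beta> U (v $ i)))\<^sup>2
     + (4 * (c $ i * c $ j * (\<beta> U (v $ i) \<bullet> \<beta> U (v $ j)))
     + (2 * (c $ i * (\<beta> U (v $ i) \<bullet> \<beta> (v $ j) (v $ j))) + (2 * (c $ j * (\<beta> U (v $ j) \<bullet> \<beta> (v $ i) (v $ i)))
     + \<beta> (v $ i) (v $ i) \<bullet> \<beta> (v $ j) (v $ j))))))))))"
    by (intro sum.cong refl) (simp only: p_def vector_add_component vec_lambda_beta quartic_expand eu \<beta>_U_norm, simp add: mult_ac)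
  also have "\<dots> = (\<Sum>i\<in>UNIV. (c $ i)\<^sup>2 * B U U) + (2 * (\<Sum>i\<in>UNIV. c $ i * B U (v $ i)) + (2 * (\<Sum>i\<in>UNIV. c $ i * B U (v $ i))
     + ((\<Sum>i\<in>UNIV. (norm (\<beta> U (v $ i)))\<^sup>2) + ((\<Sum>i\<in>UNIV. (norm (\<beta> U (v $ i)))\<^sup>2)
     + (4 * ?S (\<lambda>i j. c $ i * c $ j * (\<beta> U (v $ i) \<bullet> \<beta> U (v $ j)))
     + (2 * ?S (\<lambda>i j. c $ i * (\<beta> U (v $ i) \<bullet> \<beta> (v $ j) (v $ j)))
     + (2 * ?S (\<lambda>i j. c $ i * (\<beta> U (v $ i) \<bullet> \<beta> (v $ j) (v $ j)))
     + ?S (\<lambda>i j. \<beta> (v $ i) (v $ i) \<bullet> \<beta> (v $ j) (v $ j)))))))))"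
    unfolding S_add S_scale sum_A_left sum_A_right
      sum_A_swap[of "\<lambda>i j. c $ i * (\<beta> U (v $ i) \<bullet> \<beta> (v $ j) (v $ j))"] by simp
  finally have quart: "?S (\<lambda>i j. \<beta> ((p + v) $ i) ((p + v) $ i) \<bullet> \<beta> ((p + v) $ j) ((p + v) $ j)) = \<dots>" .
  have "?S (\<lambda>i j. \<beta> (p $ i) (p $ i) \<bullet> \<beta> (p $ j) (p $ j)) = ?S (\<lambda>i j. (c $ i)\<^sup>2 * ((c $ j)\<^sup>2 * B U U))"
    using quartic_expand[of _ 0 _ 0] by (simp add: p_def mult_ac \<beta>.zero_right)
  then have quart0: "?S (\<lambda>i j. \<beta> (p $ i) (p $ i) \<bullet> \<beta> (p $ j) (p $ j)) = (\<Sum>i\<in>UNIV. (c $ i)\<^sup>2 * B U U)"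
    unfolding sum_A_left .
  have quad: "(\<Sum>i\<in>UNIV. B ((p + v) $ i) ((p + v) $ i))
    = (\<Sum>i\<in>UNIV. B (p $ i) (p $ i)) + 2 * (\<Sum>i\<in>UNIV. c $ i * B U (v $ i)) + (\<Sum>i\<in>UNIV. B (v $ i) (v $ i))"
    by (simp add: p_def B.add_left B.add_right B.scaleR_left B.scaleR_right B_sym[of "v $ _" U] sum.distrib sum_distrib_left
        algebra_simps)
  show ?thesis unfolding energy_def quart quart0 quad by (simp add: algebra_simps)
qed

text \<open>Termwise \<open>2 c\<^sub>i c\<^sub>j y\<^sub>i \<bullet> y\<^sub>j \<le>
  c\<^sub>i\<^sup>2 |y\<^sub>j|\<^sup>2 + c\<^sub>j\<^sup>2 |y\<^sub>i|\<^sup>2\<close>, weighted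
  with \<open>a\<^sub>i\<^sub>j \<ge> 0\<close>. Each of the two terms on the right then sums to the
  same value because the weighted row and column sums are 1.\<close>

lemma coupling_bound:
  "(\<Sum>i\<in>UNIV. \<Sum>j\<in>UNIV. A $ i $ j * (c $ i * c $ j * (y i \<bullet> y j))) \<le> (\<Sum>i\<in>UNIV. (norm (y i :: 'l))\<^sup>2)"
proof -
  have "2 * (c $ i * c $ j * (y i \<bullet> y j)) \<le> (c $ i)\<^sup>2 * (norm (y j))\<^sup>2 + (c $ j)\<^sup>2 * (norm (y i))\<^sup>2" for i j
  proof -
    have "0 \<le> (c $ j *\<^sub>R y i - c $ i *\<^sub>R y j) \<bullet> (c $ j *\<^sub>R y i - c $ i *\<^sub>R y j)" by (rule inner_ge_zero)
    then show ?thesis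
      by (simp add: inner_diff_left inner_diff_right inner_commute[of "y j" "y i"] power2_norm_eq_inner
          power2_eq_square[of "c $ _"] algebra_simps)
  qed
  then have "(\<Sum>i\<in>UNIV. \<Sum>j\<in>UNIV. A $ i $ j * (2 * (c $ i * c $ j * (y i \<bullet> y j))))
    \<le> (\<Sum>i\<in>UNIV. \<Sum>j\<in>UNIV. A $ i $ j * ((c $ i)\<^sup>2 * (norm (y j))\<^sup>2 + (c $ j)\<^sup>2 * (norm (y i))\<^sup>2))"
    by (intro sum_mono mult_left_mono A_nonneg) auto
  also have "\<dots> = 2 * (\<Sum>i\<in>UNIV. (norm (y i))\<^sup>2)"
    by (simp add: distrib_left sum.distrib sum_A_left sum_A_right)
  finally show ?thesis
    by (simp add: mult.left_commute[of _ 2] flip: sum_distrib_left)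
qed

text \<open>For a general v the multiple of U is split off. On U itself the second variation is
  \<open>B U U - 3 B U U = - 2 B U U\<close>, and the cross terms vanish by the Euler equation. Half
  of \<kappa> is lost in \<open>|v|\<^sup>2 \<le> 2 |w|\<^sup>2 + 2 |t U|\<^sup>2\<close>, which
  also puts \<open>\<kappa> |U|\<^sup>2\<close> into the subtracted constant.\<close>

lemma quadratic_lower_bound:
  assumes v: "v \<in> H"
  shows "B v v - 3 * (norm (\<beta> U v))\<^sup>2 \<ge> \<kappa> / 2 * (norm v)\<^sup>2
    - (\<kappa> * (norm U)\<^sup>2 + 2 * B U U) * (B U v / B U U)\<^sup>2"
proof -
  define t where "t = B U v / B U U"
  define w where "w = v - t *\<^sub>R U"
  have w: "w \<in> H" using v U_in H by (auto simp: w_def intro: subspace_diff subspace_scale)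
  have t: "B U v = t * B U U" using B_U_pos by (simp add: t_def)
  have Bw: "B U w = 0" by (simp add: w_def B.diff_right B.scaleR_right t)
  then have \<beta>w: "\<beta> U U \<bullet> \<beta> U w = 0" using euler[OF w] by simp
  have v_eq: "v = w + t *\<^sub>R U" by (simp add: w_def)
  have 1: "B v v = B w w + t\<^sup>2 * B U U"
    unfolding v_eq using Bw by (simp add: B.add_left B.add_right B.scaleR_left B.scaleR_right B_sym[of w U] power2_eq_square)
  have 2: "(norm (\<beta> U v))\<^sup>2 = (norm (\<beta> U w))\<^sup>2 + t\<^sup>2 * B U U"
    unfolding v_eq using \<beta>w by (simp add: \<beta>.add_right \<beta>.scaleR_right power2_norm_eq_inner inner_add_left inner_add_right
        inner_commute[of "\<beta> U w" "\<beta> U U"] B_U_U power2_eq_square[of t])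
  have "(norm v)\<^sup>2 \<le> (norm w + norm (t *\<^sub>R U))\<^sup>2"
    unfolding v_eq by (intro power_mono norm_triangle_ineq) simp
  also have "\<dots> \<le> 2 * (norm w)\<^sup>2 + 2 * (norm (t *\<^sub>R U))\<^sup>2"
    using zero_le_power2[of "norm w - norm (t *\<^sub>R U)"] unfolding power2_sum power2_diff by linarith
  also have "\<dots> = 2 * (norm w)\<^sup>2 + 2 * (t\<^sup>2 * (norm U)\<^sup>2)" by (simp add: power_mult_distrib)
  finally have "(norm w)\<^sup>2 \<ge> 1/2 * (norm v)\<^sup>2 - t\<^sup>2 * (norm U)\<^sup>2" by simp
  then have "\<kappa> * (norm w)\<^sup>2 \<ge> \<kappa> * (1/2 * (norm v)\<^sup>2 - t\<^sup>2 * (norm U)\<^sup>2)" using \<kappa>_pos by simp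
  then show ?thesis using coercive[OF w Bw] 1 2 unfolding t_def[symmetric] by (simp add: algebra_simps)
qed

lemma norm_vec_squared: "(norm (v :: 'e ^ 'n))\<^sup>2 = (\<Sum>i\<in>UNIV. (norm (v $ i))\<^sup>2)"
  by (simp add: power2_norm_eq_inner inner_vec_def)

text \<open>The second-order part is at least one half of the scalar second variations: the diagonal
  coefficient - 1/2 and the coupling bound - 1 add up to half of - 3. On the unit ball the quartic
  remainder is absorbed by the cubic one.\<close>

lemma energy_lower_bound:
  obtains K where "K \<ge> 0" "\<And>v. v \<in> Hn \<Longrightarrow> norm v \<le> 1 \<Longrightarrow> energy (p + v) - energy p \<ge>
    \<kappa> / 4 * (norm v)\<^sup>2 - K * (\<Sum>i\<in>UNIV. (B U (v $ i) / B U U)\<^sup>2) - K * norm v ^ 3"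
proof -
  obtain K where K: "K > 0" "\<And>a b. norm (\<beta> a b) \<le> norm a * norm b * K" using \<beta>.pos_bounded by auto
  define K1 where "K1 = (\<Sum>i\<in>UNIV. \<Sum>j\<in>UNIV. A $ i $ j * (c $ i * (norm U * K * K)))"
  define K2 where "K2 = (\<Sum>i\<in>UNIV. \<Sum>j\<in>UNIV. A $ i $ j * (K * K))"
  define K3 where "K3 = \<kappa> * (norm U)\<^sup>2 + 2 * B U U"
  have nn: "K1 \<ge> 0" "K2 \<ge> 0" "K3 \<ge> 0"
    using A_nonneg c_pos[THEN less_imp_le] K B_U_pos \<kappa>_pos by (auto simp: K1_def K2_def K3_def intro!: sum_nonneg mult_nonneg_nonneg)
  show ?thesis
  proof (rule that[of "K1 + K2 + K3"])
    fix v assume v: "v \<in> Hn" "norm v \<le> 1"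
    let ?n = "norm v"
    have b1: "norm (\<beta> U (v $ i)) \<le> norm U * ?n * K" for i
      using K Finite_Cartesian_Product.norm_nth_le[of v i] by (intro order_trans[OF K(2)] mult_right_mono mult_left_mono) auto
    have b2: "norm (\<beta> (v $ i) (v $ i)) \<le> ?n * ?n * K" for i
      using K Finite_Cartesian_Product.norm_nth_le[of v i] by (intro order_trans[OF K(2)] mult_right_mono mult_mono) auto
    have i1: "\<beta> U (v $ i) \<bullet> \<beta> (v $ j) (v $ j) \<le> norm U * K * K * ?n ^ 3" for i j
    proof -
      have "\<beta> U (v $ i) \<bullet> \<beta> (v $ j) (v $ j) \<le> norm (\<beta> U (v $ i)) * norm (\<beta> (v $ j) (v $ j))" by (rule norm_cauchy_schwarz)
      also have "\<dots> \<le> (norm U * ?n * K) * (?n * ?n * K)" using b1 b2 K by (intro mult_mono) auto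
      finally show ?thesis by (simp add: power3_eq_cube mult_ac)
    qed
    have i2: "\<beta> (v $ i) (v $ i) \<bullet> \<beta> (v $ j) (v $ j) \<le> K * K * ?n ^ 3" for i j
    proof -
      have "\<beta> (v $ i) (v $ i) \<bullet> \<beta> (v $ j) (v $ j) \<le> norm (\<beta> (v $ i) (v $ i)) * norm (\<beta> (v $ j) (v $ j))" by (rule norm_cauchy_schwarz)
      also have "\<dots> \<le> (?n * ?n * K) * (?n * ?n * K)" using b2 K by (intro mult_mono) auto
      also have "\<dots> = K * K * ?n ^ 3 * ?n" by (simp add: power3_eq_cube mult_ac)
      also have "\<dots> \<le> K * K * ?n ^ 3 * 1" using v K by (intro mult_left_mono) auto
      finally show ?thesis by simp
    qed
    have s1: "(\<Sum>i\<in>UNIV. \<Sum>j\<in>UNIV. A $ i $ j * (c $ i * (\<beta> U (v $ i) \<bullet> \<beta> (v $ j) (v $ j)))) \<le> K1 * ?n ^ 3"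
    proof -
      have "(\<Sum>i\<in>UNIV. \<Sum>j\<in>UNIV. A $ i $ j * (c $ i * (\<beta> U (v $ i) \<bullet> \<beta> (v $ j) (v $ j))))
        \<le> (\<Sum>i\<in>UNIV. \<Sum>j\<in>UNIV. A $ i $ j * (c $ i * (norm U * K * K * ?n ^ 3)))"
        using c_pos[THEN less_imp_le] by (intro sum_mono mult_left_mono i1 A_nonneg) auto
      also have "\<dots> = K1 * ?n ^ 3" by (simp add: K1_def sum_distrib_right mult.assoc)
      finally show ?thesis .
    qed
    have s2: "(\<Sum>i\<in>UNIV. \<Sum>j\<in>UNIV. A $ i $ j * (\<beta> (v $ i) (v $ i) \<bullet> \<beta> (v $ j) (v $ j))) \<le> K2 * ?n ^ 3"
    proof -
      have "(\<Sum>i\<in>UNIV. \<Sum>j\<in>UNIV. A $ i $ j * (\<beta> (v $ i) (v $ i) \<bullet> \<beta> (v $ j) (v $ j)))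
        \<le> (\<Sum>i\<in>UNIV. \<Sum>j\<in>UNIV. A $ i $ j * (K * K * ?n ^ 3))"
        by (intro sum_mono mult_left_mono i2 A_nonneg)
      also have "\<dots> = K2 * ?n ^ 3" by (simp add: K2_def sum_distrib_right mult.assoc)
      finally show ?thesis .
    qed
    have s3: "(\<Sum>i\<in>UNIV. B (v $ i) (v $ i) - 3 * (norm (\<beta> U (v $ i)))\<^sup>2)
      \<ge> \<kappa> / 2 * ?n\<^sup>2 - K3 * (\<Sum>i\<in>UNIV. (B U (v $ i) / B U U)\<^sup>2)"
    proof -
      have "(\<Sum>i\<in>UNIV. \<kappa> / 2 * (norm (v $ i))\<^sup>2 - K3 * (B U (v $ i) / B U U)\<^sup>2)
         \<le> (\<Sum>i\<in>UNIV. B (v $ i) (v $ i) - 3 * (norm (\<beta> U (v $ i)))\<^sup>2)"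
        using v quadratic_lower_bound by (intro sum_mono) (auto simp: K3_def Hn_def)
      then show ?thesis by (simp add: sum_subtractf norm_vec_squared sum_distrib_left sum_divide_distrib)
    qed
    define T where "T = (\<Sum>i\<in>UNIV. (B U (v $ i) / B U U)\<^sup>2)"
    have T: "T \<ge> 0" by (simp add: T_def sum_nonneg)
    have arith: "1 / 2 * x - s - 1 / 4 * q \<le> e"
      if "e = 1 / 2 * b - 1 / 2 * y - a - d - 1 / 4 * f" "d \<le> s" "f \<le> q" "x \<le> b - 3 * y" "a \<le> y"
      for x s q e b y a d f :: real
      using that by linarith
    have "energy (p + v) - energy p \<ge> 1 / 2 * (\<kappa> / 2 * ?n\<^sup>2 - K3 * T) - K1 * ?n ^ 3 - 1/4 * (K2 * ?n ^ 3)"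
      using s3 unfolding sum_subtractf sum_distrib_left[symmetric] T_def
      by (rule arith[OF energy_expand[OF v(1)] s1 s2 _ coupling_bound])
    moreover have "K3 * T \<le> (K1 + K2 + K3) * T" "0 \<le> K3 * T" "0 \<le> K1 * T" "0 \<le> K2 * T" using nn T by (auto simp: algebra_simps)
    moreover have "0 \<le> K1 * ?n ^ 3" "0 \<le> K2 * ?n ^ 3" "0 \<le> K3 * ?n ^ 3" using nn by auto
    ultimately show "energy (p + v) - energy p \<ge> \<kappa> / 4 * ?n\<^sup>2
       - (K1 + K2 + K3) * (\<Sum>i\<in>UNIV. (B U (v $ i) / B U U)\<^sup>2) - (K1 + K2 + K3) * ?n ^ 3"
      unfolding T_def[symmetric] by (simp add: algebra_simps)
  qed (use nn in simp)
qed

text \<open>On the constraint set the component along \<open>U\<close> is of second order, since the linearised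
  constraints are \<open>- 2 c\<^sub>i\<^sup>2 \<Sum>\<^sub>j a\<^sub>i\<^sub>j c\<^sub>j B U v\<^sub>j\<close> and the matrix is nonsingular.\<close>

lemma constraint_tangential:
  obtains K where "K \<ge> 0" "\<And>v i. v \<in> Hn \<Longrightarrow> norm v \<le> 1 \<Longrightarrow> (\<And>i. constraint i (p + v) = 0) \<Longrightarrow>
    \<bar>B U (v $ i) / B U U\<bar> \<le> K * (norm v)\<^sup>2"
proof -
  obtain K where K: "K > 0" "\<And>a b. norm (\<beta> a b) \<le> norm a * norm b * K" using \<beta>.pos_bounded by auto
  obtain L where L: "L > 0" "\<And>a b. norm (B a b) \<le> norm a * norm b * L" using B.pos_bounded by auto
  \<comment> \<open>\<open>R\<close> collects everything of order at least two in the expanded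
    quartic term, and \<open>k\<close> is a bound for it relative to \<open>(norm v)\<^sup>2\<close>
    on the unit ball.\<close>
  define R where "R = (\<lambda>v i j. (c $ i)\<^sup>2 * (\<beta> U U \<bullet> \<beta> (v $ j) (v $ j)) + (c $ j)\<^sup>2 * (\<beta> U U \<bullet> \<beta> (v $ i) (v $ i))
     + 4 * c $ i * c $ j * (\<beta> U (v $ i) \<bullet> \<beta> U (v $ j))
     + 2 * c $ i * (\<beta> U (v $ i) \<bullet> \<beta> (v $ j) (v $ j)) + 2 * c $ j * (\<beta> U (v $ j) \<bullet> \<beta> (v $ i) (v $ i))
     + \<beta> (v $ i) (v $ i) \<bullet> \<beta> (v $ j) (v $ j))"
  define k where "k = (\<lambda>i j. (c $ i)\<^sup>2 * (norm (\<beta> U U) * K) + (c $ j)\<^sup>2 * (norm (\<beta> U U) * K)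
     + 4 * c $ i * c $ j * ((norm U * K) * (norm U * K)) + 2 * c $ i * ((norm U * K) * K) + 2 * c $ j * ((norm U * K) * K) + K * K)"
  \<comment> \<open>The terms without v cancel, and so do those in \<open>B U (v $ i)\<close>,
    because \<open>\<Sum>\<^sub>j a\<^sub>i\<^sub>j c\<^sub>j\<^sup>2 = 1\<close> gives the quartic
    part the same \<open>2 c\<^sub>i B U v\<^sub>i\<close> as the quadratic part. Only the
    combination over j survives in first order.\<close>
  have lin: "2 * (c $ i)\<^sup>2 * (\<Sum>j\<in>UNIV. A $ i $ j * (c $ j * B U (v $ j))) = B (v $ i) (v $ i) - (\<Sum>j\<in>UNIV. A $ i $ j * R v i j)"
    if v: "v \<in> Hn" and con: "constraint i (p + v) = 0" for v i
  proof -
    have eu: "\<beta> U U \<bullet> \<beta> U (v $ i) = B U (v $ i)" for i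
      using euler v by (auto simp: Hn_def)
    have "(\<Sum>j\<in>UNIV. A $ i $ j * (\<beta> ((p + v) $ i) ((p + v) $ i) \<bullet> \<beta> ((p + v) $ j) ((p + v) $ j)))
      = (\<Sum>j\<in>UNIV. ((c $ i)\<^sup>2 * B U U) * (A $ i $ j * (c $ j)\<^sup>2) + (2 * (c $ i)\<^sup>2) * (A $ i $ j * (c $ j * B U (v $ j)))
       + (2 * c $ i * B U (v $ i)) * (A $ i $ j * (c $ j)\<^sup>2) + A $ i $ j * R v i j)"
      by (intro sum.cong refl) (simp only: p_def vector_add_component vec_lambda_beta quartic_expand eu R_def, simp add: algebra_simps)
    also have "\<dots> = (c $ i)\<^sup>2 * B U U + 2 * (c $ i)\<^sup>2 * (\<Sum>j\<in>UNIV. A $ i $ j * (c $ j * B U (v $ j)))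
       + 2 * c $ i * B U (v $ i) + (\<Sum>j\<in>UNIV. A $ i $ j * R v i j)"
      by (simp add: sum.distrib sum_distrib_left[symmetric] A_c)
    finally have quart: "(\<Sum>j\<in>UNIV. A $ i $ j * (\<beta> ((p + v) $ i) ((p + v) $ i) \<bullet> \<beta> ((p + v) $ j) ((p + v) $ j))) = \<dots>" .
    have "B ((p + v) $ i) ((p + v) $ i) = (c $ i)\<^sup>2 * B U U + 2 * c $ i * B U (v $ i) + B (v $ i) (v $ i)"
      by (simp add: p_def B.add_left B.add_right B.scaleR_left B.scaleR_right B_sym[of "v $ i" U] power2_eq_square[of "c $ i"] distrib_left)
    then show ?thesis using con quart unfolding constraint_def by linarith
  qed
  have Rb: "\<bar>R v i j\<bar> \<le> k i j * (norm v)\<^sup>2" if v: "norm v \<le> 1" for v :: "'e ^ 'n" and i j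
  proof -
    let ?n = "norm v"
    have b1: "norm (\<beta> U (v $ i)) \<le> norm U * K * ?n" for i
      using K Finite_Cartesian_Product.norm_nth_le[of v i] by (intro order_trans[OF K(2)]) (simp add: mult_ac mult_left_mono mult_right_mono)
    have b2: "norm (\<beta> (v $ i) (v $ i)) \<le> K * (?n * ?n)" for i
      using K Finite_Cartesian_Product.norm_nth_le[of v i] by (intro order_trans[OF K(2)]) (simp add: mult_ac mult_left_mono mult_mono)
    have n2: "?n * ?n * ?n \<le> ?n * ?n" "(?n * ?n) * (?n * ?n) \<le> ?n * ?n"
      using v mult_left_mono[of ?n 1 "?n * ?n"] mult_left_mono[of "?n * ?n" 1 "?n * ?n"] mult_mono[of ?n 1 ?n 1] by auto
    have cs: "\<bar>x \<bullet> y\<bar> \<le> a * b" if "norm x \<le> a" "norm y \<le> b" for x y :: 'l and a b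
      using Cauchy_Schwarz_ineq2[of x y] mult_mono[OF that] that norm_ge_zero[of x] norm_ge_zero[of y] by linarith
    have t1: "\<bar>\<beta> U U \<bullet> \<beta> (v $ i) (v $ i)\<bar> \<le> norm (\<beta> U U) * K * ?n\<^sup>2" for i
      using cs[OF order_refl[of "norm (\<beta> U U)"] b2[of i]] by (simp add: power2_eq_square mult_ac)
    have t2: "\<bar>\<beta> U (v $ i) \<bullet> \<beta> U (v $ j)\<bar> \<le> (norm U * K) * (norm U * K) * ?n\<^sup>2"
      using cs[OF b1 b1] by (simp add: power2_eq_square mult_ac)
    have t3: "\<bar>\<beta> U (v $ i) \<bullet> \<beta> (v $ j) (v $ j)\<bar> \<le> (norm U * K) * K * ?n\<^sup>2" for i j
    proof -
      have "\<bar>\<beta> U (v $ i) \<bullet> \<beta> (v $ j) (v $ j)\<bar> \<le> (norm U * K * ?n) * (K * (?n * ?n))" by (rule cs[OF b1 b2])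
      also have "\<dots> = ((norm U * K) * K) * (?n * ?n * ?n)" by (simp add: mult_ac)
      also have "\<dots> \<le> ((norm U * K) * K) * (?n * ?n)" using n2 K by (intro mult_left_mono) auto
      finally show ?thesis by (simp add: power2_eq_square)
    qed
    have t4: "\<bar>\<beta> (v $ i) (v $ i) \<bullet> \<beta> (v $ j) (v $ j)\<bar> \<le> K * K * ?n\<^sup>2"
    proof -
      have "\<bar>\<beta> (v $ i) (v $ i) \<bullet> \<beta> (v $ j) (v $ j)\<bar> \<le> (K * (?n * ?n)) * (K * (?n * ?n))" by (rule cs[OF b2 b2])
      also have "\<dots> = (K * K) * ((?n * ?n) * (?n * ?n))" by (simp add: mult_ac)
      also have "\<dots> \<le> (K * K) * (?n * ?n)" using n2 K by (intro mult_left_mono) auto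
      finally show ?thesis by (simp add: power2_eq_square)
    qed
    have ab: "\<bar>r * x\<bar> \<le> r * y" if "r \<ge> 0" "\<bar>x\<bar> \<le> y" for r x y :: real
      using that by (simp add: abs_mult mult_left_mono)
    note cn = c_pos[THEN less_imp_le]
    have "\<bar>R v i j\<bar> \<le> (c $ i)\<^sup>2 * (norm (\<beta> U U) * K * ?n\<^sup>2) + (c $ j)\<^sup>2 * (norm (\<beta> U U) * K * ?n\<^sup>2)
      + 4 * c $ i * c $ j * ((norm U * K) * (norm U * K) * ?n\<^sup>2)
      + 2 * c $ i * ((norm U * K) * K * ?n\<^sup>2) + 2 * c $ j * ((norm U * K) * K * ?n\<^sup>2) + K * K * ?n\<^sup>2"
      unfolding R_def
      by (intro order_trans[OF abs_triangle_ineq] add_mono ab t1 t2 t3 t4) (auto simp: cn)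
    also have "\<dots> = k i j * ?n\<^sup>2" by (simp add: k_def algebra_simps)
    finally show ?thesis .
  qed
  define k' where "k' = (\<lambda>i. (L + (\<Sum>j\<in>UNIV. A $ i $ j * k i j)) / (2 * (c $ i)\<^sup>2))"
  have Ab: "\<bar>\<Sum>j\<in>UNIV. A $ i $ j * (c $ j * B U (v $ j))\<bar> \<le> k' i * (norm v)\<^sup>2"
    if v: "v \<in> Hn" "norm v \<le> 1" "constraint i (p + v) = 0" for v i
  proof -
    have "\<bar>B (v $ i) (v $ i)\<bar> \<le> norm (v $ i) * norm (v $ i) * L" using L(2)[of "v $ i" "v $ i"] by simp
    also have "\<dots> \<le> norm v * norm v * L" using Finite_Cartesian_Product.norm_nth_le[of v i] L by (intro mult_right_mono mult_mono) auto
    finally have 1: "\<bar>B (v $ i) (v $ i)\<bar> \<le> L * (norm v)\<^sup>2" by (simp add: power2_eq_square mult_ac)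
    have 2: "\<bar>\<Sum>j\<in>UNIV. A $ i $ j * R v i j\<bar> \<le> (\<Sum>j\<in>UNIV. A $ i $ j * k i j) * (norm v)\<^sup>2"
      unfolding sum_distrib_right
      using Rb[OF v(2)] A_nonneg
      by (intro order_trans[OF sum_abs] sum_mono) (simp add: abs_mult mult.assoc mult_left_mono)
    have "2 * (c $ i)\<^sup>2 * \<bar>\<Sum>j\<in>UNIV. A $ i $ j * (c $ j * B U (v $ j))\<bar> = \<bar>2 * (c $ i)\<^sup>2 * (\<Sum>j\<in>UNIV. A $ i $ j * (c $ j * B U (v $ j)))\<bar>"
      by (simp add: abs_mult)
    also have "\<dots> \<le> (L + (\<Sum>j\<in>UNIV. A $ i $ j * k i j)) * (norm v)\<^sup>2"
      unfolding lin[OF v(1,3)] using 1 2 by (simp add: algebra_simps)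
    finally show ?thesis using c_pos[of i] by (simp add: k'_def field_simps)
  qed
  obtain A' where A': "A' ** A = mat 1" using A_invertible by (auto simp: invertible_def)
  have kn: "k' i \<ge> 0" for i
    using A_nonneg c_pos[THEN less_imp_le] K L by (auto simp: k'_def k_def intro!: divide_nonneg_nonneg add_nonneg_nonneg sum_nonneg mult_nonneg_nonneg)
  \<comment> \<open>Summing over all i makes one constant serve every component.\<close>
  define K' where "K' = (\<Sum>i\<in>UNIV. (\<Sum>j\<in>UNIV. \<bar>A' $ i $ j\<bar> * k' j) / (c $ i * B U U))"
  have tm: "(\<Sum>j\<in>UNIV. \<bar>A' $ i $ j\<bar> * k' j) / (c $ i * B U U) \<ge> 0" for i
    using kn c_pos[of i] B_U_pos by (intro divide_nonneg_nonneg sum_nonneg mult_nonneg_nonneg) auto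
  show ?thesis
  proof (rule that[of K'])
    show "K' \<ge> 0" unfolding K'_def by (intro sum_nonneg tm)
    fix v i assume v: "v \<in> Hn" "norm v \<le> 1" "\<And>i. constraint i (p + v) = 0"
    define d where "d = (\<chi> j. c $ j * B U (v $ j))"
    \<comment> \<open>The constraints control \<open>A *v d\<close> only; the left inverse
      \<open>A'\<close> recovers each component of \<open>d\<close>.\<close>
    have "d = A' *v (A *v d)" by (simp add: matrix_vector_mul_assoc A')
    from arg_cong[OF this, of "\<lambda>x. x $ i"]
    have "d $ i = (\<Sum>j\<in>UNIV. A' $ i $ j * (\<Sum>k\<in>UNIV. A $ j $ k * (c $ k * B U (v $ k))))"
      by (simp add: matrix_vector_mult_def d_def)
    also have "\<bar>\<dots>\<bar> \<le> (\<Sum>j\<in>UNIV. \<bar>A' $ i $ j\<bar> * (k' j * (norm v)\<^sup>2))"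
      using Ab[OF v(1,2) v(3)] by (intro order_trans[OF sum_abs] sum_mono) (simp add: abs_mult mult_left_mono)
    also have "\<dots> = (\<Sum>j\<in>UNIV. \<bar>A' $ i $ j\<bar> * k' j) * (norm v)\<^sup>2" by (simp add: sum_distrib_right mult.assoc)
    finally have "c $ i * \<bar>B U (v $ i)\<bar> \<le> (\<Sum>j\<in>UNIV. \<bar>A' $ i $ j\<bar> * k' j) * (norm v)\<^sup>2"
      using c_pos[of i] by (simp add: d_def abs_mult)
    then have "\<bar>B U (v $ i) / B U U\<bar> \<le> (\<Sum>j\<in>UNIV. \<bar>A' $ i $ j\<bar> * k' j) / (c $ i * B U U) * (norm v)\<^sup>2"
      using c_pos[of i] B_U_pos by (simp add: field_simps)
    also have "\<dots> \<le> K' * (norm v)\<^sup>2"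
      unfolding K'_def by (intro mult_right_mono member_le_sum tm) auto
    finally show "\<bar>B U (v $ i) / B U U\<bar> \<le> K' * (norm v)\<^sup>2" .
  qed
qed

lemma strict_local_min:
  obtains \<epsilon> where "\<epsilon> > 0" "\<And>u. u \<in> M \<Longrightarrow> u \<noteq> p \<Longrightarrow> dist u p < \<epsilon> \<Longrightarrow> energy p < energy u"
proof -
  obtain K where K: "K \<ge> 0" "\<And>v. v \<in> Hn \<Longrightarrow> norm v \<le> 1 \<Longrightarrow> energy (p + v) - energy p \<ge>
    \<kappa> / 4 * (norm v)\<^sup>2 - K * (\<Sum>i\<in>UNIV. (B U (v $ i) / B U U)\<^sup>2) - K * norm v ^ 3"
    using energy_lower_bound by blast
  obtain L where L: "L \<ge> 0" "\<And>v i. v \<in> Hn \<Longrightarrow> norm v \<le> 1 \<Longrightarrow> (\<And>i. constraint i (p + v) = 0) \<Longrightarrow>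
    \<bar>B U (v $ i) / B U U\<bar> \<le> L * (norm v)\<^sup>2"
    using constraint_tangential by blast
  \<comment> \<open>The squared tangential bound is of order \<open>norm v ^ 4\<close>, hence of
    order 3 in the unit ball. All negative terms are then below \<open>N * norm v ^ 3\<close>, where
    the 1 in \<open>N\<close> makes the inequality strict, and \<epsilon> is chosen so that this
    stays below \<open>\<kappa> / 4 * (norm v)\<^sup>2\<close>.\<close>
  define N where "N = K * (real CARD('n) * L\<^sup>2) + K + 1"
  have N: "N > 0" using K by (auto simp: N_def intro!: add_nonneg_pos)
  define \<epsilon> where "\<epsilon> = min 1 (\<kappa> / (4 * N))"
  show ?thesis
  proof (rule that[of \<epsilon>])
    show "\<epsilon> > 0" using \<kappa>_pos N by (auto simp: \<epsilon>_def)
    fix u assume u: "u \<in> M" "u \<noteq> p" "dist u p < \<epsilon>"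
    define v where "v = u - p"
    have pv: "p + v = u" by (simp add: v_def)
    have "p \<in> Hn" using U_in H by (auto simp: p_def Hn_def subspace_scale)
    then have v: "v \<in> Hn" using u subspace_Hn by (auto simp: v_def M_def intro: subspace_diff)
    have n: "norm v > 0" "norm v \<le> 1" "norm v < \<kappa> / (4 * N)" using u by (auto simp: v_def dist_norm \<epsilon>_def)
    have "(\<Sum>i\<in>UNIV. (B U (v $ i) / B U U)\<^sup>2) \<le> (\<Sum>i\<in>(UNIV :: 'n set). (L * (norm v)\<^sup>2)\<^sup>2)"
    proof (intro sum_mono)
      fix i
      have "\<bar>B U (v $ i) / B U U\<bar> \<le> L * (norm v)\<^sup>2"
        by (rule L(2)) (use v n u pv in \<open>auto simp: M_def\<close>)
      then show "(B U (v $ i) / B U U)\<^sup>2 \<le> (L * (norm v)\<^sup>2)\<^sup>2"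
        by (rule abs_le_square_iff[THEN iffD1, OF order_trans]) simp
    qed
    also have "\<dots> = real CARD('n) * L\<^sup>2 * norm v ^ 3 * norm v"
      by (simp add: power_mult_distrib power2_eq_square power3_eq_cube)
    also have "\<dots> \<le> real CARD('n) * L\<^sup>2 * norm v ^ 3 * 1"
      using n by (intro mult_left_mono) auto
    finally have "K * (\<Sum>i\<in>UNIV. (B U (v $ i) / B U U)\<^sup>2) \<le> K * (real CARD('n) * L\<^sup>2 * norm v ^ 3)"
      using K(1) by (simp add: mult_left_mono)
    then have "energy u - energy p \<ge> \<kappa> / 4 * (norm v)\<^sup>2 - (K * (real CARD('n) * L\<^sup>2) + K) * norm v ^ 3"
      using K(2)[OF v n(2)] unfolding pv by (simp add: algebra_simps)
    moreover have "(K * (real CARD('n) * L\<^sup>2) + K) * norm v ^ 3 < N * norm v ^ 3"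
      using n by (simp add: N_def)
    moreover have "N * norm v ^ 3 = N * norm v * (norm v)\<^sup>2" by (simp add: power2_eq_square power3_eq_cube)
    moreover have "N * norm v * (norm v)\<^sup>2 \<le> \<kappa> / 4 * (norm v)\<^sup>2"
      using n N by (intro mult_right_mono) (auto simp: field_simps)
    ultimately show "energy p < energy u" by linarith
  qed
qed

section \<open>The chart that straightens the constraint set\<close>

definition along :: "'e \<Rightarrow> real" where "along v = B U v / B U U"

definition coupling :: "'e ^ 'n \<Rightarrow> real ^ 'n ^ 'n" where
  "coupling y = (\<chi> i j. A $ i $ j * (\<beta> (y $ i) (y $ i) \<bullet> \<beta> (y $ j) (y $ j)))"

text \<open>Numerator of the k-th unknown in Cramer's rule for the linear system with matrix
  \<open>coupling y\<close>.\<close>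

definition cramer_num :: "'n \<Rightarrow> 'e ^ 'n \<Rightarrow> real" where
  "cramer_num k y = det (\<chi> i j. if j = k then B (y $ i) (y $ i) else coupling y $ i $ j)"

text \<open>A positive product says that the determinant is nonzero and the Cramer quotient
  positive, without dividing; as finitely many strict inequalities for continuous functions this is
  an open condition.\<close>

definition scalable :: "('e ^ 'n) set" where
  "scalable = {y. \<forall>k. 0 < cramer_num k y * det (coupling y)}"

text \<open>\<open>(scaling i y)\<close> are the factors that move \<open>y\<close> onto the constraint set: for factors \<open>s\<close> the constraints
  are a linear system for the squares \<open>s\<^sub>i\<^sup>2\<close>, solved here by Cramer's rule.\<close>

definition scaling :: "'n \<Rightarrow> 'e ^ 'n \<Rightarrow> real" where
  "scaling k y = sqrt (cramer_num k y * inverse (det (coupling y)))"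

lemma along_linear: "bounded_linear along"
  unfolding along_def by (intro bounded_linear_compose[OF bounded_linear_divide] B.bounded_linear_right)

lemma along_simps [simp]:
  "along U = 1" "along (u + v) = along u + along v" "along (u - v) = along u - along v" "along (r *\<^sub>R u) = r * along u"
  "along 0 = 0"
  using B_U_pos by (auto simp: along_def B.add_right B.diff_right B.scaleR_right B.zero_right add_divide_distrib diff_divide_distrib)

lemma scalable_iff:
  "y \<in> scalable \<longleftrightarrow> det (coupling y) \<noteq> 0 \<and> (\<forall>k. 0 < cramer_num k y * inverse (det (coupling y)))"
proof -
  have *: "0 < a * b \<longleftrightarrow> b \<noteq> 0 \<and> 0 < a * inverse b" for a b :: real
    by (auto simp: zero_less_mult_iff)
  show ?thesis unfolding scalable_def mem_Collect_eq *[of _ "det (coupling y)"] by simp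
qed

lemma scaling_pos: "y \<in> scalable \<Longrightarrow> scaling k y > 0"
  by (simp add: scalable_iff scaling_def)

text \<open>Scaling slot i by \<open>s i\<close> turns constraint i into
  \<open>(s i)\<^sup>2\<close> times the defect of row i in a linear system for the squares. The
  squares are therefore the Cramer quotients, and positive factors are determined by their
  squares.\<close>

lemma constraint_iff_scaling:
  assumes y: "y \<in> scalable" and s: "\<And>i. s i > 0"
  shows "(\<forall>i. constraint i (\<chi> i. s i *\<^sub>R y $ i) = 0) \<longleftrightarrow> (\<forall>i. s i = scaling i y)"
proof -
  let ?S = "\<chi> i. (s i)\<^sup>2" and ?b = "\<chi> i. B (y $ i) (y $ i)"
  have det: "det (coupling y) \<noteq> 0" using y by (simp add: scalable_iff)
  have "constraint i (\<chi> i. s i *\<^sub>R y $ i) = (s i)\<^sup>2 * (?b $ i - (coupling y *v ?S) $ i)" for i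
    by (simp add: constraint_def coupling_def matrix_vector_mult_def B.scaleR_left B.scaleR_right
        \<beta>.scaleR_left \<beta>.scaleR_right right_diff_distrib sum_distrib_left power2_eq_square mult_ac)
  then have "(\<forall>i. constraint i (\<chi> i. s i *\<^sub>R y $ i) = 0) \<longleftrightarrow> coupling y *v ?S = ?b"
    using s[THEN dual_order.strict_implies_not_eq] by (auto simp: vec_eq_iff)
  also have "\<dots> \<longleftrightarrow> ?S = (\<chi> k. cramer_num k y / det (coupling y))"
    unfolding cramer[OF det] cramer_num_def vec_lambda_beta ..
  also have "\<dots> \<longleftrightarrow> (\<forall>i. (s i)\<^sup>2 = (scaling i y)\<^sup>2)"
    using y by (simp add: vec_eq_iff scaling_def scalable_iff less_imp_le divide_inverse)
  also have "\<dots> \<longleftrightarrow> (\<forall>i. s i = scaling i y)"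
    using s[THEN less_imp_le] scaling_pos[OF y, THEN less_imp_le] by (simp add: power2_eq_iff_nonneg)
  finally show ?thesis .
qed

text \<open>The map y is kept general because the scaling is composed with \<open>normalize\<close>
  in the chart and with \<open>affine_part\<close> in its inverse.\<close>

context
  fixes X S :: "'x::real_normed_vector set" and y :: "'x \<Rightarrow> 'e ^ 'n"
  assumes X: "subspace X" "S \<subseteq> X" and y: "\<And>i. smooth_at_all_orders X S (\<lambda>x. y x $ i)"
begin

lemma smooth_coupling: "smooth_at_all_orders X S (\<lambda>x. coupling (y x) $ i $ j)"
  unfolding coupling_def
  by (simp, intro smooth_at_all_orders_mult[OF X] smooth_at_all_orders_const
      smooth_at_all_orders_bilinear[OF bounded_bilinear_inner X] smooth_at_all_orders_bilinear[OF \<beta>_bilinear X] y)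

lemma smooth_det_coupling: "smooth_at_all_orders X S (\<lambda>x. det (coupling (y x)))"
  unfolding det_def
  by (intro smooth_at_all_orders_sum smooth_at_all_orders_mult[OF X] smooth_at_all_orders_const
      smooth_at_all_orders_prod[OF X] smooth_coupling)

lemma smooth_cramer_num: "smooth_at_all_orders X S (\<lambda>x. cramer_num k (y x))"
proof -
  have "smooth_at_all_orders X S (\<lambda>x. (\<chi> i j. if j = k then B (y x $ i) (y x $ i) else coupling (y x) $ i $ j) $ i $ j)" for i j
    by (cases "j = k") (simp_all add: smooth_coupling smooth_at_all_orders_bilinear[OF B_bilinear X] y)
  then show ?thesis
    unfolding cramer_num_def det_def
    by (intro smooth_at_all_orders_sum smooth_at_all_orders_mult[OF X] smooth_at_all_orders_const
      smooth_at_all_orders_prod[OF X])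
qed

lemma smooth_scaling:
  assumes "y ` S \<subseteq> scalable"
  shows "smooth_at_all_orders X S (\<lambda>x. scaling k (y x))"
  unfolding scaling_def
  by (intro smooth_at_all_orders_sqrt[OF X] smooth_at_all_orders_mult[OF X] smooth_at_all_orders_inverse[OF X]
      smooth_cramer_num smooth_det_coupling) (use assms scalable_iff in blast)+

lemma openin_scalable:
  assumes "openin (top_of_set X) S"
  shows "openin (top_of_set X) {x\<in>S. y x \<in> scalable}"
  unfolding scalable_def mem_Collect_eq
  by (intro openin_positive assms smooth_at_all_orders_continuous_on[OF smooth_at_all_orders_mult[OF X]]
      smooth_cramer_num smooth_det_coupling X)

end

text \<open>Two ways onto the affine slice where every component has \<open>along\<close> equal to
  1: \<open>normalize\<close> rescales and \<open>affine_part\<close> translates along U. The first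
  serves the chart, the second its inverse.\<close>

definition normalize :: "'e ^ 'n \<Rightarrow> 'e ^ 'n" where
  "normalize u = (\<chi> i. inverse (along (u $ i)) *\<^sub>R u $ i)"

definition affine_part :: "'e ^ 'n \<Rightarrow> 'e ^ 'n" where
  "affine_part z = (\<chi> i. z $ i - along (z $ i) *\<^sub>R U + U)"

definition chart_domain :: "('e ^ 'n) set" where
  "chart_domain = {u\<in>Hn. (\<forall>i. 0 < along (u $ i)) \<and> normalize u \<in> scalable}"

text \<open>Slot i keeps the normalized direction, translated by - U into the kernel of
  \<open>along\<close>, and has as coefficient of U the difference between the actual factor and the
  one required by the constraints. The constraint set thus becomes the zero set of these
  coefficients.\<close>

definition chart :: "'e ^ 'n \<Rightarrow> 'e ^ 'n" where
  "chart u = (\<chi> i. normalize u $ i - U + (along (u $ i) - scaling i (normalize u)) *\<^sub>R U)"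

text \<open>The last condition says that the point rebuilt by \<open>inverse_chart\<close> has
  positive coefficients along U.\<close>

definition chart_range :: "('e ^ 'n) set" where
  "chart_range = {z\<in>Hn. affine_part z \<in> scalable \<and> (\<forall>i. 0 < along (z $ i) + scaling i (affine_part z))}"

definition inverse_chart :: "'e ^ 'n \<Rightarrow> 'e ^ 'n" where
  "inverse_chart z = (\<chi> i. (along (z $ i) + scaling i (affine_part z)) *\<^sub>R affine_part z $ i)"

definition model_space :: "('e ^ 'n) set" where
  "model_space = {u\<in>Hn. \<forall>i. along (u $ i) = 0}"

lemma bounded_linear_along_nth: "bounded_linear (\<lambda>u :: 'e ^ 'n. along (u $ i))"
  by (rule bounded_linear_compose[OF along_linear bounded_linear_vec_nth])

lemma smooth_nth: "smooth_at_all_orders X S (\<lambda>u :: 'e ^ 'n. u $ i)"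
  by (rule smooth_at_all_orders_linear[OF bounded_linear_vec_nth])

lemma smooth_along: "smooth_at_all_orders X S (\<lambda>u :: 'e ^ 'n. along (u $ i))"
  by (rule smooth_at_all_orders_linear[OF bounded_linear_along_nth])

lemma smooth_normalize:
  assumes "S \<subseteq> Hn" "\<And>u i. u \<in> S \<Longrightarrow> 0 < along (u $ i)"
  shows "smooth_at_all_orders Hn S (\<lambda>u. normalize u $ i)"
proof -
  have "along (u $ i) \<noteq> 0" if "u \<in> S" for u i using assms(2)[OF that, of i] by simp
  then show ?thesis
    unfolding normalize_def vec_lambda_beta
    by (intro smooth_at_all_orders_scaleR smooth_at_all_orders_inverse smooth_along smooth_nth subspace_Hn assms(1))
qed

lemma smooth_affine_part:
  assumes "S \<subseteq> Hn"
  shows "smooth_at_all_orders Hn S (\<lambda>z. affine_part z $ i)"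
  unfolding affine_part_def
  by (simp, intro smooth_at_all_orders_scaleR smooth_at_all_orders_add smooth_at_all_orders_diff smooth_at_all_orders_const
      smooth_along smooth_nth subspace_Hn assms)

lemma openin_chart_domain: "openin (top_of_set Hn) chart_domain"
proof -
  let ?S = "{u\<in>Hn. \<forall>i. 0 < along (u $ i)}"
  have "openin (top_of_set Hn) ?S"
    by (intro openin_positive linear_continuous_on bounded_linear_along_nth) auto
  then have "openin (top_of_set Hn) {u\<in>?S. normalize u \<in> scalable}"
    by (intro openin_scalable[where y = normalize] subspace_Hn smooth_normalize) auto
  then show ?thesis by (simp add: chart_domain_def conj_assoc)
qed

lemma openin_chart_range: "openin (top_of_set Hn) chart_range"
proof -
  let ?S = "{z\<in>Hn. affine_part z \<in> scalable}"
  have S: "openin (top_of_set Hn) ?S"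
    by (intro openin_scalable[where y = affine_part] subspace_Hn smooth_affine_part) auto
  have "continuous_on ?S (\<lambda>z. along (z $ i) + scaling i (affine_part z))" for i
    by (rule smooth_at_all_orders_continuous_on[of Hn, OF smooth_at_all_orders_add[OF smooth_along smooth_scaling]])
      (auto intro!: subspace_Hn smooth_affine_part)
  then have "openin (top_of_set Hn) {z\<in>?S. \<forall>i. 0 < along (z $ i) + scaling i (affine_part z)}"
    by (rule openin_positive[OF S])
  then show ?thesis by (simp add: chart_range_def conj_assoc)
qed

lemma chart_smooth: "smooth_at_all_orders Hn chart_domain chart"
  unfolding chart_def
  by (intro smooth_at_all_orders_vec smooth_at_all_orders_scaleR smooth_at_all_orders_add smooth_at_all_orders_diff smooth_at_all_orders_const
      smooth_along smooth_scaling smooth_normalize subspace_Hn) (auto simp: chart_domain_def)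

lemma inverse_chart_smooth: "smooth_at_all_orders Hn chart_range inverse_chart"
  unfolding inverse_chart_def
  by (intro smooth_at_all_orders_vec smooth_at_all_orders_scaleR smooth_at_all_orders_add
      smooth_along smooth_scaling smooth_affine_part subspace_Hn) (auto simp: chart_range_def)

lemma along_normalize: "0 < along (u $ i) \<Longrightarrow> along (normalize u $ i) = 1"
  by (simp add: normalize_def)

lemma chart_along: "0 < along (u $ i) \<Longrightarrow> along (chart u $ i) = along (u $ i) - scaling i (normalize u)"
  by (simp add: chart_def along_normalize)

lemma affine_part_chart:
  assumes "\<And>i. 0 < along (u $ i)"
  shows "affine_part (chart u) = normalize u"
  using assms by (simp add: affine_part_def chart_along vec_eq_iff) (simp add: chart_def)

lemma normalize_inverse_chart:
  assumes "z \<in> chart_range"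
  shows "normalize (inverse_chart z) = affine_part z" "along (inverse_chart z $ i) = along (z $ i) + scaling i (affine_part z)"
proof -
  have 1: "along (affine_part z $ i) = 1" for i by (simp add: affine_part_def)
  then show 2: "along (inverse_chart z $ i) = along (z $ i) + scaling i (affine_part z)" for i
    by (simp add: inverse_chart_def)
  have "along (z $ i) + scaling i (affine_part z) \<noteq> 0" for i
    using assms by (auto simp: chart_range_def dest: spec[of _ i])
  then show "normalize (inverse_chart z) = affine_part z"
    unfolding normalize_def 2 by (simp add: inverse_chart_def vec_eq_iff)
qed

lemma inverse_chart_chart: "u \<in> chart_domain \<Longrightarrow> inverse_chart (chart u) = u"
  by (simp add: inverse_chart_def affine_part_chart chart_along chart_domain_def vec_eq_iff)
    (simp add: normalize_def dual_order.strict_implies_not_eq)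

lemma chart_inverse_chart: "z \<in> chart_range \<Longrightarrow> chart (inverse_chart z) = z"
  by (simp add: chart_def normalize_inverse_chart vec_eq_iff) (simp add: affine_part_def)

lemma in_Hn: "u \<in> Hn \<Longrightarrow> (\<And>i. \<exists>r s. v $ i = r *\<^sub>R u $ i + s *\<^sub>R U) \<Longrightarrow> v \<in> Hn"
  using H U_in unfolding Hn_def mem_Collect_eq by (metis subspace_add subspace_scale)

lemma chart_in_range:
  assumes "u \<in> chart_domain"
  shows "chart u \<in> chart_range"
proof -
  have "chart u \<in> Hn"
  proof (rule in_Hn)
    show "\<exists>r s. chart u $ i = r *\<^sub>R u $ i + s *\<^sub>R U" for i
      by (rule exI[of _ "inverse (along (u $ i))"], rule exI[of _ "along (u $ i) - scaling i (normalize u) - 1"])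
        (simp add: chart_def normalize_def algebra_simps)
  qed (use assms in \<open>simp add: chart_domain_def\<close>)
  then show ?thesis
    using assms by (simp add: chart_range_def chart_domain_def affine_part_chart chart_along)
qed

lemma inverse_chart_in_domain:
  assumes "z \<in> chart_range"
  shows "inverse_chart z \<in> chart_domain"
proof -
  have "inverse_chart z \<in> Hn"
  proof (rule in_Hn)
    show "\<exists>r s. inverse_chart z $ i = r *\<^sub>R z $ i + s *\<^sub>R U" for i
      by (rule exI[of _ "along (z $ i) + scaling i (affine_part z)"],
          rule exI[of _ "(along (z $ i) + scaling i (affine_part z)) * (1 - along (z $ i))"])
        (simp add: inverse_chart_def affine_part_def algebra_simps)
  qed (use assms in \<open>simp add: chart_range_def\<close>)
  then show ?thesis
    using assms normalize_inverse_chart[OF assms] by (simp add: chart_range_def chart_domain_def)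
qed

lemma homeomorphism_chart: "homeomorphism chart_domain chart_range chart inverse_chart"
proof (rule homeomorphismI)
  show "continuous_on chart_domain chart"
    by (rule smooth_at_all_orders_continuous_on[OF chart_smooth subspace_Hn]) (auto simp: chart_domain_def)
  show "continuous_on chart_range inverse_chart"
    by (rule smooth_at_all_orders_continuous_on[OF inverse_chart_smooth subspace_Hn]) (auto simp: chart_range_def)
qed (auto simp: chart_in_range inverse_chart_in_domain inverse_chart_chart chart_inverse_chart)

text \<open>Each u in the domain is its own normalization scaled by the factors
  \<open>along (u $ i)\<close>, so \<open>constraint_iff_scaling\<close> compares these factors with
  the required ones.\<close>

lemma M_chart_iff:
  assumes "u \<in> chart_domain"
  shows "u \<in> M \<longleftrightarrow> chart u \<in> model_space"
proof -
  have u: "u \<in> Hn" "\<And>i. 0 < along (u $ i)" "normalize u \<in> scalable" using assms by (auto simp: chart_domain_def)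
  have nz: "u $ i \<noteq> 0" for i using u(2)[of i] by auto
  have eq: "(\<chi> i. along (u $ i) *\<^sub>R normalize u $ i) = u"
    using u(2)[THEN dual_order.strict_implies_not_eq] by (simp add: normalize_def vec_eq_iff)
  have "u \<in> M \<longleftrightarrow> (\<forall>i. along (u $ i) = scaling i (normalize u))"
    using constraint_iff_scaling[OF u(3), of "\<lambda>i. along (u $ i)", OF u(2)] u(1) nz unfolding eq by (auto simp: M_def)
  also have "\<dots> \<longleftrightarrow> chart u \<in> model_space"
    using chart_in_range[OF assms] u(2) by (auto simp: model_space_def chart_along chart_range_def)
  finally show ?thesis .
qed

lemma p_in_M: "p \<in> M"
proof -
  have "constraint i p = 0" for i
  proof -
    have "(\<Sum>j\<in>UNIV. A $ i $ j * (\<beta> (p $ i) (p $ i) \<bullet> \<beta> (p $ j) (p $ j)))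
      = (\<Sum>j\<in>UNIV. ((c $ i)\<^sup>2 * B U U) * (A $ i $ j * (c $ j)\<^sup>2))"
      by (intro sum.cong refl)
        (simp add: p_def \<beta>.scaleR_left \<beta>.scaleR_right B_U_U power2_eq_square mult_ac)
    also have "\<dots> = (c $ i)\<^sup>2 * B U U" by (simp add: A_c flip: sum_distrib_left)
    finally show ?thesis
      by (simp add: constraint_def) (simp add: p_def B.scaleR_left B.scaleR_right power2_eq_square)
  qed
  moreover have "U \<noteq> 0" using B_U_pos by (auto simp: B.zero_left)
  ultimately show ?thesis using c_pos[THEN dual_order.strict_implies_not_eq] U_in H
    by (auto simp: M_def Hn_def p_def subspace_scale)
qed

text \<open>The normalization of \<open>p\<close> is constant with value U, where the coupling
  matrix is \<open>B U U\<close> times A. Nonsingularity of A makes the determinant nonzero, and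
  \<open>A_c\<close> identifies the Cramer quotients as the squares
  \<open>(c $ k)\<^sup>2 > 0\<close>.\<close>

lemma p_in_chart_domain: "p \<in> chart_domain"
proof -
  have n: "normalize p = (\<chi> i. U)"
    using c_pos[THEN dual_order.strict_implies_not_eq] by (auto simp: normalize_def p_def vec_eq_iff)
  have cp: "coupling (\<chi> i. U) = B U U *\<^sub>R A"
    by (simp add: coupling_def vec_eq_iff B_U_U)
  have "B U U *\<^sub>R A = (\<chi> i. B U U *s A $ i)" by (simp add: vec_eq_iff)
  then have "det (B U U *\<^sub>R A) \<noteq> 0"
    using A_invertible B_U_pos by (simp add: invertible_det_nz det_rows_mul)
  then have det: "det (coupling (\<chi> i. U)) \<noteq> 0" by (simp add: cp)
  have "coupling (\<chi> i. U) *v (\<chi> i. (c $ i)\<^sup>2) = (\<chi> i. B U U)"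
    by (simp add: cp vec_eq_iff matrix_vector_mult_def mult.assoc A_c flip: sum_distrib_left)
  then have "(\<chi> i. (c $ i)\<^sup>2) = (\<chi> k. cramer_num k (\<chi> i. U) / det (coupling (\<chi> i. U)))"
    unfolding cramer[OF det] cramer_num_def vec_lambda_beta .
  then have "cramer_num k (\<chi> i. U) / det (coupling (\<chi> i. U)) = (c $ k)\<^sup>2" for k
    by (simp add: vec_eq_iff)
  then have "0 < cramer_num k (\<chi> i. U) * inverse (det (coupling (\<chi> i. U)))" for k
    using c_pos[of k] by (simp add: divide_inverse)
  then have "(\<chi> i. U) \<in> scalable" using det by (simp add: scalable_iff)
  moreover have "0 < along (p $ i)" for i using c_pos by (simp add: p_def)
  ultimately show ?thesis
    using p_in_M by (simp add: M_def chart_domain_def n)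
qed

text \<open>A complement is spanned by the n vectors with U in one slot: subtracting
  \<open>along (x $ i)\<close> times U in every slot lands in the common kernel of the
  coefficients.\<close>

lemma closed_subspace_model_space: "closed_subspace_of_codim CARD('n) Hn model_space"
proof -
  let ?f = "\<lambda>i. axis i U :: 'e ^ 'n"
  have U0: "U \<noteq> 0" using B_U_pos by (auto simp: B.zero_left)
  have nth: "(\<Sum>i\<in>UNIV. r i *\<^sub>R ?f i) $ k = r k *\<^sub>R U" for r k
    by (simp add: axis_def if_distrib[of "\<lambda>x. _ *\<^sub>R x"] cong: if_cong)
  have inj: "inj ?f"
    using U0 by (auto simp: inj_on_def axis_def vec_eq_iff)
  have sp: "subspace model_space"
    using subspace_Hn by (auto simp: model_space_def subspace_def)
  have "continuous_on Hn (\<lambda>u. \<chi> i. along (u $ i))"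
    by (intro continuous_on_vec_lambda linear_continuous_on bounded_linear_along_nth)
  then have "closedin (top_of_set Hn) (Hn \<inter> (\<lambda>u. \<chi> i. along (u $ i)) -` {0})"
    by (rule continuous_closedin_preimage) simp
  also have "Hn \<inter> (\<lambda>u. \<chi> i. along (u $ i)) -` {0} = model_space" by (auto simp: model_space_def vec_eq_iff)
  finally have cl: "closedin (top_of_set Hn) model_space" .
  have fH: "range ?f \<subseteq> Hn" using U_in H by (auto simp: Hn_def axis_def subspace_0)
  have ind: "independent (range ?f)"
  proof
    assume "dependent (range ?f)"
    then obtain a v where a: "v \<in> range ?f" "a v \<noteq> 0" "(\<Sum>v\<in>range ?f. a v *\<^sub>R v) = 0"
      by (subst (asm) dependent_finite) auto
    have "(\<Sum>i\<in>UNIV. a (?f i) *\<^sub>R ?f i) = 0" using a(3) by (simp add: sum.reindex[OF inj] o_def)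
    then have "a (?f k) *\<^sub>R U = 0" for k using nth[of "\<lambda>i. a (?f i)" k] by simp
    then show False using a(1,2) U0 by auto
  qed
  \<comment> \<open>A subspace containing the span, given by explicit coefficient vectors, so that
    \<open>along\<close> can read the coefficients off.\<close>
  define R :: "('e ^ 'n) set" where "R = {x. \<exists>r. x = (\<chi> i. r i *\<^sub>R U)}"
  have RI: "x \<in> R" if "\<And>i. x $ i = r i *\<^sub>R U" for x r
    using that by (auto simp: R_def vec_eq_iff intro!: exI[of _ r])
  have RE: "\<exists>r. \<forall>i. x $ i = r i *\<^sub>R U" if "x \<in> R" for x
    using that by (auto simp: R_def)
  have "subspace R"
    unfolding subspace_def
  proof (intro conjI ballI allI)
    show "0 \<in> R" by (rule RI[of _ "\<lambda>i. 0"]) simp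
    fix x y assume "x \<in> R" "y \<in> R"
    then obtain r s where "\<And>i. x $ i = r i *\<^sub>R U" "\<And>i. y $ i = s i *\<^sub>R U" using RE by metis
    then show "x + y \<in> R" by (intro RI[of _ "\<lambda>i. r i + s i"]) (simp add: scaleR_left_distrib)
  next
    fix k :: real and x assume "x \<in> R"
    then obtain r where "\<And>i. x $ i = r i *\<^sub>R U" using RE by metis
    then show "k *\<^sub>R x \<in> R" by (intro RI[of _ "\<lambda>i. k * r i"]) simp
  qed
  moreover have "range ?f \<subseteq> R"
  proof
    fix x assume "x \<in> range ?f"
    then obtain i where "x = ?f i" by auto
    then show "x \<in> R" by (intro RI[of _ "\<lambda>j. if j = i then 1 else 0"]) (simp add: axis_def)
  qed
  ultimately have "span (range ?f) \<subseteq> R" by (rule span_minimal[rotated])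
  then have span: "x \<in> span (range ?f) \<Longrightarrow> \<exists>r. x = (\<chi> i. r i *\<^sub>R U)" for x by (auto simp: R_def)
  have span': "(\<chi> i. r i *\<^sub>R U) \<in> span (range ?f)" for r
  proof -
    have "(\<chi> i. r i *\<^sub>R U) = (\<Sum>i\<in>UNIV. r i *\<^sub>R ?f i)" unfolding vec_eq_iff nth by simp
    also have "\<dots> \<in> span (range ?f)" by (intro span_sum span_scale span_base) auto
    finally show ?thesis .
  qed
  have "model_space \<inter> span (range ?f) = {0}"
  proof (intro equalityI subsetI)
    fix x assume x: "x \<in> model_space \<inter> span (range ?f)"
    then obtain r where r: "x = (\<chi> i. r i *\<^sub>R U)" using span by auto
    have "r i = 0" for i using x by (auto simp: model_space_def r)
    then show "x \<in> {0}" by (simp add: r vec_eq_iff)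
  qed (use sp in \<open>auto simp: subspace_0 span_zero\<close>)
  moreover have "Hn = (\<lambda>(f, b). f + b) ` (model_space \<times> span (range ?f))"
  proof (intro equalityI subsetI)
    fix x assume x: "x \<in> Hn"
    let ?b = "\<chi> i. along (x $ i) *\<^sub>R U"
    have "x - ?b \<in> Hn"
      by (rule in_Hn[OF x], rule exI[of _ 1], rule_tac x = "- along (x $ i)" in exI) simp
    then have "x - ?b \<in> model_space" by (simp add: model_space_def)
    then have "(x - ?b, ?b) \<in> model_space \<times> span (range ?f)" using span' by simp
    then show "x \<in> (\<lambda>(f, b). f + b) ` (model_space \<times> span (range ?f))"
      by (rule rev_image_eqI) simp
  next
    fix x assume "x \<in> (\<lambda>(f, b). f + b) ` (model_space \<times> span (range ?f))"
    then show "x \<in> Hn"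
      using span_minimal[OF fH subspace_Hn] subspace_Hn by (auto simp: model_space_def intro!: subspace_add)
  qed
  moreover have "card (range ?f) = CARD('n)" "finite (range ?f)" by (simp_all add: card_image inj)
  moreover have "model_space \<subseteq> Hn" by (auto simp: model_space_def)
  ultimately show ?thesis
    unfolding closed_subspace_of_codim_def using sp cl ind fH
    by (intro conjI exI[of _ "range ?f"])
qed

text \<open>B and \<beta> are bounded bilinear on the whole space, so the derivative is taken there.
  In the quartic sum slot l occurs in either factor and each square contributes a 2; the resulting 4
  cancels the 1/4.\<close>

lemma energy_has_derivative:
  "\<exists>D. (energy has_derivative D) (at u) \<and> (\<forall>l. D (axis l (u $ l)) = constraint l u)"
proof (intro exI conjI allI)
  let ?X = "\<lambda>i. \<beta> (u $ i) (u $ i)" and ?X' = "\<lambda>h i. \<beta> (u $ i) (h $ i) + \<beta> (h $ i) (u $ i)"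
  let ?D = "\<lambda>h. 1/2 * (\<Sum>i\<in>UNIV. B (u $ i) (h $ i) + B (h $ i) (u $ i))
    - 1/4 * (\<Sum>i\<in>UNIV. \<Sum>j\<in>UNIV. A $ i $ j * (?X i \<bullet> ?X' h j + ?X' h i \<bullet> ?X j))"
  show "(energy has_derivative ?D) (at u)"
    unfolding energy_def
    by (intro has_derivative_diff has_derivative_mult_right has_derivative_sum B.FDERIV has_derivative_inner \<beta>.FDERIV
        bounded_linear_imp_has_derivative bounded_linear_vec_nth)
  fix l
  let ?h = "axis l (u $ l)"
  have 1: "(\<Sum>i\<in>UNIV. B (u $ i) (?h $ i) + B (?h $ i) (u $ i)) = 2 * B (u $ l) (u $ l)"
  proof -
    have "(\<Sum>i\<in>UNIV. B (u $ i) (?h $ i) + B (?h $ i) (u $ i)) = (\<Sum>i\<in>UNIV. if i = l then 2 * B (u $ l) (u $ l) else 0)"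
      by (intro sum.cong) (auto simp: axis_def B.zero_left B.zero_right)
    then show ?thesis by simp
  qed
  have X': "?X' ?h i = (if i = l then 2 *\<^sub>R ?X l else 0)" for i
    by (auto simp: axis_def \<beta>.zero_left \<beta>.zero_right scaleR_2)
  have "(\<Sum>i\<in>UNIV. \<Sum>j\<in>UNIV. A $ i $ j * (?X i \<bullet> ?X' ?h j + ?X' ?h i \<bullet> ?X j))
      = (\<Sum>i\<in>UNIV. \<Sum>j\<in>UNIV. if j = l then 2 * (A $ i $ l * (?X i \<bullet> ?X l)) else 0)
        + (\<Sum>i\<in>UNIV. \<Sum>j\<in>UNIV. if i = l then 2 * (A $ l $ j * (?X l \<bullet> ?X j)) else 0)"
    unfolding X' sum.distrib[symmetric] by (intro sum.cong refl) (auto simp: algebra_simps)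
  also have "(\<Sum>i\<in>UNIV. \<Sum>j\<in>UNIV. if i = l then 2 * (A $ l $ j * (?X l \<bullet> ?X j)) else 0)
      = (\<Sum>j\<in>UNIV. 2 * (A $ l $ j * (?X l \<bullet> ?X j)))"
    by (subst sum.swap) simp
  finally have "(\<Sum>i\<in>UNIV. \<Sum>j\<in>UNIV. A $ i $ j * (?X i \<bullet> ?X' ?h j + ?X' ?h i \<bullet> ?X j))
      = 4 * (\<Sum>j\<in>UNIV. A $ l $ j * (?X l \<bullet> ?X j))"
    by (simp add: A_sym[of _ l] inner_commute[of "?X l"] sum_distrib_left sum.distrib[symmetric])
  with 1 show "?D ?h = constraint l u" by (simp add: constraint_def)
qed

text \<open>One chart around \<open>p\<close> serves all points of V, so V is the full intersection
  of \<open>chart_domain\<close> with M. The ball in which the minimum is strict is a separate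
  matter and need not contain V.\<close>

theorem manifold_and_strict_local_min:
  "\<exists>V. openin (top_of_set M) V \<and> p \<in> V \<and> smooth_submanifold_of_codim CARD('n) Hn V \<and>
    strict_local_min_on energy V p"
proof (intro exI[of _ "chart_domain \<inter> M"] conjI)
  obtain T where T: "open T" "chart_domain = Hn \<inter> T"
    using openin_chart_domain unfolding openin_open by (elim exE conjE)
  then have "chart_domain \<inter> M = M \<inter> T" by (auto simp: M_def)
  then show "openin (top_of_set M) (chart_domain \<inter> M)" using T by (auto simp: openin_open)
  show p: "p \<in> chart_domain \<inter> M" using p_in_chart_domain p_in_M by simp
  have "chart ` (chart_domain \<inter> (chart_domain \<inter> M)) = chart_range \<inter> model_space"
  proof (intro equalityI subsetI)
    fix z assume "z \<in> chart_range \<inter> model_space"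
    then show "z \<in> chart ` (chart_domain \<inter> (chart_domain \<inter> M))"
      using inverse_chart_in_domain[of z] chart_inverse_chart[of z] M_chart_iff[of "inverse_chart z"]
      by (intro image_eqI[of _ _ "inverse_chart z"]) auto
  qed (auto simp: M_chart_iff chart_in_range)
  then show "smooth_submanifold_of_codim CARD('n) Hn (chart_domain \<inter> M)"
    unfolding smooth_submanifold_of_codim_def
    by (intro conjI ballI exI[of _ chart_domain] exI[of _ chart_range] exI[of _ chart] exI[of _ inverse_chart]
        exI[of _ model_space] openin_chart_domain openin_chart_range homeomorphism_chart closed_subspace_model_space
        smooth_on_if_smooth_at_all_orders[OF openin_chart_domain subspace_Hn chart_smooth]
        smooth_on_if_smooth_at_all_orders[OF openin_chart_range subspace_Hn inverse_chart_smooth])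
      (auto simp: M_def)
  obtain \<epsilon> where "\<epsilon> > 0" "\<And>u. u \<in> M \<Longrightarrow> u \<noteq> p \<Longrightarrow> dist u p < \<epsilon> \<Longrightarrow> energy p < energy u"
    using strict_local_min by blast
  then show "strict_local_min_on energy (chart_domain \<inter> M) p"
    using p unfolding strict_local_min_on_def by (intro conjI exI[of _ \<epsilon>]) simp_all
qed

end

section \<open>Hilbert spaces\<close>

text \<open>First-order condition at a minimum: a step of size \<open>|a| / (|b| + 1)\<close>
  against the sign of a makes the linear term dominate the quadratic one.\<close>

lemma linear_term_zero:
  fixes a b :: real
  assumes "\<And>t. 0 \<le> t * a + t\<^sup>2 * b"
  shows "a = 0"
proof (rule ccontr)
  assume a: "a \<noteq> 0"
  let ?t = "- a / (\<bar>b\<bar> + 1)"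
  have "?t * a + ?t\<^sup>2 * b \<le> ?t * a + ?t\<^sup>2 * (\<bar>b\<bar> + 1) - ?t\<^sup>2"
    using mult_left_mono[of b "\<bar>b\<bar>" "?t\<^sup>2"] by (simp add: algebra_simps)
  also have "\<dots> = - ?t\<^sup>2" by (simp add: power2_eq_square)
  also have "\<dots> < 0" using a by simp
  finally show False using assms[of ?t] by simp
qed

text \<open>Direct method: \<open>\<phi> x = 1/2 |x|\<^sup>2 - F x\<close> is bounded below on S, a
  minimizing sequence is Cauchy by the parallelogram identity, and stationarity of \<phi> at the
  limit is the representation. Linearity and boundedness of F are assumed on S alone.\<close>

lemma riesz_representation:
  fixes F :: "'e::{real_inner,complete_space} \<Rightarrow> real"
  assumes S: "subspace S" "closed S"
    and add: "\<And>u v. u \<in> S \<Longrightarrow> v \<in> S \<Longrightarrow> F (u + v) = F u + F v"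
    and scale: "\<And>r v. v \<in> S \<Longrightarrow> F (r *\<^sub>R v) = r * F v"
    and bounded: "\<And>v. v \<in> S \<Longrightarrow> \<bar>F v\<bar> \<le> C * norm v"
  obtains g where "g \<in> S" "\<And>v. v \<in> S \<Longrightarrow> F v = g \<bullet> v"
proof -
  define \<phi> where "\<phi> = (\<lambda>x. 1/2 * (x \<bullet> x) - F x)"
  have S0: "0 \<in> S" using S by (simp add: subspace_0)
  have lower: "\<phi> x \<ge> - (C\<^sup>2 / 2)" if "x \<in> S" for x
  proof -
    have "\<phi> x \<ge> 1/2 * (norm x)\<^sup>2 - C * norm x"
      using bounded[OF that] by (simp add: \<phi>_def power2_norm_eq_inner)
    moreover have "0 \<le> (norm x - C)\<^sup>2" by simp
    ultimately show ?thesis by (simp add: power2_eq_square algebra_simps)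
  qed
  define m where "m = Inf (\<phi> ` S)"
  have bdd: "bdd_below (\<phi> ` S)" using lower by (auto intro!: bdd_belowI2)
  have m_le: "m \<le> \<phi> x" if "x \<in> S" for x unfolding m_def using bdd that by (intro cInf_lower) auto
  have "\<exists>x\<in>S. \<phi> x < m + 1 / real (Suc n)" for n
  proof -
    have "Inf (\<phi> ` S) < m + 1 / real (Suc n)" by (simp add: m_def)
    then show ?thesis using S0 by (subst (asm) cInf_less_iff[OF _ bdd]) auto
  qed
  then obtain x where x: "\<And>n. x n \<in> S" "\<And>n. \<phi> (x n) < m + 1 / real (Suc n)" by metis
  have parallelogram: "1/4 * (norm (a - b))\<^sup>2 = \<phi> a + \<phi> b - 2 * \<phi> ((1/2) *\<^sub>R (a + b))" if "a \<in> S" "b \<in> S" for a b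
  proof -
    have "F ((1/2) *\<^sub>R (a + b)) = (F a + F b) / 2"
      using add[OF that] scale[of "a + b" "1/2"] that S by (simp add: subspace_add)
    then show ?thesis
      by (simp add: \<phi>_def power2_norm_eq_inner inner_add_left inner_add_right inner_diff_left inner_diff_right
        inner_commute[of b a] field_simps)
  qed
  have "Cauchy x"
  proof (rule metric_CauchyI)
    fix e :: real assume e: "e > 0"
    obtain N where N: "1 / real (Suc N) < e\<^sup>2 / 8"
      using nat_approx_posE[of "e\<^sup>2 / 8"] e by auto
    show "\<exists>N. \<forall>i\<ge>N. \<forall>j\<ge>N. dist (x i) (x j) < e"
    proof (intro exI allI impI)
      fix i j assume ij: "N \<le> i" "N \<le> j"
      have half: "(1/2) *\<^sub>R (x i + x j) \<in> S" using S x by (intro subspace_scale subspace_add) auto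
      have le: "1 / real (Suc k) \<le> 1 / real (Suc N)" if "N \<le> k" for k using that by (simp add: frac_le)
      have "1/4 * (norm (x i - x j))\<^sup>2 < e\<^sup>2 / 4"
        using parallelogram[OF x(1) x(1), of i j] m_le[OF half] x(2)[of i] x(2)[of j] N le[OF ij(1)] le[OF ij(2)] by linarith
      then have "norm (x i - x j) < e" using e by (simp add: power_less_imp_less_base)
      then show "dist (x i) (x j) < e" by (simp add: dist_norm)
    qed
  qed
  then obtain g where g: "x \<longlonglongrightarrow> g" using Cauchy_convergent_iff convergent_def by metis
  have gS: "g \<in> S" using S(2) x(1) g by (rule closed_sequentially)
  have Fd: "F (u - v) = F u - F v" if "u \<in> S" "v \<in> S" for u v
    using add[of u "- v"] scale[of v "-1"] that S by (simp add: subspace_neg)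
  have F_lim: "(\<lambda>n. F (x n)) \<longlonglongrightarrow> F g"
  proof (rule Lim_null[THEN iffD2], rule Lim_null_comparison)
    show "\<forall>\<^sub>F n in sequentially. norm (F (x n) - F g) \<le> C * norm (x n - g)"
      using bounded[of "x _ - g"] Fd x(1) gS S by (auto simp: subspace_diff)
    show "(\<lambda>n. C * norm (x n - g)) \<longlonglongrightarrow> 0"
      using g by (auto intro!: tendsto_eq_intros simp: Lim_null[of x g, symmetric] tendsto_norm_zero_iff)
  qed
  have "(\<lambda>n. \<phi> (x n)) \<longlonglongrightarrow> \<phi> g" unfolding \<phi>_def by (intro tendsto_intros F_lim g)
  moreover have "(\<lambda>n. m + 1 / real (Suc n)) \<longlonglongrightarrow> m + 0" by (intro tendsto_intros lim_1_over_n[THEN LIMSEQ_Suc])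
  ultimately have \<phi>g: "\<phi> g \<le> m" using x(2) by (intro LIMSEQ_le[of "\<lambda>n. \<phi> (x n)"]) (auto intro: less_imp_le)
  show ?thesis
  proof (rule that[OF gS])
    fix v assume v: "v \<in> S"
    define a where "a = g \<bullet> v - F v"
    have *: "0 \<le> t * a + t\<^sup>2 / 2 * (v \<bullet> v)" for t :: real
    proof -
      have "g + t *\<^sub>R v \<in> S" using gS v S by (intro subspace_add subspace_scale)
      then have "\<phi> g \<le> \<phi> (g + t *\<^sub>R v)" using m_le \<phi>g by force
      moreover have "F (g + t *\<^sub>R v) = F g + t * F v" using add[of g "t *\<^sub>R v"] scale[OF v] gS v S by (simp add: subspace_scale)
      ultimately show ?thesis
        by (simp add: \<phi>_def a_def inner_add_left inner_add_right inner_commute[of v g] power2_eq_square algebra_simps)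
    qed
    have "a = 0" by (rule linear_term_zero[of a "(v \<bullet> v) / 2"]) (use * in simp)
    then show "F v = g \<bullet> v" by (simp add: a_def)
  qed
qed

definition orthogonal_projection :: "'e::{real_inner,complete_space} set \<Rightarrow> 'e \<Rightarrow> 'e" where
  "orthogonal_projection S u = (SOME g. g \<in> S \<and> (\<forall>v\<in>S. u \<bullet> v = g \<bullet> v))"

context
  fixes S :: "'e::{real_inner,complete_space} set"
  assumes S: "subspace S" "closed S"
begin

lemma orthogonal_projection_in: "orthogonal_projection S u \<in> S"
  and orthogonal_projection_inner: "v \<in> S \<Longrightarrow> orthogonal_projection S u \<bullet> v = u \<bullet> v"
proof -
  obtain g where "g \<in> S" "\<And>v. v \<in> S \<Longrightarrow> u \<bullet> v = g \<bullet> v"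
    by (rule riesz_representation[OF S, of "\<lambda>v. u \<bullet> v" "norm u"])
      (auto simp: inner_add_right Cauchy_Schwarz_ineq2)
  then have "\<exists>g. g \<in> S \<and> (\<forall>v\<in>S. u \<bullet> v = g \<bullet> v)" by blast
  from someI_ex[OF this] have "orthogonal_projection S u \<in> S \<and> (\<forall>v\<in>S. u \<bullet> v = orthogonal_projection S u \<bullet> v)"
    unfolding orthogonal_projection_def .
  then show "orthogonal_projection S u \<in> S" "v \<in> S \<Longrightarrow> orthogonal_projection S u \<bullet> v = u \<bullet> v" by simp_all
qed

lemma orthogonal_projection_unique:
  assumes "g \<in> S" "\<And>v. v \<in> S \<Longrightarrow> g \<bullet> v = u \<bullet> v"
  shows "orthogonal_projection S u = g"
proof -
  let ?d = "orthogonal_projection S u - g"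
  have d: "?d \<in> S" using S assms orthogonal_projection_in by (intro subspace_diff)
  have "?d \<bullet> ?d = 0" using assms(2)[OF d] orthogonal_projection_inner[OF d, of u] by (simp add: inner_diff_left)
  then show ?thesis by simp
qed

lemma orthogonal_projection_ident: "u \<in> S \<Longrightarrow> orthogonal_projection S u = u"
  by (rule orthogonal_projection_unique) auto

lemma bounded_linear_orthogonal_projection: "bounded_linear (orthogonal_projection S)"
proof (rule bounded_linear_intro[where K = 1])
  show "orthogonal_projection S (u + v) = orthogonal_projection S u + orthogonal_projection S v" for u v
    using S by (intro orthogonal_projection_unique)
      (auto simp: inner_add_left orthogonal_projection_inner orthogonal_projection_in subspace_add)
  show "orthogonal_projection S (r *\<^sub>R v) = r *\<^sub>R orthogonal_projection S v" for r v
    using S by (intro orthogonal_projection_unique)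
      (auto simp: orthogonal_projection_inner orthogonal_projection_in subspace_scale)
  show "norm (orthogonal_projection S u) \<le> norm u * 1" for u
  proof -
    let ?p = "orthogonal_projection S u"
    have "norm ?p * norm ?p = u \<bullet> ?p"
      using orthogonal_projection_inner[OF orthogonal_projection_in, of u u]
      by (simp add: power2_norm_eq_inner flip: power2_eq_square)
    also have "\<dots> \<le> norm u * norm ?p" by (rule norm_cauchy_schwarz)
    finally show ?thesis by (cases "norm ?p = 0") auto
  qed
qed

end

section \<open>The space \<open>L\<^sup>2\<close>\<close>

lemma fun_of_class_of:
  assumes "square_integrable f"
  shows "AE x in lborel. fun_of (class_of f) x = f x"
  using Quotient_rep_abs[OF Quotient_L2, of f] assms by (auto simp: L2_eq_def)

lemma class_of_fun_of: "class_of (fun_of u) = u"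
  by (rule Quotient_abs_rep[OF Quotient_L2])

lemma L2_eq_iff: "u = v \<longleftrightarrow> (AE x in lborel. fun_of u x = fun_of v x)"
  using Quotient_rel_rep[OF Quotient_L2, of u v] by (auto simp: L2_eq_def square_integrable_fun_of)

lemma fun_of_measurable [measurable]: "fun_of u \<in> borel_measurable borel"
  using square_integrable_fun_of[of u] by (simp add: square_integrable_def)

lemma square_integrable_measurable: "square_integrable f \<Longrightarrow> f \<in> borel_measurable borel"
  by (simp add: square_integrable_def)

lemma fun_of_add: "AE x in lborel. fun_of (u + v) x = fun_of u x + fun_of v x"
  unfolding plus_L2_def map_fun_def by (simp add: fun_of_class_of square_integrable_add square_integrable_fun_of)

lemma fun_of_diff: "AE x in lborel. fun_of (u - v) x = fun_of u x - fun_of v x"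
  unfolding minus_L2_def map_fun_def by (simp add: fun_of_class_of square_integrable_diff square_integrable_fun_of)

lemma fun_of_scaleR: "AE x in lborel. fun_of (r *\<^sub>R u) x = r *\<^sub>R fun_of u x"
  unfolding scaleR_L2_def map_fun_def by (simp add: fun_of_class_of square_integrable_scaleR square_integrable_fun_of)

lemma fun_of_zero: "AE x in lborel. fun_of 0 x = 0"
  unfolding zero_L2_def by (simp add: fun_of_class_of square_integrable_zero)

lemma inner_L2: "u \<bullet> v = (LINT x|lborel. fun_of u x \<bullet> fun_of v x)"
  unfolding inner_L2_def map_fun_def by simp

definition L2_energy :: "('a::euclidean_space \<Rightarrow> 'b::euclidean_space) \<Rightarrow> ennreal" where
  "L2_energy f = (\<integral>\<^sup>+x. ennreal ((norm (f x))\<^sup>2) \<partial>lborel)"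

lemma L2_energy_cong_AE: "AE x in lborel. norm (f x) = norm (g x) \<Longrightarrow> L2_energy f = L2_energy g"
  unfolding L2_energy_def by (rule nn_integral_cong_AE) auto

lemma square_integrable_iff: "square_integrable f \<longleftrightarrow> f \<in> borel_measurable borel \<and> L2_energy f < \<infinity>"
  unfolding square_integrable_def L2_energy_def by (auto simp: integrable_iff_bounded)

lemma L2_energy_fun_of: "L2_energy (fun_of u) = ennreal ((norm u)\<^sup>2)"
proof -
  have "(norm u)\<^sup>2 = (LINT x|lborel. (norm (fun_of u x))\<^sup>2)"
    by (simp add: power2_norm_eq_inner inner_L2)
  then show ?thesis
    using square_integrable_fun_of[of u] unfolding L2_energy_def square_integrable_def
    by (subst nn_integral_eq_integral) auto
qed

lemma L2_energy_class_of: "square_integrable f \<Longrightarrow> L2_energy f = ennreal ((norm (class_of f))\<^sup>2)"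
  unfolding L2_energy_fun_of[symmetric]
  by (rule L2_energy_cong_AE, drule fun_of_class_of) (erule eventually_mono, simp)

lemma L2_energy_diff: "L2_energy (\<lambda>x. fun_of u x - fun_of v x) = ennreal ((norm (u - v))\<^sup>2)"
  unfolding L2_energy_fun_of[symmetric]
  by (rule L2_energy_cong_AE) (use fun_of_diff[of u v] in eventually_elim, simp)

text \<open>With weights \<open>4 ^ n\<close> the energies still form a geometric series, so the sum
  of \<open>4 ^ n * (norm (g n x))\<^sup>2\<close> is finite for almost every x. Each term is at
  most this sum, whose square root serves as C.\<close>

lemma summable_energy_bound:
  fixes g :: "nat \<Rightarrow> 'a::euclidean_space \<Rightarrow> 'b::euclidean_space"
  assumes [measurable]: "\<And>n. g n \<in> borel_measurable borel"
    and le: "\<And>n. L2_energy (g n) \<le> ennreal ((1/8) ^ n)"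
  shows "AE x in lborel. \<exists>C\<ge>0. \<forall>n. norm (g n x) \<le> C * (1/2) ^ n"
proof -
  have "(\<integral>\<^sup>+x. (\<Sum>n. ennreal (4 ^ n) * ennreal ((norm (g n x))\<^sup>2)) \<partial>lborel)
      = (\<Sum>n. ennreal (4 ^ n) * L2_energy (g n))"
    unfolding L2_energy_def by (subst nn_integral_suminf) (auto simp: nn_integral_cmult)
  also have "\<dots> \<le> (\<Sum>n. ennreal ((1/2) ^ n))"
  proof (intro suminf_le)
    fix n
    have "ennreal (4 ^ n) * L2_energy (g n) \<le> ennreal (4 ^ n) * ennreal ((1/8) ^ n)"
      using le by (intro mult_left_mono) auto
    also have "\<dots> = ennreal (4 ^ n * (1/8) ^ n)" by (rule ennreal_mult[symmetric]) auto
    also have "4 ^ n * (1/8) ^ n = (1/2 :: real) ^ n" by (simp flip: power_mult_distrib)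
    finally show "ennreal (4 ^ n) * L2_energy (g n) \<le> ennreal ((1/2) ^ n)" .
  qed auto
  also have "\<dots> = ennreal (\<Sum>n. (1/2) ^ n)" by (rule suminf_ennreal2) (auto simp: summable_geometric)
  also have "\<dots> < \<infinity>" by simp
  finally have "AE x in lborel. (\<Sum>n. ennreal (4 ^ n) * ennreal ((norm (g n x))\<^sup>2)) \<noteq> \<infinity>"
    by (intro nn_integral_PInf_AE) auto
  then show ?thesis
  proof (rule AE_mp, intro AE_I2 impI)
    fix x assume fin: "(\<Sum>n. ennreal (4 ^ n) * ennreal ((norm (g n x))\<^sup>2)) \<noteq> \<infinity>"
    then obtain S where S: "S \<ge> 0" "(\<Sum>n. ennreal (4 ^ n) * ennreal ((norm (g n x))\<^sup>2)) = ennreal S"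
      by (cases "\<Sum>n. ennreal (4 ^ n) * ennreal ((norm (g n x))\<^sup>2)" rule: ennreal_cases) auto
    have "norm (g n x) \<le> sqrt S * (1/2) ^ n" for n
    proof -
      have "ennreal (4 ^ n * (norm (g n x))\<^sup>2) = ennreal (4 ^ n) * ennreal ((norm (g n x))\<^sup>2)"
        by (simp add: ennreal_mult)
      also have "\<dots> \<le> (\<Sum>n. ennreal (4 ^ n) * ennreal ((norm (g n x))\<^sup>2))"
        using sum_le_suminf[of "\<lambda>n. ennreal (4 ^ n) * ennreal ((norm (g n x))\<^sup>2)" "{n}"] by simp
      finally have "4 ^ n * (norm (g n x))\<^sup>2 \<le> S" using S by simp
      moreover have "(2 ^ n * norm (g n x))\<^sup>2 = 4 ^ n * (norm (g n x))\<^sup>2"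
        by (simp add: power_mult_distrib power2_eq_square power_mult_distrib[of 2 2 n, symmetric])
      ultimately have "(2 ^ n * norm (g n x))\<^sup>2 \<le> S" by simp
      then have "2 ^ n * norm (g n x) \<le> sqrt S" by (rule real_le_rsqrt)
      then show ?thesis by (simp add: power_one_over field_simps)
    qed
    then show "\<exists>C\<ge>0. \<forall>n. norm (g n x) \<le> C * (1/2) ^ n" using S(1) by (intro exI[of _ "sqrt S"]) auto
  qed
qed

text \<open>\<open>r n\<close> is the sum of the thresholds so far, each raised by 1: the summation
  makes it dominate \<open>N n\<close>, and the 1 makes it strictly increasing.\<close>

lemma fast_subsequence:
  fixes P :: "nat \<Rightarrow> nat \<Rightarrow> bool"
  assumes "\<And>n. \<exists>N. \<forall>i\<ge>N. P n i"
  obtains r where "strict_mono r" "\<And>n i. i \<ge> r n \<Longrightarrow> P n i"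
proof -
  obtain N where N: "\<And>n i. i \<ge> N n \<Longrightarrow> P n i" using assms by metis
  define r where "r = (\<lambda>n. (\<Sum>k\<le>n. Suc (N k)))"
  have "strict_mono r" by (rule strict_mono_Suc_iff[THEN iffD2]) (simp add: r_def)
  moreover have "N n \<le> r n" for n
    using member_le_sum[of n "{..n}" "\<lambda>k. Suc (N k)"] by (simp add: r_def)
  ultimately show ?thesis using that N le_trans by metis
qed

lemma L2_AE_subsequence:
  fixes X :: "nat \<Rightarrow> ('a::euclidean_space, 'b::euclidean_space) L2"
  assumes "X \<longlonglongrightarrow> u"
  obtains r where "strict_mono r" "AE x in lborel. (\<lambda>n. fun_of (X (r n)) x) \<longlonglongrightarrow> fun_of u x"
proof -
  have "\<exists>N. \<forall>i\<ge>N. (norm (X i - u))\<^sup>2 \<le> (1/8) ^ n" for n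
  proof -
    have "(\<lambda>i. (norm (X i - u))\<^sup>2) \<longlonglongrightarrow> 0"
      using assms by (auto intro!: tendsto_eq_intros simp: Lim_null[of X u] tendsto_norm_zero_iff)
    then have "\<forall>\<^sub>F i in sequentially. (norm (X i - u))\<^sup>2 < (1/8) ^ n" by (rule order_tendstoD) simp
    then show ?thesis by (auto simp: eventually_sequentially intro: less_imp_le)
  qed
  then obtain r where r: "strict_mono r" "\<And>n i. i \<ge> r n \<Longrightarrow> (norm (X i - u))\<^sup>2 \<le> (1/8) ^ n"
    using fast_subsequence[of "\<lambda>n i. (norm (X i - u))\<^sup>2 \<le> (1/8) ^ n"] by blast
  have "AE x in lborel. \<exists>C\<ge>0. \<forall>n. norm (fun_of (X (r n)) x - fun_of u x) \<le> C * (1/2) ^ n"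
    by (rule summable_energy_bound) (auto simp: L2_energy_diff r intro!: ennreal_leI)
  then have "AE x in lborel. (\<lambda>n. fun_of (X (r n)) x) \<longlonglongrightarrow> fun_of u x"
  proof (rule AE_mp, intro AE_I2 impI)
    fix x assume "\<exists>C\<ge>0. \<forall>n. norm (fun_of (X (r n)) x - fun_of u x) \<le> C * (1/2) ^ n"
    then obtain C where C: "\<And>n. norm (fun_of (X (r n)) x - fun_of u x) \<le> C * (1/2) ^ n" by blast
    have "(\<lambda>n. C * (1/2) ^ n) \<longlonglongrightarrow> 0" by (intro tendsto_mult_right_zero LIMSEQ_power_zero) simp
    then have "(\<lambda>n. fun_of (X (r n)) x - fun_of u x) \<longlonglongrightarrow> 0"
      by (rule Lim_null_comparison[rotated]) (use C in auto)
    then show "(\<lambda>n. fun_of (X (r n)) x) \<longlonglongrightarrow> fun_of u x" by (rule LIM_zero_cancel)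
  qed
  then show ?thesis using that r(1) by blast
qed

text \<open>Riesz-Fischer: a fast subsequence converges almost everywhere, Fatou's lemma bounds the
  distance to the pointwise limit, and a Cauchy sequence with a convergent subsequence
  converges.\<close>

instance L2 :: (euclidean_space, euclidean_space) complete_space
proof
  fix X :: "nat \<Rightarrow> ('a, 'b) L2" assume X: "Cauchy X"
  have "\<exists>N. \<forall>i\<ge>N. \<forall>j\<ge>N. (norm (X i - X j))\<^sup>2 \<le> (1/8) ^ n" for n
  proof -
    have "sqrt ((1/8) ^ n) > 0" by simp
    from metric_CauchyD[OF X this] obtain N where N: "\<And>i j. i \<ge> N \<Longrightarrow> j \<ge> N \<Longrightarrow> dist (X i) (X j) < sqrt ((1/8) ^ n)" by blast
    have "(norm (X i - X j))\<^sup>2 \<le> (1/8) ^ n" if "i \<ge> N" "j \<ge> N" for i j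
    proof -
      have "(norm (X i - X j))\<^sup>2 \<le> (sqrt ((1/8) ^ n))\<^sup>2"
        using N[OF that] by (intro power_mono) (auto simp: dist_norm)
      then show ?thesis by simp
    qed
    then show ?thesis by blast
  qed
  then have "\<exists>N. \<forall>i\<ge>N. \<forall>j\<ge>i. (norm (X i - X j))\<^sup>2 \<le> (1/8) ^ n" for n by (meson le_trans)
  then obtain r where r: "strict_mono r" "\<And>n i. i \<ge> r n \<Longrightarrow> \<forall>j\<ge>i. (norm (X i - X j))\<^sup>2 \<le> (1/8) ^ n"
    using fast_subsequence[of "\<lambda>n i. \<forall>j\<ge>i. (norm (X i - X j))\<^sup>2 \<le> (1/8) ^ n"] by blast
  define f where "f = (\<lambda>n. fun_of (X (r n)))"
  have [measurable]: "f n \<in> borel_measurable borel" for n by (simp add: f_def)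
  have diff: "L2_energy (\<lambda>x. f n x - f m x) \<le> ennreal ((1/8) ^ n)" if "n \<le> m" for n m
    using r(2)[of n "r n"] strict_mono_less_eq[OF r(1)] that by (auto simp: f_def L2_energy_diff intro!: ennreal_leI)
  have "AE x in lborel. \<exists>C\<ge>0. \<forall>n. norm (f n x - f (Suc n) x) \<le> C * (1/2) ^ n"
    by (rule summable_energy_bound) (auto simp: diff)
  then have AE_lim: "AE x in lborel. (\<lambda>n. f n x) \<longlonglongrightarrow> lim (\<lambda>n. f n x)"
  proof (rule AE_mp, intro AE_I2 impI)
    fix x assume "\<exists>C\<ge>0. \<forall>n. norm (f n x - f (Suc n) x) \<le> C * (1/2) ^ n"
    then obtain C where C: "\<And>n. norm (f n x - f (Suc n) x) \<le> C * (1/2) ^ n" by blast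
    have "summable (\<lambda>n. f (Suc n) x - f n x)"
      by (rule summable_comparison_test'[of "\<lambda>n. C * (1/2) ^ n" 0])
        (use C in \<open>auto simp: norm_minus_commute intro!: summable_mult summable_geometric\<close>)
    then have "convergent (\<lambda>n. f n x)"
      by (auto simp: summable_iff_convergent sum_lessThan_telescope[of "\<lambda>n. f n x"] convergent_diff_const_right_iff)
    then show "(\<lambda>n. f n x) \<longlonglongrightarrow> lim (\<lambda>n. f n x)" by (simp add: convergent_LIMSEQ_iff)
  qed
  define g where "g = (\<lambda>x. lim (\<lambda>n. f n x))"
  have [measurable]: "g \<in> borel_measurable borel" unfolding g_def by measurable
  have fg: "L2_energy (\<lambda>x. f n x - g x) \<le> ennreal ((1/8) ^ n)" for n
  proof -
    have "L2_energy (\<lambda>x. f n x - g x) = (\<integral>\<^sup>+x. liminf (\<lambda>m. ennreal ((norm (f n x - f m x))\<^sup>2)) \<partial>lborel)"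
      unfolding L2_energy_def
    proof (rule nn_integral_cong_AE, use AE_lim in eventually_elim)
      fix x assume "(\<lambda>n. f n x) \<longlonglongrightarrow> lim (\<lambda>n. f n x)"
      then have "(\<lambda>m. ennreal ((norm (f n x - f m x))\<^sup>2)) \<longlonglongrightarrow> ennreal ((norm (f n x - g x))\<^sup>2)"
        unfolding g_def by (intro tendsto_intros)
      then show "ennreal ((norm (f n x - g x))\<^sup>2) = liminf (\<lambda>m. ennreal ((norm (f n x - f m x))\<^sup>2))"
        by (rule lim_imp_Liminf[OF trivial_limit_sequentially, symmetric])
    qed
    also have "\<dots> \<le> liminf (\<lambda>m. L2_energy (\<lambda>x. f n x - f m x))"
      unfolding L2_energy_def by (rule nn_integral_liminf) measurable
    also have "\<dots> \<le> ennreal ((1/8) ^ n)"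
      by (rule Liminf_le) (auto simp: eventually_sequentially diff intro!: exI[of _ n])
    finally show ?thesis .
  qed
  have "square_integrable (\<lambda>x. f 0 x - g x)"
    using fg[of 0] by (auto simp: square_integrable_iff intro: le_less_trans)
  from square_integrable_diff[OF _ this, of "f 0"]
  have "square_integrable (\<lambda>x. f 0 x - (f 0 x - g x))"
    by (simp add: f_def square_integrable_fun_of)
  then have g2: "square_integrable g" by simp
  define u where "u = class_of g"
  have "(norm (X (r n) - u))\<^sup>2 \<le> (1/8) ^ n" for n
  proof -
    have "ennreal ((norm (X (r n) - u))\<^sup>2) = L2_energy (\<lambda>x. f n x - fun_of u x)"
      by (simp add: f_def L2_energy_diff)
    also have "\<dots> = L2_energy (\<lambda>x. f n x - g x)"
      using fun_of_class_of[OF g2] by (intro L2_energy_cong_AE) (auto simp: u_def)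
    also have "\<dots> \<le> ennreal ((1/8) ^ n)" by (rule fg)
    finally show ?thesis by (subst (asm) ennreal_le_iff) auto
  qed
  then have le: "norm (X (r n) - u) \<le> sqrt ((1/8) ^ n)" for n by (rule real_le_rsqrt)
  have "(\<lambda>n. sqrt ((1/8) ^ n)) \<longlonglongrightarrow> sqrt 0" by (intro tendsto_real_sqrt LIMSEQ_power_zero) simp
  then have "(\<lambda>n. X (r n) - u) \<longlonglongrightarrow> 0"
    by (intro Lim_null_comparison[OF always_eventually[OF allI[OF le]]]) simp
  then have "(X \<circ> r) \<longlonglongrightarrow> u" by (auto simp: o_def dest: LIM_zero_cancel)
  with X r(1) have "X \<longlonglongrightarrow> u" by (rule Cauchy_converges_subseq)
  then show "convergent X" by (auto simp: convergent_def)
qed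

section \<open>Averages over dyadic cells\<close>

lemma nn_integral_lborel_translate:
  fixes f :: "'a::euclidean_space \<Rightarrow> ennreal"
  assumes [measurable]: "f \<in> borel_measurable borel"
  shows "(\<integral>\<^sup>+x. f (x + z) \<partial>lborel) = (\<integral>\<^sup>+x. f x \<partial>lborel)"
proof -
  have "(\<integral>\<^sup>+x. f x \<partial>lborel) = (\<integral>\<^sup>+x. f x \<partial>distr lborel borel ((+) z))" by (simp only: lborel_distr_plus)
  also have "\<dots> = (\<integral>\<^sup>+x. f (z + x) \<partial>lborel)" by (subst nn_integral_distr) auto
  finally show ?thesis by (simp add: add.commute)
qed

lemma L2_energy_add_le:
  assumes [measurable]: "f \<in> borel_measurable borel" "g \<in> borel_measurable borel"
  shows "L2_energy (\<lambda>x. f x + g x) \<le> 2 * L2_energy f + 2 * L2_energy g"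
proof -
  have "L2_energy (\<lambda>x. f x + g x) \<le> (\<integral>\<^sup>+x. 2 * ennreal ((norm (f x))\<^sup>2) + 2 * ennreal ((norm (g x))\<^sup>2) \<partial>lborel)"
    unfolding L2_energy_def
  proof (rule nn_integral_mono)
    fix x
    have "(norm (f x + g x))\<^sup>2 \<le> (norm (f x) + norm (g x))\<^sup>2" by (intro power_mono norm_triangle_ineq) simp
    also have "\<dots> \<le> 2 * (norm (f x))\<^sup>2 + 2 * (norm (g x))\<^sup>2"
      using zero_le_power2[of "norm (f x) - norm (g x)"] unfolding power2_sum power2_diff by linarith
    finally have "ennreal ((norm (f x + g x))\<^sup>2) \<le> ennreal (2 * (norm (f x))\<^sup>2 + 2 * (norm (g x))\<^sup>2)" by (rule ennreal_leI)
    then show "ennreal ((norm (f x + g x))\<^sup>2) \<le> 2 * ennreal ((norm (f x))\<^sup>2) + 2 * ennreal ((norm (g x))\<^sup>2)"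
      by (simp add: ennreal_plus ennreal_mult)
  qed
  also have "\<dots> = 2 * L2_energy f + 2 * L2_energy g"
    unfolding L2_energy_def by (subst nn_integral_add) (auto simp: nn_integral_cmult)
  finally show ?thesis .
qed

lemma L2_energy_uminus: "L2_energy (\<lambda>x. - f x) = L2_energy f"
  by (simp add: L2_energy_def)

lemma L2_energy_diff_le:
  assumes [measurable]: "f \<in> borel_measurable borel" "g \<in> borel_measurable borel"
  shows "L2_energy (\<lambda>x. f x - g x) \<le> 2 * L2_energy f + 2 * L2_energy g"
  using L2_energy_add_le[of f "\<lambda>x. - g x"] by (simp add: L2_energy_uminus)

text \<open>Half-open dyadic cubes of side \<open>(1/2) ^ j\<close>, addressed by any of their
  points: equality of integer parts is an equivalence relation, so the cells of one level partition
  the space.\<close>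

definition cell :: "nat \<Rightarrow> 'a::euclidean_space \<Rightarrow> 'a set" where
  "cell j x = {y. \<forall>b\<in>Basis. \<lfloor>2 ^ j * (y \<bullet> b)\<rfloor> = \<lfloor>2 ^ j * (x \<bullet> b)\<rfloor>}"

lemma cell_refl: "x \<in> cell j x" by (simp add: cell_def)

lemma cell_eq: "y \<in> cell j x \<Longrightarrow> cell j y = cell j x" by (auto simp: cell_def)

text \<open>Nesting holds because the integer part of t is determined by that of 2 t.\<close>

lemma cell_Suc: "cell (Suc j) x \<subseteq> cell j (x :: 'a::euclidean_space)"
proof -
  have "\<lfloor>t\<rfloor> = \<lfloor>2 * t\<rfloor> div 2" for t :: real
    using floor_divide_real_eq_div[of 2 "2 * t"] by simp
  from this[of "2 ^ j * _"] show ?thesis by (auto simp: cell_def mult.assoc)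
qed

lemma cell_measurable_pair [measurable]:
  "Measurable.pred (borel \<Otimes>\<^sub>M borel) (\<lambda>p :: 'a::euclidean_space \<times> 'a. snd p \<in> cell j (fst p))"
proof -
  have "(\<lambda>p :: 'a \<times> 'a. snd p \<in> cell j (fst p)) =
    (\<lambda>p. \<forall>b\<in>Basis. real_of_int \<lfloor>2 ^ j * (snd p \<bullet> b)\<rfloor> \<le> real_of_int \<lfloor>2 ^ j * (fst p \<bullet> b)\<rfloor>
      \<and> real_of_int \<lfloor>2 ^ j * (fst p \<bullet> b)\<rfloor> \<le> real_of_int \<lfloor>2 ^ j * (snd p \<bullet> b)\<rfloor>)"
    by (auto simp: cell_def fun_eq_iff intro: antisym)
  also have "Measurable.pred (borel \<Otimes>\<^sub>M borel) \<dots>"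
    unfolding pred_def
    by (intro sets.sets_Collect_finite_All sets.sets_Collect_conj borel_measurable_le finite_Basis
        measurable_compose[OF _ borel_measurable_real_floor]) measurable
  finally show ?thesis .
qed

lemma cell_sets [measurable]: "cell j x \<in> sets borel"
proof -
  have "Measurable.pred borel (\<lambda>y. snd (x, y) \<in> cell j (fst (x, y)))" by measurable
  then show ?thesis by (simp add: pred_def)
qed

lemma emeasure_cell: "emeasure lborel (cell j (x :: 'a::euclidean_space)) = ennreal ((1 / 2 ^ j) ^ DIM('a))"
proof -
  define l where "l = (\<Sum>b\<in>Basis. (real_of_int \<lfloor>2 ^ j * (x \<bullet> b)\<rfloor> / 2 ^ j) *\<^sub>R b)"
  define u where "u = l + (\<Sum>b\<in>Basis. (1 / 2 ^ j) *\<^sub>R b)"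
  have lb: "l \<bullet> b = real_of_int \<lfloor>2 ^ j * (x \<bullet> b)\<rfloor> / 2 ^ j" if "b \<in> Basis" for b using that by (simp add: l_def)
  have ub: "u \<bullet> b = (real_of_int \<lfloor>2 ^ j * (x \<bullet> b)\<rfloor> + 1) / 2 ^ j" if "b \<in> Basis" for b
    using that by (simp add: u_def lb inner_add_left add_divide_distrib)
  have iff: "y \<in> cell j x \<longleftrightarrow> (\<forall>b\<in>Basis. l \<bullet> b \<le> y \<bullet> b \<and> y \<bullet> b < u \<bullet> b)" for y
    unfolding cell_def mem_Collect_eq
    by (intro ball_cong refl) (auto simp: lb ub floor_eq_iff field_simps)
  have "box l u \<subseteq> cell j x" "cell j x \<subseteq> cbox l u"
    unfolding subset_iff iff by (auto simp: mem_box intro: less_imp_le)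
  then have "emeasure lborel (box l u) \<le> emeasure lborel (cell j x)" "emeasure lborel (cell j x) \<le> emeasure lborel (cbox l u)"
    by (auto intro!: emeasure_mono)
  moreover have "l \<bullet> b \<le> u \<bullet> b" if "b \<in> Basis" for b using that by (simp add: lb ub divide_right_mono)
  ultimately have "emeasure lborel (cell j x) = ennreal (\<Prod>b\<in>Basis. (u - l) \<bullet> b)"
    by (simp add: emeasure_lborel_box_eq emeasure_lborel_cbox_eq antisym)
  also have "(\<Prod>b\<in>Basis. (u - l) \<bullet> b) = (\<Prod>b\<in>(Basis :: 'a set). 1 / 2 ^ j)"
    by (intro prod.cong refl) (simp add: u_def)
  finally show ?thesis by simp
qed

lemma measure_cell: "measure lborel (cell j (x :: 'a::euclidean_space)) = (1 / 2 ^ j) ^ DIM('a)"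
  by (simp add: measure_def emeasure_cell)

text \<open>The prefactor is the reciprocal of the volume of a cell.\<close>

definition cell_average :: "nat \<Rightarrow> ('a::euclidean_space \<Rightarrow> real) \<Rightarrow> 'a \<Rightarrow> real" where
  "cell_average j f x = (2 ^ j) ^ DIM('a) * (LINT y|lborel. indicator (cell j x) y * f y)"

lemma square_integrable_indicator:
  "A \<in> sets borel \<Longrightarrow> emeasure lborel A < \<infinity> \<Longrightarrow> square_integrable (indicator A :: 'a::euclidean_space \<Rightarrow> real)"
  by (auto simp: square_integrable_def power2_eq_square indicator_inter_arith[symmetric] integrable_indicator_iff)

lemma square_integrable_cell: "square_integrable (indicator (cell j x) :: 'a::euclidean_space \<Rightarrow> real)"
  by (rule square_integrable_indicator) (auto simp: emeasure_cell)

lemma cell_integrable: "square_integrable f \<Longrightarrow> integrable lborel (\<lambda>y. indicator (cell j x) y * f y :: real)"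
  using integrable_inner_square_integrable[OF square_integrable_cell, of f j x] by simp

lemma cell_average_eq: "y \<in> cell j x \<Longrightarrow> cell_average j f y = cell_average j f x"
  by (simp add: cell_average_def cell_eq)

lemma cell_average_measurable [measurable]:
  fixes f :: "'a::euclidean_space \<Rightarrow> real"
  assumes [measurable]: "f \<in> borel_measurable borel"
  shows "cell_average j f \<in> borel_measurable borel"
proof -
  have "(\<lambda>x. LINT y|lborel. (if snd (x, y) \<in> cell j (fst (x, y)) then f y else 0)) \<in> borel_measurable borel"
    by (rule lborel.borel_measurable_lebesgue_integral) measurable
  then show ?thesis unfolding cell_average_def by (simp add: indicator_def if_distrib cong: if_cong)
qed

text \<open>Jensen's inequality for the average over the cell, obtained from Cauchy-Schwarz.\<close>

lemma cell_average_diff_bound: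
  fixes f :: "'a::euclidean_space \<Rightarrow> real"
  assumes f: "square_integrable f"
  shows "ennreal ((f x - cell_average j f x)\<^sup>2)
    \<le> ennreal ((2 ^ j) ^ DIM('a)) * (\<integral>\<^sup>+y. indicator (cell j x) y * ennreal ((f x - f y)\<^sup>2) \<partial>lborel)"
proof -
  have [measurable]: "f \<in> borel_measurable borel" using f by (rule square_integrable_measurable)
  let ?c = "(2 ^ j :: real) ^ DIM('a)" and ?i = "indicator (cell j x) :: 'a \<Rightarrow> real"
  have c: "?c > 0" by simp
  have cm: "?c * (1 / 2 ^ j) ^ DIM('a) = 1" by (simp flip: power_mult_distrib)
  have i: "integrable lborel ?i" by (auto simp: integrable_indicator_iff emeasure_cell)
  have "f x - cell_average j f x = ?c * (LINT y|lborel. ?i y * (f x - f y))"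
    using cell_integrable[OF f, of j x] i cm
    by (simp add: cell_average_def right_diff_distrib measure_cell mult.assoc[symmetric] mult.commute[of "f x"])
  also have "\<bar>\<dots>\<bar> \<le> ?c * (LINT y|lborel. \<bar>?i y * (f x - f y)\<bar>)"
    using integral_abs_bound[of lborel "\<lambda>y. ?i y * (f x - f y)"] by (simp add: abs_mult)
  finally have "ennreal \<bar>f x - cell_average j f x\<bar> \<le> ennreal ?c * ennreal (LINT y|lborel. \<bar>?i y * (f x - f y)\<bar>)"
    by (simp add: ennreal_mult[symmetric] ennreal_leI)
  also have "ennreal (LINT y|lborel. \<bar>?i y * (f x - f y)\<bar>) = (\<integral>\<^sup>+y. ennreal \<bar>?i y * (f x - f y)\<bar> \<partial>lborel)"
    using cell_integrable[OF f, of j x] i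
    by (intro nn_integral_eq_integral[symmetric]) (auto simp: right_diff_distrib)
  \<comment> \<open>The indicator is doubled so that one copy can be the second function in
    Cauchy-Schwarz.\<close>
  also have "\<dots> = (\<integral>\<^sup>+y. indicator (cell j x) y * (indicator (cell j x) y * ennreal \<bar>f x - f y\<bar>) \<partial>lborel)"
    by (intro nn_integral_cong) (auto simp: indicator_def)
  finally have "(ennreal \<bar>f x - cell_average j f x\<bar>)\<^sup>2
    \<le> (ennreal ?c * (\<integral>\<^sup>+y. indicator (cell j x) y * (indicator (cell j x) y * ennreal \<bar>f x - f y\<bar>) \<partial>lborel))\<^sup>2"
    by (rule power_mono) simp
  also have "\<dots> = (ennreal ?c)\<^sup>2 * (\<integral>\<^sup>+y. indicator (cell j x) y * (indicator (cell j x) y * ennreal \<bar>f x - f y\<bar>) \<partial>lborel)\<^sup>2"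
    by (rule power_mult_distrib)
  also have "\<dots> \<le> (ennreal ?c)\<^sup>2 * ((\<integral>\<^sup>+y. (indicator (cell j x) y)\<^sup>2 \<partial>lborel) * (\<integral>\<^sup>+y. (indicator (cell j x) y * ennreal \<bar>f x - f y\<bar>)\<^sup>2 \<partial>lborel))"
    by (intro mult_left_mono Cauchy_Schwarz_nn_integral) auto
  also have "(\<integral>\<^sup>+y. (indicator (cell j x) y)\<^sup>2 \<partial>lborel) = emeasure lborel (cell j x)"
    by (simp add: power2_eq_square indicator_inter_arith[symmetric])
  also have "(\<integral>\<^sup>+y. (indicator (cell j x) y * ennreal \<bar>f x - f y\<bar>)\<^sup>2 \<partial>lborel) = (\<integral>\<^sup>+y. indicator (cell j x) y * ennreal ((f x - f y)\<^sup>2) \<partial>lborel)"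
    by (intro nn_integral_cong) (auto simp: indicator_def ennreal_power)
  also have "(ennreal ?c)\<^sup>2 * (emeasure lborel (cell j x) * (\<integral>\<^sup>+y. indicator (cell j x) y * ennreal ((f x - f y)\<^sup>2) \<partial>lborel))
    = ennreal (?c * (?c * (1 / 2 ^ j) ^ DIM('a))) * (\<integral>\<^sup>+y. indicator (cell j x) y * ennreal ((f x - f y)\<^sup>2) \<partial>lborel)"
    by (simp add: emeasure_cell power2_eq_square ennreal_mult mult.assoc)
  finally show ?thesis unfolding cm by (simp add: ennreal_power)
qed

text \<open>The only trace of the gradient that the embedding and the compactness argument see; for
  Sobolev functions D is the \<open>L\<^sup>2\<close> norm of the weak gradient.\<close>

definition translation_bound :: "('a::euclidean_space \<Rightarrow> real) \<Rightarrow> real \<Rightarrow> bool" where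
  "translation_bound f D \<longleftrightarrow> (\<forall>z. L2_energy (\<lambda>x. f (x + z) - f x) \<le> ennreal ((norm z * D)\<^sup>2))"

text \<open>Seen from any of its points a cell lies in a cube of twice its side, which costs
  \<open>2 ^ N\<close> in volume, and there \<open>|z|\<^sup>2\<close> is at most N times the square
  of the side.\<close>

definition cell_constant :: "'a::euclidean_space itself \<Rightarrow> real" where
  "cell_constant _ = 2 ^ DIM('a) * real DIM('a)"

text \<open>Averaged translation bound: f at x is compared with f at the points x + z of the same
  cell, all these z lie in the fixed cube Q, and Fubini's theorem leaves one translation estimate
  for each z.\<close>

lemma cell_average_L2:
  fixes f :: "'a::euclidean_space \<Rightarrow> real"
  assumes f: "square_integrable f" and t: "translation_bound f D"
  shows "L2_energy (\<lambda>x. f x - cell_average j f x) \<le> ennreal (cell_constant TYPE('a) * (1 / 4) ^ j * D\<^sup>2)"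
proof -
  have [measurable]: "f \<in> borel_measurable borel" using f by (rule square_integrable_measurable)
  let ?c = "(2 ^ j :: real) ^ DIM('a)"
  define h where "h = (1 / 2 ^ j :: real)"
  have h: "h > 0" by (simp add: h_def)
  define w :: 'a where "w = (\<Sum>b\<in>Basis. h *\<^sub>R b)"
  have w: "w \<bullet> b = h" if "b \<in> Basis" for b using that by (simp add: w_def)
  define Q where "Q = cbox (- w) w"
  have Q: "z \<in> Q \<longleftrightarrow> (\<forall>b\<in>Basis. \<bar>z \<bullet> b\<bar> \<le> h)" for z by (auto simp: Q_def mem_box w abs_le_iff)
  have [measurable]: "Q \<in> sets borel" by (simp add: Q_def)
  have emQ: "emeasure lborel Q = ennreal ((2 * h) ^ DIM('a))"

  proof -
    have "(\<Prod>b\<in>Basis. (w - - w) \<bullet> b) = (\<Prod>b\<in>(Basis :: 'a set). 2 * h)"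
      by (intro prod.cong refl) (simp add: inner_add_left w)
    then show ?thesis using h by (simp add: Q_def emeasure_lborel_cbox_eq w)
  qed
  have QI: "z \<in> Q" if "x + z \<in> cell j x" for x z
    unfolding Q
  proof
    fix b :: 'a assume "b \<in> Basis"
    then have "\<lfloor>2 ^ j * ((x + z) \<bullet> b)\<rfloor> = \<lfloor>2 ^ j * (x \<bullet> b)\<rfloor>" using that by (auto simp: cell_def)
    then have "\<bar>2 ^ j * ((x + z) \<bullet> b) - 2 ^ j * (x \<bullet> b)\<bar> < 1" by linarith
    then have "\<bar>2 ^ j * (z \<bullet> b)\<bar> < 1" by (simp add: inner_add_left algebra_simps)
    then show "\<bar>z \<bullet> b\<bar> \<le> h" by (simp add: h_def abs_mult field_simps)
  qed
  have "L2_energy (\<lambda>x. f x - cell_average j f x)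
    \<le> (\<integral>\<^sup>+x. ennreal ?c * (\<integral>\<^sup>+y. indicator (cell j x) y * ennreal ((f x - f y)\<^sup>2) \<partial>lborel) \<partial>lborel)"
    unfolding L2_energy_def using cell_average_diff_bound[OF f] by (intro nn_integral_mono) simp
  also have "\<dots> = (\<integral>\<^sup>+x. ennreal ?c * (\<integral>\<^sup>+z. indicator (cell j x) (z + x) * ennreal ((f x - f (z + x))\<^sup>2) \<partial>lborel) \<partial>lborel)"
    by (intro nn_integral_cong arg_cong2[where f = "(*)"] refl nn_integral_lborel_translate[symmetric]) measurable
  also have "\<dots> \<le> (\<integral>\<^sup>+x. ennreal ?c * (\<integral>\<^sup>+z. indicator Q z * ennreal ((f (x + z) - f x)\<^sup>2) \<partial>lborel) \<partial>lborel)"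
  proof (intro nn_integral_mono mult_left_mono)
    fix x z
    show "indicator (cell j x) (z + x) * ennreal ((f x - f (z + x))\<^sup>2) \<le> indicator Q z * ennreal ((f (x + z) - f x)\<^sup>2)"
      unfolding add.commute[of z x] power2_commute[of "f x" "f (x + z)"]
      using QI[of x z] by (intro mult_right_mono) (auto simp: indicator_def)
  qed simp
  also have "\<dots> = ennreal ?c * (\<integral>\<^sup>+x. (\<integral>\<^sup>+z. indicator Q z * ennreal ((f (x + z) - f x)\<^sup>2) \<partial>lborel) \<partial>lborel)"
    by (rule nn_integral_cmult) measurable
  also have "(\<integral>\<^sup>+x. (\<integral>\<^sup>+z. indicator Q z * ennreal ((f (x + z) - f x)\<^sup>2) \<partial>lborel) \<partial>lborel)
    = (\<integral>\<^sup>+z. (\<integral>\<^sup>+x. indicator Q z * ennreal ((f (x + z) - f x)\<^sup>2) \<partial>lborel) \<partial>lborel)"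
    by (rule lborel_pair.Fubini'[symmetric]) measurable
  also have "\<dots> \<le> (\<integral>\<^sup>+z. indicator Q z * ennreal ((sqrt DIM('a) * h * D)\<^sup>2) \<partial>lborel)"
  proof (rule nn_integral_mono)
    fix z :: 'a
    have "(\<integral>\<^sup>+x. indicator Q z * ennreal ((f (x + z) - f x)\<^sup>2) \<partial>lborel) = indicator Q z * L2_energy (\<lambda>x. f (x + z) - f x)"
      unfolding L2_energy_def by (subst nn_integral_cmult[symmetric]) auto
    also have "\<dots> \<le> indicator Q z * ennreal ((norm z * D)\<^sup>2)"
      using t unfolding translation_bound_def by (intro mult_left_mono) auto
    also have "\<dots> \<le> indicator Q z * ennreal ((sqrt DIM('a) * h * D)\<^sup>2)"
    proof (cases "z \<in> Q")
      case True
      have "(norm z)\<^sup>2 = (\<Sum>b\<in>Basis. (z \<bullet> b)\<^sup>2)"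
        unfolding power2_norm_eq_inner euclidean_inner[of z z] by (simp add: power2_eq_square)
      also have "\<dots> \<le> (\<Sum>b\<in>(Basis :: 'a set). h\<^sup>2)"
        using True h unfolding Q by (intro sum_mono) (auto simp: abs_le_square_iff[symmetric])
      also have "\<dots> = (sqrt DIM('a) * h)\<^sup>2" by (simp add: power_mult_distrib)
      finally have "(norm z * D)\<^sup>2 \<le> (sqrt DIM('a) * h * D)\<^sup>2"
        by (simp add: power_mult_distrib mult_right_mono)
      then show ?thesis by (simp add: True ennreal_leI)
    qed simp
    finally show "(\<integral>\<^sup>+x. indicator Q z * ennreal ((f (x + z) - f x)\<^sup>2) \<partial>lborel) \<le> indicator Q z * ennreal ((sqrt DIM('a) * h * D)\<^sup>2)" .
  qed
  also have "\<dots> = ennreal ((2 * h) ^ DIM('a)) * ennreal ((sqrt DIM('a) * h * D)\<^sup>2)"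
    by (subst nn_integral_multc) (auto simp: emQ)
  also have "ennreal ?c * \<dots> = ennreal (?c * ((2 * h) ^ DIM('a) * (sqrt DIM('a) * h * D)\<^sup>2))"
    using h by (simp add: ennreal_mult)
  also have "?c * ((2 * h) ^ DIM('a) * (sqrt DIM('a) * h * D)\<^sup>2) = cell_constant TYPE('a) * (1 / 4) ^ j * D\<^sup>2"
  proof -
    have "?c * (2 * h) ^ DIM('a) = 2 ^ DIM('a)" by (simp add: h_def flip: power_mult_distrib)
    moreover have "h\<^sup>2 = (1/4) ^ j" by (simp add: h_def power2_eq_square power_one_over flip: power_mult_distrib)
    ultimately show ?thesis by (simp add: cell_constant_def power_mult_distrib mult.assoc[symmetric])
  qed
  finally show ?thesis by (simp add: mult_left_mono)
qed

section \<open>The Sobolev embedding into \<open>L\<^sup>4\<close> and local compactness\<close>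

definition L4_energy :: "('a::euclidean_space \<Rightarrow> real) \<Rightarrow> ennreal" where
  "L4_energy f = (\<integral>\<^sup>+x. ennreal (f x ^ 4) \<partial>lborel)"

text \<open>Minkowski's inequality in \<open>L\<^sup>4\<close> without roots, from convexity of the
  fourth power.\<close>

lemma L4_energy_add:
  assumes [measurable]: "f \<in> borel_measurable borel" "g \<in> borel_measurable borel"
    and f: "L4_energy f \<le> ennreal (a ^ 4)" and g: "L4_energy g \<le> ennreal (b ^ 4)" and ab: "a > 0" "b > 0"
  shows "L4_energy (\<lambda>x. f x + g x) \<le> ennreal ((a + b) ^ 4)"
proof -
  \<comment> \<open>The optimal weight: with it the two convexity terms add up to exactly
    \<open>(a + b) ^ 4\<close>.\<close>
  define t where "t = a / (a + b)"
  have t: "t > 0" "t < 1" "1 - t = b / (a + b)" using ab by (auto simp: t_def field_simps)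
  have pt: "(x + y) ^ 4 \<le> x ^ 4 / t ^ 3 + y ^ 4 / (1 - t) ^ 3" for x y :: real
  proof -
    have "((1 - t) *\<^sub>R (y / (1 - t)) + t *\<^sub>R (x / t)) ^ 4 \<le> (1 - t) * (y / (1 - t)) ^ 4 + t * (x / t) ^ 4"
      using convex_onD[OF convex_power_even[of 4], of t "y / (1 - t)" "x / t"] t by simp
    also have "(1 - t) *\<^sub>R (y / (1 - t)) + t *\<^sub>R (x / t) = x + y" using t(1,2) by simp
    also have "(1 - t) * (y / (1 - t)) ^ 4 + t * (x / t) ^ 4 = y ^ 4 / (1 - t) ^ 3 + x ^ 4 / t ^ 3"
    proof -
      have q: "s * (x / s) ^ 4 = x ^ 4 / s ^ 3" if "s > 0" for s x :: real
        using that by (simp add: power_divide numeral_eq_Suc)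
      show ?thesis using t(1,2) by (simp only: q diff_gt_0_iff_gt)
    qed
    finally show ?thesis by simp
  qed
  have "L4_energy (\<lambda>x. f x + g x) \<le> (\<integral>\<^sup>+x. ennreal (1 / t ^ 3) * ennreal (f x ^ 4) + ennreal (1 / (1 - t) ^ 3) * ennreal (g x ^ 4) \<partial>lborel)"
    unfolding L4_energy_def
  proof (rule nn_integral_mono)
    fix x
    have "ennreal ((f x + g x) ^ 4) \<le> ennreal (1 / t ^ 3 * f x ^ 4 + 1 / (1 - t) ^ 3 * g x ^ 4)"
      using pt[of "f x" "g x"] by (intro ennreal_leI) simp
    also have "\<dots> = ennreal (1 / t ^ 3) * ennreal (f x ^ 4) + ennreal (1 / (1 - t) ^ 3) * ennreal (g x ^ 4)"
      using t(1,2) by (subst ennreal_plus) (auto simp: ennreal_mult'[symmetric])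
    finally show "ennreal ((f x + g x) ^ 4) \<le> \<dots>" .
  qed
  also have "\<dots> = ennreal (1 / t ^ 3) * L4_energy f + ennreal (1 / (1 - t) ^ 3) * L4_energy g"
    unfolding L4_energy_def by (subst nn_integral_add) (auto simp: nn_integral_cmult)
  also have "\<dots> \<le> ennreal (1 / t ^ 3) * ennreal (a ^ 4) + ennreal (1 / (1 - t) ^ 3) * ennreal (b ^ 4)"
    by (intro add_mono mult_left_mono f g) auto
  also have "\<dots> = ennreal (1 / t ^ 3 * a ^ 4 + 1 / (1 - t) ^ 3 * b ^ 4)"
    using t(1,2) by (simp add: ennreal_mult'[symmetric] ennreal_plus)
  also have "1 / t ^ 3 * a ^ 4 = (a + b) ^ 3 * a"
    using ab by (simp add: t_def power_divide numeral_eq_Suc)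
  also have "1 / (1 - t) ^ 3 * b ^ 4 = (a + b) ^ 3 * b"
    unfolding t(3) using ab by (simp add: power_divide numeral_eq_Suc)
  also have "(a + b) ^ 3 * a + (a + b) ^ 3 * b = (a + b) ^ 4" by (simp add: numeral_eq_Suc algebra_simps)
  finally show ?thesis .
qed

text \<open>Inverse estimate: \<open>(g x)\<^sup>2\<close> equals its average over the cell of x and
  is therefore at most the total \<open>L\<^sup>2\<close> mass divided by the cell volume. One of
  the two squares in the fourth power is estimated in this way.\<close>

lemma cellwise_constant_L4:
  fixes g :: "'a::euclidean_space \<Rightarrow> real"
  assumes [measurable]: "g \<in> borel_measurable borel" and c: "\<And>x y. y \<in> cell j x \<Longrightarrow> g y = g x"
  shows "L4_energy g \<le> ennreal ((2 ^ j) ^ DIM('a)) * (L2_energy g)\<^sup>2"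
proof -
  let ?c = "(2 ^ j :: real) ^ DIM('a)"
  have sup: "ennreal ((g x)\<^sup>2) \<le> ennreal ?c * L2_energy g" for x
  proof -
    have "ennreal ((g x)\<^sup>2) = ennreal ?c * (ennreal ((1 / 2 ^ j) ^ DIM('a)) * ennreal ((g x)\<^sup>2))"
      by (simp add: ennreal_mult[symmetric] mult.assoc[symmetric] flip: power_mult_distrib)
    also have "ennreal ((1 / 2 ^ j) ^ DIM('a)) * ennreal ((g x)\<^sup>2) = (\<integral>\<^sup>+y. indicator (cell j x) y * ennreal ((g x)\<^sup>2) \<partial>lborel)"
      by (subst nn_integral_multc) (auto simp: emeasure_cell)
    also have "\<dots> \<le> L2_energy g"
      unfolding L2_energy_def by (intro nn_integral_mono) (auto simp: indicator_def dest: c)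
    finally show ?thesis by (simp add: mult_left_mono)
  qed
  have "L4_energy g \<le> (\<integral>\<^sup>+x. (ennreal ?c * L2_energy g) * ennreal ((norm (g x))\<^sup>2) \<partial>lborel)"
    unfolding L4_energy_def
  proof (rule nn_integral_mono)
    fix x
    have "ennreal (g x ^ 4) = ennreal ((g x)\<^sup>2) * ennreal ((g x)\<^sup>2)"
      by (simp add: ennreal_mult[symmetric] flip: power_add)
    also have "\<dots> \<le> (ennreal ?c * L2_energy g) * ennreal ((norm (g x))\<^sup>2)"
      using sup by (intro mult_mono) auto
    finally show "ennreal (g x ^ 4) \<le> \<dots>" .
  qed
  also have "\<dots> = ennreal ?c * (L2_energy g)\<^sup>2"
    by (subst nn_integral_cmult) (auto simp: L2_energy_def power2_eq_square mult.assoc)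
  finally show ?thesis .
qed

lemma translation_boundI_mono:
  "translation_bound f D \<Longrightarrow> 0 \<le> D \<Longrightarrow> D \<le> D' \<Longrightarrow> translation_bound f D'"
  unfolding translation_bound_def
  by (meson ennreal_leI mult_left_mono norm_ge_zero order_trans power_mono mult_nonneg_nonneg)

text \<open>With C the cell constant, \<open>2 + 2 * C\<close> accounts for the average over unit
  cells and \<open>128 * C\<^sup>2 + 1\<close> for the differences of consecutive averages; 8 is the
  sum of the geometric series with ratio 7/8.\<close>

definition L4_constant :: "'a::euclidean_space itself \<Rightarrow> real" where
  "L4_constant _ = (2 + 2 * cell_constant TYPE('a)) + 8 * (128 * (cell_constant TYPE('a))\<^sup>2 + 1)"

lemma cell_constant_nonneg: "cell_constant TYPE('a::euclidean_space) \<ge> 0"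
  by (simp add: cell_constant_def)

lemma cell_average_L2':
  fixes f :: "'a::euclidean_space \<Rightarrow> real"
  assumes f: "square_integrable f" and t: "translation_bound f D"
  shows "square_integrable (cell_average j f)"
proof -
  have [measurable]: "f \<in> borel_measurable borel" using f by (rule square_integrable_measurable)
  have "L2_energy (\<lambda>x. f x - cell_average j f x) < \<infinity>"
    using cell_average_L2[OF f t, of j] by (rule le_less_trans) simp
  then have "square_integrable (\<lambda>x. f x - cell_average j f x)" by (simp add: square_integrable_iff)
  from square_integrable_diff[OF f this] show ?thesis by simp
qed

text \<open>The restriction to dimension at most 3 makes the series of differences of consecutive averages
  converge in \<open>L\<^sup>4\<close>: its terms decay like \<open>2\<^bsup>- j / 4\<^esup>\<close>.\<close>

lemma cell_average_L4:
  fixes f :: "'a::euclidean_space \<Rightarrow> real"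
  assumes dim: "DIM('a) \<le> 3" and f: "square_integrable f" and fD: "L2_energy f \<le> ennreal (D\<^sup>2)"
    and t: "translation_bound f D" and D: "D > 0"
  shows "L4_energy (cell_average J f) \<le> ennreal ((L4_constant TYPE('a) * D) ^ 4)"
proof -
  have [measurable]: "f \<in> borel_measurable borel" using f by (rule square_integrable_measurable)
  let ?C = "cell_constant TYPE('a)"
  \<comment> \<open>128 is \<open>2 ^ 3 * 4\<^sup>2\<close>, from one refinement of the cells in
    dimension 3 and from the square of the constant in the \<open>L\<^sup>2\<close> bound. The added
    1 gives \<open>K \<ge> 1\<close>, hence \<open>K \<le> K ^ 4\<close>, which fits the fourth
    power on the right.\<close>
  define K where "K = 128 * ?C\<^sup>2 + 1"
  have C: "?C \<ge> 0" by (rule cell_constant_nonneg)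
  have K: "K \<ge> 1" by (simp add: K_def)
  have step: "L4_energy (\<lambda>x. cell_average (Suc j) f x - cell_average j f x) \<le> ennreal ((K * D * (7/8) ^ j) ^ 4)" for j
  proof -
    let ?d = "\<lambda>x. cell_average (Suc j) f x - cell_average j f x"
    have "L2_energy ?d = L2_energy (\<lambda>x. (f x - cell_average j f x) - (f x - cell_average (Suc j) f x))" by simp
    also have "\<dots> \<le> 2 * L2_energy (\<lambda>x. f x - cell_average j f x) + 2 * L2_energy (\<lambda>x. f x - cell_average (Suc j) f x)"
      by (rule L2_energy_diff_le) measurable
    also have "\<dots> \<le> 2 * ennreal (?C * (1/4) ^ j * D\<^sup>2) + 2 * ennreal (?C * (1/4) ^ j * D\<^sup>2)"
    proof (intro add_mono mult_left_mono cell_average_L2[OF f t])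
      show "L2_energy (\<lambda>x. f x - cell_average (Suc j) f x) \<le> ennreal (?C * (1/4) ^ j * D\<^sup>2)"
        using C by (intro order_trans[OF cell_average_L2[OF f t]] ennreal_leI mult_right_mono mult_left_mono) auto
    qed auto
    also have "\<dots> = ennreal (4 * ?C * (1/4) ^ j * D\<^sup>2)"
      using C by (simp add: ennreal_mult' ennreal_plus[symmetric] ennreal_numeral[symmetric] del: ennreal_plus ennreal_numeral flip: ennreal_mult')
    finally have L2: "L2_energy ?d \<le> ennreal (4 * ?C * (1/4) ^ j * D\<^sup>2)" .
    have "L4_energy ?d \<le> ennreal ((2 ^ Suc j) ^ DIM('a)) * (L2_energy ?d)\<^sup>2"
    proof (rule cellwise_constant_L4)
      fix x y :: 'a assume "y \<in> cell (Suc j) x"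
      then show "?d y = ?d x" using cell_Suc[of j x] by (auto simp: cell_average_eq[of y _ x] subset_iff)
    qed measurable
    \<comment> \<open>Here the dimension enters: its exponent is raised to 3, so that the growth
      \<open>8 ^ j\<close> from the cell volume meets the decay \<open>(1/16) ^ j\<close> of the
      squared \<open>L\<^sup>2\<close> bound.\<close>
    also have "\<dots> \<le> ennreal ((2 ^ Suc j) ^ 3) * (ennreal (4 * ?C * (1/4) ^ j * D\<^sup>2))\<^sup>2"
    proof -
      have "1 \<le> (2 :: real) ^ Suc j" by (rule one_le_power) simp
      then show ?thesis by (intro mult_mono power_mono L2 ennreal_leI power_increasing dim) auto
    qed
    also have "\<dots> = ennreal ((2 ^ Suc j) ^ 3 * (4 * ?C * (1/4) ^ j * D\<^sup>2)\<^sup>2)"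
    proof -
      have "4 * ?C * (1/4) ^ j * D\<^sup>2 \<ge> 0" using C by simp
      then show ?thesis by (simp only: ennreal_power) (rule ennreal_mult[symmetric], auto)
    qed
    also have "(2 ^ Suc j) ^ 3 * (4 * ?C * (1/4) ^ j * D\<^sup>2)\<^sup>2 = 128 * ?C\<^sup>2 * (1/2) ^ j * D ^ 4"
    proof -
      have "(2 ^ Suc j :: real) ^ 3 * ((1/4) ^ j)\<^sup>2 = 8 * (1/2) ^ j"
      proof (induction j)
        case (Suc j)
        have "(2 ^ Suc (Suc j) :: real) ^ 3 * ((1/4) ^ Suc j)\<^sup>2 = (2 ^ Suc j) ^ 3 * ((1/4) ^ j)\<^sup>2 * (1/2)"
          by (simp add: power2_eq_square power3_eq_cube)
        also have "\<dots> = 8 * (1/2) ^ Suc j" unfolding Suc by simp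
        finally show ?case .
      qed simp
      moreover have "(2 ^ Suc j) ^ 3 * (4 * ?C * (1/4) ^ j * D\<^sup>2)\<^sup>2 = ((2 ^ Suc j) ^ 3 * ((1/4) ^ j)\<^sup>2) * (16 * ?C\<^sup>2 * D ^ 4)"
        by (simp add: power_mult_distrib power2_eq_square numeral_eq_Suc)
      ultimately show ?thesis by simp
    qed
    \<comment> \<open>The ratio 1/2 of the fourth powers is weakened to \<open>(7/8) ^ 4\<close>,
      which is larger than 1/2, so that no fourth roots are needed.\<close>
    also have "ennreal (128 * ?C\<^sup>2 * (1/2) ^ j * D ^ 4) \<le> ennreal ((K * D * (7/8) ^ j) ^ 4)"
    proof (rule ennreal_leI)
      have "128 * ?C\<^sup>2 \<le> K" by (simp add: K_def)
      also have "K \<le> K ^ 4" using K by (simp add: self_le_power)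
      finally have "128 * ?C\<^sup>2 * (1/2) ^ j \<le> K ^ 4 * ((7/8) ^ 4) ^ j"
        using K by (intro mult_mono power_mono) (auto simp: power_divide)
      then have "128 * ?C\<^sup>2 * (1/2) ^ j * D ^ 4 \<le> K ^ 4 * ((7/8) ^ 4) ^ j * D ^ 4"
        by (intro mult_right_mono) auto
      also have "\<dots> = (K * D * (7/8) ^ j) ^ 4"
        by (simp add: power_mult_distrib power_mult[symmetric] mult.commute)
      finally show "128 * ?C\<^sup>2 * (1/2) ^ j * D ^ 4 \<le> (K * D * (7/8) ^ j) ^ 4" .
    qed
    finally show ?thesis .
  qed
  have "L4_energy (cell_average J f) \<le> ennreal (((2 + 2 * ?C) * D + (\<Sum>j<J. K * D * (7/8) ^ j)) ^ 4)"
  proof (induction J)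
    case 0
    have "L2_energy (cell_average 0 f) = L2_energy (\<lambda>x. f x - (f x - cell_average 0 f x))" by simp
    also have "\<dots> \<le> 2 * L2_energy f + 2 * L2_energy (\<lambda>x. f x - cell_average 0 f x)"
      by (rule L2_energy_diff_le) measurable
    also have "\<dots> \<le> 2 * ennreal (D\<^sup>2) + 2 * ennreal (?C * D\<^sup>2)"
      using cell_average_L2[OF f t, of 0] fD by (intro add_mono mult_left_mono) auto
    also have "\<dots> = ennreal ((2 + 2 * ?C) * D\<^sup>2)"
      using C by (simp add: ennreal_mult' ennreal_plus[symmetric] ennreal_numeral[symmetric] algebra_simps del: ennreal_plus ennreal_numeral flip: ennreal_mult')
    finally have L2: "L2_energy (cell_average 0 f) \<le> ennreal ((2 + 2 * ?C) * D\<^sup>2)" .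
    have "L4_energy (cell_average 0 f) \<le> ennreal ((2 ^ 0) ^ DIM('a)) * (L2_energy (cell_average 0 f))\<^sup>2"
      by (rule cellwise_constant_L4) (auto intro: cell_average_eq)
    also have "\<dots> \<le> (ennreal ((2 + 2 * ?C) * D\<^sup>2))\<^sup>2" using L2 by (simp add: power_mono)
    also have "\<dots> = ennreal ((2 + 2 * ?C)\<^sup>2 * D ^ 4)"
      using C by (simp add: ennreal_power power_mult_distrib flip: power_mult)
    also have "\<dots> \<le> ennreal ((2 + 2 * ?C) ^ 4 * D ^ 4)"
      using C by (intro ennreal_leI mult_right_mono power_increasing) auto
    finally show ?case by (simp add: power_mult_distrib)
  next
    case (Suc J)
    have S: "(\<Sum>j<J. K * D * (7/8) ^ j) \<ge> 0" using K D by (intro sum_nonneg) auto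
    have "L4_energy (\<lambda>x. cell_average J f x + (cell_average (Suc J) f x - cell_average J f x))
      \<le> ennreal (((2 + 2 * ?C) * D + (\<Sum>j<J. K * D * (7/8) ^ j) + K * D * (7/8) ^ J) ^ 4)"
      using K D C S by (intro L4_energy_add Suc step) (auto intro!: add_pos_nonneg mult_pos_pos)
    then show ?case by (simp add: add.assoc)
  qed
  also have "\<dots> \<le> ennreal ((L4_constant TYPE('a) * D) ^ 4)"
  proof (intro ennreal_leI power_mono)
    have "(\<Sum>j<J. (7/8 :: real) ^ j) \<le> (\<Sum>j. (7/8) ^ j)" by (intro sum_le_suminf) (auto simp: summable_geometric)
    also have "\<dots> = 8" by (simp add: suminf_geometric)
    finally have "K * D * (\<Sum>j<J. (7/8 :: real) ^ j) \<le> K * D * 8" using K D by (intro mult_left_mono) auto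
    then show "(2 + 2 * ?C) * D + (\<Sum>j<J. K * D * (7/8) ^ j) \<le> L4_constant TYPE('a) * D"
      unfolding sum_distrib_left[symmetric] by (simp add: L4_constant_def K_def[symmetric] distrib_right)
    show "0 \<le> (2 + 2 * ?C) * D + (\<Sum>j<J. K * D * (7/8) ^ j)"
      using K D C by (intro add_nonneg_nonneg sum_nonneg) auto
  qed
  finally show ?thesis .
qed

text \<open>The averages tend to f in \<open>L\<^sup>2\<close>, hence almost everywhere along a
  subsequence; Fatou's lemma carries their uniform \<open>L\<^sup>4\<close> bound over to f.\<close>

lemma L4_embedding:
  fixes f :: "'a::euclidean_space \<Rightarrow> real"
  assumes dim: "DIM('a) \<le> 3" and f: "square_integrable f" and fD: "L2_energy f \<le> ennreal (D\<^sup>2)"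
    and t: "translation_bound f D" and D: "D > 0"
  shows "L4_energy f \<le> ennreal ((L4_constant TYPE('a) * D) ^ 4)"
proof -
  have [measurable]: "f \<in> borel_measurable borel" using f by (rule square_integrable_measurable)
  let ?C = "cell_constant TYPE('a)"
  let ?a = "\<lambda>j. class_of (cell_average j f) :: ('a, real) L2"
  note sq = cell_average_L2'[OF f t]
  have "(norm (?a j - class_of f))\<^sup>2 \<le> ?C * (1/4) ^ j * D\<^sup>2" for j
  proof -
    have "ennreal ((norm (?a j - class_of f))\<^sup>2) = L2_energy (\<lambda>x. fun_of (?a j) x - fun_of (class_of f) x)"
      by (simp add: L2_energy_diff)
    also have "\<dots> = L2_energy (\<lambda>x. f x - cell_average j f x)"
      by (rule L2_energy_cong_AE)
        (use fun_of_class_of[OF sq, of j] fun_of_class_of[OF f] in eventually_elim, simp add: abs_minus_commute)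
    also have "\<dots> \<le> ennreal (?C * (1/4) ^ j * D\<^sup>2)" by (rule cell_average_L2[OF f t])
    finally show ?thesis using cell_constant_nonneg[where 'a = 'a] by (subst (asm) ennreal_le_iff) auto
  qed
  then have le: "norm (?a j - class_of f) \<le> sqrt (?C * (1/4) ^ j * D\<^sup>2)" for j by (rule real_le_rsqrt)
  have "(\<lambda>j. sqrt (?C * (1/4) ^ j * D\<^sup>2)) \<longlonglongrightarrow> sqrt (?C * 0 * D\<^sup>2)"
    by (intro tendsto_intros LIMSEQ_power_zero) simp
  then have "(\<lambda>j. ?a j - class_of f) \<longlonglongrightarrow> 0"
    by (intro Lim_null_comparison[OF always_eventually[OF allI[OF le]]]) simp
  then have "?a \<longlonglongrightarrow> class_of f" by (rule LIM_zero_cancel)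
  from L2_AE_subsequence[OF this] obtain r where
    r: "strict_mono r" "AE x in lborel. (\<lambda>n. fun_of (?a (r n)) x) \<longlonglongrightarrow> fun_of (class_of f) x" by blast
  have "AE x in lborel. \<forall>n. fun_of (?a (r n)) x = cell_average (r n) f x"
    unfolding AE_all_countable using fun_of_class_of[OF sq] by blast
  then have conv: "AE x in lborel. (\<lambda>n. cell_average (r n) f x) \<longlonglongrightarrow> f x"
    using r(2) fun_of_class_of[OF f] by eventually_elim simp
  have "L4_energy f = (\<integral>\<^sup>+x. liminf (\<lambda>n. ennreal (cell_average (r n) f x ^ 4)) \<partial>lborel)"
    unfolding L4_energy_def
  proof (rule nn_integral_cong_AE, use conv in eventually_elim)
    fix x assume "(\<lambda>n. cell_average (r n) f x) \<longlonglongrightarrow> f x"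
    then have "(\<lambda>n. ennreal (cell_average (r n) f x ^ 4)) \<longlonglongrightarrow> ennreal (f x ^ 4)" by (intro tendsto_intros)
    then show "ennreal (f x ^ 4) = liminf (\<lambda>n. ennreal (cell_average (r n) f x ^ 4))"
      by (rule lim_imp_Liminf[OF trivial_limit_sequentially, symmetric])
  qed
  also have "\<dots> \<le> liminf (\<lambda>n. L4_energy (cell_average (r n) f))"
    unfolding L4_energy_def by (rule nn_integral_liminf) measurable
  also have "\<dots> \<le> ennreal ((L4_constant TYPE('a) * D) ^ 4)"
    by (intro Liminf_le always_eventually allI cell_average_L4 assms) simp
  finally show ?thesis .
qed

text \<open>This replaces Rellich's compactness theorem.\<close>

lemma local_finite_rank_bound:
  fixes R \<epsilon> :: real
  assumes \<epsilon>: "\<epsilon> > 0"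
  obtains I :: "'a::euclidean_space set set" and C :: real
  where "finite I" "\<And>q. q \<in> I \<Longrightarrow> q \<in> sets borel \<and> emeasure lborel q < \<infinity>" "C \<ge> 0"
    "\<And>f D. square_integrable f \<Longrightarrow> translation_bound f D \<Longrightarrow>
      (\<integral>\<^sup>+x. indicator (cball 0 R) x * ennreal ((f x)\<^sup>2) \<partial>lborel)
        \<le> ennreal (\<epsilon> * D\<^sup>2 + C * (\<Sum>q\<in>I. (LINT y|lborel. indicator q y * f y)\<^sup>2))"
proof -
  let ?C = "cell_constant TYPE('a)"
  have C: "?C \<ge> 0" by (rule cell_constant_nonneg)
  \<comment> \<open>The factor 2 comes from splitting f into its cell average and the rest before
    squaring.\<close>
  obtain j where j: "2 * ?C * (1/4) ^ j \<le> \<epsilon>"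
  proof -
    have "(\<lambda>j. 2 * ?C * (1/4) ^ j) \<longlonglongrightarrow> 2 * ?C * 0" by (intro tendsto_intros LIMSEQ_power_zero) simp
    then have "\<forall>\<^sub>F j in sequentially. 2 * ?C * (1/4) ^ j < \<epsilon>" using \<epsilon> by (intro order_tendstoD) auto
    then show ?thesis using that by (auto simp: eventually_sequentially intro: less_imp_le)
  qed
  \<comment> \<open>A bound for the integer parts of the coordinates in the ball; the cells meeting
    the ball are thus coded by finitely many integer vectors.\<close>
  define m where "m = \<lceil>2 ^ j * R\<rceil> + 1"
  let ?g = "\<lambda>k. {y :: 'a. \<forall>b\<in>Basis. \<lfloor>2 ^ j * (y \<bullet> b)\<rfloor> = k b}"
  define I where "I = cell j ` cball (0 :: 'a) R"
  have "I \<subseteq> ?g ` (PiE Basis (\<lambda>b. {-m..m}))"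
  proof
    fix q assume "q \<in> I"
    then obtain x where x: "norm x \<le> R" "q = cell j x" by (auto simp: I_def)
    have "\<lfloor>2 ^ j * (x \<bullet> b)\<rfloor> \<in> {-m..m}" if "b \<in> Basis" for b
    proof -
      have "\<bar>x \<bullet> b\<bar> \<le> R" using Basis_le_norm[OF that, of x] x by simp
      then have "\<bar>2 ^ j * (x \<bullet> b)\<bar> \<le> 2 ^ j * R" by (simp add: abs_mult)
      then show ?thesis by (auto simp: m_def) linarith+
    qed
    then show "q \<in> ?g ` (PiE Basis (\<lambda>b. {-m..m}))"
      using x by (intro image_eqI[of _ _ "restrict (\<lambda>b. \<lfloor>2 ^ j * (x \<bullet> b)\<rfloor>) Basis"]) (auto simp: cell_def)
  qed
  then have fin: "finite I" by (rule finite_subset) (intro finite_imageI finite_PiE; simp)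
  define c where "c = (2 ^ j :: real) ^ DIM('a)"
  have c: "c > 0" by (simp add: c_def)
  show ?thesis
  proof (rule that[of I "2 * c"])
    show "finite I" by (rule fin)
    show "q \<in> sets borel \<and> emeasure lborel q < \<infinity>" if "q \<in> I" for q
      using that by (auto simp: I_def emeasure_cell)
    fix f :: "'a \<Rightarrow> real" and D assume f: "square_integrable f" and t: "translation_bound f D"
    have [measurable]: "f \<in> borel_measurable borel" using f by (rule square_integrable_measurable)
    let ?A = "\<lambda>q. LINT y|lborel. indicator q y * f y"
    have pt: "ennreal (indicator (cball 0 R) x * (f x)\<^sup>2)
      \<le> 2 * ennreal ((norm (f x - cell_average j f x))\<^sup>2) + (\<Sum>q\<in>I. indicator q x * ennreal (2 * (c * ?A q)\<^sup>2))" for x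
    proof (cases "x \<in> cball 0 R")
      case True
      then have q: "cell j x \<in> I" by (simp add: I_def)
      have "(f x)\<^sup>2 \<le> 2 * (f x - cell_average j f x)\<^sup>2 + 2 * (cell_average j f x)\<^sup>2"
        using zero_le_power2[of "f x - 2 * cell_average j f x"] by (simp add: power2_eq_square algebra_simps)
      then have "ennreal ((f x)\<^sup>2) \<le> ennreal (2 * (f x - cell_average j f x)\<^sup>2 + 2 * (cell_average j f x)\<^sup>2)"
        by (rule ennreal_leI)
      also have "\<dots> = 2 * ennreal ((norm (f x - cell_average j f x))\<^sup>2) + indicator (cell j x) x * ennreal (2 * (c * ?A (cell j x))\<^sup>2)"
        by (simp add: ennreal_plus ennreal_mult cell_refl cell_average_def c_def)
      also have "\<dots> \<le> 2 * ennreal ((norm (f x - cell_average j f x))\<^sup>2) + (\<Sum>q\<in>I. indicator q x * ennreal (2 * (c * ?A q)\<^sup>2))"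
        by (intro add_left_mono member_le_sum[OF q _ fin, of "\<lambda>q. indicator q x * ennreal (2 * (c * ?A q)\<^sup>2)"]) auto
      finally show ?thesis using True by simp
    qed simp
    have "(\<integral>\<^sup>+x. indicator (cball 0 R) x * ennreal ((f x)\<^sup>2) \<partial>lborel) = (\<integral>\<^sup>+x. ennreal (indicator (cball 0 R) x * (f x)\<^sup>2) \<partial>lborel)"
      by (intro nn_integral_cong) (auto simp: indicator_def)
    also have "\<dots> \<le> (\<integral>\<^sup>+x. 2 * ennreal ((norm (f x - cell_average j f x))\<^sup>2) + (\<Sum>q\<in>I. indicator q x * ennreal (2 * (c * ?A q)\<^sup>2)) \<partial>lborel)"
      by (intro nn_integral_mono pt)
    also have "\<dots> = 2 * L2_energy (\<lambda>x. f x - cell_average j f x) + (\<integral>\<^sup>+x. (\<Sum>q\<in>I. indicator q x * ennreal (2 * (c * ?A q)\<^sup>2)) \<partial>lborel)"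
      unfolding L2_energy_def
      by (subst nn_integral_add) (auto simp: I_def nn_integral_cmult intro!: borel_measurable_sum)
    also have "(\<integral>\<^sup>+x. (\<Sum>q\<in>I. indicator q x * ennreal (2 * (c * ?A q)\<^sup>2)) \<partial>lborel)
      = (\<Sum>q\<in>I. emeasure lborel q * ennreal (2 * (c * ?A q)\<^sup>2))"
    proof -
      have "(\<integral>\<^sup>+x. indicator q x * k \<partial>lborel) = emeasure lborel q * k" if "q \<in> I" for q k
        using that by (subst nn_integral_multc) (auto simp: I_def)
      then show ?thesis by (subst nn_integral_sum) (auto simp: I_def intro!: sum.cong)
    qed
    also have "\<dots> = (\<Sum>q\<in>I. ennreal (2 * c * (?A q)\<^sup>2))"
    proof (intro sum.cong refl)
      fix q assume "q \<in> I"
      then have "emeasure lborel q = ennreal (1 / c)" by (auto simp: I_def emeasure_cell c_def power_one_over)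
      then have "emeasure lborel q * ennreal (2 * (c * ?A q)\<^sup>2) = ennreal (1 / c * (2 * (c * ?A q)\<^sup>2))"
        using c by (simp add: ennreal_mult[symmetric])
      also have "1 / c * (2 * (c * ?A q)\<^sup>2) = 2 * c * (?A q)\<^sup>2" using c by (simp add: power2_eq_square)
      finally show "emeasure lborel q * ennreal (2 * (c * ?A q)\<^sup>2) = ennreal (2 * c * (?A q)\<^sup>2)" .
    qed
    also have "\<dots> = ennreal (2 * c * (\<Sum>q\<in>I. (?A q)\<^sup>2))"
      using c by (simp add: sum_distrib_left)
    also have "2 * L2_energy (\<lambda>x. f x - cell_average j f x) + ennreal (2 * c * (\<Sum>q\<in>I. (?A q)\<^sup>2))
      \<le> 2 * ennreal (?C * (1/4) ^ j * D\<^sup>2) + ennreal (2 * c * (\<Sum>q\<in>I. (?A q)\<^sup>2))"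
      by (intro add_right_mono mult_left_mono cell_average_L2[OF f t]) auto
    also have "\<dots> = ennreal (2 * ?C * (1/4) ^ j * D\<^sup>2 + 2 * c * (\<Sum>q\<in>I. (?A q)\<^sup>2))"
    proof -
      have "2 * ennreal (?C * (1/4) ^ j * D\<^sup>2) = ennreal (2 * ?C * (1/4) ^ j * D\<^sup>2)"
        using C by (simp add: ennreal_mult mult.assoc)
      then show ?thesis using C c by (simp add: ennreal_plus sum_nonneg)
    qed
    also have "\<dots> \<le> ennreal (\<epsilon> * D\<^sup>2 + 2 * c * (\<Sum>q\<in>I. (?A q)\<^sup>2))"
      using j by (intro ennreal_leI add_right_mono mult_right_mono) auto
    finally show "(\<integral>\<^sup>+x. indicator (cball 0 R) x * ennreal ((f x)\<^sup>2) \<partial>lborel)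
        \<le> ennreal (\<epsilon> * D\<^sup>2 + 2 * c * (\<Sum>q\<in>I. (?A q)\<^sup>2))" .
  qed (use c in simp)
qed

section \<open>Measure preserving maps\<close>

definition measure_preserving :: "('a::euclidean_space \<Rightarrow> 'a) \<Rightarrow> bool" where
  "measure_preserving T \<longleftrightarrow> T \<in> borel_measurable borel \<and> distr lborel borel T = lborel"

lemma measure_preserving_translation: "measure_preserving (\<lambda>x. x + z)"
proof -
  have "(\<lambda>x. x + z) = (+) z" by (auto simp: add.commute)
  then show ?thesis using lborel_distr_plus[of z] by (simp add: measure_preserving_def)
qed

definition L2_comp :: "('a::euclidean_space \<Rightarrow> 'a) \<Rightarrow> ('a, 'b::euclidean_space) L2 \<Rightarrow> ('a, 'b) L2" where
  "L2_comp T u = class_of (\<lambda>x. fun_of u (T x))"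

context
  fixes T :: "'a::euclidean_space \<Rightarrow> 'a"
  assumes T: "measure_preserving T"
begin

lemma measure_preserving_measurable: "T \<in> borel_measurable borel"
  using T by (simp add: measure_preserving_def)

lemma nn_integral_measure_preserving:
  assumes "f \<in> borel_measurable borel"
  shows "(\<integral>\<^sup>+x. f (T x) \<partial>lborel) = (\<integral>\<^sup>+x. f x \<partial>lborel)"
  using nn_integral_distr[of T lborel borel f] T assms by (simp add: measure_preserving_def)

lemma integral_measure_preserving:
  fixes f :: "'a \<Rightarrow> 'b::{banach, second_countable_topology}"
  assumes "f \<in> borel_measurable borel"
  shows "(LINT x|lborel. f (T x)) = (LINT x|lborel. f x)"
  using integral_distr[of T lborel borel f] T assms by (simp add: measure_preserving_def)

lemma AE_measure_preserving:
  assumes "AE x in lborel. P x"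
  shows "AE x in lborel. P (T x)"
proof (rule AE_distrD[of T lborel borel P])
  show "T \<in> lborel \<rightarrow>\<^sub>M borel" using measure_preserving_measurable by simp
  have "distr lborel borel T = lborel" using T by (simp add: measure_preserving_def)
  then show "AE x in distr lborel borel T. P x" by (simp only: assms)
qed

lemma square_integrable_comp:
  fixes f :: "'a \<Rightarrow> 'b::euclidean_space"
  assumes "square_integrable f"
  shows "square_integrable (\<lambda>x. f (T x))"
proof -
  note [measurable] = square_integrable_measurable[OF assms] measure_preserving_measurable
  show ?thesis
    using assms nn_integral_measure_preserving[of "\<lambda>x. ennreal ((norm (f x))\<^sup>2)"]
    by (simp add: square_integrable_iff L2_energy_def)
qed

lemma fun_of_L2_comp: "AE x in lborel. fun_of (L2_comp T u) x = fun_of u (T x)"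
  unfolding L2_comp_def by (intro fun_of_class_of square_integrable_comp square_integrable_fun_of)

lemma L2_comp_class_of:
  assumes "square_integrable f"
  shows "L2_comp T (class_of f) = class_of (\<lambda>x. f (T x))"
  unfolding L2_eq_iff
  using fun_of_L2_comp[of "class_of f"] fun_of_class_of[OF square_integrable_comp[OF assms]]
    AE_measure_preserving[OF fun_of_class_of[OF assms]]
  by eventually_elim simp

lemma inner_L2_comp: "L2_comp T u \<bullet> L2_comp T v = u \<bullet> v"
proof -
  note [measurable] = measure_preserving_measurable
  have "L2_comp T u \<bullet> L2_comp T v = (LINT x|lborel. fun_of u (T x) \<bullet> fun_of v (T x))"
    unfolding inner_L2
    by (rule integral_cong_AE) (measurable, use fun_of_L2_comp[of u] fun_of_L2_comp[of v] in eventually_elim, simp)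
  also have "\<dots> = u \<bullet> v" unfolding inner_L2 by (rule integral_measure_preserving) measurable
  finally show ?thesis .
qed

lemma norm_L2_comp: "norm (L2_comp T u) = norm u"
  by (simp add: norm_eq_sqrt_inner inner_L2_comp)

lemma L2_comp_add: "L2_comp T (u + v) = L2_comp T u + L2_comp T v"
  unfolding L2_eq_iff
  using fun_of_L2_comp[of "u + v"] fun_of_L2_comp[of u] fun_of_L2_comp[of v]
    AE_measure_preserving[OF fun_of_add[of u v]] fun_of_add[of "L2_comp T u" "L2_comp T v"]
  by eventually_elim simp

lemma L2_comp_scaleR: "L2_comp T (r *\<^sub>R u) = r *\<^sub>R L2_comp T u"
  unfolding L2_eq_iff
  using fun_of_L2_comp[of "r *\<^sub>R u"] fun_of_L2_comp[of u]
    AE_measure_preserving[OF fun_of_scaleR[of r u]] fun_of_scaleR[of r "L2_comp T u"]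
  by eventually_elim simp

lemma bounded_linear_L2_comp: "bounded_linear (L2_comp T)"
  by (rule bounded_linear_intro[where K = 1]) (auto simp: L2_comp_add L2_comp_scaleR norm_L2_comp)

end

lemma class_of_eq_iff:
  assumes "square_integrable f" "square_integrable g"
  shows "class_of f = class_of g \<longleftrightarrow> (AE x in lborel. f x = g x)"
  unfolding L2_eq_iff
proof
  assume "AE x in lborel. fun_of (class_of f) x = fun_of (class_of g) x"
  then show "AE x in lborel. f x = g x"
    using fun_of_class_of[OF assms(1)] fun_of_class_of[OF assms(2)] by eventually_elim simp
next
  assume "AE x in lborel. f x = g x"
  then show "AE x in lborel. fun_of (class_of f) x = fun_of (class_of g) x"
    using fun_of_class_of[OF assms(1)] fun_of_class_of[OF assms(2)] by eventually_elim simp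
qed

lemma class_of_add:
  assumes "square_integrable f" "square_integrable g"
  shows "class_of (\<lambda>x. f x + g x) = class_of f + class_of g"
  unfolding L2_eq_iff
  using fun_of_add[of "class_of f" "class_of g"] fun_of_class_of[OF assms(1)] fun_of_class_of[OF assms(2)]
    fun_of_class_of[OF square_integrable_add[OF assms]] by eventually_elim simp

lemma class_of_diff:
  assumes "square_integrable f" "square_integrable g"
  shows "class_of (\<lambda>x. f x - g x) = class_of f - class_of g"
  unfolding L2_eq_iff
  using fun_of_diff[of "class_of f" "class_of g"] fun_of_class_of[OF assms(1)] fun_of_class_of[OF assms(2)]
    fun_of_class_of[OF square_integrable_diff[OF assms]] by eventually_elim simp

lemma class_of_scaleR:
  assumes "square_integrable f"
  shows "class_of (\<lambda>x. r *\<^sub>R f x) = r *\<^sub>R class_of f"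
  unfolding L2_eq_iff
  using fun_of_scaleR[of r "class_of f"] fun_of_class_of[OF assms]
    fun_of_class_of[OF square_integrable_scaleR[OF assms]] by eventually_elim simp

lemma inner_class_of:
  assumes "square_integrable f"
  shows "u \<bullet> class_of f = (LINT x|lborel. fun_of u x \<bullet> f x)"
proof -
  have [measurable]: "f \<in> borel_measurable borel" using assms by (rule square_integrable_measurable)
  show ?thesis unfolding inner_L2
    by (rule integral_cong_AE) (measurable, use fun_of_class_of[OF assms] in eventually_elim, simp)
qed

section \<open>Test functions and Sobolev spaces\<close>

lemma smooth_on_UNIV_iff:
  "smooth_on UNIV UNIV f \<longleftrightarrow> smooth_at_all_orders UNIV UNIV f"
  using smooth_at_all_orders_if_smooth_on[of UNIV UNIV f] smooth_on_if_smooth_at_all_orders[of UNIV UNIV f] by auto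

lemma test_functionsI:
  assumes "smooth_at_all_orders UNIV UNIV \<phi>" "\<And>x. \<phi> x \<noteq> 0 \<Longrightarrow> x \<in> S" "compact S" "S \<subseteq> \<Omega>"
  shows "\<phi> \<in> test_functions \<Omega>"
proof -
  have "closure {x. \<phi> x \<noteq> 0} \<subseteq> S"
    using assms by (intro closure_minimal) (auto intro: compact_imp_closed)
  moreover from this have "compact (closure {x. \<phi> x \<noteq> 0})"
    using assms(3) by (metis closed_closure compact_Int_closed inf.absorb_iff2)
  ultimately show ?thesis using assms by (auto simp: test_functions_def smooth_on_UNIV_iff)
qed

lemma test_functions_mono: "\<Omega> \<subseteq> \<Omega>' \<Longrightarrow> test_functions \<Omega> \<subseteq> test_functions \<Omega>'"
  by (auto simp: test_functions_def)

text \<open>Two levels of the tower are used: the first is the derivative, represented by its values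
  on the basis, and the second makes it Lipschitz from each point and therefore continuous.\<close>

lemma smooth_gradient:
  fixes f :: "'a::euclidean_space \<Rightarrow> real"
  assumes "smooth_at_all_orders UNIV UNIV f"
  shows "(f has_derivative (\<lambda>h. gradient f x \<bullet> h)) (at x)" "continuous_on UNIV (gradient f)"
proof -
  have fam: "smooth_family (Suc (Suc 0)) UNIV UNIV 0 (\<lambda>x vs. f x)" using assms by (simp add: smooth_at_all_orders_def)
  then obtain m' where m': "family_derivative UNIV UNIV 0 (\<lambda>x vs. f x) m'" "smooth_family (Suc 0) UNIV UNIV (Suc 0) m'"
    unfolding smooth_family.simps(2)[of "Suc 0"] by blast
  then obtain m'' where m'': "family_derivative UNIV UNIV (Suc 0) m' m''" "smooth_family 0 UNIV UNIV (Suc (Suc 0)) m''"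
    unfolding smooth_family.simps(2)[of "0"] by blast
  have ml: "bounded_multilinear_on UNIV (Suc 0) (m' x)" "bounded_multilinear_on UNIV (Suc (Suc 0)) (m'' x)" for x
    using smooth_family_multilinear[OF m'(2)] smooth_family_multilinear[OF m''(2)] by auto
  have der: "(f has_derivative (\<lambda>h. m' x [h])) (at x)" for x
    unfolding has_derivative_at_alt
  proof
    obtain C where C: "\<And>vs. length vs = Suc 0 \<Longrightarrow> norm (m' x vs) \<le> C * prod_list (map norm vs)"
      by (rule bounded_multilinear_on_bound[OF ml(1)[of x]]) auto
    show "bounded_linear (\<lambda>h. m' x [h])"
    proof (rule bounded_linear_intro[where K = C])
      show "m' x [u + v] = m' x [u] + m' x [v]" for u v
        using bounded_multilinear_on_Cons[OF ml(1)[of x], of "[]" u v 1 1] by simp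
      show "m' x [r *\<^sub>R v] = r *\<^sub>R m' x [v]" for r v
        using bounded_multilinear_on_Cons[OF ml(1)[of x], of "[]" v v r 0] by simp
      show "norm (m' x [h]) \<le> norm h * C" for h using C[of "[h]"] by (simp add: mult.commute)
    qed
    show "\<forall>e>0. \<exists>d>0. \<forall>y. norm (y - x) < d \<longrightarrow> norm (f y - f x - m' x [y - x]) \<le> e * norm (y - x)"
    proof (intro allI impI)
      fix e :: real assume e: "e > 0"
      obtain d where "d > 0" "\<And>y vs. y \<in> UNIV \<Longrightarrow> norm (y - x) < d \<Longrightarrow> vs \<in> lists UNIV \<Longrightarrow> length vs = 0 \<Longrightarrow>
        norm (f y - f x - m' x ((y - x) # vs)) \<le> e * norm (y - x) * prod_list (map norm vs)"
        by (rule family_derivativeE[OF m'(1) UNIV_I e]) auto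
      from this(1) this(2)[of _ "[]"]
      show "\<exists>d>0. \<forall>y. norm (y - x) < d \<longrightarrow> norm (f y - f x - m' x [y - x]) \<le> e * norm (y - x)"
        by (intro exI[of _ d]) simp
    qed
  qed
  have grad: "gradient f x \<bullet> h = m' x [h]" for x h
  proof -
    have fd: "frechet_derivative f (at x) = (\<lambda>h. m' x [h])"
      using der by (rule frechet_derivative_at[symmetric])
    interpret bounded_linear "\<lambda>h. m' x [h]" using der by (rule has_derivative_bounded_linear)
    have "m' x [h] = m' x [\<Sum>b\<in>Basis. (h \<bullet> b) *\<^sub>R b]" by (simp add: euclidean_representation)
    also have "\<dots> = (\<Sum>b\<in>Basis. (h \<bullet> b) * m' x [b])" by (simp add: sum scaleR)
    also have "\<dots> = gradient f x \<bullet> h"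
      by (simp add: gradient_def fd inner_sum_left inner_commute[of h] mult.commute)
    finally show ?thesis by simp
  qed
  then show "(f has_derivative (\<lambda>h. gradient f x \<bullet> h)) (at x)" using der[of x] by simp
  have "continuous_on UNIV (\<lambda>x. m' x [b])" for b
    unfolding continuous_on_iff
  proof (intro ballI allI impI)
    fix x and e :: real assume e: "e > 0"
    obtain d L where L: "d > 0" "L \<ge> 0" "\<And>y vs. y \<in> UNIV \<Longrightarrow> norm (y - x) < d \<Longrightarrow> vs \<in> lists UNIV \<Longrightarrow> length vs = Suc 0 \<Longrightarrow>
      norm (m' y vs - m' x vs) \<le> L * norm (y - x) * prod_list (map norm vs)"
      by (rule family_derivative_lipschitz[OF m''(1) UNIV_I ml(2)]) auto
    define q where "q = L * norm b + 1"
    have q: "q > 0" using L by (auto simp: q_def intro!: add_nonneg_pos)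
    show "\<exists>d>0. \<forall>x'\<in>UNIV. dist x' x < d \<longrightarrow> dist (m' x' [b]) (m' x [b]) < e"
    proof (intro exI[of _ "min d (e / q)"] conjI ballI impI)
      fix y assume y: "dist y x < min d (e / q)"
      have "norm (m' y [b] - m' x [b]) \<le> L * norm (y - x) * norm b"
        using L(3)[of y "[b]"] y by (simp add: dist_norm)
      also have "\<dots> \<le> q * norm (y - x)" by (simp add: q_def algebra_simps)
      also have "\<dots> < e" using y q by (simp add: dist_norm field_simps)
      finally show "dist (m' y [b]) (m' x [b]) < e" by (simp add: dist_norm)
    qed (use L e q in auto)
  qed
  then have "continuous_on UNIV (\<lambda>x. \<Sum>b\<in>Basis. m' x [b] *\<^sub>R b)" by (intro continuous_intros)
  moreover have "(\<lambda>x. \<Sum>b\<in>Basis. m' x [b] *\<^sub>R b) = gradient f"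
    by (rule ext) (simp add: grad[symmetric] euclidean_representation)
  ultimately show "continuous_on UNIV (gradient f)" by (simp only:)
qed

lemma gradient_eqI:
  assumes "(f has_derivative (\<lambda>h. g \<bullet> h)) (at x)"
  shows "gradient f x = g"
proof -
  have "frechet_derivative f (at x) = (\<lambda>h. g \<bullet> h)" using assms by (rule frechet_derivative_at[symmetric])
  then show ?thesis by (simp add: gradient_def euclidean_representation)
qed

definition test_element :: "('a::euclidean_space \<Rightarrow> real) \<Rightarrow> 'a sobolev" where
  "test_element \<phi> = (class_of \<phi>, class_of (gradient \<phi>))"

text \<open>On the compact support both functions are bounded by continuity. The complement of the
  closed support is open, so the gradient vanishes there together with the function.\<close>

lemma test_function_bounds:
  fixes \<phi> :: "'a::euclidean_space \<Rightarrow> real"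
  assumes "\<phi> \<in> test_functions UNIV"
  obtains B R where "B \<ge> 0" "R \<ge> 0" "\<And>x. \<bar>\<phi> x\<bar> \<le> B * indicator (cball 0 R) x"
    "\<And>x. norm (gradient \<phi> x) \<le> B * indicator (cball 0 R) x"
proof -
  let ?S = "closure {x. \<phi> x \<noteq> 0}"
  have s: "smooth_at_all_orders UNIV UNIV \<phi>" and S: "compact ?S" using assms by (auto simp: test_functions_def smooth_on_UNIV_iff)
  note g = smooth_gradient[OF s]
  have c: "continuous_on UNIV \<phi>" by (rule smooth_at_all_orders_continuous_on[OF s]) auto
  have "bounded (\<phi> ` ?S)" "bounded (gradient \<phi> ` ?S)"
    by (intro compact_imp_bounded compact_continuous_image S continuous_on_subset[OF c] continuous_on_subset[OF g(2)]; simp)+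
  then obtain B1 B2 where B: "\<And>x. x \<in> ?S \<Longrightarrow> norm (\<phi> x) \<le> B1" "\<And>x. x \<in> ?S \<Longrightarrow> norm (gradient \<phi> x) \<le> B2"
    by (auto simp: bounded_iff)
  obtain R where "\<forall>x\<in>?S. norm x \<le> R" using compact_imp_bounded[OF S] by (auto simp: bounded_pos)
  then have R: "?S \<subseteq> cball 0 R" by auto
  have z: "\<phi> x = 0" if "x \<notin> ?S" for x using that closure_subset[of "{x. \<phi> x \<noteq> 0}"] by auto
  have gz: "gradient \<phi> x = 0" if "x \<notin> ?S" for x
  proof (rule gradient_eqI)
    have "(\<phi> has_derivative (\<lambda>h. 0)) (at x)"
    proof (rule has_derivative_transform_within_open[of "\<lambda>x. 0" _ x _ "- ?S"])
      show "((\<lambda>x. 0) has_derivative (\<lambda>h. 0 :: real)) (at x)" by (rule has_derivative_const)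
      show "open (- ?S)" by (simp add: open_Compl)
      show "x \<in> - ?S" using that by simp
      show "0 = \<phi> y" if "y \<in> - ?S" for y using z[of y] that by simp
    qed
    then show "(\<phi> has_derivative (\<lambda>h. 0 \<bullet> h)) (at x)" by simp
  qed
  show ?thesis
  proof (rule that[of "max 0 (max B1 B2)" "max 0 R"])
    show "\<bar>\<phi> x\<bar> \<le> max 0 (max B1 B2) * indicator (cball 0 (max 0 R)) x" for x
      using B(1)[of x] z[of x] R by (cases "x \<in> ?S") (auto simp: indicator_def subset_iff)
    show "norm (gradient \<phi> x) \<le> max 0 (max B1 B2) * indicator (cball 0 (max 0 R)) x" for x
      using B(2)[of x] gz[of x] R by (cases "x \<in> ?S") (auto simp: indicator_def subset_iff)
  qed auto
qed

lemma test_function_vanishes: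
  assumes "\<phi> \<in> test_functions \<Omega>" "x \<notin> \<Omega>"
  shows "\<phi> x = 0" "gradient \<phi> x = 0"
proof -
  let ?S = "closure {x. \<phi> x \<noteq> 0}"
  have S: "x \<notin> ?S" using assms by (auto simp: test_functions_def)
  have z: "\<phi> x = 0" if "x \<notin> ?S" for x using that closure_subset[of "{x. \<phi> x \<noteq> 0}"] by auto
  show "\<phi> x = 0" using z[OF S] .
  show "gradient \<phi> x = 0"
  proof (rule gradient_eqI)
    have "(\<phi> has_derivative (\<lambda>h. 0)) (at x)"
    proof (rule has_derivative_transform_within_open[of "\<lambda>x. 0" _ x _ "- ?S"])
      show "((\<lambda>x. 0) has_derivative (\<lambda>h. 0 :: real)) (at x)" by (rule has_derivative_const)
      show "open (- ?S)" by (simp add: open_Compl)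
      show "x \<in> - ?S" using S by simp
      show "0 = \<phi> y" if "y \<in> - ?S" for y using z[of y] that by simp
    qed
    then show "(\<phi> has_derivative (\<lambda>h. 0 \<bullet> h)) (at x)" by simp
  qed
qed

lemma bounded_support_square_integrable:
  fixes f :: "'a::euclidean_space \<Rightarrow> 'b::euclidean_space"
  assumes [measurable]: "f \<in> borel_measurable borel" and b: "\<And>x. norm (f x) \<le> B * indicator (cball 0 R) x"
  shows "square_integrable f" "integrable lborel f"
proof -
  have fin: "emeasure lborel (cball (0::'a) R) < \<infinity>" by (rule emeasure_bounded_finite) simp
  have B: "B \<ge> 0 \<or> (\<forall>x. f x = 0)"
  proof (cases "cball (0 :: 'a) R = {}")
    case True
    then show ?thesis using b by auto
  next
    case False
    then obtain x :: 'a where "x \<in> cball 0 R" by blast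
    then have "norm (f x) \<le> B" using b[of x] by simp
    then have "0 \<le> B" by (rule order_trans[OF norm_ge_zero])
    then show ?thesis ..
  qed
  have "integrable lborel (\<lambda>x. B\<^sup>2 * indicator (cball 0 R) (x::'a) :: real)"
    using fin by (intro integrable_mult_right) (auto simp: integrable_indicator_iff)
  then have "integrable lborel (\<lambda>x. (norm (f x))\<^sup>2)"
  proof (rule Bochner_Integration.integrable_bound)
    show "AE x in lborel. norm ((norm (f x))\<^sup>2) \<le> norm (B\<^sup>2 * indicator (cball 0 R) x :: real)"
    proof (rule AE_I2)
      fix x
      have "(norm (f x))\<^sup>2 \<le> (B * indicator (cball 0 R) x)\<^sup>2" by (intro power_mono b) simp
      then show "norm ((norm (f x))\<^sup>2) \<le> norm (B\<^sup>2 * indicator (cball 0 R) x :: real)"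
        by (auto simp: indicator_def split: if_splits)
    qed
  qed simp
  then show "square_integrable f" by (simp add: square_integrable_def)
  have "integrable lborel (\<lambda>x. B * indicator (cball 0 R) (x::'a) :: real)"
    using fin by (intro integrable_mult_right) (auto simp: integrable_indicator_iff)
  then show "integrable lborel f"
    by (rule Bochner_Integration.integrable_bound) (use b in \<open>auto intro: order_trans[OF _ abs_ge_self]\<close>)
qed

context
  fixes \<phi> :: "'a::euclidean_space \<Rightarrow> real"
  assumes \<phi>: "\<phi> \<in> test_functions UNIV"
begin

lemma test_function_smooth: "smooth_at_all_orders UNIV UNIV \<phi>"
  using \<phi> by (auto simp: test_functions_def smooth_on_UNIV_iff)

lemma test_function_continuous: "continuous_on UNIV \<phi>"
  by (rule smooth_at_all_orders_continuous_on[OF test_function_smooth]) auto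

lemma test_function_measurable: "\<phi> \<in> borel_measurable borel" "gradient \<phi> \<in> borel_measurable borel"
  using smooth_gradient(2)[OF test_function_smooth] test_function_continuous
  by (auto intro: borel_measurable_continuous_onI)

lemma test_function_derivative: "(\<phi> has_derivative (\<lambda>h. gradient \<phi> x \<bullet> h)) (at x)"
  by (rule smooth_gradient(1)[OF test_function_smooth])

lemma test_function_integrable:
  "square_integrable \<phi>" "integrable lborel \<phi>" "square_integrable (gradient \<phi>)" "integrable lborel (gradient \<phi>)"
proof -
  obtain B R where "B \<ge> 0" "R \<ge> 0" and B: "\<And>x. \<bar>\<phi> x\<bar> \<le> B * indicator (cball 0 R) x"
    "\<And>x. norm (gradient \<phi> x) \<le> B * indicator (cball 0 R) x"
    by (rule test_function_bounds[OF \<phi>]) auto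
  show "square_integrable \<phi>" "integrable lborel \<phi>" "square_integrable (gradient \<phi>)" "integrable lborel (gradient \<phi>)"
    using bounded_support_square_integrable[of \<phi> B R] bounded_support_square_integrable[of "gradient \<phi>" B R]
      test_function_measurable B by auto
qed

text \<open>Dominated convergence needs one integrable majorant for all n: the mean value inequality
  bounds the quotient by \<open>B * norm z\<close>, and since no step is longer than
  \<open>norm z\<close> all quotients are supported in the enlarged ball.\<close>

lemma difference_quotient:
  obtains B R where "\<And>x n. \<bar>real (Suc n) * (\<phi> (x + (1 / real (Suc n)) *\<^sub>R z) - \<phi> x)\<bar> \<le> B * indicator (cball 0 R) x"
    "\<And>x. (\<lambda>n. real (Suc n) * (\<phi> (x + (1 / real (Suc n)) *\<^sub>R z) - \<phi> x)) \<longlonglongrightarrow> gradient \<phi> x \<bullet> z"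
proof -
  obtain B R where B: "B \<ge> 0" "R \<ge> 0" "\<And>x. \<bar>\<phi> x\<bar> \<le> B * indicator (cball 0 R) x"
    "\<And>x. norm (gradient \<phi> x) \<le> B * indicator (cball 0 R) x"
    by (rule test_function_bounds[OF \<phi>]) auto
  show ?thesis
  proof (rule that[of "B * norm z" "R + norm z"])
    fix x n
    let ?t = "1 / real (Suc n)"
    have t: "0 < ?t" "?t \<le> 1" by auto
    have tz: "norm (?t *\<^sub>R z) \<le> norm z" using t mult_right_mono[of ?t 1 "norm z"] by simp
    have lip: "\<bar>\<phi> (x + ?t *\<^sub>R z) - \<phi> x\<bar> \<le> B * norm (?t *\<^sub>R z)"
    proof -
      have "norm (\<phi> (x + ?t *\<^sub>R z) - \<phi> x) \<le> B * norm ((x + ?t *\<^sub>R z) - x)"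
      proof (rule differentiable_bound[of UNIV \<phi> "\<lambda>x h. gradient \<phi> x \<bullet> h"])
        fix y
        show "onorm (\<lambda>h. gradient \<phi> y \<bullet> h) \<le> B"
        proof (rule onorm_bound)
          have "norm (gradient \<phi> y) \<le> B" using B(4)[of y] B(1) by (cases "norm y \<le> R") auto
          then show "norm (gradient \<phi> y \<bullet> h) \<le> B * norm h" for h
            using Cauchy_Schwarz_ineq2[of "gradient \<phi> y" h] mult_right_mono[of "norm (gradient \<phi> y)" B "norm h"] by simp
        qed (rule B)
      qed (auto intro: test_function_derivative)
      then show ?thesis by simp
    qed
    show "\<bar>real (Suc n) * (\<phi> (x + ?t *\<^sub>R z) - \<phi> x)\<bar> \<le> B * norm z * indicator (cball 0 (R + norm z)) x"
    proof (cases "norm x \<le> R + norm z")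
      case True
      have "\<bar>real (Suc n) * (\<phi> (x + ?t *\<^sub>R z) - \<phi> x)\<bar> \<le> real (Suc n) * (B * norm (?t *\<^sub>R z))"
        unfolding abs_mult using lip by (intro mult_mono) auto
      also have "\<dots> = B * norm z" by simp
      finally show ?thesis using True by simp
    next
      case False
      have "norm x \<le> norm (x + ?t *\<^sub>R z) + norm (?t *\<^sub>R z)"
        using norm_triangle_ineq4[of "x + ?t *\<^sub>R z" "?t *\<^sub>R z"] by simp
      then have "norm x > R" "norm (x + ?t *\<^sub>R z) > R" using False tz norm_ge_zero[of z] by linarith+
      then have "\<phi> x = 0" "\<phi> (x + ?t *\<^sub>R z) = 0" using B(3)[of x] B(3)[of "x + ?t *\<^sub>R z"] by auto
      then show ?thesis using B by simp
    qed
  next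
    fix x
    have "((\<lambda>t. \<phi> (x + t *\<^sub>R z)) has_derivative (\<lambda>t. gradient \<phi> x \<bullet> (t *\<^sub>R z))) (at 0)"
    proof (rule has_derivative_compose[of "\<lambda>t. x + t *\<^sub>R z" "\<lambda>t. t *\<^sub>R z" 0 UNIV \<phi>, simplified])
      show "((\<lambda>t. x + t *\<^sub>R z) has_derivative (\<lambda>t. t *\<^sub>R z)) (at 0)" by (auto intro!: derivative_eq_intros)
    qed (use test_function_derivative[of x] in simp)
    then have "((\<lambda>t. \<phi> (x + t *\<^sub>R z)) has_real_derivative gradient \<phi> x \<bullet> z) (at 0)"
      unfolding has_field_derivative_def by (rule has_derivative_eq_rhs) (auto simp: mult.commute)
    then have "((\<lambda>h. (\<phi> (x + h *\<^sub>R z) - \<phi> x) / h) \<longlongrightarrow> gradient \<phi> x \<bullet> z) (at 0)"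
      by (simp add: DERIV_def)
    moreover have "filterlim (\<lambda>n. 1 / real (Suc n)) (at 0) sequentially"
      unfolding filterlim_at using LIMSEQ_inverse_real_of_nat by (auto simp: inverse_eq_divide)
    ultimately have "(\<lambda>n. (\<phi> (x + (1 / real (Suc n)) *\<^sub>R z) - \<phi> x) / (1 / real (Suc n))) \<longlonglongrightarrow> gradient \<phi> x \<bullet> z"
      by (rule filterlim_compose)
    then show "(\<lambda>n. real (Suc n) * (\<phi> (x + (1 / real (Suc n)) *\<^sub>R z) - \<phi> x)) \<longlonglongrightarrow> gradient \<phi> x \<bullet> z"
      by (simp add: mult.commute)
  qed
qed

text \<open>Every difference quotient has integral 0 by translation invariance; the limit is taken
  under the integral.\<close>

lemma integral_gradient: "(LINT x|lborel. gradient \<phi> x \<bullet> z) = 0"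
proof -
  obtain B R where B: "\<And>x n. \<bar>real (Suc n) * (\<phi> (x + (1 / real (Suc n)) *\<^sub>R z) - \<phi> x)\<bar> \<le> B * indicator (cball 0 R) x"
    "\<And>x. (\<lambda>n. real (Suc n) * (\<phi> (x + (1 / real (Suc n)) *\<^sub>R z) - \<phi> x)) \<longlonglongrightarrow> gradient \<phi> x \<bullet> z"
    by (rule difference_quotient[of z]) auto
  note [measurable] = test_function_measurable
  have "(\<lambda>n. LINT x|lborel. real (Suc n) * (\<phi> (x + (1 / real (Suc n)) *\<^sub>R z) - \<phi> x)) \<longlonglongrightarrow> (LINT x|lborel. gradient \<phi> x \<bullet> z)"
  proof (rule integral_dominated_convergence[where w = "\<lambda>x. B * indicator (cball 0 R) x"])
    have "emeasure lborel (cball (0::'a) R) < \<infinity>" by (rule emeasure_bounded_finite) simp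
    then show "integrable lborel (\<lambda>x. B * indicator (cball 0 R) (x::'a) :: real)"
      by (intro integrable_mult_right) (auto simp: integrable_indicator_iff)
  qed (use B in auto)
  moreover have "(LINT x|lborel. real (Suc n) * (\<phi> (x + (1 / real (Suc n)) *\<^sub>R z) - \<phi> x)) = 0" for n
  proof -
    let ?w = "(1 / real (Suc n)) *\<^sub>R z"
    have i: "integrable lborel (\<lambda>x. \<phi> (x + ?w))"
      using integrable_distr[of "\<lambda>x. x + ?w" lborel borel \<phi>] test_function_integrable(2) measure_preserving_translation[of ?w]
      by (simp add: measure_preserving_def)
    have "(LINT x|lborel. \<phi> (x + ?w)) = (LINT x|lborel. \<phi> x)"
      by (rule integral_measure_preserving[OF measure_preserving_translation]) measurable
    then show ?thesis using i test_function_integrable(2) by simp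
  qed
  ultimately show ?thesis by (simp add: LIMSEQ_const_iff)
qed

text \<open>The translation by z is composed of n + 1 translations by z / (n + 1), all isometries of
  \<open>L\<^sup>2\<close>, so for every n the total change is at most the norm of the difference
  quotient. Its square tends to the integral of
  \<open>(gradient \<phi> x \<bullet> z)\<^sup>2\<close>.\<close>

lemma test_function_translation:
  "norm (L2_comp (\<lambda>x. x + z) (class_of \<phi>) - class_of \<phi>) \<le> norm z * norm (class_of (gradient \<phi>))"
proof -
  note [measurable] = test_function_measurable
  note sq = test_function_integrable(1,3)
  let ?T = "\<lambda>z. L2_comp (\<lambda>x. x + z) (class_of \<phi>)"
  have T: "?T z = class_of (\<lambda>x. \<phi> (x + z))" for z
    by (rule L2_comp_class_of[OF measure_preserving_translation sq(1)])
  have sqT: "square_integrable (\<lambda>x. \<phi> (x + z))" for z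
    by (rule square_integrable_comp[OF measure_preserving_translation sq(1)])
  obtain B R where B: "\<And>x n. \<bar>real (Suc n) * (\<phi> (x + (1 / real (Suc n)) *\<^sub>R z) - \<phi> x)\<bar> \<le> B * indicator (cball 0 R) x"
    "\<And>x. (\<lambda>n. real (Suc n) * (\<phi> (x + (1 / real (Suc n)) *\<^sub>R z) - \<phi> x)) \<longlonglongrightarrow> gradient \<phi> x \<bullet> z"
    by (rule difference_quotient[of z]) auto
  let ?q = "\<lambda>n x. real (Suc n) * (\<phi> (x + (1 / real (Suc n)) *\<^sub>R z) - \<phi> x)"
  have tele: "norm (?T z - class_of \<phi>) \<le> norm (real (Suc n) *\<^sub>R (?T ((1 / real (Suc n)) *\<^sub>R z) - class_of \<phi>))" for n
  proof -
    define w where "w = (1 / real (Suc n)) *\<^sub>R z"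
    have comp: "L2_comp (\<lambda>x. x + b) (?T a) = ?T (a + b)" for a b
      by (simp add: T L2_comp_class_of[OF measure_preserving_translation sqT] add_ac)
    have "norm (?T (real k *\<^sub>R w) - class_of \<phi>) \<le> real k * norm (?T w - class_of \<phi>)" for k
    proof (induction k)
      case 0
      then show ?case using T[of 0] by simp
    next
      case (Suc k)
      have "?T (real (Suc k) *\<^sub>R w) - class_of \<phi> = L2_comp (\<lambda>x. x + real k *\<^sub>R w) (?T w - class_of \<phi>) + (?T (real k *\<^sub>R w) - class_of \<phi>)"
        using linear_diff[OF bounded_linear.linear[OF bounded_linear_L2_comp[OF measure_preserving_translation]], of "real k *\<^sub>R w" "?T w" "class_of \<phi>"]
        unfolding comp by (simp add: scaleR_left_distrib add.commute)
      also have "norm \<dots> \<le> norm (?T w - class_of \<phi>) + real k * norm (?T w - class_of \<phi>)"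
        using Suc by (intro norm_triangle_le add_mono) (auto simp: norm_L2_comp[OF measure_preserving_translation])
      finally show ?case by (simp add: algebra_simps)
    qed
    moreover have "real (Suc n) *\<^sub>R w = z" by (simp add: w_def)
    ultimately show ?thesis unfolding w_def[symmetric] by (metis abs_of_nat norm_scaleR real_norm_def)
  qed
  have "norm (real (Suc n) *\<^sub>R (?T ((1 / real (Suc n)) *\<^sub>R z) - class_of \<phi>)) ^ 2 = (LINT x|lborel. (?q n x)\<^sup>2)" for n
  proof -
    let ?w = "(1 / real (Suc n)) *\<^sub>R z"
    have eq: "real (Suc n) *\<^sub>R (?T ?w - class_of \<phi>) = class_of (?q n)"
      using class_of_scaleR[OF square_integrable_diff[OF sqT sq(1)], of "real (Suc n)" ?w]
      by (simp add: T class_of_diff[OF sqT sq(1)])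
    have sqq: "square_integrable (?q n)"
      using square_integrable_scaleR[OF square_integrable_diff[OF sqT sq(1)], of "real (Suc n)" ?w] by simp
    then have "(norm (class_of (?q n)))\<^sup>2 = (LINT x|lborel. fun_of (class_of (?q n)) x \<bullet> ?q n x)"
      by (simp add: power2_norm_eq_inner inner_class_of)
    also have "\<dots> = (LINT x|lborel. (?q n x)\<^sup>2)"
      by (rule integral_cong_AE) (measurable, use fun_of_class_of[OF sqq] in eventually_elim, simp add: power2_eq_square)
    finally show ?thesis unfolding eq .
  qed
  then have le: "(norm (?T z - class_of \<phi>))\<^sup>2 \<le> (LINT x|lborel. (?q n x)\<^sup>2)" for n
    using power_mono[OF tele[of n], of 2] by simp
  have fin: "emeasure lborel (cball (0::'a) R) < \<infinity>" by (rule emeasure_bounded_finite) simp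
  have "(\<lambda>n. LINT x|lborel. (?q n x)\<^sup>2) \<longlonglongrightarrow> (LINT x|lborel. (gradient \<phi> x \<bullet> z)\<^sup>2)"
  proof (rule integral_dominated_convergence[where w = "\<lambda>x. B\<^sup>2 * indicator (cball 0 R) x"])
    show "integrable lborel (\<lambda>x. B\<^sup>2 * indicator (cball 0 R) (x::'a) :: real)"
      using fin by (intro integrable_mult_right) (auto simp: integrable_indicator_iff)
    show "AE x in lborel. norm ((?q n x)\<^sup>2) \<le> B\<^sup>2 * indicator (cball 0 R) x" for n
    proof (rule AE_I2)
      fix x
      have "\<bar>?q n x\<bar>\<^sup>2 \<le> (B * indicator (cball 0 R) x)\<^sup>2" by (intro power_mono B(1)) simp
      then show "norm ((?q n x)\<^sup>2) \<le> B\<^sup>2 * indicator (cball 0 R) x"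
        by (auto simp: indicator_def power_mult_distrib split: if_splits)
    qed
    show "AE x in lborel. (\<lambda>n. (?q n x)\<^sup>2) \<longlonglongrightarrow> (gradient \<phi> x \<bullet> z)\<^sup>2"
      using B(2) by (intro AE_I2 tendsto_power)
  qed measurable
  then have "(norm (?T z - class_of \<phi>))\<^sup>2 \<le> (LINT x|lborel. (gradient \<phi> x \<bullet> z)\<^sup>2)"
    by (rule LIMSEQ_le_const) (use le in auto)
  also have "\<dots> \<le> (LINT x|lborel. (norm z)\<^sup>2 * (norm (gradient \<phi> x))\<^sup>2)"
  proof (rule integral_mono)
    show i: "integrable lborel (\<lambda>x. (norm z)\<^sup>2 * (norm (gradient \<phi> x))\<^sup>2)"
      using sq(2) by (simp add: square_integrable_def)
    show c: "(gradient \<phi> x \<bullet> z)\<^sup>2 \<le> (norm z)\<^sup>2 * (norm (gradient \<phi> x))\<^sup>2" for x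
      using Cauchy_Schwarz_ineq[of "gradient \<phi> x" z] by (simp add: power2_norm_eq_inner mult.commute)
    show "integrable lborel (\<lambda>x. (gradient \<phi> x \<bullet> z)\<^sup>2)"
      by (rule Bochner_Integration.integrable_bound[OF i]) (use c in auto)
  qed
  also have "\<dots> = (norm z * norm (class_of (gradient \<phi>)))\<^sup>2"
  proof -
    have "(norm (class_of (gradient \<phi>)))\<^sup>2 = (LINT x|lborel. fun_of (class_of (gradient \<phi>)) x \<bullet> gradient \<phi> x)"
      by (simp add: power2_norm_eq_inner inner_class_of[OF sq(2)])
    also have "\<dots> = (LINT x|lborel. (norm (gradient \<phi> x))\<^sup>2)"
      by (rule integral_cong_AE) (measurable, use fun_of_class_of[OF sq(2)] in eventually_elim, simp add: power2_norm_eq_inner)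
    finally show ?thesis by (simp add: power_mult_distrib)
  qed
  finally show ?thesis by (rule power2_le_imp_le) simp
qed

end

lemma test_function_mult:
  assumes "\<phi> \<in> test_functions \<Omega>" "smooth_at_all_orders UNIV UNIV \<eta>"
  shows "(\<lambda>x. \<phi> x * \<eta> x) \<in> test_functions \<Omega>"
    "gradient (\<lambda>x. \<phi> x * \<eta> x) x = \<phi> x *\<^sub>R gradient \<eta> x + \<eta> x *\<^sub>R gradient \<phi> x"
proof -
  have s: "smooth_at_all_orders UNIV UNIV \<phi>" and S: "compact (closure {x. \<phi> x \<noteq> 0})" "closure {x. \<phi> x \<noteq> 0} \<subseteq> \<Omega>"
    using assms by (auto simp: test_functions_def smooth_on_UNIV_iff)
  show "(\<lambda>x. \<phi> x * \<eta> x) \<in> test_functions \<Omega>"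
    by (rule test_functionsI[OF smooth_at_all_orders_mult[OF _ _ s assms(2)] _ S])
      (auto intro: closure_subset[THEN subsetD])
  show "gradient (\<lambda>x. \<phi> x * \<eta> x) x = \<phi> x *\<^sub>R gradient \<eta> x + \<eta> x *\<^sub>R gradient \<phi> x"
    by (rule gradient_eqI, rule has_derivative_eq_rhs[OF has_derivative_mult[OF smooth_gradient(1)[OF s] smooth_gradient(1)[OF assms(2)]]])
      (auto simp: inner_add_left algebra_simps)
qed

lemma test_function_add_scale:
  assumes "\<phi> \<in> test_functions \<Omega>" "\<eta> \<in> test_functions \<Omega>"
  shows "(\<lambda>x. \<phi> x + r * \<eta> x) \<in> test_functions \<Omega>"
    "gradient (\<lambda>x. \<phi> x + r * \<eta> x) x = gradient \<phi> x + r *\<^sub>R gradient \<eta> x"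
proof -
  have s: "smooth_at_all_orders UNIV UNIV \<phi>" and S: "compact (closure {x. \<phi> x \<noteq> 0})" "closure {x. \<phi> x \<noteq> 0} \<subseteq> \<Omega>"
    using assms by (auto simp: test_functions_def smooth_on_UNIV_iff)
  have s': "smooth_at_all_orders UNIV UNIV \<eta>" and S': "compact (closure {x. \<eta> x \<noteq> 0})" "closure {x. \<eta> x \<noteq> 0} \<subseteq> \<Omega>"
    using assms by (auto simp: test_functions_def smooth_on_UNIV_iff)
  show "(\<lambda>x. \<phi> x + r * \<eta> x) \<in> test_functions \<Omega>"
  proof (rule test_functionsI[of _ "closure {x. \<phi> x \<noteq> 0} \<union> closure {x. \<eta> x \<noteq> 0}"])
    show "smooth_at_all_orders UNIV UNIV (\<lambda>x. \<phi> x + r * \<eta> x)"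
      by (intro smooth_at_all_orders_add smooth_at_all_orders_mult smooth_at_all_orders_const s s') auto
    show "x \<in> closure {x. \<phi> x \<noteq> 0} \<union> closure {x. \<eta> x \<noteq> 0}" if "\<phi> x + r * \<eta> x \<noteq> 0" for x
      using that closure_subset[of "{x. \<phi> x \<noteq> 0}"] closure_subset[of "{x. \<eta> x \<noteq> 0}"]
      by (cases "\<phi> x = 0") auto
  qed (use S S' in auto)
  show "gradient (\<lambda>x. \<phi> x + r * \<eta> x) x = gradient \<phi> x + r *\<^sub>R gradient \<eta> x"
    by (rule gradient_eqI) (auto intro!: derivative_eq_intros smooth_gradient(1)[OF s] smooth_gradient(1)[OF s'] simp: inner_add_left)
qed

text \<open>The product is again a test function, so its derivative in direction b has integral
  0.\<close>

lemma integration_by_parts: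
  assumes \<phi>: "\<phi> \<in> test_functions UNIV" and \<eta>: "\<eta> \<in> test_functions UNIV"
  shows "(LINT x|lborel. \<phi> x * (gradient \<eta> x \<bullet> b)) = - (LINT x|lborel. (gradient \<phi> x \<bullet> b) * \<eta> x)"
proof -
  note m = test_function_mult[OF \<phi> test_function_smooth[OF \<eta>]]
  note [measurable] = test_function_measurable[OF \<phi>] test_function_measurable[OF \<eta>]
  have i: "integrable lborel (\<lambda>x. f x \<bullet> g x)" if "square_integrable f" "square_integrable g" for f g :: "'a \<Rightarrow> real"
    using that by (rule integrable_inner_square_integrable)
  have g: "square_integrable (\<lambda>x. gradient \<phi> x \<bullet> b)" if t: "\<phi> \<in> test_functions UNIV" for \<phi>
  proof -
    note [measurable] = test_function_measurable[OF t]
    obtain B R where "B \<ge> 0" "R \<ge> 0" "\<And>x. \<bar>\<phi> x\<bar> \<le> B * indicator (cball 0 R) x" and B: "\<And>x. norm (gradient \<phi> x) \<le> B * indicator (cball 0 R) x"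
      by (rule test_function_bounds[OF t]) auto
    show ?thesis
    proof (rule bounded_support_square_integrable(1)[of _ "B * norm b" R])
      show "norm (gradient \<phi> x \<bullet> b) \<le> B * norm b * indicator (cball 0 R) x" for x
        using Cauchy_Schwarz_ineq2[of "gradient \<phi> x" b] mult_right_mono[OF B[of x] norm_ge_zero[of b]] by (simp add: mult_ac)
    qed measurable
  qed
  have "(LINT x|lborel. \<phi> x * (gradient \<eta> x \<bullet> b) + (gradient \<phi> x \<bullet> b) * \<eta> x) = 0"
    using integral_gradient[OF m(1), of b] unfolding m(2) by (simp add: inner_add_left mult.commute)
  then show ?thesis
    using i[OF test_function_integrable(1)[OF \<phi>] g[OF \<eta>]] i[OF g[OF \<phi>] test_function_integrable(1)[OF \<eta>]]
    by (simp add: add_eq_0_iff)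
qed

lemma integrable_scaleR_square_integrable:
  fixes f :: "'a::euclidean_space \<Rightarrow> real" and g :: "'a \<Rightarrow> 'b::euclidean_space"
  assumes "square_integrable f" "square_integrable g"
  shows "integrable lborel (\<lambda>x. f x *\<^sub>R g x)"
proof -
  note [measurable] = square_integrable_measurable[OF assms(1)] square_integrable_measurable[OF assms(2)]
  have "square_integrable (\<lambda>x. norm (g x))" using assms(2) by (simp add: square_integrable_def)
  from integrable_inner_square_integrable[OF assms(1) this] show ?thesis
    by (rule Bochner_Integration.integrable_bound) (auto simp: abs_mult)
qed

section \<open>Closedness, linearity and the translation bound for Sobolev spaces\<close>

lemma val_square_integrable: "square_integrable (val u)" "square_integrable (wgrad u)"
  by (simp_all add: val_def wgrad_def square_integrable_fun_of)

lemma val_measurable [measurable]: "val u \<in> borel_measurable borel" "wgrad u \<in> borel_measurable borel"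
  by (simp_all add: val_def wgrad_def)

lemma square_integrable_inner_const: "square_integrable g \<Longrightarrow> square_integrable (\<lambda>x. g x \<bullet> b :: real)"
proof -
  assume g: "square_integrable g"
  note [measurable] = square_integrable_measurable[OF g]
  have "integrable lborel (\<lambda>x. (norm b)\<^sup>2 * (norm (g x))\<^sup>2)" using g by (simp add: square_integrable_def)
  then have "integrable lborel (\<lambda>x. (g x \<bullet> b)\<^sup>2)"
    by (rule Bochner_Integration.integrable_bound)
      (use Cauchy_Schwarz_ineq[of "g _" b] in \<open>auto simp: power2_norm_eq_inner mult.commute\<close>)
  then show ?thesis by (simp add: square_integrable_def)
qed

lemma square_integrable_scaleR_const:
  fixes f :: "'a::euclidean_space \<Rightarrow> real"
  assumes "square_integrable f"
  shows "square_integrable (\<lambda>x. f x *\<^sub>R (b :: 'b::euclidean_space))"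
proof -
  note [measurable] = square_integrable_measurable[OF assms]
  show ?thesis using assms by (simp add: square_integrable_def power_mult_distrib)
qed

text \<open>In terms of inner products with fixed elements of \<open>L\<^sup>2\<close> the
  definition becomes a family of continuous linear equations, from which closedness and linearity
  are read off.\<close>

lemma H1_iff:
  "u \<in> H1 \<longleftrightarrow> (\<forall>\<phi>\<in>test_functions UNIV. \<forall>b\<in>Basis.
     fst u \<bullet> class_of (\<lambda>x. gradient \<phi> x \<bullet> b) = - (snd u \<bullet> class_of (\<lambda>x. \<phi> x *\<^sub>R b)))"
proof -
  have "(LINT x|lborel. val u x *\<^sub>R gradient \<phi> x) = - (LINT x|lborel. \<phi> x *\<^sub>R wgrad u x) \<longleftrightarrow>
    (\<forall>b\<in>Basis. fst u \<bullet> class_of (\<lambda>x. gradient \<phi> x \<bullet> b) = - (snd u \<bullet> class_of (\<lambda>x. \<phi> x *\<^sub>R b)))"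
    if \<phi>: "\<phi> \<in> test_functions UNIV" for \<phi>
  proof -
    note sq = test_function_integrable(1,3)[OF \<phi>]
    have "(LINT x|lborel. val u x *\<^sub>R gradient \<phi> x) \<bullet> b = fst u \<bullet> class_of (\<lambda>x. gradient \<phi> x \<bullet> b)" for b
      using integrable_scaleR_square_integrable[OF val_square_integrable(1) sq(2), of u]
      by (simp add: inner_class_of square_integrable_inner_const[OF sq(2)] val_def flip: integral_inner_left)
    moreover have "(LINT x|lborel. \<phi> x *\<^sub>R wgrad u x) \<bullet> b = snd u \<bullet> class_of (\<lambda>x. \<phi> x *\<^sub>R b)" for b
      using integrable_scaleR_square_integrable[OF sq(1) val_square_integrable(2), of u]
      by (simp add: inner_class_of square_integrable_scaleR_const[OF sq(1)] wgrad_def flip: integral_inner_left)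
    ultimately show ?thesis
      unfolding euclidean_eq_iff[of "LINT x|lborel. val u x *\<^sub>R gradient \<phi> x"] by (simp only: inner_minus_left)
  qed
  then show ?thesis by (auto simp: H1_def)
qed

lemma subspace_H1: "subspace H1"
  unfolding subspace_def by (auto simp: H1_iff inner_add_left)

lemma closed_H1: "closed H1"
proof -
  have "H1 = (\<Inter>\<phi>\<in>test_functions UNIV. \<Inter>b\<in>Basis.
    {u. fst u \<bullet> class_of (\<lambda>x. gradient \<phi> x \<bullet> b) = - (snd u \<bullet> class_of (\<lambda>x. \<phi> x *\<^sub>R b))})"
    by (auto simp: H1_iff)
  also have "closed \<dots>" by (intro closed_INT ballI closed_Collect_eq continuous_intros)
  finally show ?thesis .
qed

lemma fst_test_element: "\<phi> \<in> test_functions UNIV \<Longrightarrow> AE x in lborel. val (test_element \<phi>) x = \<phi> x"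
  by (simp add: val_def test_element_def fun_of_class_of test_function_integrable)

lemma snd_test_element: "\<phi> \<in> test_functions UNIV \<Longrightarrow> AE x in lborel. wgrad (test_element \<phi>) x = gradient \<phi> x"
  by (simp add: wgrad_def test_element_def fun_of_class_of test_function_integrable)

lemma test_functions_UNIV: "\<phi> \<in> test_functions \<Omega> \<Longrightarrow> \<phi> \<in> test_functions UNIV"
  using test_functions_mono by blast

lemma fun_of_AE_eq_iff:
  assumes "square_integrable f"
  shows "(AE x in lborel. fun_of u x = f x) \<longleftrightarrow> u = class_of f"
  using class_of_eq_iff[OF square_integrable_fun_of assms, of u] by (simp add: class_of_fun_of)

lemma H10_eq: "H10 \<Omega> = closure (test_element ` test_functions \<Omega>)"
proof -
  have "{u. \<exists>\<phi>\<in>test_functions \<Omega>. (AE x in lborel. val u x = \<phi> x) \<and> (AE x in lborel. wgrad u x = gradient \<phi> x)}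
    = test_element ` test_functions \<Omega>"
    by (auto simp: val_def wgrad_def fun_of_AE_eq_iff test_function_integrable test_functions_UNIV test_element_def prod_eq_iff image_iff)
  then show ?thesis by (simp add: H10_def)
qed

lemma closed_H10: "closed (H10 \<Omega>)" by (simp add: H10_def)

lemma test_element_in_H10: "\<phi> \<in> test_functions \<Omega> \<Longrightarrow> test_element \<phi> \<in> H10 \<Omega>"
  unfolding H10_eq by (rule subsetD[OF closure_subset]) simp

lemma H10_sequence:
  assumes "u \<in> H10 \<Omega>"
  obtains \<phi> where "\<And>n. \<phi> n \<in> test_functions \<Omega>" "(\<lambda>n. test_element (\<phi> n)) \<longlonglongrightarrow> u"
proof -
  obtain x where x: "\<forall>n. x n \<in> test_element ` test_functions \<Omega>" "x \<longlonglongrightarrow> u"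
    using assms unfolding H10_eq closure_sequential by (elim exE conjE) simp
  then have "\<forall>n. \<exists>\<phi>. \<phi> \<in> test_functions \<Omega> \<and> x n = test_element \<phi>" by blast
  then obtain \<phi> where \<phi>: "\<And>n. \<phi> n \<in> test_functions \<Omega>" "\<And>n. x n = test_element (\<phi> n)" by metis
  from \<phi>(2) have "x = (\<lambda>n. test_element (\<phi> n))" by (rule ext)
  with x(2) have "(\<lambda>n. test_element (\<phi> n)) \<longlonglongrightarrow> u" by simp
  with \<phi>(1) show ?thesis by (rule that)
qed

lemma test_element_add_scale:
  assumes "\<phi> \<in> test_functions \<Omega>" "\<eta> \<in> test_functions \<Omega>"
  shows "test_element (\<lambda>x. \<phi> x + r * \<eta> x) = test_element \<phi> + r *\<^sub>R test_element \<eta>"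
proof -
  note t = assms[THEN test_functions_UNIV]
  note i = test_function_integrable(1,3)[OF t(1)] test_function_integrable(1,3)[OF t(2)]
  have "gradient (\<lambda>x. \<phi> x + r * \<eta> x) = (\<lambda>x. gradient \<phi> x + r *\<^sub>R gradient \<eta> x)"
    using test_function_add_scale(2)[OF assms] by auto
  then show ?thesis
    using class_of_add[OF i(1) square_integrable_scaleR[OF i(3)], of r] class_of_scaleR[OF i(3), of r]
      class_of_add[OF i(2) square_integrable_scaleR[OF i(4)], of r] class_of_scaleR[OF i(4), of r]
    by (simp add: test_element_def prod_eq_iff)
qed

lemma zero_test_function: "(\<lambda>x. 0) \<in> test_functions \<Omega>"
  by (rule test_functionsI[of _ "{}"]) (auto intro: smooth_at_all_orders_const)

lemma subspace_H10: "subspace (H10 \<Omega> :: 'a::euclidean_space sobolev set)"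
proof -
  have z: "test_element (\<lambda>x :: 'a. 0) = 0"
    using test_element_add_scale[OF zero_test_function[of \<Omega>] zero_test_function, of "-1"]
    by (simp add: scaleR_minus1_left)
  have comb: "u + r *\<^sub>R v \<in> H10 \<Omega>" if uv: "u \<in> H10 \<Omega>" "v \<in> H10 \<Omega>" for u v :: "'a sobolev" and r
  proof -
    obtain \<phi> where \<phi>: "\<And>n. \<phi> n \<in> test_functions \<Omega>" "(\<lambda>n. test_element (\<phi> n)) \<longlonglongrightarrow> u" by (rule H10_sequence[OF uv(1)]) auto
    obtain \<eta> where \<eta>: "\<And>n. \<eta> n \<in> test_functions \<Omega>" "(\<lambda>n. test_element (\<eta> n)) \<longlonglongrightarrow> v" by (rule H10_sequence[OF uv(2)]) auto
    have mem: "test_element (\<phi> n) + r *\<^sub>R test_element (\<eta> n) \<in> H10 \<Omega>" for n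
      using test_element_in_H10[OF test_function_add_scale(1)[OF \<phi>(1) \<eta>(1)], of n r n]
      by (simp add: test_element_add_scale[OF \<phi>(1) \<eta>(1)])
    have lim: "(\<lambda>n. test_element (\<phi> n) + r *\<^sub>R test_element (\<eta> n)) \<longlonglongrightarrow> u + r *\<^sub>R v"
      by (intro tendsto_intros \<phi> \<eta>)
    show ?thesis by (rule closed_sequentially[where f = "\<lambda>n. test_element (\<phi> n) + r *\<^sub>R test_element (\<eta> n)", OF closed_H10 mem lim])
  qed
  have 0: "0 \<in> (H10 \<Omega> :: 'a sobolev set)" using test_element_in_H10[OF zero_test_function[of \<Omega>]] z by simp
  show ?thesis
    unfolding subspace_def using 0 comb[of _ _ 1] comb[OF 0] by auto
qed

lemma H10_subset_H1: "H10 (\<Omega> :: 'a::euclidean_space set) \<subseteq> H1"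
  unfolding H10_eq
proof (rule closure_minimal[OF image_subsetI closed_H1])
  fix \<phi> :: "'a \<Rightarrow> real" assume "\<phi> \<in> test_functions \<Omega>"
  then have \<phi>: "\<phi> \<in> test_functions UNIV" by (rule test_functions_UNIV)
  note i = test_function_integrable(1,3)[OF \<phi>]
  show "test_element \<phi> \<in> H1"
    unfolding H1_iff
  proof (intro ballI)
    fix \<eta> :: "'a \<Rightarrow> real" and b :: 'a assume \<eta>: "\<eta> \<in> test_functions UNIV" and "b \<in> Basis"
    note j = test_function_integrable(1,3)[OF \<eta>]
    note [measurable] = test_function_measurable[OF \<phi>] test_function_measurable[OF \<eta>]
    have "fst (test_element \<phi>) \<bullet> class_of (\<lambda>x. gradient \<eta> x \<bullet> b) = (LINT x|lborel. \<phi> x * (gradient \<eta> x \<bullet> b))"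
      unfolding test_element_def fst_conv inner_commute[of "class_of \<phi>"] inner_class_of[OF i(1)]
      by (rule integral_cong_AE)
        (measurable, use fun_of_class_of[OF square_integrable_inner_const[OF j(2), of b]] in eventually_elim, simp)
    moreover have "snd (test_element \<phi>) \<bullet> class_of (\<lambda>x. \<eta> x *\<^sub>R b) = (LINT x|lborel. (gradient \<phi> x \<bullet> b) * \<eta> x)"
      unfolding test_element_def snd_conv inner_commute[of "class_of (gradient \<phi>)"] inner_class_of[OF i(2)]
      by (rule integral_cong_AE)
        (measurable, use fun_of_class_of[OF square_integrable_scaleR_const[OF j(1), of b]] in eventually_elim, simp add: inner_commute)
    ultimately show "fst (test_element \<phi>) \<bullet> class_of (\<lambda>x. gradient \<eta> x \<bullet> b) = - (snd (test_element \<phi>) \<bullet> class_of (\<lambda>x. \<eta> x *\<^sub>R b))"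
      using integration_by_parts[OF \<phi> \<eta>, of b] by simp
  qed
qed

text \<open>Both sides are continuous in the Sobolev norm, so the estimate passes from test
  functions to their closure.\<close>

lemma H10_translation_bound:
  assumes "u \<in> H10 \<Omega>"
  shows "translation_bound (val u) (norm (snd u))"
  unfolding translation_bound_def
proof
  fix z :: 'a
  let ?T = "L2_comp (\<lambda>x. x + z) :: ('a, real) L2 \<Rightarrow> _"
  note mp = measure_preserving_translation[of z]
  obtain \<phi> where \<phi>: "\<And>n. \<phi> n \<in> test_functions \<Omega>" "(\<lambda>n. test_element (\<phi> n)) \<longlonglongrightarrow> u" by (rule H10_sequence[OF assms]) auto
  have f: "(\<lambda>n. fst (test_element (\<phi> n))) \<longlonglongrightarrow> fst u" by (rule tendsto_fst[OF \<phi>(2)])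
  have "(\<lambda>n. norm (?T (fst (test_element (\<phi> n))) - fst (test_element (\<phi> n)))) \<longlonglongrightarrow> norm (?T (fst u) - fst u)"
    by (intro tendsto_intros bounded_linear.tendsto[OF bounded_linear_L2_comp[OF mp]] f)
  moreover have "(\<lambda>n. norm z * norm (snd (test_element (\<phi> n)))) \<longlonglongrightarrow> norm z * norm (snd u)"
    by (intro tendsto_intros tendsto_snd[OF \<phi>(2)])
  ultimately have "norm (?T (fst u) - fst u) \<le> norm z * norm (snd u)"
    by (rule LIMSEQ_le) (use test_function_translation[OF test_functions_UNIV[OF \<phi>(1)]] in \<open>auto simp: test_element_def\<close>)
  then have "ennreal ((norm (?T (fst u) - fst u))\<^sup>2) \<le> ennreal ((norm z * norm (snd u))\<^sup>2)"
    by (intro ennreal_leI power_mono) auto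
  also have "ennreal ((norm (?T (fst u) - fst u))\<^sup>2) = L2_energy (\<lambda>x. val u (x + z) - val u x)"
    unfolding L2_energy_diff[symmetric]
    by (rule L2_energy_cong_AE) (use fun_of_L2_comp[OF mp, of "fst u"] in eventually_elim, simp add: val_def)
  finally show "L2_energy (\<lambda>x. val u (x + z) - val u x) \<le> ennreal ((norm z * norm (snd u))\<^sup>2)" .
qed

text \<open>Convergence in \<open>L\<^sup>2\<close> gives convergence almost everywhere along
  subsequences, separately for values and gradients. Integrals over \<Omega> may therefore be taken
  over the whole space.\<close>

lemma H10_vanishes:
  assumes "u \<in> H10 \<Omega>"
  shows "AE x in lborel. x \<notin> \<Omega> \<longrightarrow> val u x = 0 \<and> wgrad u x = 0"
proof -
  obtain \<phi> where \<phi>: "\<And>n. \<phi> n \<in> test_functions \<Omega>" "(\<lambda>n. test_element (\<phi> n)) \<longlonglongrightarrow> u" by (rule H10_sequence[OF assms]) auto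
  obtain r where r: "strict_mono r" "AE x in lborel. (\<lambda>n. fun_of (fst (test_element (\<phi> (r n)))) x) \<longlonglongrightarrow> fun_of (fst u) x"
    by (rule L2_AE_subsequence[OF tendsto_fst[OF \<phi>(2)]]) auto
  obtain s where s: "strict_mono s" "AE x in lborel. (\<lambda>n. fun_of (snd (test_element (\<phi> (s n)))) x) \<longlonglongrightarrow> fun_of (snd u) x"
    by (rule L2_AE_subsequence[OF tendsto_snd[OF \<phi>(2)]]) auto
  have "AE x in lborel. \<forall>n. val (test_element (\<phi> n)) x = \<phi> n x" "AE x in lborel. \<forall>n. wgrad (test_element (\<phi> n)) x = gradient (\<phi> n) x"
    unfolding AE_all_countable using fst_test_element snd_test_element \<phi>(1) test_functions_UNIV by blast+
  then show ?thesis using r(2) s(2)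
  proof (eventually_elim, intro impI)
    fix x assume h: "\<forall>n. val (test_element (\<phi> n)) x = \<phi> n x" "\<forall>n. wgrad (test_element (\<phi> n)) x = gradient (\<phi> n) x"
      "(\<lambda>n. fun_of (fst (test_element (\<phi> (r n)))) x) \<longlonglongrightarrow> fun_of (fst u) x"
      "(\<lambda>n. fun_of (snd (test_element (\<phi> (s n)))) x) \<longlonglongrightarrow> fun_of (snd u) x" "x \<notin> \<Omega>"
    have "fun_of (fst (test_element (\<phi> n))) x = 0" "fun_of (snd (test_element (\<phi> n))) x = 0" for n
      using h(1,2) test_function_vanishes[OF \<phi>(1) h(5)] by (auto simp: val_def wgrad_def)
    then show "val u x = 0 \<and> wgrad u x = 0" using h(3,4) by (simp add: val_def wgrad_def LIMSEQ_const_iff)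
  qed
qed

section \<open>Mollification\<close>

text \<open>The functions \<open>p (1/t) exp (- 1/t)\<close>, extended by 0, form a class closed
  under differentiation: the derivative replaces p by \<open>x\<^sup>2 (p - p')\<close>. This makes
  the standard cutoff profile smooth.\<close>

definition flat_poly :: "real poly \<Rightarrow> real \<Rightarrow> real" where
  "flat_poly p t = (if t > 0 then poly p (1 / t) * exp (- (1 / t)) else 0)"

text \<open>The power \<open>x ^ k\<close> is carried along because \<open>pCons\<close> shifts the
  remaining polynomial by one power of x.\<close>

lemma poly_exp_limit: "((\<lambda>x. x ^ k * poly p x * exp (- x)) \<longlongrightarrow> (0 :: real)) at_top"
proof (induction p arbitrary: k)
  case (pCons a p)
  have "((\<lambda>x. a * (x ^ k / exp x) + x ^ Suc k * poly p x * exp (- x)) \<longlongrightarrow> a * 0 + 0) at_top"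
    by (intro tendsto_intros tendsto_power_div_exp_0 pCons.IH)
  then show ?case by (simp add: exp_minus divide_inverse algebra_simps)
qed simp

lemma flat_poly_derivative:
  "(flat_poly p has_real_derivative flat_poly (monom 1 2 * (p - pderiv p)) t) (at t)"
proof -
  consider "t > 0" | "t < 0" | "t = 0" by linarith
  then show ?thesis
  proof cases
    case 1
    have "((\<lambda>t. poly p (1 / t) * exp (- (1 / t))) has_real_derivative
        flat_poly (monom 1 2 * (p - pderiv p)) t) (at t)"
      using 1 by (auto intro!: derivative_eq_intros poly_DERIV[THEN DERIV_chain2] simp: flat_poly_def poly_monom power2_eq_square field_simps)
    then show ?thesis
    proof (rule has_field_derivative_transform_within_open)
      show "open {0 :: real <..}" "t \<in> {0 <..}" using 1 by auto
      show "poly p (1 / x) * exp (- (1 / x)) = flat_poly p x" if "x \<in> {0<..}" for x using that by (simp add: flat_poly_def)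
    qed
  next
    case 2
    have "((\<lambda>t. 0) has_real_derivative 0) (at t)" by simp
    then have "(flat_poly p has_real_derivative 0) (at t)"
    proof (rule has_field_derivative_transform_within_open)
      show "open {..< 0 :: real}" "t \<in> {..< 0}" using 2 by auto
      show "0 = flat_poly p x" if "x \<in> {..<0}" for x using that by (simp add: flat_poly_def)
    qed
    then show ?thesis using 2 by (simp add: flat_poly_def)
  next
    case 3
    \<comment> \<open>From the right the difference quotient at 0 is again a polynomial in 1/h times
      \<open>exp (- 1/h)\<close>; from the left it is 0.\<close>
    have "((\<lambda>h. flat_poly p h / h) \<longlongrightarrow> 0) (at 0)"
    proof (rule filterlim_split_at)
      have "((\<lambda>h. inverse h ^ 1 * poly p (inverse h) * exp (- inverse h)) \<longlongrightarrow> 0) (at_right 0)"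
        by (rule filterlim_compose[OF poly_exp_limit filterlim_inverse_at_top_right])
      then show "((\<lambda>h. flat_poly p h / h) \<longlongrightarrow> 0) (at_right 0)"
        by (rule Lim_transform_eventually)
          (auto simp: eventually_at_right_less flat_poly_def divide_inverse intro!: eventually_mono[OF eventually_at_right_less[of 0]])
      show "((\<lambda>h. flat_poly p h / h) \<longlongrightarrow> 0) (at_left 0)"
        by (rule Lim_transform_eventually[OF tendsto_const], rule eventually_mono[OF eventually_at_left_real[of "-1" 0]])
          (auto simp: flat_poly_def)
    qed
    then show ?thesis using 3 by (simp add: DERIV_def flat_poly_def)
  qed
qed

definition flat :: "real \<Rightarrow> real" where "flat = flat_poly 1"

lemma flat_simps: "t > 0 \<Longrightarrow> flat t = exp (- (1 / t))" "t \<le> 0 \<Longrightarrow> flat t = 0"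
  by (auto simp: flat_def flat_poly_def)

lemma flat_nonneg: "flat t \<ge> 0" and flat_pos: "flat t > 0 \<longleftrightarrow> t > 0" and flat_le_1: "flat t \<le> 1"
  by (auto simp: flat_def flat_poly_def)

lemma smooth_flat:
  assumes "subspace X" "S \<subseteq> X" "smooth_at_all_orders X S f"
  shows "smooth_at_all_orders X S (\<lambda>x. flat (f x))"
proof -
  define P where "P = (\<lambda>k. ((\<lambda>p :: real poly. monom 1 2 * (p - pderiv p)) ^^ k) 1)"
  have "smooth_at_all_orders X S (\<lambda>x. flat_poly (P 0) (f x))"
    by (rule smooth_at_all_orders_real_comp[where d = "\<lambda>k. flat_poly (P k)" and T = UNIV, OF assms(1,2) _ _ assms(3)])
      (use flat_poly_derivative in \<open>auto simp: P_def\<close>)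
  then show ?thesis by (simp add: P_def flat_def)
qed

lemma flat_derivative: "(flat has_real_derivative flat_poly (monom 1 2) t) (at t)"
  using flat_poly_derivative[of 1 t] by (simp add: flat_def)

text \<open>With s = 1/t this is \<open>s\<^sup>2 exp (- s) \<le> 2\<close>, from the quadratic
  Taylor bound for the exponential.\<close>

lemma flat_derivative_bound: "\<bar>flat_poly (monom 1 2) t\<bar> \<le> 2"
proof (cases "t > 0")
  case True
  have "(1 / t)\<^sup>2 / 2 \<le> exp (1 / t)"
  proof -
    have "0 < 1 / t" using True by simp
    then show ?thesis using exp_lower_Taylor_quadratic[of "1 / t"] by linarith
  qed
  then have "(1 / t)\<^sup>2 * exp (- (1 / t)) \<le> (2 * exp (1 / t)) * exp (- (1 / t))" by (intro mult_right_mono) auto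
  also have "\<dots> = 2" by (simp add: mult.assoc flip: exp_add)
  finally have "(1 / t)\<^sup>2 * exp (- (1 / t)) \<le> 2" .
  then show ?thesis using True by (simp add: flat_poly_def poly_monom abs_mult)
qed (simp add: flat_poly_def)

definition bump :: "real \<Rightarrow> 'a::euclidean_space \<Rightarrow> real" where
  "bump r x = flat (1 - (x \<bullet> x) / r\<^sup>2)"

context
  fixes r :: real
  assumes r: "r > 0"
begin

lemma bump_pos_iff: "bump r x > 0 \<longleftrightarrow> norm x < r"
proof -
  have "bump r x > 0 \<longleftrightarrow> (norm x)\<^sup>2 < r\<^sup>2" using r by (simp add: bump_def flat_pos power2_norm_eq_inner field_simps)
  also have "\<dots> \<longleftrightarrow> norm x < r"
    by (metis less_imp_le norm_ge_zero pos2 power2_less_imp_less power_strict_mono r)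
  finally show ?thesis .
qed

lemma bump_nonneg: "bump r x \<ge> 0" by (simp add: bump_def flat_nonneg)

lemma smooth_bump: "smooth_at_all_orders UNIV UNIV (bump r :: 'a::euclidean_space \<Rightarrow> real)"
proof -
  have "smooth_at_all_orders UNIV UNIV (\<lambda>x :: 'a. flat (1 - (x \<bullet> x) * (1 / r\<^sup>2)))"
    by (intro smooth_flat smooth_at_all_orders_diff smooth_at_all_orders_mult smooth_at_all_orders_const
        smooth_at_all_orders_bilinear[OF bounded_bilinear_inner] smooth_at_all_orders_linear[OF bounded_linear_ident]) auto
  then show ?thesis by (simp add: bump_def[abs_def])
qed

lemma bump_test_function: "(bump r :: 'a::euclidean_space \<Rightarrow> real) \<in> test_functions UNIV"
proof (rule test_functionsI[OF smooth_bump, of "cball 0 r"])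
  fix x :: 'a assume "bump r x \<noteq> 0"
  then show "x \<in> cball 0 r" using bump_nonneg[of x] bump_pos_iff[of x] by simp
qed auto

text \<open>The slope of \<open>flat\<close> is at most 2, and the inner function has a gradient of
  norm at most 2 / r inside the ball. The decay in r is what makes cutoffs of large radius
  harmless.\<close>

lemma bump_gradient_bound: "norm (gradient (bump r) (x :: 'a::euclidean_space)) \<le> 4 / r"
proof -
  let ?g = "flat_poly (monom 1 2) (1 - (x \<bullet> x) / r\<^sup>2)"
  have "(bump r has_derivative (\<lambda>h. ((- (2 * ?g / r\<^sup>2)) *\<^sub>R x) \<bullet> h)) (at x)"
  proof -
    have eq: "bump r = (\<lambda>x :: 'a. flat (1 - (x \<bullet> x) * (1 / r\<^sup>2)))" by (simp add: bump_def[abs_def])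
    have "((\<lambda>x :: 'a. 1 - (x \<bullet> x) * (1 / r\<^sup>2)) has_derivative (\<lambda>h. - (2 * (x \<bullet> h) * (1 / r\<^sup>2)))) (at x)"
      by (rule has_derivative_eq_rhs) (rule derivative_intros refl | simp add: inner_commute)+
    from has_derivative_compose[OF this flat_derivative[of "1 - (x \<bullet> x) * (1 / r\<^sup>2)", unfolded has_field_derivative_def]]
    show ?thesis unfolding eq by (rule has_derivative_eq_rhs) (simp add: fun_eq_iff)
  qed
  then have g: "gradient (bump r) x = (- (2 * ?g / r\<^sup>2)) *\<^sub>R x" by (rule gradient_eqI)
  show ?thesis
  proof (cases "norm x \<le> r")
    case True
    have "norm (gradient (bump r) x) = 2 * \<bar>?g\<bar> / r\<^sup>2 * norm x" by (simp add: g abs_mult)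
    also have "\<dots> \<le> 2 * 2 / r\<^sup>2 * r"
      using True flat_derivative_bound r by (intro mult_mono divide_right_mono) auto
    finally show ?thesis using r by (simp add: power2_eq_square)
  next
    case False
    then have "r\<^sup>2 \<le> (norm x)\<^sup>2" using r by (intro power_mono) auto
    then have "1 - (x \<bullet> x) / r\<^sup>2 \<le> 0" using r by (simp add: power2_norm_eq_inner field_simps)
    then have "?g = 0" by (simp add: flat_poly_def)
    then show ?thesis using r by (simp add: g)
  qed
qed

end

section \<open>Convolution with a test function\<close>

lemma family_has_derivative:
  fixes m :: "'a::real_normed_vector \<Rightarrow> 'a list \<Rightarrow> 'b::real_normed_vector"
  assumes d: "family_derivative UNIV UNIV k m m'" and ml: "bounded_multilinear_on UNIV (Suc k) (m' x)"
    and vs: "length vs = k"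
  shows "((\<lambda>x. m x vs) has_derivative (\<lambda>h. m' x (h # vs))) (at x)"
  unfolding has_derivative_at_alt
proof
  obtain C where C: "C \<ge> 0" "\<And>ws. ws \<in> lists UNIV \<Longrightarrow> length ws = Suc k \<Longrightarrow> norm (m' x ws) \<le> C * prod_list (map norm ws)"
    by (rule bounded_multilinear_on_bound[OF ml]) auto
  show "bounded_linear (\<lambda>h. m' x (h # vs))"
  proof (rule bounded_linear_intro[where K = "C * prod_list (map norm vs)"])
    show "m' x ((u + v) # vs) = m' x (u # vs) + m' x (v # vs)" for u v
      using bounded_multilinear_on_Cons[OF ml, of vs u v 1 1] vs by simp
    show "m' x ((r *\<^sub>R v) # vs) = r *\<^sub>R m' x (v # vs)" for r v
      using bounded_multilinear_on_Cons[OF ml, of vs v v r 0] vs by simp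
    show "norm (m' x (h # vs)) \<le> norm h * (C * prod_list (map norm vs))" for h
      using C(2)[of "h # vs"] vs by (simp add: mult_ac)
  qed
  show "\<forall>e>0. \<exists>d>0. \<forall>y. norm (y - x) < d \<longrightarrow> norm (m y vs - m x vs - m' x ((y - x) # vs)) \<le> e * norm (y - x)"
  proof (intro allI impI)
    fix e :: real assume e: "e > 0"
    define P where "P = prod_list (map norm vs) + 1"
    have P: "P > 0" by (simp add: P_def add_nonneg_pos)
    obtain d where dd: "d > 0" "\<And>y vs. y \<in> UNIV \<Longrightarrow> norm (y - x) < d \<Longrightarrow> vs \<in> lists UNIV \<Longrightarrow> length vs = k \<Longrightarrow>
      norm (m y vs - m x vs - m' x ((y - x) # vs)) \<le> e / P * norm (y - x) * prod_list (map norm vs)"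
      by (rule family_derivativeE[OF d UNIV_I, of "e / P" x]) (use e P in auto)
    show "\<exists>d>0. \<forall>y. norm (y - x) < d \<longrightarrow> norm (m y vs - m x vs - m' x ((y - x) # vs)) \<le> e * norm (y - x)"
    proof (intro exI[of _ d] conjI allI impI)
      fix y assume "norm (y - x) < d"
      then have "norm (m y vs - m x vs - m' x ((y - x) # vs)) \<le> e / P * norm (y - x) * prod_list (map norm vs)"
        using dd(2)[of y vs] vs by simp
      also have "\<dots> \<le> e / P * norm (y - x) * P" using e P by (intro mult_left_mono) (auto simp: P_def)
      also have "\<dots> = e * norm (y - x)" using P by simp
      finally show "norm (m y vs - m x vs - m' x ((y - x) # vs)) \<le> e * norm (y - x)" .
    qed (rule dd)
  qed
qed

lemma family_derivative_restrict:
  "family_derivative X S j m m' \<Longrightarrow> T \<subseteq> S \<Longrightarrow> family_derivative X T j m m'"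
  unfolding family_derivative_def by (meson subsetD)

text \<open>Off the closed support the zero family is a derivative as well, so uniqueness forces all
  derivatives to vanish there. On the compact support the local bounds of each order are patched
  together by a finite cover.\<close>

lemma test_function_family:
  fixes \<phi> :: "'a::euclidean_space \<Rightarrow> real"
  assumes \<phi>: "\<phi> \<in> test_functions UNIV"
  obtains D R B where "\<And>x. D x [] = \<phi> x" "\<And>k x. bounded_multilinear_on UNIV k (D x)"
    "\<And>k. family_derivative UNIV UNIV k D D"
    "\<And>k. B k \<ge> 0" "\<And>x vs. \<bar>D x vs\<bar> \<le> B (length vs) * prod_list (map norm vs) * indicator (cball 0 R) x"
proof -
  let ?S = "closure {x. \<phi> x \<noteq> 0}"
  have "smooth_on UNIV UNIV \<phi>" and S: "compact ?S" using \<phi> by (auto simp: test_functions_def)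
  then obtain D where D: "\<forall>x\<in>UNIV. D x [] = \<phi> x \<and>
        (\<forall>k. bounded_multilinear_on UNIV k (D x) \<and>
           (\<forall>\<epsilon>>0. \<exists>\<delta>>0. \<forall>y\<in>UNIV. norm (y - x) < \<delta> \<longrightarrow>
              (\<forall>vs\<in>lists UNIV. length vs = k \<longrightarrow>
                 norm (D y vs - D x vs - D x ((y - x) # vs))
                   \<le> \<epsilon> * norm (y - x) * prod_list (map norm vs))))"
    unfolding smooth_on_def by (elim exE)
  have D0: "D x [] = \<phi> x" and ml: "bounded_multilinear_on UNIV k (D x)"
    and fd: "family_derivative UNIV UNIV k D D" for x k
    unfolding family_derivative_def using D by simp_all
  have z: "D x vs = 0" if x: "x \<in> - ?S" for x vs
    using x
  proof (induction vs arbitrary: x)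
    case Nil
    then show ?case using D0[of x] closure_subset[of "{x. \<phi> x \<noteq> 0}"] by auto
  next
    case (Cons h vs)
    have zero: "D y ws = 0" if "y \<in> - ?S" "length ws = length vs" for y and ws :: "'a list"
    proof -
      have "\<forall>(ws :: 'a list) y. length ws = n \<longrightarrow> y \<in> - ?S \<longrightarrow> D y ws = 0" if "n \<le> length vs" for n
        using that
      proof (induction n)
        case 0
        have "D y [] = 0" if "y \<in> - ?S" for y
          using that D0[of y] closure_subset[of "{x. \<phi> x \<noteq> 0}"] by auto
        then show ?case by simp
      next
        case (Suc n)
        show ?case
        proof (intro allI impI)
          fix ws :: "'a list" and y assume ws: "length ws = Suc n" and y: "y \<in> - ?S"
          obtain v us where ws': "ws = v # us" "length us = n" using ws by (cases ws) auto
          have "family_derivative UNIV (- ?S) n D D"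
            by (rule family_derivative_restrict[OF fd]) simp
          moreover have "family_derivative UNIV (- ?S) n D (\<lambda>x vs. 0)"
            using Suc by (auto simp: family_derivative_def intro!: exI[of _ 1])
          moreover have "bounded_multilinear_on UNIV (Suc n) (\<lambda>vs. 0)" by (rule bounded_multilinear_on_zero)
          moreover have "openin (top_of_set UNIV) (- ?S)" by (simp add: open_Compl)
          ultimately show "D y ws = 0" unfolding ws'(1)
            by (intro family_derivative_unique[of UNIV "- ?S" n D D "\<lambda>x vs. 0" y v us])
              (use y ml ws' in auto)
        qed
      qed
      then show ?thesis using that by blast
    qed
    have "family_derivative UNIV (- ?S) (length vs) D D" by (rule family_derivative_restrict[OF fd]) simp
    moreover have "family_derivative UNIV (- ?S) (length vs) D (\<lambda>x vs. 0)"
      using zero by (auto simp: family_derivative_def intro!: exI[of _ 1])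
    moreover have "openin (top_of_set UNIV) (- ?S)" by (simp add: open_Compl)
    ultimately show ?case
      by (intro family_derivative_unique[of UNIV "- ?S" "length vs" D D "\<lambda>x vs. 0" x h vs])
        (use Cons.prems ml bounded_multilinear_on_zero in auto)
  qed
  have "\<exists>B\<ge>0. \<forall>x vs. length vs = k \<longrightarrow> \<bar>D x vs\<bar> \<le> B * prod_list (map norm vs)" for k
  proof -
    have "\<exists>\<delta> C. \<delta> > 0 \<and> C \<ge> 0 \<and> (\<forall>y vs. norm (y - x) < \<delta> \<longrightarrow> length vs = k \<longrightarrow> \<bar>D y vs\<bar> \<le> C * prod_list (map norm vs))" for x
    proof -
      obtain \<delta> L where L: "\<delta> > 0" "L \<ge> 0" "\<And>y vs. y \<in> UNIV \<Longrightarrow> norm (y - x) < \<delta> \<Longrightarrow> vs \<in> lists UNIV \<Longrightarrow> length vs = k \<Longrightarrow>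
        norm (D y vs - D x vs) \<le> L * norm (y - x) * prod_list (map norm vs)"
        by (rule family_derivative_lipschitz[OF fd[of k] UNIV_I ml[of "Suc k" x]]) auto
      obtain C where C: "C \<ge> 0" "\<And>vs. vs \<in> lists UNIV \<Longrightarrow> length vs = k \<Longrightarrow> norm (D x vs) \<le> C * prod_list (map norm vs)"
        by (rule bounded_multilinear_on_bound[OF ml[of k x]]) auto
      have "\<bar>D y vs\<bar> \<le> (C + L * \<delta>) * prod_list (map norm vs)" if "norm (y - x) < \<delta>" "length vs = k" for y vs
      proof -
        have "\<bar>D y vs - D x vs\<bar> \<le> L * norm (y - x) * prod_list (map norm vs)" using L(3)[of y vs] that by simp
        also have "\<dots> \<le> L * \<delta> * prod_list (map norm vs)" using that L by (intro mult_right_mono mult_left_mono) auto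
        finally show ?thesis using C(2)[of vs] that by (simp add: distrib_right)
      qed
      then show ?thesis using L C by (intro exI[of _ \<delta>] exI[of _ "C + L * \<delta>"]) simp
    qed
    then obtain \<delta> C where dC: "\<And>x. \<delta> x > 0" "\<And>x. C x \<ge> 0"
      "\<And>x y vs. norm (y - x) < \<delta> x \<Longrightarrow> length vs = k \<Longrightarrow> \<bar>D y vs\<bar> \<le> C x * prod_list (map norm vs)" by metis
    obtain F where F: "F \<subseteq> ?S" "finite F" "?S \<subseteq> (\<Union>x\<in>F. ball x (\<delta> x))"
      by (rule compactE_image[OF S, of ?S "\<lambda>x. ball x (\<delta> x)"]) (use dC(1) in auto)
    have "\<bar>D y vs\<bar> \<le> (\<Sum>x\<in>F. C x) * prod_list (map norm vs)" if "length vs = k" for y vs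
    proof (cases "y \<in> ?S")
      case True
      then obtain x where x: "x \<in> F" "norm (y - x) < \<delta> x" using F by (auto simp: dist_norm norm_minus_commute)
      have "\<bar>D y vs\<bar> \<le> C x * prod_list (map norm vs)" by (rule dC(3)[OF x(2) that])
      also have "\<dots> \<le> (\<Sum>x\<in>F. C x) * prod_list (map norm vs)"
        using x dC(2) F by (intro mult_right_mono member_le_sum) auto
      finally show ?thesis .
    next
      case False
      then show ?thesis using z[of y vs] dC(2) by (simp add: sum_nonneg)
    qed
    then show ?thesis using dC(2) by (intro exI[of _ "\<Sum>x\<in>F. C x"]) (simp add: sum_nonneg)
  qed
  then obtain B where B: "\<And>k. B k \<ge> 0" "\<And>k x vs. length vs = k \<Longrightarrow> \<bar>D x vs\<bar> \<le> B k * prod_list (map norm vs)" by metis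
  obtain R where R: "\<forall>x\<in>?S. norm x \<le> R" using compact_imp_bounded[OF S] by (auto simp: bounded_pos)
  show ?thesis
  proof (rule that[of D B R, OF D0 ml fd B(1)])
    fix x vs
    show "\<bar>D x vs\<bar> \<le> B (length vs) * prod_list (map norm vs) * indicator (cball 0 R) x"
    proof (cases "x \<in> ?S")
      case True
      then show ?thesis using B(2)[of vs "length vs" x] R by simp
    next
      case False
      then show ?thesis using z[of x vs] B(1) by simp
    qed
  qed
qed

lemma bounded_multilinear_on_isometry:
  assumes T: "linear T" "\<And>v. norm (T v) = norm (v :: 'a::real_normed_vector)"
    and m: "bounded_multilinear_on UNIV k m"
  shows "bounded_multilinear_on UNIV k (\<lambda>vs. m (map T vs))"
  unfolding bounded_multilinear_on_def
proof (intro conjI ballI impI allI)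
  have n: "map norm (map T vs) = map norm vs" for vs using T(2) by simp
  obtain C where C: "C \<ge> 0" "\<And>vs. vs \<in> lists UNIV \<Longrightarrow> length vs = k \<Longrightarrow> norm (m vs) \<le> C * prod_list (map norm vs)"
    by (rule bounded_multilinear_on_bound[OF m]) auto
  show "\<exists>C. \<forall>vs\<in>lists UNIV. length vs = k \<longrightarrow> norm (m (map T vs)) \<le> C * prod_list (map norm vs)"
    using C(2)[of "map T _"] unfolding n by (intro exI[of _ C]) simp
  fix vs :: "'a list" and i and x y :: 'a and a b :: real
  assume "length vs = k" "i < k"
  then show "m (map T (vs[i := a *\<^sub>R x + b *\<^sub>R y])) = a *\<^sub>R m (map T (vs[i := x])) + b *\<^sub>R m (map T (vs[i := y]))"
    using bounded_multilinear_on_update[OF m, of "map T vs" i "T x" "T y" a b] T(1)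
    by (simp add: map_update linear_add linear_scale)
qed

text \<open>An affine isometry acts on the base point and on all directions at once, and leaves the
  products of norms unchanged. This serves rotations and the reflection \<open>x - y\<close> in
  convolutions.\<close>

lemma smooth_family_isometry:
  assumes T: "linear T" "\<And>v. norm (T v) = norm (v :: 'a::real_normed_vector)"
  shows "smooth_family r UNIV UNIV k m \<Longrightarrow> smooth_family r UNIV UNIV k (\<lambda>x vs. m (a + T x) (map T vs))"
proof (induction r arbitrary: k m)
  case 0
  then show ?case by (auto intro!: bounded_multilinear_on_isometry[OF T])
next
  case (Suc r)
  then obtain m' where m': "family_derivative UNIV UNIV k m m'" "smooth_family r UNIV UNIV (Suc k) m'" by auto
  have n: "map norm (map T vs) = map norm vs" for vs using T(2) by simp
  have "family_derivative UNIV UNIV k (\<lambda>x vs. m (a + T x) (map T vs)) (\<lambda>x vs. m' (a + T x) (map T vs))"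
    unfolding family_derivative_def
  proof (intro ballI allI impI)
    fix x and \<epsilon> :: real assume "\<epsilon> > 0"
    obtain d where d: "d > 0" "\<And>y vs. y \<in> UNIV \<Longrightarrow> norm (y - (a + T x)) < d \<Longrightarrow> vs \<in> lists UNIV \<Longrightarrow> length vs = k \<Longrightarrow>
      norm (m y vs - m (a + T x) vs - m' (a + T x) ((y - (a + T x)) # vs)) \<le> \<epsilon> * norm (y - (a + T x)) * prod_list (map norm vs)"
      by (rule family_derivativeE[OF m'(1) UNIV_I \<open>\<epsilon> > 0\<close>]) auto
    have e: "a + T y - (a + T x) = T (y - x)" for y using T(1) by (simp add: linear_diff)
    show "\<exists>\<delta>>0. \<forall>y\<in>UNIV. norm (y - x) < \<delta> \<longrightarrow> (\<forall>vs\<in>lists UNIV. length vs = k \<longrightarrow>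
       norm (m (a + T y) (map T vs) - m (a + T x) (map T vs) - m' (a + T x) (map T ((y - x) # vs)))
       \<le> \<epsilon> * norm (y - x) * prod_list (map norm vs))"
      using d(2)[of "a + T _" "map T _"] unfolding e n T(2) by (intro exI[of _ d]) (simp add: d(1))
  qed
  moreover have "bounded_multilinear_on UNIV k (\<lambda>vs. m (a + T x) (map T vs))" for x
    by (rule bounded_multilinear_on_isometry[OF T smooth_family_multilinear[OF Suc.prems UNIV_I]])
  ultimately show ?case using Suc.IH[OF m'(2)] by auto
qed

lemma test_function_isometry:
  fixes \<phi> :: "'a::euclidean_space \<Rightarrow> real"
  assumes T: "linear T" "\<And>v. norm (T v) = norm v" and \<phi>: "\<phi> \<in> test_functions UNIV"
  shows "(\<lambda>x. \<phi> (a + T x)) \<in> test_functions UNIV"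
    "gradient (\<lambda>x. \<phi> (a + T x)) x \<bullet> h = gradient \<phi> (a + T x) \<bullet> T h"
proof -
  have s: "smooth_at_all_orders UNIV UNIV (\<lambda>x. \<phi> (a + T x))"
    using test_function_smooth[OF \<phi>] unfolding smooth_at_all_orders_def
    by (intro allI smooth_family_isometry[OF T]) simp
  obtain B R where B: "B \<ge> 0" "R \<ge> 0" "\<And>x. \<bar>\<phi> x\<bar> \<le> B * indicator (cball 0 R) x"
    "\<And>x. norm (gradient \<phi> x) \<le> B * indicator (cball 0 R) x"
    by (rule test_function_bounds[OF \<phi>]) auto
  show t: "(\<lambda>x. \<phi> (a + T x)) \<in> test_functions UNIV"
  proof (rule test_functionsI[OF s, of "cball 0 (R + norm a)"])
    fix x assume "\<phi> (a + T x) \<noteq> 0"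
    then have "norm (a + T x) \<le> R" using B(3)[of "a + T x"] by (cases "norm (a + T x) \<le> R") auto
    moreover have "norm (T x) \<le> norm (a + T x) + norm a" using norm_triangle_ineq4[of "a + T x" a] by simp
    ultimately show "x \<in> cball 0 (R + norm a)" by (simp add: T(2))
  qed auto
  have "((\<lambda>x. a + T x) has_derivative T) (at x)"
    using linear_conv_bounded_linear[of T] T(1) by (auto intro!: derivative_eq_intros bounded_linear_imp_has_derivative)
  from has_derivative_compose[OF this test_function_derivative[OF \<phi>]]
  have "((\<lambda>x. \<phi> (a + T x)) has_derivative (\<lambda>h. gradient \<phi> (a + T x) \<bullet> T h)) (at x)" .
  from has_derivative_unique[OF test_function_derivative[OF t] this]
  show "gradient (\<lambda>x. \<phi> (a + T x)) x \<bullet> h = gradient \<phi> (a + T x) \<bullet> T h" by (rule fun_cong)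
qed

lemma test_function_reflect:
  fixes \<phi> :: "'a::euclidean_space \<Rightarrow> real"
  assumes "\<phi> \<in> test_functions UNIV"
  shows "(\<lambda>y. \<phi> (x - y)) \<in> test_functions UNIV" "gradient (\<lambda>y. \<phi> (x - y)) y = - gradient \<phi> (x - y)"
proof -
  have l: "linear (uminus :: 'a \<Rightarrow> 'a)" by (simp add: linear_iff)
  note t = test_function_isometry[OF l _ assms, of x, simplified]
  show "(\<lambda>y. \<phi> (x - y)) \<in> test_functions UNIV" by (rule t(1))
  show "gradient (\<lambda>y. \<phi> (x - y)) y = - gradient \<phi> (x - y)"
    by (rule vector_eq_rdot[THEN iffD1]) (simp add: t(2))
qed

definition mollify :: "('a::euclidean_space \<Rightarrow> real) \<Rightarrow> ('a \<Rightarrow> 'b::euclidean_space) \<Rightarrow> 'a \<Rightarrow> 'b" where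
  "mollify \<rho> w x = (LINT y|lborel. \<rho> (x - y) *\<^sub>R w y)"

text \<open>Each derivative of the convolution is the convolution with the corresponding derivative
  of \<rho>. Taylor remainders of \<rho> that are uniform and supported in a fixed ball turn
  differentiation under the integral into a direct estimate.\<close>

lemma smooth_mollify:
  fixes w :: "'a::euclidean_space \<Rightarrow> real"
  assumes \<rho>: "\<rho> \<in> test_functions UNIV" and w: "square_integrable w"
  shows "smooth_at_all_orders UNIV UNIV (mollify \<rho> w)"
    "gradient (mollify \<rho> w) x \<bullet> h = (LINT y|lborel. (gradient \<rho> (x - y) \<bullet> h) * w y)"
proof -
  note [measurable] = square_integrable_measurable[OF w]
  obtain D R B where D: "\<And>x. D x [] = \<rho> x" "\<And>k x. bounded_multilinear_on UNIV k (D x)"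
    "\<And>k. family_derivative UNIV UNIV k D D" and B0: "\<And>k. B k \<ge> 0"
    and B: "\<And>x vs. \<bar>D x vs\<bar> \<le> B (length vs) * prod_list (map norm vs) * indicator (cball 0 R) x"
    by (rule test_function_family[OF \<rho>]) auto
  let ?P = "\<lambda>vs :: 'a list. prod_list (map norm vs)"
  have Dder: "((\<lambda>x. D x vs) has_derivative (\<lambda>h. D x (h # vs))) (at x)" for x vs
    by (rule family_has_derivative[OF D(3) D(2) refl])
  have B': "\<bar>D x vs\<bar> \<le> B (length vs) * ?P vs" for x vs
    using B[of x vs] B0[of "length vs"] by (cases "x \<in> cball 0 R") auto
  have cont: "continuous_on UNIV (\<lambda>x. D x vs)" for vs
    using Dder by (intro continuous_at_imp_continuous_on ballI) (blast intro: has_derivative_continuous)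
  have [measurable]: "(\<lambda>x. D x vs) \<in> borel_measurable borel" for vs
    by (rule borel_measurable_continuous_onI[OF cont])
  have lip: "\<bar>D x vs - D y vs\<bar> \<le> B (Suc (length vs)) * ?P vs * norm (x - y)" for x y vs
  proof -
    have "norm (D x vs - D y vs) \<le> B (Suc (length vs)) * ?P vs * norm (x - y)"
    proof (rule differentiable_bound[of UNIV "\<lambda>x. D x vs" "\<lambda>x h. D x (h # vs)"])
      fix z
      show "onorm (\<lambda>h. D z (h # vs)) \<le> B (Suc (length vs)) * ?P vs"
        by (rule onorm_bound) (use B'[of z "_ # vs"] B0 in \<open>auto simp: mult_ac\<close>)
    qed (use Dder in auto)
    then show ?thesis by simp
  qed
  \<comment> \<open>Second-order remainder; the ball is enlarged by 1 because h has norm at most 1,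
    and outside of it all three terms vanish.\<close>
  have rem: "\<bar>D (z + h) vs - D z vs - D z (h # vs)\<bar> \<le> B (Suc (Suc (length vs))) * (norm h)\<^sup>2 * ?P vs * indicator (cball 0 (R + 1)) z"
    if h: "norm h \<le> 1" for z h vs
  proof (cases "z \<in> cball 0 (R + 1)")
    case True
    let ?S = "cball z (norm h)"
    have "norm (D (z + h) vs - D z vs - D z ((z + h - z) # vs)) \<le> norm (z + h - z) * (B (Suc (Suc (length vs))) * norm h * ?P vs)"
    proof (rule differentiable_bound_linearization[of z "z + h" ?S "\<lambda>x. D x vs" "\<lambda>x v. D x (v # vs)"])
      show "z + t *\<^sub>R (z + h - z) \<in> ?S" if "t \<in> {0..1}" for t
        using that mult_right_mono[of t 1 "norm h"] by (simp add: dist_norm)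
      show "((\<lambda>x. D x vs) has_derivative (\<lambda>v. D x (v # vs))) (at x within ?S)" for x
        by (rule has_derivative_at_withinI[OF Dder])
      fix x assume x: "x \<in> ?S"
      show "onorm ((\<lambda>v. D x (v # vs)) - (\<lambda>v. D z (v # vs))) \<le> B (Suc (Suc (length vs))) * norm h * ?P vs"
      proof (rule onorm_bound)
        fix v
        have "\<bar>D x (v # vs) - D z (v # vs)\<bar> \<le> B (Suc (Suc (length vs))) * (norm v * ?P vs) * norm (x - z)"
          using lip[of x "v # vs" z] by simp
        also have "\<dots> \<le> B (Suc (Suc (length vs))) * (norm v * ?P vs) * norm h"
          using x B0 by (intro mult_left_mono) (auto simp: dist_norm norm_minus_commute)
        finally show "norm (((\<lambda>v. D x (v # vs)) - (\<lambda>v. D z (v # vs))) v) \<le> B (Suc (Suc (length vs))) * norm h * ?P vs * norm v"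
          by (simp add: mult_ac)
      qed (use B0 in auto)
    qed simp
    then show ?thesis using True by (simp add: power2_eq_square mult_ac)
  next
    case False
    have "norm z \<le> norm (z + h) + norm h" using norm_triangle_ineq4[of "z + h" h] by simp
    then have "z \<notin> cball 0 R" "z + h \<notin> cball 0 R" using False h by auto
    then have "D (z + h) vs = 0" "D z vs = 0" "D z (h # vs) = 0" using B[of "z + h" vs] B[of z vs] B[of z "h # vs"] by auto
    then show ?thesis using B0 by simp
  qed
  \<comment> \<open>\<open>E\<close> is the candidate tower of derivatives; \<open>K x\<close> is
    the mass of \<open>|w|\<close> near x by which all pointwise bounds are multiplied.\<close>
  define E where "E = (\<lambda>x vs. LINT y|lborel. D (x - y) vs * w y)"
  define K where "K = (\<lambda>x. LINT y|lborel. indicator (cball 0 (R + 1)) (x - y) * \<bar>w y\<bar>)"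
  have wabs: "square_integrable (\<lambda>y. \<bar>w y\<bar>)" using w by (simp add: square_integrable_def)
  have cb: "indicator (cball 0 R') (x - y) \<le> (indicator (cball 0 (R' + norm x)) y :: real)" for x y :: 'a and R'
  proof -
    have "norm y \<le> norm (x - y) + norm x" using norm_triangle_ineq4[of x "x - y"] by (simp add: add.commute)
    then show ?thesis by (auto simp: indicator_def)
  qed
  have sqI: "square_integrable (\<lambda>y. indicator (cball 0 (R + 1)) (x - y) :: real)" for x :: 'a
  proof (rule bounded_support_square_integrable(1)[of _ 1 "R + 1 + norm x"])
    show "(\<lambda>y. indicator (cball 0 (R + 1)) (x - y) :: real) \<in> borel_measurable borel"
      by (rule measurable_compose[of "\<lambda>y. x - y" borel borel "indicator (cball 0 (R + 1))"]) (auto intro!: borel_measurable_indicator)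
  qed (use cb in auto)
  have sqD: "square_integrable (\<lambda>y. D (x - y) vs)" for x vs
  proof (rule bounded_support_square_integrable(1)[of _ "B (length vs) * ?P vs" "R + norm x"])
    show "norm (D (x - y) vs) \<le> B (length vs) * ?P vs * indicator (cball 0 (R + norm x)) y" for y
    proof -
      have "\<bar>D (x - y) vs\<bar> \<le> B (length vs) * ?P vs * indicator (cball 0 R) (x - y)" by (rule B)
      also have "\<dots> \<le> B (length vs) * ?P vs * indicator (cball 0 (R + norm x)) y"
        using B0 cb by (intro mult_left_mono) auto
      finally show ?thesis by simp
    qed
  qed measurable
  have int: "integrable lborel (\<lambda>y. D (x - y) vs * w y)" for x vs
    using integrable_inner_square_integrable[OF sqD[of x vs] w] by simp
  have intK: "integrable lborel (\<lambda>y. indicator (cball 0 (R + 1)) (x - y) * \<bar>w y\<bar>)" for x :: 'a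
    using integrable_inner_square_integrable[OF sqI[of x] wabs] by simp
  have K0: "K x \<ge> 0" for x unfolding K_def by (rule integral_nonneg_AE) auto
  have est: "\<bar>LINT y|lborel. f y * w y\<bar> \<le> c * K x"
    if f: "\<And>y. \<bar>f y\<bar> \<le> c * indicator (cball 0 (R + 1)) (x - y)" and i: "integrable lborel (\<lambda>y. f y * w y)" for f c x
  proof -
    have "\<bar>LINT y|lborel. f y * w y\<bar> \<le> (LINT y|lborel. \<bar>f y * w y\<bar>)" by (rule integral_abs_bound)
    also have "\<dots> \<le> (LINT y|lborel. c * (indicator (cball 0 (R + 1)) (x - y) * \<bar>w y\<bar>))"
    proof (rule integral_mono)
      show "integrable lborel (\<lambda>y. \<bar>f y * w y\<bar>)" using i by (rule integrable_abs)
      show "integrable lborel (\<lambda>y. c * (indicator (cball 0 (R + 1)) (x - y) * \<bar>w y\<bar>))"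
        by (rule integrable_mult_right[OF intK])
      show "\<bar>f y * w y\<bar> \<le> c * (indicator (cball 0 (R + 1)) (x - y) * \<bar>w y\<bar>)" for y
        unfolding abs_mult mult.assoc[symmetric] by (intro mult_right_mono f) simp
    qed
    also have "\<dots> = c * K x" by (simp add: K_def)
    finally show ?thesis .
  qed
  have lin: "D z (vs[i := a *\<^sub>R u + b *\<^sub>R v]) = a * D z (vs[i := u]) + b * D z (vs[i := v])"
    if "i < length vs" for z vs i u v and a b :: real
    using bounded_multilinear_on_update[OF D(2)[of "length vs" z], of vs i u v a b] that by simp
  have mlE: "bounded_multilinear_on UNIV k (E x)" for k x
    unfolding bounded_multilinear_on_def
  proof (intro conjI ballI impI allI)
    show "\<exists>C. \<forall>vs\<in>lists UNIV. length vs = k \<longrightarrow> norm (E x vs) \<le> C * ?P vs"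
    proof (intro exI[of _ "B k * K x"] ballI impI)
      fix vs :: "'a list" assume vs: "length vs = k"
      have "\<bar>E x vs\<bar> \<le> (B k * ?P vs) * K x"
        unfolding E_def
      proof (rule est[OF _ int])
        fix y
        have "\<bar>D (x - y) vs\<bar> \<le> B k * ?P vs * indicator (cball 0 R) (x - y)" using B[of "x - y" vs] vs by simp
        also have "\<dots> \<le> B k * ?P vs * indicator (cball 0 (R + 1)) (x - y)"
          using B0 by (intro mult_left_mono) (auto simp: indicator_def)
        finally show "\<bar>D (x - y) vs\<bar> \<le> B k * ?P vs * indicator (cball 0 (R + 1)) (x - y)" .
      qed
      then show "norm (E x vs) \<le> B k * K x * ?P vs" by (simp add: mult_ac)
    qed
    fix vs :: "'a list" and i and u v :: 'a and a b :: real
    assume "length vs = k" "i < k"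
    then have "i < length vs" by simp
    then show "E x (vs[i := a *\<^sub>R u + b *\<^sub>R v]) = a *\<^sub>R E x (vs[i := u]) + b *\<^sub>R E x (vs[i := v])"
      unfolding E_def using int[of x "vs[i := u]"] int[of x "vs[i := v]"]
      by (simp add: lin distrib_right mult.assoc)
  qed
  have fdE: "family_derivative UNIV UNIV k E E" for k
    unfolding family_derivative_def
  proof (intro ballI allI impI)
    fix x and \<epsilon> :: real assume \<epsilon>: "\<epsilon> > 0"
    define q where "q = B (Suc (Suc k)) * K x + 1"
    have q: "q > 0" using B0 K0 by (auto simp: q_def intro!: add_nonneg_pos)
    show "\<exists>\<delta>>0. \<forall>y\<in>UNIV. norm (y - x) < \<delta> \<longrightarrow> (\<forall>vs\<in>lists UNIV. length vs = k \<longrightarrow>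
      norm (E y vs - E x vs - E x ((y - x) # vs)) \<le> \<epsilon> * norm (y - x) * ?P vs)"
    proof (intro exI[of _ "min 1 (\<epsilon> / q)"] conjI ballI impI)
      fix x' and vs :: "'a list" assume h: "norm (x' - x) < min 1 (\<epsilon> / q)" and vs: "length vs = k"
      define h where "h = x' - x"
      have h1: "norm h \<le> 1" "norm h * q \<le> \<epsilon>" using h q by (auto simp: h_def field_simps)
      have x': "x' = x + h" by (simp add: h_def)
      have "E x' vs - E x vs - E x (h # vs) = (LINT y|lborel. (D (x - y + h) vs - D (x - y) vs - D (x - y) (h # vs)) * w y)"
        unfolding E_def x' using int[of x vs] int[of "x + h" vs] int[of x "h # vs"]
        by (simp add: left_diff_distrib add_diff_eq diff_add_eq)
      also have "\<bar>\<dots>\<bar> \<le> (B (Suc (Suc k)) * (norm h)\<^sup>2 * ?P vs) * K x"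
      proof (rule est)
        show "\<bar>D (x - y + h) vs - D (x - y) vs - D (x - y) (h # vs)\<bar> \<le> B (Suc (Suc k)) * (norm h)\<^sup>2 * ?P vs * indicator (cball 0 (R + 1)) (x - y)" for y
          using rem[OF h1(1), of "x - y" vs] vs by simp
        show "integrable lborel (\<lambda>y. (D (x - y + h) vs - D (x - y) vs - D (x - y) (h # vs)) * w y)"
          using int[of x vs] int[of "x + h" vs] int[of x "h # vs"]
          by (simp add: left_diff_distrib add_diff_eq diff_add_eq)
      qed
      also have "\<dots> = (B (Suc (Suc k)) * K x) * norm h * (norm h * ?P vs)" by (simp add: power2_eq_square mult_ac)
      also have "\<dots> \<le> (q * norm h) * (norm h * ?P vs)" by (intro mult_right_mono) (auto simp: q_def)
      also have "\<dots> \<le> \<epsilon> * (norm h * ?P vs)" using h1 by (intro mult_right_mono) (auto simp: mult.commute)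
      finally show "norm (E x' vs - E x vs - E x ((x' - x) # vs)) \<le> \<epsilon> * norm (x' - x) * ?P vs"
        by (simp add: h_def mult.assoc)
    qed (use \<epsilon> q in auto)
  qed
  have E0: "E x [] = mollify \<rho> w x" for x by (simp add: E_def D(1) mollify_def)
  have "smooth_on UNIV UNIV (mollify \<rho> w)"
    unfolding smooth_on_def
    by (intro exI[of _ E] ballI conjI allI impI E0 mlE) (use fdE[unfolded family_derivative_def] in blast)
  then show s: "smooth_at_all_orders UNIV UNIV (mollify \<rho> w)" by (simp add: smooth_on_UNIV_iff)
  have "((\<lambda>x. E x []) has_derivative (\<lambda>h. E x [h])) (at x)"
    by (rule family_has_derivative[OF fdE mlE]) simp
  then have "(mollify \<rho> w has_derivative (\<lambda>h. E x [h])) (at x)" by (simp add: E0)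
  from has_derivative_unique[OF smooth_gradient(1)[OF s] this]
  have 1: "gradient (mollify \<rho> w) x \<bullet> h = E x [h]" by (rule fun_cong)
  have "((\<lambda>x. D x []) has_derivative (\<lambda>h. D z [h])) (at z)" for z by (rule Dder)
  then have "(\<rho> has_derivative (\<lambda>h. D z [h])) (at z)" for z by (simp add: D(1))
  then have "gradient \<rho> z \<bullet> h = D z [h]" for z
    by (rule fun_cong[OF has_derivative_unique[OF test_function_derivative[OF \<rho>]]])
  then show "gradient (mollify \<rho> w) x \<bullet> h = (LINT y|lborel. (gradient \<rho> (x - y) \<bullet> h) * w y)"
    by (simp add: 1 E_def)
qed

section \<open>Density of test functions\<close>

lemma smooth_exp:
  assumes "subspace X" "S \<subseteq> X" "smooth_at_all_orders X S f"
  shows "smooth_at_all_orders X S (\<lambda>x. exp (- f x :: real))"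
proof -
  have "smooth_at_all_orders X S (\<lambda>x. (-1) ^ 0 * exp (- f x))"
    by (rule smooth_at_all_orders_real_comp[where d = "\<lambda>k t. (-1) ^ k * exp (- t)" and T = UNIV and k = 0, OF assms(1,2) _ _ assms(3)])
      (auto intro!: derivative_eq_intros)
  then show ?thesis by simp
qed

text \<open>The indicator of the box is a pointwise limit of test functions that it dominates, so
  the orthogonality relation passes to the limit.\<close>

lemma box_integral_zero:
  fixes u :: "('a::euclidean_space, real) L2"
  assumes u: "\<And>\<phi>. \<phi> \<in> test_functions UNIV \<Longrightarrow> u \<bullet> class_of \<phi> = 0"
  shows "(LINT x|lborel. indicator (box a b) x * fun_of u x) = 0"
proof -
  define p where "p = (\<lambda>x. \<Prod>i\<in>Basis. flat (x \<bullet> i - a \<bullet> i) * flat (b \<bullet> i - x \<bullet> i))"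
  have ps: "smooth_at_all_orders UNIV UNIV p"
    unfolding p_def
    by (intro smooth_at_all_orders_prod smooth_at_all_orders_mult smooth_flat smooth_at_all_orders_diff
        smooth_at_all_orders_const smooth_at_all_orders_linear bounded_linear_inner_left) auto
  have p_pos: "p x > 0" if "x \<in> box a b" for x
    using that unfolding p_def by (intro prod_pos) (auto simp: mem_box flat_pos)
  have p_zero: "p x = 0" if "x \<notin> box a b" for x
  proof -
    have "\<exists>i\<in>Basis. x \<bullet> i \<le> a \<bullet> i \<or> b \<bullet> i \<le> x \<bullet> i" using that by (auto simp: mem_box not_less)
    then obtain i where "i \<in> Basis" "x \<bullet> i \<le> a \<bullet> i \<or> b \<bullet> i \<le> x \<bullet> i" by blast
    then show ?thesis unfolding p_def by (intro prod_zero) (auto intro!: bexI[of _ i] simp: flat_simps)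
  qed
  \<comment> \<open>p is positive in the box and 0 elsewhere, hence \<open>1 - exp (- n p)\<close>
    tends to the indicator and is supported in the closed box.\<close>
  define \<phi> where "\<phi> = (\<lambda>n x. 1 - exp (- (real n * p x)))"
  have \<phi>0: "\<phi> n x = 0" if "x \<notin> box a b" for n x using p_zero[OF that] by (simp add: \<phi>_def)
  have p0: "p x \<ge> 0" for x using p_pos[of x] p_zero[of x] by (cases "x \<in> box a b") auto
  have \<phi>t: "\<phi> n \<in> test_functions UNIV" for n
  proof (rule test_functionsI[of _ "cbox a b"])
    show "smooth_at_all_orders UNIV UNIV (\<phi> n)" unfolding \<phi>_def
      by (intro smooth_at_all_orders_diff smooth_exp smooth_at_all_orders_mult smooth_at_all_orders_const ps) auto
    show "x \<in> cbox a b" if "\<phi> n x \<noteq> 0" for x using that \<phi>0[of x n] box_subset_cbox by (cases "x \<in> box a b") auto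
  qed auto
  have \<phi>b: "\<bar>\<phi> n x\<bar> \<le> indicator (box a b) x" for n x
    using p0[of x] \<phi>0[of x n] by (cases "x \<in> box a b") (auto simp: \<phi>_def)
  note [measurable] = test_function_measurable(1)[OF \<phi>t]
  have sqb: "square_integrable (indicator (box a b) :: 'a \<Rightarrow> real)"
    by (rule square_integrable_indicator) (simp, rule emeasure_bounded_finite, rule bounded_box)
  have "(\<lambda>n. LINT x|lborel. fun_of u x \<bullet> \<phi> n x) \<longlonglongrightarrow> (LINT x|lborel. indicator (box a b) x * fun_of u x)"
  proof (rule integral_dominated_convergence[where w = "\<lambda>x. \<bar>fun_of u x * indicator (box a b) x\<bar>"])
    show "integrable lborel (\<lambda>x. \<bar>fun_of u x * indicator (box a b) x\<bar>)"
      using integrable_inner_square_integrable[OF square_integrable_fun_of[of u] sqb] by simp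
    show "AE x in lborel. (\<lambda>n. fun_of u x \<bullet> \<phi> n x) \<longlonglongrightarrow> indicator (box a b) x * fun_of u x"
    proof (rule AE_I2)
      fix x
      have "(\<lambda>n. \<phi> n x) \<longlonglongrightarrow> indicator (box a b) x"
      proof (cases "x \<in> box a b")
        case True
        have "(\<lambda>n. exp (- p x) ^ n) \<longlonglongrightarrow> 0" using p_pos[OF True] by (intro LIMSEQ_power_zero) simp
        then have "(\<lambda>n. 1 - exp (- p x) ^ n) \<longlonglongrightarrow> 1 - 0" by (rule tendsto_diff[OF tendsto_const])
        then show ?thesis using True by (simp add: \<phi>_def exp_of_nat_mult[symmetric])
      qed (simp add: \<phi>0)
      then have "(\<lambda>n. fun_of u x * \<phi> n x) \<longlonglongrightarrow> fun_of u x * indicator (box a b) x" by (intro tendsto_intros)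
      then show "(\<lambda>n. fun_of u x \<bullet> \<phi> n x) \<longlonglongrightarrow> indicator (box a b) x * fun_of u x" by (simp add: mult.commute)
    qed
    show "AE x in lborel. norm (fun_of u x \<bullet> \<phi> n x) \<le> \<bar>fun_of u x * indicator (box a b) x\<bar>" for n
      using \<phi>b[of n] by (intro AE_I2) (auto simp: abs_mult intro!: mult_left_mono)
  qed measurable
  moreover have "(LINT x|lborel. fun_of u x \<bullet> \<phi> n x) = 0" for n
    using u[OF \<phi>t[of n]] inner_class_of[OF test_function_integrable(1)[OF \<phi>t[of n]], of u] by simp
  ultimately show ?thesis by (simp add: LIMSEQ_const_iff)
qed

text \<open>The positive and the negative part of u are densities of measures that agree on all
  boxes. These generate the Borel sets, are stable under intersection and exhaust the space, so the
  two parts coincide and u vanishes.\<close>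

lemma orthogonal_test_functions_zero:
  fixes u :: "('a::euclidean_space, real) L2"
  assumes u: "\<And>\<phi>. \<phi> \<in> test_functions UNIV \<Longrightarrow> u \<bullet> class_of \<phi> = 0"
  shows "u = 0"
proof -
  let ?g = "fun_of u"
  have fin: "(\<integral>\<^sup>+x. ennreal (?g x) * indicator (box a b) x \<partial>lborel) = (\<integral>\<^sup>+x. ennreal (- ?g x) * indicator (box a b) x \<partial>lborel)
     \<and> (\<integral>\<^sup>+x. ennreal (?g x) * indicator (box a b) x \<partial>lborel) \<noteq> \<infinity>" for a b :: 'a
  proof -
    let ?h = "\<lambda>x. indicator (box a b) x * ?g x"
    have sqb: "square_integrable (indicator (box a b) :: 'a \<Rightarrow> real)"
      by (rule square_integrable_indicator) (simp, rule emeasure_bounded_finite, rule bounded_box)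
    have i: "integrable lborel ?h"
      using integrable_inner_square_integrable[OF sqb square_integrable_fun_of[of u]] by simp
    have "(\<integral>\<^sup>+x. ennreal (?g x) * indicator (box a b) x \<partial>lborel) = (\<integral>\<^sup>+x. ennreal (?h x) \<partial>lborel)"
      "(\<integral>\<^sup>+x. ennreal (- ?g x) * indicator (box a b) x \<partial>lborel) = (\<integral>\<^sup>+x. ennreal (- ?h x) \<partial>lborel)"
      by (auto intro!: nn_integral_cong simp: indicator_def)
    moreover have "(\<integral>\<^sup>+x. ennreal (?h x) \<partial>lborel) \<noteq> \<infinity>" "(\<integral>\<^sup>+x. ennreal (- ?h x) \<partial>lborel) \<noteq> \<infinity>"
      using i by (auto simp: real_integrable_def)
    moreover have "enn2real (\<integral>\<^sup>+x. ennreal (?h x) \<partial>lborel) = enn2real (\<integral>\<^sup>+x. ennreal (- ?h x) \<partial>lborel)"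
      using box_integral_zero[OF u, of a b] i by (simp add: real_lebesgue_integral_def)
    moreover have "a = b" if "enn2real a = enn2real b" "a \<noteq> \<infinity>" "b \<noteq> \<infinity>" for a b
      using that by (cases a; cases b) auto
    ultimately show ?thesis by simp
  qed
  have "density lborel (\<lambda>x. ennreal (?g x)) = density lborel (\<lambda>x. ennreal (- ?g x))"
  proof (rule measure_eqI_generator_eq)
    let ?E = "range (\<lambda>(a, b). box a b :: 'a set)"
    show "Int_stable ?E" by (auto simp: Int_stable_def box_Int_box)
    show "?E \<subseteq> Pow UNIV" "sets (density lborel (\<lambda>x. ennreal (?g x))) = sigma_sets UNIV ?E"
      "sets (density lborel (\<lambda>x. ennreal (- ?g x))) = sigma_sets UNIV ?E"
      by (simp_all add: borel_eq_box)
    let ?A = "\<lambda>n::nat. box (- (real n *\<^sub>R One)) (real n *\<^sub>R One) :: 'a set"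
    show "range ?A \<subseteq> ?E" "(\<Union>i. ?A i) = UNIV" unfolding UN_box_eq_UNIV by auto
    show "emeasure (density lborel (\<lambda>x. ennreal (?g x))) (?A i) \<noteq> \<infinity>" for i
      using fin[THEN conjunct2] by (simp add: emeasure_density)
    show "emeasure (density lborel (\<lambda>x. ennreal (?g x))) X = emeasure (density lborel (\<lambda>x. ennreal (- ?g x))) X" if "X \<in> ?E" for X
    proof -
      obtain a b where "X = box a b" using \<open>X \<in> ?E\<close> by auto
      then show ?thesis using fin[of a b] by (simp add: emeasure_density)
    qed
  qed
  then have "AE x in lborel. ennreal (?g x) = ennreal (- ?g x)"
    by (subst (asm) sigma_finite_measure.density_unique_iff[OF sigma_finite_lborel]) auto
  moreover have "AE x in lborel. fun_of (0 :: ('a, real) L2) x = 0" by (rule fun_of_zero)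
  ultimately have "AE x in lborel. ?g x = fun_of 0 x"
  proof eventually_elim
    case (elim x)
    then show ?case by (cases "?g x \<ge> 0"; cases "?g x = 0") (auto simp: ennreal_neg ennreal_eq_0_iff)
  qed
  then show ?thesis by (simp add: L2_eq_iff)
qed

text \<open>The u with this property form a closed subspace, because translations are isometries,
  and it contains the test functions. The difference of u and its projection is orthogonal to all
  test functions, hence zero.\<close>

lemma translation_continuous:
  fixes u :: "('a::euclidean_space, real) L2"
  shows "((\<lambda>z. L2_comp (\<lambda>x. x + z) u) \<longlongrightarrow> u) (at 0)"
proof -
  let ?T = "\<lambda>z. L2_comp (\<lambda>x. x + z) :: ('a, real) L2 \<Rightarrow> ('a, real) L2"
  note mp = measure_preserving_translation
  define C where "C = {u. ((\<lambda>z. ?T z u) \<longlongrightarrow> u) (at 0)}"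
  have sub: "subspace C"
    unfolding subspace_def C_def mem_Collect_eq
  proof (intro conjI ballI allI impI)
    show "((\<lambda>z. ?T z 0) \<longlongrightarrow> 0) (at 0)" by (simp add: linear_0[OF bounded_linear.linear[OF bounded_linear_L2_comp[OF mp]]])
  qed (auto simp: L2_comp_add[OF mp] L2_comp_scaleR[OF mp] intro!: tendsto_intros)
  have cl: "closed C"
    unfolding closed_sequential_limits
  proof (intro allI impI, elim conjE)
    fix x l assume x: "\<forall>n. x n \<in> C" "x \<longlonglongrightarrow> l"
    show "l \<in> C"
      unfolding C_def mem_Collect_eq
    proof (rule tendstoI)
      fix e :: real assume e: "e > 0"
      obtain n where n: "dist (x n) l < e / 3" using metric_LIMSEQ_D[OF x(2), of "e / 3"] e by auto
      have "\<forall>\<^sub>F z in at 0. dist (?T z (x n)) (x n) < e / 3"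
        using x(1) e unfolding C_def by (intro tendstoD) auto
      then show "\<forall>\<^sub>F z in at 0. dist (?T z l) l < e"
      proof (rule eventually_mono)
        fix z assume z: "dist (?T z (x n)) (x n) < e / 3"
        have "dist (?T z l) (?T z (x n)) = dist l (x n)"
          using linear_diff[OF bounded_linear.linear[OF bounded_linear_L2_comp[OF mp[of z]]], of l "x n"] norm_L2_comp[OF mp[of z], of "l - x n"]
          by (simp add: dist_norm)
        then show "dist (?T z l) l < e"
          using z n dist_triangle[of "?T z l" l "?T z (x n)"] dist_triangle[of "?T z (x n)" l "x n"] by (simp add: dist_commute)
      qed
    qed
  qed
  have test: "class_of \<phi> \<in> C" if "\<phi> \<in> test_functions UNIV" for \<phi>
    unfolding C_def mem_Collect_eq
  proof (rule LIM_zero_cancel, rule Lim_null_comparison)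
    show "\<forall>\<^sub>F z in at 0. norm (?T z (class_of \<phi>) - class_of \<phi>) \<le> norm z * norm (class_of (gradient \<phi>))"
      using test_function_translation[OF that] by simp
    show "((\<lambda>z :: 'a. norm z * norm (class_of (gradient \<phi>))) \<longlongrightarrow> 0) (at 0)"
      by (intro tendsto_mult_left_zero tendsto_norm_zero tendsto_ident_at)
  qed
  have "u - orthogonal_projection C u = 0"
  proof (rule orthogonal_test_functions_zero)
    fix \<phi> :: "'a \<Rightarrow> real" assume "\<phi> \<in> test_functions UNIV"
    from orthogonal_projection_inner[OF sub cl test[OF this], of u]
    show "(u - orthogonal_projection C u) \<bullet> class_of \<phi> = 0" by (simp add: inner_diff_left)
  qed
  then have "u \<in> C" using orthogonal_projection_in[OF sub cl, of u] by simp
  then show ?thesis by (simp add: C_def)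
qed

section \<open>Approximate identities and density of test functions\<close>

definition mollifier :: "real \<Rightarrow> 'a::euclidean_space \<Rightarrow> real" where
  "mollifier r x = bump r x / (LINT x|lborel. bump r (x :: 'a))"

lemma mollifier:
  fixes x :: "'a::euclidean_space"
  assumes r: "r > 0"
  shows "(mollifier r :: 'a::euclidean_space \<Rightarrow> real) \<in> test_functions UNIV"
    and "mollifier r x \<ge> 0" and "(LINT x|lborel. mollifier r (x :: 'a)) = 1"
    and "mollifier r (- x) = mollifier r x" and "norm x \<ge> r \<Longrightarrow> mollifier r x = 0"
proof -
  let ?b = "bump r :: 'a \<Rightarrow> real"
  note b = bump_test_function[OF r, where 'a = 'a]
  have "(LINT x|lborel. ?b x) \<noteq> 0"
  proof
    assume "(LINT x|lborel. ?b x) = 0"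
    then have "AE x in lborel. ?b x = 0"
      using test_function_integrable(2)[OF b] bump_nonneg[OF r] by (subst (asm) integral_nonneg_eq_0_iff_AE) auto
    then have "AE x in lborel. x \<notin> ball (0 :: 'a) r"
    proof (rule eventually_mono)
      fix x :: 'a assume "?b x = 0"
      then show "x \<notin> ball 0 r" using bump_pos_iff[OF r, of x] by simp
    qed
    then have "emeasure lborel (ball (0 :: 'a) r) = 0"
      by (subst (asm) AE_iff_measurable[of "ball 0 r"]) auto
    then show False using content_ball_pos[OF r, of "0 :: 'a"] by (simp add: measure_def)
  qed
  moreover have "(LINT x|lborel. ?b x) \<ge> 0" using bump_nonneg[OF r] by (intro integral_nonneg_AE AE_I2) auto
  ultimately have pos: "(LINT x|lborel. ?b x) > 0" by simp
  have eq: "mollifier r = (\<lambda>x. ?b x * (1 / (LINT x|lborel. ?b x)))" by (simp add: mollifier_def[abs_def])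
  show "(mollifier r :: 'a \<Rightarrow> real) \<in> test_functions UNIV"
    unfolding eq by (rule test_function_mult(1)[OF b smooth_at_all_orders_const])
  show "mollifier r x \<ge> 0" using bump_nonneg[OF r, of x] pos unfolding mollifier_def by (intro divide_nonneg_nonneg) auto
  show "(LINT x|lborel. mollifier r (x :: 'a)) = 1" using pos by (simp add: mollifier_def)
  show "mollifier r (- x) = mollifier r x" by (simp add: mollifier_def bump_def)
  show "mollifier r x = 0" if "norm x \<ge> r"
    using that bump_pos_iff[OF r, of x] bump_nonneg[OF r, of x] by (simp add: mollifier_def)
qed

text \<open>Jensen's inequality for the probability density of the mollifier, by Cauchy-Schwarz with
  its square root in both factors; Fubini's theorem then leaves an average of translation
  differences.\<close>

lemma mollify_L2_bound:
  fixes w :: "'a::euclidean_space \<Rightarrow> real"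
  assumes r: "r > 0" and w: "square_integrable w"
    and e: "\<And>z. norm z < r \<Longrightarrow> L2_energy (\<lambda>x. w (x + z) - w x) \<le> e"
  shows "L2_energy (\<lambda>x. mollify (mollifier r) w x - w x) \<le> e"
proof -
  let ?\<rho> = "mollifier r :: 'a \<Rightarrow> real"
  note \<rho> = mollifier[OF r, where 'a = 'a]
  note [measurable] = square_integrable_measurable[OF w] test_function_measurable(1)[OF \<rho>(1)]
  have int: "(\<integral>\<^sup>+x. ennreal (?\<rho> x) \<partial>lborel) = 1"
    using nn_integral_eq_integral[OF test_function_integrable(2)[OF \<rho>(1)]] \<rho>(2,3) by simp
  have sqr: "square_integrable (\<lambda>y. ?\<rho> (x - y))" for x
    by (rule test_function_integrable(1)[OF test_function_reflect(1)[OF \<rho>(1)]])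
  have int1: "(LINT y|lborel. ?\<rho> (x - y)) = 1" for x
  proof -
    have "(LINT y|lborel. ?\<rho> (x - y)) = (LINT y|lborel. ?\<rho> (y + (- x)))"
      using \<rho>(4) by (intro Bochner_Integration.integral_cong refl) (metis minus_diff_eq uminus_add_conv_diff add.commute)
    also have "\<dots> = 1"
      using \<rho>(3) by (subst integral_measure_preserving[OF measure_preserving_translation]) auto
    finally show ?thesis .
  qed
  have pt: "ennreal ((mollify ?\<rho> w x - w x)\<^sup>2) \<le> (\<integral>\<^sup>+z. ennreal (?\<rho> z) * ennreal ((w (x + z) - w x)\<^sup>2) \<partial>lborel)" for x
  proof -
    have i1: "integrable lborel (\<lambda>y. ?\<rho> (x - y) * w y)"
      using integrable_inner_square_integrable[OF sqr[of x] w] by simp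
    have i2: "integrable lborel (\<lambda>y. ?\<rho> (x - y))"
      by (rule test_function_integrable(2)[OF test_function_reflect(1)[OF \<rho>(1)]])
    have "mollify ?\<rho> w x - w x = (LINT y|lborel. ?\<rho> (x - y) * (w y - w x))"
      using i1 i2 int1[of x] by (simp add: mollify_def right_diff_distrib)
    also have "\<bar>\<dots>\<bar> \<le> (LINT y|lborel. \<bar>?\<rho> (x - y) * (w y - w x)\<bar>)" by (rule integral_abs_bound)
    finally have "ennreal \<bar>mollify ?\<rho> w x - w x\<bar> \<le> ennreal (LINT y|lborel. \<bar>?\<rho> (x - y) * (w y - w x)\<bar>)"
      by (rule ennreal_leI)
    also have "\<dots> = (\<integral>\<^sup>+y. ennreal \<bar>?\<rho> (x - y) * (w y - w x)\<bar> \<partial>lborel)"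
      using i1 i2 by (intro nn_integral_eq_integral[symmetric]) (auto simp: right_diff_distrib)
    also have "\<dots> = (\<integral>\<^sup>+z. ennreal \<bar>?\<rho> (x - (z + x)) * (w (z + x) - w x)\<bar> \<partial>lborel)"
      by (rule nn_integral_lborel_translate[symmetric]) measurable
    also have "\<dots> = (\<integral>\<^sup>+z. ennreal (sqrt (?\<rho> z)) * ennreal (sqrt (?\<rho> z) * \<bar>w (x + z) - w x\<bar>) \<partial>lborel)"
      using \<rho>(2,4) by (intro nn_integral_cong) (simp add: ennreal_mult[symmetric] abs_mult mult.assoc[symmetric] add.commute)
    finally have "(ennreal \<bar>mollify ?\<rho> w x - w x\<bar>)\<^sup>2 \<le> (\<integral>\<^sup>+z. ennreal (sqrt (?\<rho> z)) * ennreal (sqrt (?\<rho> z) * \<bar>w (x + z) - w x\<bar>) \<partial>lborel)\<^sup>2"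
      by (rule power_mono) simp
    also have "\<dots> \<le> (\<integral>\<^sup>+z. (ennreal (sqrt (?\<rho> z)))\<^sup>2 \<partial>lborel) * (\<integral>\<^sup>+z. (ennreal (sqrt (?\<rho> z) * \<bar>w (x + z) - w x\<bar>))\<^sup>2 \<partial>lborel)"
      by (rule Cauchy_Schwarz_nn_integral) measurable
    also have "(\<integral>\<^sup>+z. (ennreal (sqrt (?\<rho> z)))\<^sup>2 \<partial>lborel) = 1"
      unfolding int[symmetric] using \<rho>(2) by (intro nn_integral_cong) (simp add: ennreal_power)
    also have "(\<integral>\<^sup>+z. (ennreal (sqrt (?\<rho> z) * \<bar>w (x + z) - w x\<bar>))\<^sup>2 \<partial>lborel) = (\<integral>\<^sup>+z. ennreal (?\<rho> z) * ennreal ((w (x + z) - w x)\<^sup>2) \<partial>lborel)"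
      using \<rho>(2) by (intro nn_integral_cong) (simp add: ennreal_power ennreal_mult[symmetric] power_mult_distrib)
    finally show ?thesis by (simp add: ennreal_power)
  qed
  have "L2_energy (\<lambda>x. mollify ?\<rho> w x - w x) \<le> (\<integral>\<^sup>+x. (\<integral>\<^sup>+z. ennreal (?\<rho> z) * ennreal ((w (x + z) - w x)\<^sup>2) \<partial>lborel) \<partial>lborel)"
    unfolding L2_energy_def using pt by (intro nn_integral_mono) simp
  also have "\<dots> = (\<integral>\<^sup>+z. (\<integral>\<^sup>+x. ennreal (?\<rho> z) * ennreal ((w (x + z) - w x)\<^sup>2) \<partial>lborel) \<partial>lborel)"
    by (rule lborel_pair.Fubini'[symmetric]) measurable
  also have "\<dots> = (\<integral>\<^sup>+z. ennreal (?\<rho> z) * L2_energy (\<lambda>x. w (x + z) - w x) \<partial>lborel)"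
    unfolding L2_energy_def by (intro nn_integral_cong) (simp add: nn_integral_cmult)
  also have "\<dots> \<le> (\<integral>\<^sup>+z. ennreal (?\<rho> z) * e \<partial>lborel)"
  proof (rule nn_integral_mono)
    fix z :: 'a
    show "ennreal (?\<rho> z) * L2_energy (\<lambda>x. w (x + z) - w x) \<le> ennreal (?\<rho> z) * e"
      using e[of z] \<rho>(5)[of z] by (cases "norm z < r") (auto intro: mult_left_mono)
  qed
  also have "\<dots> = e" using int by (subst nn_integral_multc) auto
  finally show ?thesis .
qed

lemma tendsto_0_le_ennreal:
  fixes f :: "'c \<Rightarrow> ennreal"
  assumes "\<And>e. e > 0 \<Longrightarrow> \<forall>\<^sub>F n in F. f n \<le> ennreal e"
  shows "(f \<longlongrightarrow> 0) F"
proof (rule order_tendstoI)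
  fix a :: ennreal assume a: "0 < a"
  obtain e where e: "e > 0" "ennreal e < a"
  proof (cases a)
    case (real r)
    then show ?thesis using that[of "r / 2"] a by (simp add: ennreal_lessI)
  next
    case top
    then show ?thesis using that[of 1] by simp
  qed
  show "\<forall>\<^sub>F n in F. f n < a"
    using assms[OF e(1)] by (rule eventually_mono) (use e(2) in \<open>auto intro: le_less_trans\<close>)
qed simp

lemma mollify_tendsto:
  fixes w :: "'a::euclidean_space \<Rightarrow> real"
  assumes w: "square_integrable w"
  shows "(\<lambda>n. L2_energy (\<lambda>x. mollify (mollifier (1 / real (Suc n))) w x - w x)) \<longlonglongrightarrow> 0"
proof (rule tendsto_0_le_ennreal)
  fix e :: real assume e: "e > 0"
  have "\<forall>\<^sub>F z in at 0. dist (L2_comp (\<lambda>x. x + z) (class_of w)) (class_of w) < sqrt e"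
    using translation_continuous[of "class_of w"] e by (intro tendstoD) auto
  then obtain d where d: "d > 0" "\<And>z. z \<noteq> 0 \<Longrightarrow> norm z < d \<Longrightarrow> dist (L2_comp (\<lambda>x. x + z) (class_of w)) (class_of w) < sqrt e"
    by (auto simp: eventually_at dist_norm)
  have en: "L2_energy (\<lambda>x. w (x + z) - w x) \<le> ennreal e" if z: "norm z < d" for z
  proof (cases "z = 0")
    case True
    then show ?thesis by (simp add: L2_energy_def)
  next
    case False
    note mp = measure_preserving_translation[of z]
    have sqT: "square_integrable (\<lambda>x. w (x + z))" by (rule square_integrable_comp[OF mp w])
    have "L2_energy (\<lambda>x. w (x + z) - w x) = ennreal ((norm (class_of (\<lambda>x. w (x + z)) - class_of w))\<^sup>2)"
      using L2_energy_class_of[OF square_integrable_diff[OF sqT w]] class_of_diff[OF sqT w] by simp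
    also have "\<dots> \<le> ennreal ((sqrt e)\<^sup>2)"
      using d(2)[OF False z] by (intro ennreal_leI power_mono) (auto simp: L2_comp_class_of[OF mp w] dist_norm)
    finally show ?thesis using e by simp
  qed
  obtain N where N: "1 / real (Suc N) < d" using nat_approx_posE[OF d(1)] by blast
  show "\<forall>\<^sub>F n in sequentially. L2_energy (\<lambda>x. mollify (mollifier (1 / real (Suc n))) w x - w x) \<le> ennreal e"
    unfolding eventually_sequentially
  proof (intro exI[of _ N] allI impI)
    fix n assume "N \<le> n"
    then have "1 / real (Suc n) \<le> 1 / real (Suc N)" by (simp add: frac_le)
    then have "1 / real (Suc n) < d" using N by linarith
    then show "L2_energy (\<lambda>x. mollify (mollifier (1 / real (Suc n))) w x - w x) \<le> ennreal e"
      by (intro mollify_L2_bound w en) auto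
  qed
qed

lemma L2_energy_components:
  fixes f :: "'a::euclidean_space \<Rightarrow> 'b::euclidean_space"
  assumes [measurable]: "f \<in> borel_measurable borel"
  shows "L2_energy f = (\<Sum>b\<in>Basis. L2_energy (\<lambda>x. f x \<bullet> b))"
proof -
  have "(norm (f x))\<^sup>2 = (\<Sum>b\<in>Basis. (f x \<bullet> b)\<^sup>2)" for x
    unfolding power2_norm_eq_inner euclidean_inner[of "f x" "f x"] by (simp add: power2_eq_square)
  then have "L2_energy f = (\<integral>\<^sup>+x. (\<Sum>b\<in>Basis. ennreal ((norm (f x \<bullet> b))\<^sup>2)) \<partial>lborel)"
    unfolding L2_energy_def by simp
  also have "\<dots> = (\<Sum>b\<in>Basis. L2_energy (\<lambda>x. f x \<bullet> b))"
    unfolding L2_energy_def by (rule nn_integral_sum) measurable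
  finally show ?thesis .
qed

lemma mollify_inner:
  fixes w :: "'a::euclidean_space \<Rightarrow> 'b::euclidean_space"
  assumes "\<rho> \<in> test_functions UNIV" "square_integrable w"
  shows "mollify \<rho> w x \<bullet> b = mollify \<rho> (\<lambda>y. w y \<bullet> b) x"
  using integrable_scaleR_square_integrable[OF test_function_integrable(1)[OF test_function_reflect(1)[OF assms(1)]] assms(2), of x]
  by (simp add: mollify_def flip: integral_inner_left)

lemma mollify_measurable:
  assumes "\<rho> \<in> test_functions UNIV" and "square_integrable w"
  shows "mollify \<rho> w \<in> borel_measurable borel"
proof -
  note [measurable] = test_function_measurable(1)[OF assms(1)] square_integrable_measurable[OF assms(2)]
  show ?thesis unfolding mollify_def[abs_def] by (rule lborel.borel_measurable_lebesgue_integral) measurable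
qed

lemma class_of_tendsto:
  assumes f: "\<And>n. square_integrable (\<lambda>x. f n x - g x)" and g: "square_integrable g"
    and lim: "(\<lambda>n. L2_energy (\<lambda>x. f n x - g x)) \<longlonglongrightarrow> 0"
  shows "(\<lambda>n. class_of (f n)) \<longlonglongrightarrow> class_of g" "square_integrable (f n)"
proof -
  show sq: "square_integrable (f n)" for n using square_integrable_add[OF f g, of n] by simp
  have "L2_energy (\<lambda>x. f n x - g x) = ennreal ((norm (class_of (f n) - class_of g))\<^sup>2)" for n
    using L2_energy_class_of[OF f[of n]] class_of_diff[OF sq g] by simp
  then have "(\<lambda>n. ennreal ((norm (class_of (f n) - class_of g))\<^sup>2)) \<longlonglongrightarrow> ennreal 0" using lim by simp
  then have "(\<lambda>n. (norm (class_of (f n) - class_of g))\<^sup>2) \<longlonglongrightarrow> 0" by (subst (asm) tendsto_ennreal_iff) auto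
  then have "(\<lambda>n. sqrt ((norm (class_of (f n) - class_of g))\<^sup>2)) \<longlonglongrightarrow> sqrt 0" by (rule tendsto_real_sqrt)
  then have "(\<lambda>n. norm (class_of (f n) - class_of g)) \<longlonglongrightarrow> 0" by simp
  then show "(\<lambda>n. class_of (f n)) \<longlonglongrightarrow> class_of g" using tendsto_norm_zero_iff LIM_zero_cancel by blast
qed

lemma mollify_class_tendsto:
  fixes w :: "'a::euclidean_space \<Rightarrow> 'b::euclidean_space"
  assumes w: "square_integrable w"
  shows "(\<lambda>n. class_of (mollify (mollifier (1 / real (Suc n))) w)) \<longlonglongrightarrow> class_of w"
    "square_integrable (mollify (mollifier (1 / real (Suc n))) w)"
proof -
  let ?\<rho> = "\<lambda>n. mollifier (1 / real (Suc n)) :: 'a \<Rightarrow> real"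
  have \<rho>: "?\<rho> n \<in> test_functions UNIV" for n by (rule mollifier) simp
  note [measurable] = mollify_measurable[OF \<rho> w] square_integrable_measurable[OF w]
  have sqb: "square_integrable (\<lambda>x. w x \<bullet> b)" for b by (rule square_integrable_inner_const[OF w])
  have eq: "L2_energy (\<lambda>x. mollify (?\<rho> n) w x - w x) = (\<Sum>b\<in>Basis. L2_energy (\<lambda>x. mollify (?\<rho> n) (\<lambda>y. w y \<bullet> b) x - w x \<bullet> b))" for n
  proof -
    have "(\<lambda>x. mollify (?\<rho> n) w x - w x) \<in> borel_measurable borel" by measurable
    from L2_energy_components[OF this] show ?thesis by (simp only: inner_diff_left mollify_inner[OF \<rho> w])
  qed
  have fin: "L2_energy (\<lambda>x. mollify (?\<rho> n) (\<lambda>y. w y \<bullet> b) x - w x \<bullet> b) < \<infinity>" for n b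
  proof -
    have "L2_energy (\<lambda>x. mollify (?\<rho> n) (\<lambda>y. w y \<bullet> b) x - w x \<bullet> b) \<le> 4 * L2_energy (\<lambda>x. w x \<bullet> b)"
    proof (rule mollify_L2_bound[OF _ sqb])
      fix z :: 'a
      have "L2_energy (\<lambda>x. w (x + z) \<bullet> b - w x \<bullet> b) \<le> 2 * L2_energy (\<lambda>x. w (x + z) \<bullet> b) + 2 * L2_energy (\<lambda>x. w x \<bullet> b)"
        by (rule L2_energy_diff_le) measurable
      also have "L2_energy (\<lambda>x. w (x + z) \<bullet> b) = L2_energy (\<lambda>x. w x \<bullet> b)"
        unfolding L2_energy_def by (rule nn_integral_lborel_translate) measurable
      also have "2 * L2_energy (\<lambda>x. w x \<bullet> b) + 2 * L2_energy (\<lambda>x. w x \<bullet> b) = 4 * L2_energy (\<lambda>x. w x \<bullet> b)"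
        by (simp flip: distrib_right)
      finally show "L2_energy (\<lambda>x. w (x + z) \<bullet> b - w x \<bullet> b) \<le> 4 * L2_energy (\<lambda>x. w x \<bullet> b)" .
    qed simp
    also have "\<dots> < \<infinity>" using sqb[of b] by (auto simp: square_integrable_iff ennreal_mult_less_top)
    finally show ?thesis .
  qed
  have sq: "square_integrable (\<lambda>x. mollify (?\<rho> n) w x - w x)" for n
  proof -
    have "(\<lambda>x. mollify (?\<rho> n) w x - w x) \<in> borel_measurable borel" by measurable
    then show ?thesis unfolding square_integrable_iff eq using fin by (auto simp del: of_nat_Suc)
  qed
  have "(\<lambda>n. L2_energy (\<lambda>x. mollify (?\<rho> n) w x - w x)) \<longlonglongrightarrow> (\<Sum>b\<in>(Basis :: 'b set). 0)"
    unfolding eq by (intro tendsto_sum mollify_tendsto sqb)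
  then have lim: "(\<lambda>n. L2_energy (\<lambda>x. mollify (?\<rho> n) w x - w x)) \<longlonglongrightarrow> 0" by simp
  show "(\<lambda>n. class_of (mollify (?\<rho> n) w)) \<longlonglongrightarrow> class_of w" "square_integrable (mollify (?\<rho> n) w)"
    by (rule class_of_tendsto[OF sq w lim])+
qed

lemma class_of_dominated:
  fixes f :: "nat \<Rightarrow> 'a::euclidean_space \<Rightarrow> 'b::euclidean_space"
  assumes [measurable]: "\<And>n. f n \<in> borel_measurable borel" and g: "square_integrable g" and h: "square_integrable h"
    and bound: "\<And>n x. norm (f n x - g x) \<le> \<bar>h x :: real\<bar>" and lim: "\<And>x. (\<lambda>n. f n x) \<longlonglongrightarrow> g x"
  shows "(\<lambda>n. class_of (f n)) \<longlonglongrightarrow> class_of g"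
proof (rule class_of_tendsto(1)[OF _ g])
  note [measurable] = square_integrable_measurable[OF g] square_integrable_measurable[OF h]
  have i: "integrable lborel (\<lambda>x. (h x)\<^sup>2)" using h by (simp add: square_integrable_def)
  have le: "(norm (f n x - g x))\<^sup>2 \<le> (h x)\<^sup>2" for n x
    using power_mono[OF bound[of n x], of 2] by simp
  have ii: "integrable lborel (\<lambda>x. (norm (f n x - g x))\<^sup>2)" for n
    by (rule Bochner_Integration.integrable_bound[OF i]) (use le in auto)
  then show "square_integrable (\<lambda>x. f n x - g x)" for n by (simp add: square_integrable_def)
  have "(\<lambda>n. LINT x|lborel. (norm (f n x - g x))\<^sup>2) \<longlonglongrightarrow> (LINT x|(lborel :: 'a measure). (0 :: real))"
  proof (rule integral_dominated_convergence[OF _ _ i])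
    show "AE x in lborel. (\<lambda>n. (norm (f n x - g x))\<^sup>2) \<longlonglongrightarrow> 0"
    proof (rule AE_I2)
      fix x
      have "(\<lambda>n. f n x - g x) \<longlonglongrightarrow> 0" using lim[of x] by (rule LIM_zero)
      from tendsto_power[OF tendsto_norm[OF this], of 2] show "(\<lambda>n. (norm (f n x - g x))\<^sup>2) \<longlonglongrightarrow> 0" by simp
    qed
  qed (use le in auto)
  then have "(\<lambda>n. ennreal (LINT x|lborel. (norm (f n x - g x))\<^sup>2)) \<longlonglongrightarrow> ennreal 0" by (intro tendsto_intros) simp
  then show "(\<lambda>n. L2_energy (\<lambda>x. f n x - g x)) \<longlonglongrightarrow> 0"
    unfolding L2_energy_def using nn_integral_eq_integral[OF ii] by simp
qed

text \<open>Multiplication by cutoffs of growing radius. The product rule adds v times the gradient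
  of the cutoff, which decays like the reciprocal radius.\<close>

lemma smooth_L2_in_H10:
  fixes v :: "'a::euclidean_space \<Rightarrow> real"
  assumes s: "smooth_at_all_orders UNIV UNIV v" and v: "square_integrable v" "square_integrable (gradient v)"
  shows "(class_of v, class_of (gradient v)) \<in> H10 UNIV"
proof -
  \<comment> \<open>\<open>flat 1\<close> is the value of the bump at its centre; dividing by it
    makes the cutoffs tend to 1.\<close>
  define k where "k = 1 / flat 1"
  have k: "k > 0" by (simp add: k_def flat_pos)
  define cut :: "nat \<Rightarrow> 'a \<Rightarrow> real" where "cut = (\<lambda>n x. bump (real (Suc n)) x * k)"
  have cut: "cut n \<in> test_functions UNIV" for n
    unfolding cut_def by (rule test_function_mult(1)[OF bump_test_function smooth_at_all_orders_const]) simp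
  have mono: "flat s \<le> flat t" if "s \<le> t" for s t
    using that by (cases "s > 0") (auto simp: flat_simps flat_nonneg frac_le)
  have cutb: "0 \<le> cut n x" "cut n x \<le> 1" for n x
  proof -
    show "0 \<le> cut n x" using k by (simp add: cut_def bump_def flat_nonneg)
    have "bump (real (Suc n)) x \<le> flat 1" unfolding bump_def by (rule mono) simp
    then show "cut n x \<le> 1" using flat_pos[of 1] by (simp add: cut_def k_def)
  qed
  have gcut: "norm (gradient (cut n) x) \<le> 4 * k / real (Suc n)" for n x
  proof -
    have "gradient (cut n) x = k *\<^sub>R gradient (bump (real (Suc n))) x"
      unfolding cut_def
      using test_function_mult(2)[OF bump_test_function[of "real (Suc n)"] smooth_at_all_orders_const[of UNIV UNIV k], of x]
        gradient_eqI[of "\<lambda>x. k" 0 x] by simp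
    then show ?thesis
      using bump_gradient_bound[of "real (Suc n)" x] k mult_left_mono[of "norm (gradient (bump (real (Suc n))) x)" "4 / real (Suc n)" k]
      by (simp add: mult.commute)
  qed
  have cutlim: "(\<lambda>n. cut n x) \<longlonglongrightarrow> 1" for x
  proof -
    have "(\<lambda>n. 1 - (x \<bullet> x) * (inverse (real (Suc n)))\<^sup>2) \<longlonglongrightarrow> 1 - (x \<bullet> x) * 0\<^sup>2"
      by (intro tendsto_intros LIMSEQ_inverse_real_of_nat)
    then have l: "(\<lambda>n. 1 - (x \<bullet> x) / (real (Suc n))\<^sup>2) \<longlonglongrightarrow> 1" by (simp add: divide_inverse power_inverse)
    have "isCont flat 1" by (rule DERIV_isCont[OF flat_derivative])
    from isCont_tendsto_compose[OF this l] have "(\<lambda>n. bump (real (Suc n)) x) \<longlonglongrightarrow> flat 1" by (simp add: bump_def)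
    then have "(\<lambda>n. cut n x) \<longlonglongrightarrow> flat 1 * k" unfolding cut_def by (intro tendsto_intros)
    then show ?thesis using flat_pos[of 1] by (simp add: k_def)
  qed
  note [measurable] = square_integrable_measurable[OF v(1)] square_integrable_measurable[OF v(2)] test_function_measurable[OF cut]
  have t: "(\<lambda>x. cut n x * v x) \<in> test_functions UNIV" for n by (rule test_function_mult(1)[OF cut s])
  have gt: "gradient (\<lambda>x. cut n x * v x) = (\<lambda>x. cut n x *\<^sub>R gradient v x + v x *\<^sub>R gradient (cut n) x)" for n
    using test_function_mult(2)[OF cut s] by auto
  have d1: "\<bar>cut n x - 1\<bar> \<le> 1" for n x using cutb[of n x] by simp
  have e1: "(\<lambda>n. class_of (\<lambda>x. cut n x * v x)) \<longlonglongrightarrow> class_of v"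
  proof (rule class_of_dominated[OF _ v(1) v(1)])
    show "norm (cut n x * v x - v x) \<le> \<bar>v x\<bar>" for n x
      using mult_right_mono[OF d1[of n x], of "\<bar>v x\<bar>"] by (simp add: left_diff_distrib flip: abs_mult)
    show "(\<lambda>n. cut n x * v x) \<longlonglongrightarrow> v x" for x
      using tendsto_mult[OF cutlim[of x] tendsto_const[of "v x"]] by simp
  qed measurable
  have sqh: "square_integrable (\<lambda>x. norm (gradient v x) + 4 * k * \<bar>v x\<bar>)"
  proof -
    have a: "square_integrable (\<lambda>x. norm (gradient v x))" "square_integrable (\<lambda>x. \<bar>v x\<bar>)"
      using v by (auto simp: square_integrable_def)
    from square_integrable_add[OF a(1) square_integrable_scaleR[OF a(2), of "4 * k"]] show ?thesis by simp
  qed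
  have e2: "(\<lambda>n. class_of (\<lambda>x. cut n x *\<^sub>R gradient v x + v x *\<^sub>R gradient (cut n) x)) \<longlonglongrightarrow> class_of (gradient v)"
  proof (rule class_of_dominated[OF _ v(2) sqh])
    fix n x
    have "norm (cut n x *\<^sub>R gradient v x + v x *\<^sub>R gradient (cut n) x - gradient v x)
      = norm ((cut n x - 1) *\<^sub>R gradient v x + v x *\<^sub>R gradient (cut n) x)" by (simp add: algebra_simps)
    also have "\<dots> \<le> \<bar>cut n x - 1\<bar> * norm (gradient v x) + \<bar>v x\<bar> * norm (gradient (cut n) x)"
      by (rule order_trans[OF norm_triangle_ineq]) simp
    also have "\<dots> \<le> 1 * norm (gradient v x) + \<bar>v x\<bar> * (4 * k)"
    proof (intro add_mono mult_right_mono mult_left_mono d1)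
      have "4 * k / real (Suc n) \<le> 4 * k" using k by (simp add: field_simps)
      then show "norm (gradient (cut n) x) \<le> 4 * k" using gcut[of n x] by linarith
    qed auto
    also have "\<dots> \<le> \<bar>norm (gradient v x) + 4 * k * \<bar>v x\<bar>\<bar>" by (simp add: mult.commute)
    finally show "norm (cut n x *\<^sub>R gradient v x + v x *\<^sub>R gradient (cut n) x - gradient v x) \<le> \<bar>norm (gradient v x) + 4 * k * \<bar>v x\<bar>\<bar>" .
  next
    fix x
    have "(\<lambda>n. gradient (cut n) x) \<longlonglongrightarrow> 0"
    proof (rule Lim_null_comparison[OF always_eventually])
      show "\<forall>n. norm (gradient (cut n) x) \<le> 4 * k * inverse (real (Suc n))" using gcut[of _ x] by (simp add: divide_inverse)
      show "(\<lambda>n. 4 * k * inverse (real (Suc n))) \<longlonglongrightarrow> 0" by (intro tendsto_mult_right_zero LIMSEQ_inverse_real_of_nat)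
    qed
    then have "(\<lambda>n. cut n x *\<^sub>R gradient v x + v x *\<^sub>R gradient (cut n) x) \<longlonglongrightarrow> 1 *\<^sub>R gradient v x + v x *\<^sub>R 0"
      by (intro tendsto_intros cutlim)
    then show "(\<lambda>n. cut n x *\<^sub>R gradient v x + v x *\<^sub>R gradient (cut n) x) \<longlonglongrightarrow> gradient v x" by simp
  qed measurable
  have "(\<lambda>n. test_element (\<lambda>x. cut n x * v x)) \<longlonglongrightarrow> (class_of v, class_of (gradient v))"
    unfolding test_element_def gt by (rule tendsto_Pair[OF e1 e2])
  then show ?thesis by (rule closed_sequentially[OF closed_H10 test_element_in_H10[OF t]])
qed

text \<open>Testing the weak derivative with the reflected mollifier shows that the gradient of the
  mollified function is the mollified weak gradient. Hence values and gradients converge together,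
  and each mollified function is smooth enough to be cut off.\<close>

lemma H1_eq_H10: "H1 = H10 (UNIV :: 'a::euclidean_space set)"
proof (rule equalityI[OF _ H10_subset_H1], rule subsetI)
  fix u :: "'a sobolev" assume u: "u \<in> H1"
  let ?\<rho> = "\<lambda>n. mollifier (1 / real (Suc n)) :: 'a \<Rightarrow> real"
  have \<rho>: "?\<rho> n \<in> test_functions UNIV" for n by (rule mollifier) simp
  let ?v = "\<lambda>n. mollify (?\<rho> n) (val u)" and ?w = "\<lambda>n. mollify (?\<rho> n) (wgrad u)"
  have g: "gradient (?v n) = ?w n" for n
  proof
    fix x
    note t = test_function_reflect[OF \<rho>[of n], of x]
    have "(LINT y|lborel. val u y *\<^sub>R gradient (\<lambda>y. ?\<rho> n (x - y)) y) = - (LINT y|lborel. ?\<rho> n (x - y) *\<^sub>R wgrad u y)"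
      using u t(1) unfolding H1_def by blast
    then have eq: "(LINT y|lborel. val u y *\<^sub>R gradient (?\<rho> n) (x - y)) = ?w n x"
      by (simp add: t(2) mollify_def del: of_nat_Suc)
    have i: "integrable lborel (\<lambda>y. val u y *\<^sub>R gradient (?\<rho> n) (x - y))"
      using integrable_scaleR_square_integrable[OF val_square_integrable(1)[of u] test_function_integrable(3)[OF t(1)]]
      by (simp add: t(2) del: of_nat_Suc)
    have "gradient (?v n) x \<bullet> h = ?w n x \<bullet> h" for h
      using i unfolding smooth_mollify(2)[OF \<rho> val_square_integrable(1)] eq[symmetric]
      by (simp add: mult.commute del: of_nat_Suc flip: integral_inner_left)
    then show "gradient (?v n) x = ?w n x" by (rule vector_eq_rdot[THEN iffD1, OF allI])
  qed
  note v = mollify_class_tendsto[OF val_square_integrable(1)[of u]] and w = mollify_class_tendsto[OF val_square_integrable(2)[of u]]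
  have "(class_of (?v n), class_of (gradient (?v n))) \<in> H10 UNIV" for n
    by (rule smooth_L2_in_H10[OF smooth_mollify(1)[OF \<rho> val_square_integrable(1)] v(2)]) (simp only: g w(2))
  then have mem: "(class_of (?v n), class_of (?w n)) \<in> H10 UNIV" for n by (simp only: g)
  have "(\<lambda>n. (class_of (?v n), class_of (?w n))) \<longlonglongrightarrow> (class_of (val u), class_of (wgrad u))"
    by (rule tendsto_Pair[OF v(1) w(1)])
  from closed_sequentially[OF closed_H10 mem this] show "u \<in> H10 UNIV"
    by (simp add: val_def wgrad_def class_of_fun_of)
qed

section \<open>Radial Sobolev functions\<close>

text \<open>Uniqueness of the translation invariant measure: both \<open>f \<circ> T\<close> and \<open>f\<close> are integrated against
  the indicator of the unit ball, which \<open>T\<close> preserves.\<close>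

lemma measure_preserving_orthogonal:
  fixes T :: "'a::euclidean_space \<Rightarrow> 'a"
  assumes T: "orthogonal_transformation T"
  shows "measure_preserving T"
proof -
  have lin: "linear T" and nT: "norm (T x) = norm x" for x
    using T by (auto simp: orthogonal_transformation)
  obtain T' where T': "\<And>x. T (T' x) = x"
    using orthogonal_transformation_surj[OF T] by (metis surj_def)
  have [measurable]: "T \<in> borel_measurable borel"
    using lin by (intro borel_measurable_continuous_onI linear_continuous_on) (simp add: linear_conv_bounded_linear)
  have inv: "(\<integral>\<^sup>+x. f (T x) \<partial>lborel) = (\<integral>\<^sup>+x. f x \<partial>lborel)" if [measurable]: "f \<in> borel_measurable borel" for f
  proof -
    define g :: "'a \<Rightarrow> ennreal" where "g = indicator (ball 0 1)"
    have [measurable]: "g \<in> borel_measurable borel" by (auto simp: g_def intro!: borel_measurable_indicator)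
    define V where "V = (\<integral>\<^sup>+x. g x \<partial>lborel)"
    have gT: "g (- T x) = g x" for x by (simp add: g_def indicator_def nT)
    have "(\<integral>\<^sup>+x. f (T x) \<partial>lborel) * V = (\<integral>\<^sup>+x. f (T x) * (\<integral>\<^sup>+y. g (y + (- T x)) \<partial>lborel) \<partial>lborel)"
      by (subst nn_integral_lborel_translate) (auto simp: V_def nn_integral_multc)
    also have "\<dots> = (\<integral>\<^sup>+x. (\<integral>\<^sup>+y. f (T x) * g (y + (- T x)) \<partial>lborel) \<partial>lborel)"
      by (intro nn_integral_cong nn_integral_cmult[symmetric]) measurable
    also have "\<dots> = (\<integral>\<^sup>+y. (\<integral>\<^sup>+x. f (T x) * g (y + (- T x)) \<partial>lborel) \<partial>lborel)"
      by (rule lborel_pair.Fubini'[symmetric]) measurable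
    \<comment> \<open>Translating x by \<open>T' y\<close> moves y from g into f; what remains in g
      is \<open>- T x\<close>, from which the invariance of the ball removes T.\<close>
    also have "\<dots> = (\<integral>\<^sup>+y. (\<integral>\<^sup>+x. f (T (x + T' y)) * g (y + (- T (x + T' y))) \<partial>lborel) \<partial>lborel)"
      by (intro nn_integral_cong nn_integral_lborel_translate[symmetric]) measurable
    also have "\<dots> = (\<integral>\<^sup>+y. (\<integral>\<^sup>+x. f (y + T x) * g x \<partial>lborel) \<partial>lborel)"
      using lin T' gT by (simp add: linear_add add.commute)
    also have "\<dots> = (\<integral>\<^sup>+x. (\<integral>\<^sup>+y. f (y + T x) * g x \<partial>lborel) \<partial>lborel)"
      by (rule lborel_pair.Fubini') measurable
    also have "\<dots> = (\<integral>\<^sup>+x. (\<integral>\<^sup>+y. f y \<partial>lborel) * g x \<partial>lborel)"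
      by (intro nn_integral_cong) (simp add: nn_integral_multc nn_integral_lborel_translate)
    also have "\<dots> = (\<integral>\<^sup>+x. f x \<partial>lborel) * V"
      unfolding V_def by (rule nn_integral_cmult) measurable
    finally have eq: "(\<integral>\<^sup>+x. f (T x) \<partial>lborel) * V = (\<integral>\<^sup>+x. f x \<partial>lborel) * V" .
    have V: "V = emeasure lborel (ball (0::'a) 1)" by (simp add: V_def g_def)
    have "V \<noteq> 0" using content_ball_pos[of 1 "0 :: 'a"] by (auto simp: V measure_def)
    moreover have "V \<noteq> top" using emeasure_lborel_ball_finite[of "0 :: 'a" 1] by (simp add: V)
    ultimately show ?thesis using eq by (simp add: mult.commute[of _ V] ennreal_mult_cancel_left)
  qed
  have "distr lborel borel T = (lborel :: 'a measure)"
  proof (rule measure_eqI)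
    fix A assume "A \<in> sets (distr lborel borel T)"
    then have [measurable]: "A \<in> sets borel" by simp
    have "emeasure (distr lborel borel T) A = (\<integral>\<^sup>+x. indicator A (T x) \<partial>lborel)"
      using nn_integral_distr[of T lborel borel "indicator A"] by simp
    also have "\<dots> = emeasure lborel A" by (subst inv) auto
    finally show "emeasure (distr lborel borel T) A = emeasure lborel A" .
  qed simp
  then show ?thesis by (simp add: measure_preserving_def)
qed

text \<open>Weak gradients are unique: if the value vanishes, each component of the gradient is
  orthogonal to all test functions.\<close>

lemma H1_determined_by_value:
  fixes u :: "'a::euclidean_space sobolev"
  assumes u: "u \<in> H1" and 0: "fst u = 0"
  shows "u = 0"
proof -
  have comp: "AE x in lborel. fun_of (snd u) x \<bullet> b = 0" if b: "b \<in> Basis" for b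
  proof -
    let ?f = "\<lambda>x. fun_of (snd u) x \<bullet> b"
    have sq: "square_integrable ?f" by (rule square_integrable_inner_const[OF square_integrable_fun_of])
    have "class_of ?f = 0"
    proof (rule orthogonal_test_functions_zero)
      fix \<phi> :: "'a \<Rightarrow> real" assume \<phi>: "\<phi> \<in> test_functions UNIV"
      note i = test_function_integrable(1)[OF \<phi>]
      note [measurable] = test_function_measurable(1)[OF \<phi>]
      have "class_of ?f \<bullet> class_of \<phi> = (LINT x|lborel. ?f x * \<phi> x)"
        unfolding inner_class_of[OF i]
        by (rule integral_cong_AE) (measurable, use fun_of_class_of[OF sq] in eventually_elim, simp)
      also have "\<dots> = snd u \<bullet> class_of (\<lambda>x. \<phi> x *\<^sub>R b)"
        unfolding inner_class_of[OF square_integrable_scaleR_const[OF i]] by (simp add: mult.commute)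
      also have "\<dots> = 0" using u b \<phi> 0 unfolding H1_iff by fastforce
      finally show "class_of ?f \<bullet> class_of \<phi> = 0" .
    qed
    then have "AE x in lborel. fun_of (class_of ?f) x = 0" using fun_of_zero by simp
    then show ?thesis using fun_of_class_of[OF sq] by eventually_elim simp
  qed
  have "AE x in lborel. \<forall>b\<in>Basis. fun_of (snd u) x \<bullet> b = 0"
    using comp by (intro AE_finite_allI) auto
  moreover have "AE x in lborel. fun_of (0 :: ('a, 'a) L2) x = 0" by (rule fun_of_zero)
  ultimately have "AE x in lborel. fun_of (snd u) x = fun_of 0 x"
    by eventually_elim (simp add: euclidean_all_zero_iff)
  then have "snd u = 0" by (simp add: L2_eq_iff)
  with 0 show ?thesis by (simp add: prod_eq_iff)
qed

text \<open>The chain rule: the gradient of the composite of u with T is the adjoint of T applied to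
  the gradient of u at T x.\<close>

definition rotate_sobolev :: "('a::euclidean_space \<Rightarrow> 'a) \<Rightarrow> 'a sobolev \<Rightarrow> 'a sobolev" where
  "rotate_sobolev T u = (L2_comp T (fst u), class_of (\<lambda>x. adjoint T (fun_of (L2_comp T (snd u)) x)))"

context
  fixes T :: "'a::euclidean_space \<Rightarrow> 'a"
  assumes T: "orthogonal_transformation T"
begin

lemma orthogonal_linear: "linear T" and orthogonal_norm: "norm (T x) = norm x"
  using T by (auto simp: orthogonal_transformation)

lemma adjoint_inner: "adjoint T x \<bullet> adjoint T y = x \<bullet> y"
proof -
  obtain x' where x': "x = T x'" using orthogonal_transformation_surj[OF T] by (metis surj_def)
  obtain y' where y': "y = T y'" using orthogonal_transformation_surj[OF T] by (metis surj_def)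
  have a: "adjoint T (T z) = z" for z
  proof (rule vector_eq_rdot[THEN iffD1, OF allI])
    show "adjoint T (T z) \<bullet> w = z \<bullet> w" for w
      using adjoint_works[OF orthogonal_linear, of w "T z"] T by (simp add: orthogonal_transformation_def inner_commute)
  qed
  show ?thesis using T by (simp add: x' y' a orthogonal_transformation_def)
qed

lemma adjoint_norm: "norm (adjoint T x) = norm x"
  by (simp add: norm_eq_sqrt_inner adjoint_inner)

lemma adjoint_lin: "linear (adjoint T)"
  by (rule adjoint_linear[OF orthogonal_linear])

lemma adjoint_measurable: "adjoint T \<in> borel_measurable borel"
  using adjoint_lin by (intro borel_measurable_continuous_onI linear_continuous_on) (simp add: linear_conv_bounded_linear)

lemma square_integrable_adjoint:
  assumes "square_integrable f"
  shows "square_integrable (\<lambda>x. adjoint T (f x))"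
proof -
  note [measurable] = adjoint_measurable square_integrable_measurable[OF assms]
  show ?thesis using assms by (simp add: square_integrable_def adjoint_norm)
qed

lemmas mp = measure_preserving_orthogonal[OF T]

lemma snd_rotate: "AE x in lborel. fun_of (snd (rotate_sobolev T u)) x = adjoint T (fun_of (snd u) (T x))"
  unfolding rotate_sobolev_def snd_conv
  using fun_of_class_of[OF square_integrable_adjoint[OF square_integrable_fun_of[of "L2_comp T (snd u)"]]] fun_of_L2_comp[OF mp, of "snd u"]
  by eventually_elim simp

lemma inner_rotate:
  "fst (rotate_sobolev T u) \<bullet> fst (rotate_sobolev T v) = fst u \<bullet> fst v" "snd (rotate_sobolev T u) \<bullet> snd (rotate_sobolev T v) = snd u \<bullet> snd v"
proof -
  show "fst (rotate_sobolev T u) \<bullet> fst (rotate_sobolev T v) = fst u \<bullet> fst v" by (simp add: rotate_sobolev_def inner_L2_comp[OF mp])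
  note [measurable] = measure_preserving_measurable[OF mp]
  have "snd (rotate_sobolev T u) \<bullet> snd (rotate_sobolev T v) = (LINT x|lborel. fun_of (snd u) (T x) \<bullet> fun_of (snd v) (T x))"
    unfolding inner_L2
    by (rule integral_cong_AE) (measurable, use snd_rotate[of u] snd_rotate[of v] in eventually_elim, simp add: adjoint_inner)
  also have "\<dots> = snd u \<bullet> snd v" unfolding inner_L2 by (rule integral_measure_preserving[OF mp]) measurable
  finally show "snd (rotate_sobolev T u) \<bullet> snd (rotate_sobolev T v) = snd u \<bullet> snd v" .
qed

lemma rotate_inner: "rotate_sobolev T u \<bullet> rotate_sobolev T v = u \<bullet> v"
  by (simp add: inner_prod_def inner_rotate)

lemma rotate_diff: "rotate_sobolev T (u - v) = rotate_sobolev T u - rotate_sobolev T v"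
proof -
  have "snd (rotate_sobolev T (u - v)) = snd (rotate_sobolev T u - rotate_sobolev T v)"
    unfolding L2_eq_iff snd_diff
    using snd_rotate[of "u - v"] snd_rotate[of u] snd_rotate[of v] AE_measure_preserving[OF mp fun_of_diff[of "snd u" "snd v"]]
      fun_of_diff[of "snd (rotate_sobolev T u)" "snd (rotate_sobolev T v)"]
    by eventually_elim (simp add: linear_diff[OF adjoint_lin])
  moreover have "fst (rotate_sobolev T (u - v)) = fst (rotate_sobolev T u - rotate_sobolev T v)"
    by (simp add: rotate_sobolev_def linear_diff[OF bounded_linear.linear[OF bounded_linear_L2_comp[OF mp]]])
  ultimately show ?thesis by (rule prod_eqI[rotated])
qed

lemma rotate_norm: "norm (rotate_sobolev T u) = norm u"
  by (simp add: norm_eq_sqrt_inner rotate_inner)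

lemma rotate_test_element:
  assumes \<phi>: "\<phi> \<in> test_functions UNIV"
  shows "(\<lambda>x. \<phi> (T x)) \<in> test_functions UNIV" "rotate_sobolev T (test_element \<phi>) = test_element (\<lambda>x. \<phi> (T x))"
proof -
  note t = test_function_isometry[OF orthogonal_linear orthogonal_norm \<phi>, of 0, simplified]
  show tt: "(\<lambda>x. \<phi> (T x)) \<in> test_functions UNIV" by (rule t(1))
  have g: "gradient (\<lambda>x. \<phi> (T x)) x = adjoint T (gradient \<phi> (T x))" for x
  proof (rule vector_eq_rdot[THEN iffD1, OF allI])
    show "gradient (\<lambda>x. \<phi> (T x)) x \<bullet> h = adjoint T (gradient \<phi> (T x)) \<bullet> h" for h
      unfolding t(2) using adjoint_works[OF orthogonal_linear, of h "gradient \<phi> (T x)"] by (simp add: inner_commute)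
  qed
  have "snd (rotate_sobolev T (test_element \<phi>)) = class_of (gradient (\<lambda>x. \<phi> (T x)))"
    unfolding fun_of_AE_eq_iff[OF test_function_integrable(3)[OF tt], symmetric]
    using snd_rotate[of "test_element \<phi>"] AE_measure_preserving[OF mp snd_test_element[OF \<phi>]]
    by eventually_elim (simp add: g wgrad_def)
  moreover have "fst (rotate_sobolev T (test_element \<phi>)) = class_of (\<lambda>x. \<phi> (T x))"
    by (simp add: rotate_sobolev_def test_element_def L2_comp_class_of[OF mp test_function_integrable(1)[OF \<phi>]])
  ultimately show "rotate_sobolev T (test_element \<phi>) = test_element (\<lambda>x. \<phi> (T x))"
    by (simp add: test_element_def prod_eq_iff)
qed

text \<open>For test functions the chain rule holds classically; the rotation is an isometry, so
  density and closedness transfer the membership.\<close>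

lemma rotate_H1:
  assumes u: "u \<in> H1"
  shows "rotate_sobolev T u \<in> H1"
proof -
  obtain \<phi> where \<phi>: "\<And>n. \<phi> n \<in> test_functions UNIV" "(\<lambda>n. test_element (\<phi> n)) \<longlonglongrightarrow> u"
    by (rule H10_sequence[of u UNIV]) (use u in \<open>auto simp: H1_eq_H10\<close>)
  have "(\<lambda>n. rotate_sobolev T (test_element (\<phi> n))) \<longlonglongrightarrow> rotate_sobolev T u"
  proof (rule LIM_zero_cancel)
    have "(\<lambda>n. norm (test_element (\<phi> n) - u)) \<longlonglongrightarrow> 0"
      using LIM_zero[OF \<phi>(2)] by (rule tendsto_norm_zero)
    then have "(\<lambda>n. norm (rotate_sobolev T (test_element (\<phi> n)) - rotate_sobolev T u)) \<longlonglongrightarrow> 0"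
      by (simp add: rotate_diff[symmetric] rotate_norm)
    then show "(\<lambda>n. rotate_sobolev T (test_element (\<phi> n)) - rotate_sobolev T u) \<longlonglongrightarrow> 0" by (rule tendsto_norm_zero_cancel)
  qed
  moreover have "rotate_sobolev T (test_element (\<phi> n)) \<in> H1" for n
    unfolding rotate_test_element(2)[OF \<phi>(1)] H1_eq_H10 by (rule test_element_in_H10[OF rotate_test_element(1)[OF \<phi>(1)]])
  ultimately show ?thesis using closed_sequentially[OF closed_H1, of "\<lambda>n. rotate_sobolev T (test_element (\<phi> n))"] by simp
qed

text \<open>By uniqueness of weak gradients, invariance of the values already implies invariance of
  the whole pair.\<close>

lemma rotate_fixed_iff:
  assumes "u \<in> H1"
  shows "rotate_sobolev T u = u \<longleftrightarrow> (AE x in lborel. val u (T x) = val u x)"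
proof -
  have sq: "square_integrable (\<lambda>x. val u (T x))" by (rule square_integrable_comp[OF mp val_square_integrable(1)])
  have "L2_comp T (fst u) = class_of (\<lambda>x. val u (T x))" by (simp add: L2_comp_def val_def)
  then have iff: "fst (rotate_sobolev T u) = fst u \<longleftrightarrow> (AE x in lborel. val u (T x) = val u x)"
    using class_of_eq_iff[OF sq val_square_integrable(1), of u] by (simp add: rotate_sobolev_def val_def class_of_fun_of)
  have "rotate_sobolev T u = u" if "fst (rotate_sobolev T u) = fst u"
    using H1_determined_by_value[of "rotate_sobolev T u - u"] that subspace_diff[OF subspace_H1 rotate_H1[OF assms] assms] by simp
  then show ?thesis using iff by metis
qed

end

text \<open>As a fixed-point condition for linear isometries radial symmetry is visibly a closed
  linear condition.\<close>

lemma H1_radial_iff: "u \<in> H1_radial \<longleftrightarrow> u \<in> H1 \<and> (\<forall>T. orthogonal_transformation T \<longrightarrow> rotate_sobolev T u = u)"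
  unfolding H1_radial_def mem_Collect_eq using rotate_fixed_iff[of _ u] by metis

lemma rotate_linear:
  assumes T: "orthogonal_transformation T"
  shows "rotate_sobolev T (u + v) = rotate_sobolev T u + rotate_sobolev T v" "rotate_sobolev T (r *\<^sub>R u) = r *\<^sub>R rotate_sobolev T u"
proof -
  note ml = measure_preserving_orthogonal[OF T]
  show 1: "rotate_sobolev T (u + v) = rotate_sobolev T u + rotate_sobolev T v"
    using rotate_diff[OF T, of "u + v" v] by (simp add: eq_diff_eq)
  have "snd (rotate_sobolev T (r *\<^sub>R u)) = snd (r *\<^sub>R rotate_sobolev T u)"
    unfolding L2_eq_iff snd_scaleR
    using snd_rotate[OF T, of "r *\<^sub>R u"] snd_rotate[OF T, of u] AE_measure_preserving[OF ml fun_of_scaleR[of r "snd u"]]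
      fun_of_scaleR[of r "snd (rotate_sobolev T u)"]
    by eventually_elim (simp add: linear_scale[OF adjoint_lin[OF T]])
  moreover have "fst (rotate_sobolev T (r *\<^sub>R u)) = fst (r *\<^sub>R rotate_sobolev T u)"
    by (simp add: rotate_sobolev_def L2_comp_scaleR[OF ml])
  ultimately show "rotate_sobolev T (r *\<^sub>R u) = r *\<^sub>R rotate_sobolev T u" by (rule prod_eqI[rotated])
qed

lemma subspace_H1_radial: "subspace (H1_radial :: 'a::euclidean_space sobolev set)"
proof (rule subspaceI)
  have "rotate_sobolev T 0 = 0" if "orthogonal_transformation T" for T :: "'a \<Rightarrow> 'a"
    using rotate_linear(2)[OF that, of 0 0] by simp
  then show "0 \<in> (H1_radial :: 'a sobolev set)" by (simp add: H1_radial_iff subspace_0[OF subspace_H1])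
  show "u + v \<in> H1_radial" if "u \<in> H1_radial" "v \<in> H1_radial" for u v :: "'a sobolev"
    using that subspace_add[OF subspace_H1, of u v] by (simp add: H1_radial_iff rotate_linear)
  show "r *\<^sub>R u \<in> H1_radial" if "u \<in> H1_radial" for r and u :: "'a sobolev"
    using that subspace_scale[OF subspace_H1, of u r] by (simp add: H1_radial_iff rotate_linear)
qed

lemma closed_H1_radial: "closed (H1_radial :: 'a::euclidean_space sobolev set)"
proof -
  have "closed {u :: 'a sobolev. rotate_sobolev T u = u}" if T: "orthogonal_transformation T" for T
  proof -
    have "bounded_linear (rotate_sobolev T)"
      by (rule bounded_linear_intro[where K = 1]) (auto simp: rotate_linear[OF T] rotate_norm[OF T])
    then have "continuous_on UNIV (rotate_sobolev T)" by (rule linear_continuous_on)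
    then show ?thesis by (intro closed_Collect_eq continuous_on_id)
  qed
  then have "closed (H1 \<inter> (\<Inter>T\<in>{T. orthogonal_transformation T}. {u :: 'a sobolev. rotate_sobolev T u = u}))"
    by (intro closed_Int closed_H1 closed_INT ballI) simp
  also have "H1 \<inter> (\<Inter>T\<in>{T. orthogonal_transformation T}. {u :: 'a sobolev. rotate_sobolev T u = u}) = H1_radial"
    by (auto simp: H1_radial_iff)
  finally show ?thesis .
qed

lemma subspace_H_space: "subspace (H_space \<Omega>)"
  by (simp add: H_space_def subspace_H1_radial subspace_H10)

lemma closed_H_space: "closed (H_space \<Omega>)"
  by (simp add: H_space_def closed_H1_radial closed_H10)

lemma H_space_subset_H10: "H_space \<Omega> \<subseteq> H10 \<Omega>"
  using H1_eq_H10 by (auto simp: H_space_def H1_radial_def)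

section \<open>The quadratic and quartic forms\<close>

definition sobolev_form :: "real \<Rightarrow> 'a::euclidean_space sobolev \<Rightarrow> 'a sobolev \<Rightarrow> real" where
  "sobolev_form lam u v = snd u \<bullet> snd v + lam * (fst u \<bullet> fst v)"

text \<open>The projection makes the product total, as products of elements outside of \<open>H\<^sup>1\<close> need not be
  square integrable.\<close>

abbreviation H1_projection :: "'a::euclidean_space sobolev \<Rightarrow> 'a sobolev" where
  "H1_projection \<equiv> orthogonal_projection H1"

definition sobolev_product :: "'a::euclidean_space sobolev \<Rightarrow> 'a sobolev \<Rightarrow> ('a, real) L2" where
  "sobolev_product u v = class_of (\<lambda>x. val (H1_projection u) x * val (H1_projection v) x)"

lemma bounded_bilinear_linear_combination:
  fixes f g :: "'e::real_normed_vector \<Rightarrow> 'f::real_normed_vector \<Rightarrow> real"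
  assumes "bounded_bilinear f" "bounded_bilinear g"
  shows "bounded_bilinear (\<lambda>u v. f u v + r * g u v)"
proof -
  interpret f: bounded_bilinear f by (rule assms)
  interpret g: bounded_bilinear g by (rule assms)
  obtain K where K: "\<And>u v. norm (f u v) \<le> norm u * norm v * K" using f.bounded by blast
  obtain L where L: "\<And>u v. norm (g u v) \<le> norm u * norm v * L" using g.bounded by blast
  show ?thesis
  proof
    have "norm (f u v + r * g u v) \<le> norm u * norm v * (K + \<bar>r\<bar> * L)" for u v
    proof -
      have "norm (f u v + r * g u v) \<le> norm (f u v) + \<bar>r\<bar> * norm (g u v)"
        by (rule norm_triangle_le) (simp add: abs_mult)
      also have "\<dots> \<le> norm u * norm v * K + \<bar>r\<bar> * (norm u * norm v * L)"
        by (intro add_mono K mult_left_mono L) auto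
      finally show ?thesis by (simp add: algebra_simps)
    qed
    then show "\<exists>K. \<forall>u v. norm (f u v + r * g u v) \<le> norm u * norm v * K" by blast
  qed (auto simp: f.add_left f.add_right f.scaleR_left f.scaleR_right g.add_left g.add_right g.scaleR_left g.scaleR_right algebra_simps)
qed

lemma bounded_bilinear_sobolev_form: "bounded_bilinear (sobolev_form lam :: 'a::euclidean_space sobolev \<Rightarrow> _)"
  unfolding sobolev_form_def
  by (intro bounded_bilinear_linear_combination bounded_bilinear.comp[OF bounded_bilinear_inner]
      bounded_linear_fst bounded_linear_snd)

lemma sobolev_form_sym: "sobolev_form lam u v = sobolev_form lam v u"
  by (simp add: sobolev_form_def inner_commute)

lemma sobolev_form_lower_bound: "min 1 lam * (norm u)\<^sup>2 \<le> sobolev_form lam u u"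
proof -
  have "(norm u)\<^sup>2 = (norm (fst u))\<^sup>2 + (norm (snd u))\<^sup>2" by (simp add: power2_norm_eq_inner inner_prod_def)
  moreover have "min 1 lam * (norm (fst u))\<^sup>2 \<le> lam * (norm (fst u))\<^sup>2" by (intro mult_right_mono) auto
  moreover have "min 1 lam * (norm (snd u))\<^sup>2 \<le> 1 * (norm (snd u))\<^sup>2" by (intro mult_right_mono) auto
  ultimately show ?thesis by (simp add: sobolev_form_def power2_norm_eq_inner algebra_simps)
qed

lemma inner_class_of_class_of:
  assumes "square_integrable f" "square_integrable g"
  shows "class_of f \<bullet> class_of g = (LINT x|lborel. f x \<bullet> g x)"
proof -
  have [measurable]: "f \<in> borel_measurable borel" "g \<in> borel_measurable borel"
    using assms by (auto intro: square_integrable_measurable)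
  show ?thesis unfolding inner_class_of[OF assms(2)]
    by (rule integral_cong_AE) (measurable, use fun_of_class_of[OF assms(1)] in eventually_elim, simp)
qed

lemma val_add: "AE x in lborel. val (u + v) x = val u x + val v x"
  and val_scaleR: "AE x in lborel. val (r *\<^sub>R u) x = r * val u x"
  using fun_of_add[of "fst u" "fst v"] fun_of_scaleR[of r "fst u"] by (auto simp: val_def)

lemma ennreal_square_le_imp_le: "x\<^sup>2 \<le> (ennreal r)\<^sup>2 \<Longrightarrow> 0 \<le> r \<Longrightarrow> x \<le> ennreal r"
  by (cases x) (auto simp: ennreal_power ennreal_top_mult power2_eq_square[of top] top_unique intro: ennreal_leI power2_le_imp_le)

context
  fixes dim_type :: "'a::euclidean_space itself"
  assumes dim: "DIM('a) \<le> 3"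
begin

lemma L4_constant_pos: "L4_constant TYPE('a) > 0"
  using cell_constant_nonneg[where 'a = 'a] by (simp add: L4_constant_def add_pos_nonneg)

lemma val_L4:
  fixes u :: "'a sobolev"
  assumes u: "u \<in> H1"
  shows "L4_energy (val u) \<le> ennreal ((L4_constant TYPE('a) * norm u) ^ 4)"
proof (cases "u = 0")
  case True
  have "L4_energy (val u) = (\<integral>\<^sup>+x. 0 \<partial>(lborel :: 'a measure))" unfolding L4_energy_def
    by (rule nn_integral_cong_AE, use fun_of_zero[where 'a = 'a and 'b = real] in eventually_elim)
      (simp add: True val_def)
  then show ?thesis by simp
next
  case False
  have n: "norm (fst u) \<le> norm u" "norm (snd u) \<le> norm u"
    using norm_fst_le[of "fst u" "snd u"] norm_snd_le[of "snd u" "fst u"] by simp_all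
  show ?thesis
  proof (rule L4_embedding[OF dim val_square_integrable(1)])
    show "L2_energy (val u) \<le> ennreal ((norm u)\<^sup>2)"
      unfolding val_def L2_energy_fun_of by (intro ennreal_leI power_mono n) simp
    show "translation_bound (val u) (norm u)"
      by (rule translation_boundI_mono[OF H10_translation_bound[of u UNIV]]) (use u n in \<open>auto simp: H1_eq_H10\<close>)
  qed (use False in simp)
qed

text \<open>By Cauchy-Schwarz the square of the \<open>L\<^sup>2\<close> energy of the product is at
  most the product of the two fourth-power integrals, to which the embedding applies.\<close>

lemma H1_product:
  fixes u v :: "'a sobolev"
  assumes u: "u \<in> H1" and v: "v \<in> H1"
  shows "square_integrable (\<lambda>x. val u x * val v x)"
    and "norm (class_of (\<lambda>x. val u x * val v x)) \<le> (L4_constant TYPE('a))\<^sup>2 * norm u * norm v"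
proof -
  let ?S = "L4_constant TYPE('a)" and ?f = "\<lambda>x. val u x * val v x"
  have "(L2_energy ?f)\<^sup>2 = (\<integral>\<^sup>+x. ennreal ((val u x)\<^sup>2) * ennreal ((val v x)\<^sup>2) \<partial>lborel)\<^sup>2"
    by (simp add: L2_energy_def ennreal_mult'[symmetric] power_mult_distrib)
  also have "\<dots> \<le> L4_energy (val u) * L4_energy (val v)"
    using Cauchy_Schwarz_nn_integral[of "\<lambda>x. ennreal ((val u x)\<^sup>2)" lborel "\<lambda>x. ennreal ((val v x)\<^sup>2)"]
    by (simp add: L4_energy_def ennreal_power flip: power_mult)
  also have "\<dots> \<le> ennreal ((?S * norm u) ^ 4) * ennreal ((?S * norm v) ^ 4)"
    by (intro mult_mono val_L4 u v) auto
  also have "\<dots> = (ennreal ((?S\<^sup>2 * norm u * norm v)\<^sup>2))\<^sup>2"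
    using L4_constant_pos by (simp add: ennreal_mult'[symmetric] ennreal_power power_mult_distrib flip: power_mult)
  finally have le: "L2_energy ?f \<le> ennreal ((?S\<^sup>2 * norm u * norm v)\<^sup>2)"
    using L4_constant_pos by (intro ennreal_square_le_imp_le) auto
  show sq: "square_integrable ?f"
    unfolding square_integrable_iff using le by (auto simp: le_less_trans[OF le])
  show "norm (class_of ?f) \<le> ?S\<^sup>2 * norm u * norm v"
    using le unfolding L2_energy_class_of[OF sq] by (auto intro: power2_le_imp_le)
qed

lemmas P_in = orthogonal_projection_in[OF subspace_H1 closed_H1]
  and P_ident = orthogonal_projection_ident[OF subspace_H1 closed_H1]
  and P_linear = bounded_linear_orthogonal_projection[OF subspace_H1 closed_H1]

lemma sobolev_product_sym: "sobolev_product u v = sobolev_product v (u :: 'a sobolev)"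
  by (simp add: sobolev_product_def mult.commute)

lemma sobolev_product_H1: "u \<in> H1 \<Longrightarrow> v \<in> H1 \<Longrightarrow> sobolev_product u v = class_of (\<lambda>x. val u x * val v x)"
  by (simp add: sobolev_product_def P_ident)

lemma bounded_bilinear_sobolev_product: "bounded_bilinear (sobolev_product :: 'a sobolev \<Rightarrow> _)"
proof -
  have P: "H1_projection (u + v) = H1_projection u + H1_projection v" "H1_projection (r *\<^sub>R u) = r *\<^sub>R H1_projection u"
    for u v :: "'a sobolev" and r
    by (rule linear_add[OF bounded_linear.linear[OF P_linear]], rule linear_scale[OF bounded_linear.linear[OF P_linear]])
  note sq = H1_product(1)[OF P_in P_in]
  have add: "sobolev_product (u + u') v = sobolev_product u v + sobolev_product u' v" for u u' v :: "'a sobolev"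
  proof -
    have "class_of (\<lambda>x. val (H1_projection (u + u')) x * val (H1_projection v) x) = class_of (\<lambda>x. val (H1_projection u) x * val (H1_projection v) x + val (H1_projection u') x * val (H1_projection v) x)"
      unfolding class_of_eq_iff[OF sq square_integrable_add[OF sq sq]] unfolding P
      using val_add[of "H1_projection u" "H1_projection u'"] by eventually_elim (simp add: algebra_simps)
    then show ?thesis unfolding sobolev_product_def class_of_add[OF sq sq] .
  qed
  have scale: "sobolev_product (r *\<^sub>R u) v = r *\<^sub>R sobolev_product u v" for r and u v :: "'a sobolev"
  proof -
    have "class_of (\<lambda>x. val (H1_projection (r *\<^sub>R u)) x * val (H1_projection v) x) = class_of (\<lambda>x. r *\<^sub>R (val (H1_projection u) x * val (H1_projection v) x))"
      unfolding class_of_eq_iff[OF sq square_integrable_scaleR[OF sq]] unfolding P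
      using val_scaleR[of r "H1_projection u"] by eventually_elim simp
    then show ?thesis unfolding sobolev_product_def class_of_scaleR[OF sq] .
  qed
  obtain K where K: "K > 0" "\<And>u :: 'a sobolev. norm (H1_projection u) \<le> norm u * K" using bounded_linear.pos_bounded[OF P_linear] by auto
  have bd: "norm (sobolev_product u v) \<le> norm u * norm v * ((L4_constant TYPE('a))\<^sup>2 * K\<^sup>2)" for u v :: "'a sobolev"
  proof -
    have "norm (sobolev_product u v) \<le> (L4_constant TYPE('a))\<^sup>2 * (norm (H1_projection u) * norm (H1_projection v))"
      unfolding sobolev_product_def using H1_product(2)[OF P_in P_in, of u v] by (simp add: mult.assoc)
    also have "\<dots> \<le> (L4_constant TYPE('a))\<^sup>2 * ((norm u * K) * (norm v * K))"
      by (intro mult_left_mono mult_mono K) (use K(1) in auto)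
    finally show ?thesis by (simp add: power2_eq_square mult_ac)
  qed
  show ?thesis
  proof
    show "\<exists>K. \<forall>u v :: 'a sobolev. norm (sobolev_product u v) \<le> norm u * norm v * K" using bd by blast
    show "sobolev_product u (v + v') = sobolev_product u v + sobolev_product u v'" for u v v' :: "'a sobolev"
      using add[of v v' u] by (simp add: sobolev_product_sym)
    show "sobolev_product u (r *\<^sub>R v) = r *\<^sub>R sobolev_product u v" for u v :: "'a sobolev" and r
      using scale[of r v u] by (simp add: sobolev_product_sym)
  qed (fact add scale)+
qed

lemma sobolev_product_inner:
  "sobolev_product u v \<bullet> sobolev_product w (z :: 'a sobolev) =
    (LINT x|lborel. val (H1_projection u) x * val (H1_projection v) x * val (H1_projection w) x * val (H1_projection z) x)"
  unfolding sobolev_product_def inner_class_of_class_of[OF H1_product(1)[OF P_in P_in] H1_product(1)[OF P_in P_in]]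
  by (simp add: mult.assoc)

lemma sobolev_product_inner_H1:
  "u \<in> H1 \<Longrightarrow> v \<in> H1 \<Longrightarrow> w \<in> H1 \<Longrightarrow> z \<in> H1 \<Longrightarrow> sobolev_product u v \<bullet> sobolev_product w (z :: 'a sobolev) =
    (LINT x|lborel. val u x * val v x * val w x * val z x)"
  unfolding sobolev_product_inner by (simp add: P_ident)

lemma integrable_sobolev_product:
  fixes u v w z :: "'a sobolev"
  assumes "u \<in> H1" "v \<in> H1" "w \<in> H1" "z \<in> H1"
  shows "integrable lborel (\<lambda>x. val u x * val v x * val w x * val z x)"
  using integrable_inner_square_integrable[OF H1_product(1)[OF assms(1,2)] H1_product(1)[OF assms(3,4)]]
  by (simp add: mult.assoc)

lemma sobolev_product_inner_sym:
  "sobolev_product u v \<bullet> sobolev_product w z = sobolev_product u w \<bullet> sobolev_product v (z :: 'a sobolev)"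
  unfolding sobolev_product_inner by (simp add: mult_ac)

end

section \<open>Coercivity from a compact perturbation\<close>

text \<open>Bolzano-Weierstrass for one functional at a time, thinning the sequence at each of the
  finitely many steps.\<close>

lemma convergent_functionals_subsequence:
  fixes x :: "nat \<Rightarrow> 'e::real_inner"
  assumes "finite G" "\<And>n. norm (x n) \<le> C"
  shows "\<exists>r. strict_mono (r :: nat \<Rightarrow> nat) \<and> (\<forall>g\<in>G. convergent (\<lambda>n. g \<bullet> x (r n)))"
  using assms(1)
proof (induction G)
  case empty
  show ?case by (intro exI[of _ id]) (simp add: strict_mono_def)
next
  case (insert g G)
  then obtain r where r: "strict_mono (r :: nat \<Rightarrow> nat)" "\<And>g. g \<in> G \<Longrightarrow> convergent (\<lambda>n. g \<bullet> x (r n))" by metis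
  have "\<bar>g \<bullet> x (r n)\<bar> \<le> norm g * C" for n
    by (rule order_trans[OF Cauchy_Schwarz_ineq2 mult_left_mono[OF assms(2)]]) simp
  then have "bounded (range (\<lambda>n. g \<bullet> x (r n)))" unfolding bounded_iff by auto
  from bounded_imp_convergent_subsequence[OF this] obtain l s where s: "strict_mono (s :: nat \<Rightarrow> nat)"
    "((\<lambda>n. g \<bullet> x (r n)) \<circ> s) \<longlonglongrightarrow> l" by blast
  have "convergent (\<lambda>n. h \<bullet> x ((r \<circ> s) n))" if h: "h \<in> insert g G" for h
  proof (cases "h = g")
    case True
    then show ?thesis using s(2) by (auto simp: convergent_def o_def)
  next
    case False
    then show ?thesis using convergent_subseq_convergent[OF r(2)[of h] s(1)] h by (simp add: o_def)
  qed
  then show ?case using strict_mono_o[OF r(1) s(1)] by blast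
qed

text \<open>If no constant worked, Q would tend to 0 along unit vectors. On a subsequence the
  finitely many functionals converge, and the Garding inequality turns this into convergence in
  norm. The limit is a unit vector with \<open>Q v v = 0\<close>; as a minimum point of a
  nonnegative form it lies in the kernel.\<close>

lemma coercive_if_nonnegative:
  fixes Q :: "'e::{real_inner,complete_space} \<Rightarrow> 'e \<Rightarrow> real" and f :: "'i \<Rightarrow> 'e"
  assumes S: "subspace S" "closed S" and Q: "bounded_bilinear Q" and sym: "\<And>u v. Q u v = Q v u"
    and nonneg: "\<And>v. v \<in> S \<Longrightarrow> 0 \<le> Q v v"
    and kernel: "\<And>v. v \<in> S \<Longrightarrow> (\<And>w. w \<in> S \<Longrightarrow> Q v w = 0) \<Longrightarrow> v = 0"
    and m: "m > 0" and C: "C \<ge> 0" and G: "finite G"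
    and garding: "\<And>v. v \<in> S \<Longrightarrow> m * (norm v)\<^sup>2 \<le> Q v v + C * (\<Sum>g\<in>G. (f g \<bullet> v)\<^sup>2)"
  shows "\<exists>\<kappa>>0. \<forall>v\<in>S. \<kappa> * (norm v)\<^sup>2 \<le> Q v v"
proof (rule ccontr)
  interpret Q: bounded_bilinear Q by (rule Q)
  assume neg: "\<not> ?thesis"
  have "\<exists>v. v \<in> S \<and> norm v = 1 \<and> Q v v < 1 / real (Suc n)" for n
  proof -
    have "1 / real (Suc n) > 0" by simp
    with neg obtain v where v: "v \<in> S" "Q v v < 1 / real (Suc n) * (norm v)\<^sup>2" by (meson not_le)
    then have v0: "v \<noteq> 0" using Q.zero_left by auto
    let ?w = "(1 / norm v) *\<^sub>R v"
    have "Q ?w ?w = Q v v / (norm v)\<^sup>2" by (simp add: Q.scaleR_left Q.scaleR_right power2_eq_square)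
    also have "\<dots> < 1 / real (Suc n)" using v(2) v0 by (simp add: divide_simps mult.commute del: of_nat_Suc)
    finally have "Q ?w ?w < 1 / real (Suc n)" .
    then show ?thesis using v0 subspace_scale[OF S(1) v(1)] by (intro exI[of _ ?w]) (simp del: of_nat_Suc)
  qed
  then obtain x where x: "\<And>n. x n \<in> S" "\<And>n. norm (x n) = 1" "\<And>n. Q (x n) (x n) < 1 / real (Suc n)" by metis
  obtain r where r: "strict_mono (r :: nat \<Rightarrow> nat)" "\<And>g. g \<in> G \<Longrightarrow> convergent (\<lambda>n. f g \<bullet> x (r n))"
    using convergent_functionals_subsequence[OF finite_imageI[OF G], of x 1 f] x(2) by auto
  define y where "y n = x (r n)" for n
  have y: "y n \<in> S" "norm (y n) = 1" for n by (simp_all add: y_def x)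
  have "(\<lambda>n. Q (x n) (x n)) \<longlonglongrightarrow> 0"
  proof (rule tendsto_sandwich)
    show "\<forall>\<^sub>F n in sequentially. 0 \<le> Q (x n) (x n)" by (simp add: nonneg x)
    show "\<forall>\<^sub>F n in sequentially. Q (x n) (x n) \<le> 1 / real (Suc n)" using x(3) by (simp add: less_imp_le del: of_nat_Suc)
    show "(\<lambda>n. 1 / real (Suc n)) \<longlonglongrightarrow> 0" using LIMSEQ_inverse_real_of_nat by (simp add: inverse_eq_divide)
  qed auto
  then have Qy: "(\<lambda>n. Q (y n) (y n)) \<longlonglongrightarrow> 0" unfolding y_def by (rule LIMSEQ_subseq_LIMSEQ[OF _ r(1), unfolded o_def])
  \<comment> \<open>The parallelogram identity with the nonnegative term
    \<open>Q (u + v) (u + v)\<close> dropped.\<close>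
  have par: "Q (u - v) (u - v) \<le> 2 * Q u u + 2 * Q v v" if "u \<in> S" "v \<in> S" for u v
    using nonneg[OF subspace_add[OF S(1) that]] by (simp add: Q.add_left Q.add_right Q.diff_left Q.diff_right sym[of v u])
  have "Cauchy y"
  proof (rule CauchyI)
    fix e :: real assume e: "e > 0"
    \<comment> \<open>For late indices the right side of the Garding inequality is at most
      \<open>\<delta> * D\<close>: 4 \<delta> from the form Q and, with weight C, another 4 \<delta>
      from each functional, where \<open>\<delta> \<le> 1\<close> replaces
      \<open>(2 * \<delta>)\<^sup>2\<close>.\<close>
    define D where "D = 4 + 4 * C * card G"
    define \<delta> where "\<delta> = min 1 (m * e\<^sup>2 / (2 * D))"
    have D: "D > 0" using C by (simp add: D_def add_pos_nonneg)
    have \<delta>: "0 < \<delta>" "\<delta> \<le> 1" "\<delta> * D < m * e\<^sup>2"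
    proof -
      show "0 < \<delta>" "\<delta> \<le> 1" using D m e by (auto simp: \<delta>_def)
      have "\<delta> * D \<le> m * e\<^sup>2 / (2 * D) * D" using D by (intro mult_right_mono) (auto simp: \<delta>_def)
      also have "\<dots> < m * e\<^sup>2" using D m e by simp
      finally show "\<delta> * D < m * e\<^sup>2" .
    qed
    have "\<forall>\<^sub>F n in sequentially. \<forall>g\<in>G. \<bar>f g \<bullet> y n - lim (\<lambda>n. f g \<bullet> y n)\<bar> < \<delta>"
    proof (rule eventually_ball_finite[OF G], rule ballI)
      fix g assume "g \<in> G"
      then have "(\<lambda>n. f g \<bullet> y n) \<longlonglongrightarrow> lim (\<lambda>n. f g \<bullet> y n)" using r(2)[of g] by (simp add: y_def convergent_LIMSEQ_iff)
      from tendstoD[OF this \<delta>(1)] show "\<forall>\<^sub>F n in sequentially. \<bar>f g \<bullet> y n - lim (\<lambda>n. f g \<bullet> y n)\<bar> < \<delta>"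
        by (simp add: dist_real_def)
    qed
    moreover have "\<forall>\<^sub>F n in sequentially. Q (y n) (y n) < \<delta>" using order_tendstoD(2)[OF Qy \<delta>(1)] .
    ultimately have "\<forall>\<^sub>F n in sequentially. (\<forall>g\<in>G. \<bar>f g \<bullet> y n - lim (\<lambda>n. f g \<bullet> y n)\<bar> < \<delta>) \<and> Q (y n) (y n) < \<delta>"
      by (rule eventually_conj)
    then obtain N where N: "\<And>n g. n \<ge> N \<Longrightarrow> g \<in> G \<Longrightarrow> \<bar>f g \<bullet> y n - lim (\<lambda>n. f g \<bullet> y n)\<bar> < \<delta>"
      "\<And>n. n \<ge> N \<Longrightarrow> Q (y n) (y n) < \<delta>" unfolding eventually_sequentially by metis
    have "norm (y a - y b) < e" if a: "a \<ge> N" and b: "b \<ge> N" for a b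
    proof -
      have "(f g \<bullet> (y a - y b))\<^sup>2 \<le> 4 * \<delta>" if g: "g \<in> G" for g
      proof -
        have "\<bar>f g \<bullet> (y a - y b)\<bar> \<le> 2 * \<delta>" using N(1)[OF a g] N(1)[OF b g] by (simp add: inner_diff_right)
        then have "(f g \<bullet> (y a - y b))\<^sup>2 \<le> (2 * \<delta>)\<^sup>2" by (rule abs_le_square_iff[THEN iffD1, OF order_trans]) simp
        also have "\<dots> \<le> 4 * \<delta>" using \<delta> by (simp add: power2_eq_square)
        finally show ?thesis .
      qed
      then have sum: "(\<Sum>g\<in>G. (f g \<bullet> (y a - y b))\<^sup>2) \<le> card G * (4 * \<delta>)" by (rule sum_bounded_above)
      have "m * (norm (y a - y b))\<^sup>2 \<le> Q (y a - y b) (y a - y b) + C * (\<Sum>g\<in>G. (f g \<bullet> (y a - y b))\<^sup>2)"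
        by (rule garding[OF subspace_diff[OF S(1) y(1) y(1)]])
      also have "\<dots> \<le> 4 * \<delta> + C * (card G * (4 * \<delta>))"
        using par[OF y(1) y(1), of a b] N(2)[OF a] N(2)[OF b] by (intro add_mono mult_left_mono sum C) linarith
      also have "\<dots> = \<delta> * D" by (simp add: D_def algebra_simps)
      also have "\<dots> < m * e\<^sup>2" by (rule \<delta>)
      finally have "(norm (y a - y b))\<^sup>2 < e\<^sup>2" using m by simp
      then show ?thesis using e by (simp add: power_less_imp_less_base)
    qed
    then show "\<exists>M. \<forall>a\<ge>M. \<forall>b\<ge>M. norm (y a - y b) < e" by blast
  qed
  then obtain v where v: "y \<longlonglongrightarrow> v" using Cauchy_convergent_iff convergent_def by blast
  have vS: "v \<in> S" by (rule closed_sequentially[where f = y, OF S(2) y(1) v])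
  have "norm v = 1" using tendsto_norm[OF v] y(2) by (simp add: LIMSEQ_const_iff)
  have Qv: "Q v v = 0" by (rule LIMSEQ_unique[OF Q.tendsto[OF v v] Qy])
  have "Q v w = 0" if w: "w \<in> S" for w
  proof -
    have "2 * Q v w = 0"
    proof (rule linear_term_zero)
      fix t
      have "0 \<le> Q (v + t *\<^sub>R w) (v + t *\<^sub>R w)" by (intro nonneg subspace_add[OF S(1)] subspace_scale[OF S(1)] vS w)
      then show "0 \<le> t * (2 * Q v w) + t\<^sup>2 * Q w w"
        by (simp add: Q.add_left Q.add_right Q.scaleR_left Q.scaleR_right sym[of w v] Qv power2_eq_square algebra_simps)
    qed
    then show ?thesis by simp
  qed
  from kernel[OF vS this] \<open>norm v = 1\<close> show False by simp
qed

section \<open>The scalar ground state\<close>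

lemma set_integral_eq_integral:
  fixes f :: "'a::euclidean_space \<Rightarrow> real"
  assumes [measurable]: "\<Omega> \<in> sets borel" "f \<in> borel_measurable borel" and "AE x in lborel. x \<notin> \<Omega> \<longrightarrow> f x = 0"
  shows "(LINT x:\<Omega>|lborel. f x) = (LINT x|lborel. f x)"
  unfolding set_lebesgue_integral_def
  by (rule integral_cong_AE) (measurable, use assms(3) in eventually_elim, auto simp: indicator_def)

lemma not_AE_outside_open:
  fixes \<Omega> :: "'a::euclidean_space set"
  assumes "open \<Omega>" "\<Omega> \<noteq> {}"
  shows "\<not> (AE x in lborel. x \<notin> \<Omega>)"
proof
  assume "AE x in lborel. x \<notin> \<Omega>"
  then have "\<Omega> \<in> null_sets lborel" using assms(1) by (simp add: AE_iff_null_sets)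
  then have "negligible \<Omega>" using null_sets_completionI negligible_iff_null_sets by blast
  then show False using assms open_not_negligible by blast
qed

context
  fixes \<Omega> :: "'a::euclidean_space set"
  assumes dim: "DIM('a) \<le> 3" and \<Omega>: "open \<Omega>"
begin

lemma domain_measurable: "\<Omega> \<in> sets borel" using \<Omega> by simp

lemma in_H1: "u \<in> H10 \<Omega> \<Longrightarrow> u \<in> H1" using H10_subset_H1 by blast

lemma sobolev_form_integral:
  assumes u: "u \<in> H10 \<Omega>"
  shows "(LINT x:\<Omega>|lborel. (wgrad u x \<bullet> wgrad v x + lam * val u x * val v x)) = sobolev_form lam u v"
proof -
  note [measurable] = domain_measurable
  have "(LINT x:\<Omega>|lborel. (wgrad u x \<bullet> wgrad v x + lam * val u x * val v x))
      = (LINT x|lborel. (wgrad u x \<bullet> wgrad v x + lam * val u x * val v x))"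
    by (rule set_integral_eq_integral) (measurable, use H10_vanishes[OF u] in eventually_elim, auto)
  also have "\<dots> = (LINT x|lborel. wgrad u x \<bullet> wgrad v x + lam * (val u x \<bullet> val v x))"
    by (simp add: mult.assoc)
  also have "\<dots> = (LINT x|lborel. wgrad u x \<bullet> wgrad v x) + (LINT x|lborel. lam * (val u x \<bullet> val v x))"
    by (intro Bochner_Integration.integral_add integrable_mult_right integrable_inner_square_integrable val_square_integrable)
  also have "\<dots> = sobolev_form lam u v"
    by (simp add: sobolev_form_def inner_L2 val_def wgrad_def)
  finally show ?thesis .
qed

lemma sobolev_product_integral:
  assumes "u \<in> H10 \<Omega>" "v \<in> H10 \<Omega>" "w \<in> H10 \<Omega>" "z \<in> H10 \<Omega>"
  shows "(LINT x:\<Omega>|lborel. val u x * val v x * val w x * val z x) = sobolev_product u v \<bullet> sobolev_product w z"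
proof -
  note [measurable] = domain_measurable
  show ?thesis unfolding sobolev_product_inner_H1[OF dim assms[THEN in_H1]]
    by (rule set_integral_eq_integral) (measurable, use H10_vanishes[OF assms(1)] in eventually_elim, simp)
qed

text \<open>Both sides are continuous in the test element, so test functions may be replaced by
  their closure. The form assumed for f covers the scalar equation, its linearization and one row of
  the system.\<close>

lemma weak_solution_iff:
  fixes u v w z :: "'a sobolev"
  assumes uvwz: "u \<in> H10 \<Omega>" "v \<in> H10 \<Omega>" "w \<in> H10 \<Omega>" "z \<in> H10 \<Omega>"
    and [measurable]: "f \<in> borel_measurable borel"
    and f: "AE x in lborel. f x = r * (val v x * val w x * val z x)"
  shows "weak_solution \<Omega> lam u f \<longleftrightarrow>
    (\<forall>\<eta>\<in>H10 \<Omega>. sobolev_form lam u \<eta> = r * (sobolev_product v w \<bullet> sobolev_product z \<eta>))"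
proof -
  note [measurable] = domain_measurable
  interpret B: bounded_bilinear "sobolev_form lam :: 'a sobolev \<Rightarrow> _" by (rule bounded_bilinear_sobolev_form)
  interpret \<beta>: bounded_bilinear "sobolev_product :: 'a sobolev \<Rightarrow> _" by (rule bounded_bilinear_sobolev_product[OF dim])
  have l: "(LINT x:\<Omega>|lborel. (wgrad u x \<bullet> gradient \<phi> x + lam * val u x * \<phi> x)) = sobolev_form lam u (test_element \<phi>)"
    (is "?l = _") and r: "(LINT x:\<Omega>|lborel. f x * \<phi> x) = r * (sobolev_product v w \<bullet> sobolev_product z (test_element \<phi>))"
    (is "?r = _") if \<phi>: "\<phi> \<in> test_functions \<Omega>" for \<phi>
  proof -
    note \<phi>' = test_functions_UNIV[OF \<phi>]
    note [measurable] = test_function_measurable[OF \<phi>']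
    note AE = fst_test_element[OF \<phi>'] snd_test_element[OF \<phi>']
    have "?l = (LINT x:\<Omega>|lborel. (wgrad u x \<bullet> wgrad (test_element \<phi>) x + lam * val u x * val (test_element \<phi>) x))"
      unfolding set_lebesgue_integral_def
      by (rule integral_cong_AE) (measurable, use AE in eventually_elim, simp)
    then show "?l = sobolev_form lam u (test_element \<phi>)" by (simp add: sobolev_form_integral[OF uvwz(1)])
    have "?r = (LINT x:\<Omega>|lborel. r * (val v x * val w x * val z x * val (test_element \<phi>) x))"
      unfolding set_lebesgue_integral_def
      by (rule integral_cong_AE) (measurable, use AE(1) f in eventually_elim, simp)
    also have "\<dots> = r * (sobolev_product v w \<bullet> sobolev_product z (test_element \<phi>))"
      by (simp add: sobolev_product_integral[OF uvwz(2-4) test_element_in_H10[OF \<phi>]])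
    finally show "?r = r * (sobolev_product v w \<bullet> sobolev_product z (test_element \<phi>))" .
  qed
  show ?thesis
  proof
    assume sol: "weak_solution \<Omega> lam u f"
    show "\<forall>\<eta>\<in>H10 \<Omega>. sobolev_form lam u \<eta> = r * (sobolev_product v w \<bullet> sobolev_product z \<eta>)"
    proof
      fix \<eta> assume \<eta>: "\<eta> \<in> H10 \<Omega>"
      obtain \<phi> where \<phi>: "\<And>n. \<phi> n \<in> test_functions \<Omega>" "(\<lambda>n. test_element (\<phi> n)) \<longlonglongrightarrow> \<eta>"
        by (rule H10_sequence[OF \<eta>]) auto
      have "(\<lambda>n. sobolev_form lam u (test_element (\<phi> n))) \<longlonglongrightarrow> sobolev_form lam u \<eta>"
        by (rule B.tendsto[OF tendsto_const \<phi>(2)])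
      moreover have "(\<lambda>n. r * (sobolev_product v w \<bullet> sobolev_product z (test_element (\<phi> n))))
          \<longlonglongrightarrow> r * (sobolev_product v w \<bullet> sobolev_product z \<eta>)"
        by (intro tendsto_mult_left tendsto_inner tendsto_const \<beta>.tendsto \<phi>(2))
      moreover have "sobolev_form lam u (test_element (\<phi> n)) = r * (sobolev_product v w \<bullet> sobolev_product z (test_element (\<phi> n)))" for n
        using sol l[OF \<phi>(1)] r[OF \<phi>(1)] \<phi>(1) unfolding weak_solution_def by metis
      ultimately show "sobolev_form lam u \<eta> = r * (sobolev_product v w \<bullet> sobolev_product z \<eta>)"
        using LIMSEQ_unique by simp
    qed
  next
    assume sol: "\<forall>\<eta>\<in>H10 \<Omega>. sobolev_form lam u \<eta> = r * (sobolev_product v w \<bullet> sobolev_product z \<eta>)"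
    show "weak_solution \<Omega> lam u f"
      unfolding weak_solution_def
    proof
      fix \<phi> assume \<phi>: "\<phi> \<in> test_functions \<Omega>"
      show "(LINT x:\<Omega>|lborel. (wgrad u x \<bullet> gradient \<phi> x + lam * val u x * \<phi> x)) = (LINT x:\<Omega>|lborel. f x * \<phi> x)"
        unfolding l[OF \<phi>] r[OF \<phi>] by (rule bspec[OF sol test_element_in_H10[OF \<phi>]])
    qed
  qed
qed

end

text \<open>Palais' principle of symmetric criticality for the linearized equation: the residual is
  represented by a rotation invariant element of \<open>H\<^sup>1\<close>.\<close>

lemma symmetric_criticality:
  fixes \<psi> U w :: "'a::euclidean_space sobolev"
  assumes dim: "DIM('a) \<le> 3" and \<psi>: "\<psi> \<in> H1_radial" and U: "U \<in> H1_radial"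
    and crit: "\<And>w. w \<in> H1_radial \<Longrightarrow> sobolev_form lam \<psi> w = r * (sobolev_product U U \<bullet> sobolev_product \<psi> w)"
    and w: "w \<in> H1"
  shows "sobolev_form lam \<psi> w = r * (sobolev_product U U \<bullet> sobolev_product \<psi> w)"
proof -
  interpret B: bounded_bilinear "sobolev_form lam :: 'a sobolev \<Rightarrow> _" by (rule bounded_bilinear_sobolev_form)
  interpret \<beta>: bounded_bilinear "sobolev_product :: 'a sobolev \<Rightarrow> _" by (rule bounded_bilinear_sobolev_product[OF dim])
  define F where "F w = sobolev_form lam \<psi> w - r * (sobolev_product U U \<bullet> sobolev_product \<psi> w)" for w
  have F: "bounded_linear F" unfolding F_def
    by (intro bounded_linear_sub B.bounded_linear_right bounded_linear_const_mult bounded_linear_inner_right_comp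
        \<beta>.bounded_linear_right)
  obtain C where C: "\<And>v. \<bar>F v\<bar> \<le> C * norm v" using bounded_linear.bounded[OF F] by (auto simp: mult.commute)
  obtain g where g: "g \<in> H1" "\<And>v. v \<in> H1 \<Longrightarrow> F v = g \<bullet> v"
    by (rule riesz_representation[OF subspace_H1 closed_H1, of F C])
      (use C in \<open>auto simp: linear_add[OF bounded_linear.linear[OF F]] linear_scale[OF bounded_linear.linear[OF F]]\<close>)
  have H1: "\<psi> \<in> H1" "U \<in> H1" using \<psi> U by (auto simp: H1_radial_def)
  have "rotate_sobolev T g = g" if T: "orthogonal_transformation T" for T :: "'a \<Rightarrow> 'a"
  proof -
    let ?R = "rotate_sobolev T"
    note mp = measure_preserving_orthogonal[OF T]
    note [measurable] = measure_preserving_measurable[OF mp]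
    have R\<psi>: "?R \<psi> = \<psi>" using \<psi> T by (simp add: H1_radial_iff)
    have val_R: "AE x in lborel. val (?R u) x = val u (T x)" for u
      using fun_of_L2_comp[OF mp, of "fst u"] by (simp add: val_def rotate_sobolev_def)
    have val_fixed: "AE x in lborel. val u (T x) = val u x" if "u \<in> H1_radial" for u
      using that T by (simp add: H1_radial_def)
    note Rg = rotate_H1[OF T g(1)]
    have "sobolev_form lam \<psi> (?R g) = sobolev_form lam (?R \<psi>) (?R g)" by (simp add: R\<psi>)
    also have "\<dots> = sobolev_form lam \<psi> g" unfolding sobolev_form_def inner_rotate[OF T] ..
    finally have 1: "sobolev_form lam \<psi> (?R g) = sobolev_form lam \<psi> g" .
    have "sobolev_product U U \<bullet> sobolev_product \<psi> (?R g)
        = (LINT x|lborel. val U (T x) * val U (T x) * val \<psi> (T x) * val g (T x))"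
      unfolding sobolev_product_inner_H1[OF dim H1(2) H1(2) H1(1) Rg]
      by (rule integral_cong_AE) (measurable, use val_R[of g] val_fixed[OF \<psi>] val_fixed[OF U] in eventually_elim, simp)
    also have "\<dots> = sobolev_product U U \<bullet> sobolev_product \<psi> g"
      unfolding sobolev_product_inner_H1[OF dim H1(2) H1(2) H1(1) g(1)]
      by (rule integral_measure_preserving[OF mp]) measurable
    finally have "F (?R g) = F g" unfolding F_def 1 by simp
    \<comment> \<open>Equality in Cauchy-Schwarz: \<open>?R g\<close> has the same norm as g, so the
      two coincide.\<close>
    then have "g \<bullet> ?R g = g \<bullet> g" using g(2)[OF Rg] g(2)[OF g(1)] by simp
    then have "(?R g - g) \<bullet> (?R g - g) = 0"
      by (simp add: inner_diff_left inner_diff_right rotate_inner[OF T] inner_commute[of "?R g" g])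
    then show ?thesis by simp
  qed
  then have "g \<in> H1_radial" using g(1) by (simp add: H1_radial_iff)
  \<comment> \<open>The radial g is itself an admissible direction, and the functional that it
    represents vanishes there.\<close>
  then have "g \<bullet> g = 0" using crit g(2)[OF g(1)] by (simp add: F_def)
  then have "F w = 0" using g(2)[OF w] by simp
  then show ?thesis by (simp add: F_def)
qed

text \<open>The square of U is approximated in \<open>L\<^sup>2\<close> by bounded functions of bounded support, for which
  the local bound applies.\<close>

lemma potential_finite_rank_bound:
  fixes U :: "'a::euclidean_space sobolev"
  assumes dim: "DIM('a) \<le> 3" and U: "U \<in> H1" and \<epsilon>: "\<epsilon> > 0"
  obtains I :: "'a set set" and f C where "finite I" "C \<ge> 0"
    "\<And>v. v \<in> H1 \<Longrightarrow> (norm (sobolev_product U v))\<^sup>2 \<le> \<epsilon> * (norm v)\<^sup>2 + C * (\<Sum>q\<in>I. (f q \<bullet> v)\<^sup>2)"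
proof -
  define S where "S = (L4_constant TYPE('a))\<^sup>2"
  define h where "h x = val U x * val U x" for x
  \<comment> \<open>The truncations have height at most n and support in the ball of radius n. At
    each x they equal h for large n, and they are dominated by h, which is square integrable by the
    embedding.\<close>
  define k where "k n x = indicator (cball 0 (real n)) x * min (h x) (real n)" for n x
  have S: "S \<ge> 0" by (simp add: S_def)
  have h: "square_integrable h" unfolding h_def by (rule H1_product(1)[OF dim U U])
  have h0: "h x \<ge> 0" for x by (simp add: h_def)
  have k0: "0 \<le> k n x" "k n x \<le> h x" for n x using h0[of x] by (auto simp: k_def indicator_def)
  note [measurable] = square_integrable_measurable[OF h]
  have [measurable]: "cball 0 (real n) \<in> sets (borel :: 'a measure)" for n by simp
  have km [measurable]: "k n \<in> borel_measurable borel" for n unfolding k_def by measurable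
  have k: "square_integrable (k n)" for n
  proof -
    have "integrable lborel (\<lambda>x. (h x)\<^sup>2)" using h by (simp add: square_integrable_def)
    then have "integrable lborel (\<lambda>x. (k n x)\<^sup>2)"
      by (rule Bochner_Integration.integrable_bound) (use k0 in \<open>auto intro!: AE_I2 power_mono\<close>)
    then show ?thesis by (simp add: square_integrable_def)
  qed
  have "(\<lambda>n. class_of (k n)) \<longlonglongrightarrow> class_of h"
  proof (rule class_of_dominated[OF km h h])
    show "norm (k n x - h x) \<le> \<bar>h x\<bar>" for n x using k0[where n = n and x = x] by simp
    show "(\<lambda>n. k n x) \<longlonglongrightarrow> h x" for x
    proof (rule tendsto_eventually, unfold eventually_sequentially, intro exI allI impI)
      fix n assume "nat \<lceil>max (norm x) (h x)\<rceil> \<le> n"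
      then have "max (norm x) (h x) \<le> real n" by linarith
      then show "k n x = h x" by (simp add: k_def)
    qed
  qed
  \<comment> \<open>Half of \<epsilon> is reserved for replacing h by a truncation; S is the
    constant in the \<open>L\<^sup>2\<close> bound for \<open>v\<^sup>2\<close>, and the added 1
    keeps the denominator positive.\<close>
  moreover define \<delta> where "\<delta> = \<epsilon> / (2 * (S + 1))"
  moreover have \<delta>: "\<delta> > 0" using \<epsilon> S by (simp add: \<delta>_def)
  ultimately obtain n where n: "norm (class_of (k n) - class_of h) < \<delta>"
    unfolding LIMSEQ_iff by blast
  \<comment> \<open>The accuracy is divided by n + 1 since the truncated potential can be as large
    as n.\<close>
  obtain I :: "'a set set" and C where I: "finite I" "\<And>q. q \<in> I \<Longrightarrow> q \<in> sets borel \<and> emeasure lborel q < \<infinity>" "C \<ge> 0"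
    and bd: "\<And>f D. square_integrable f \<Longrightarrow> translation_bound f D \<Longrightarrow>
      (\<integral>\<^sup>+x. indicator (cball 0 (real n)) x * ennreal ((f x)\<^sup>2) \<partial>lborel)
        \<le> ennreal (\<epsilon> / (2 * (real n + 1)) * D\<^sup>2 + C * (\<Sum>q\<in>I. (LINT y|lborel. indicator q y * f y)\<^sup>2))"
    by (rule local_finite_rank_bound[of "\<epsilon> / (2 * (real n + 1))" "real n"]) (use \<epsilon> in auto)
  define f :: "'a set \<Rightarrow> 'a sobolev" where "f q = (class_of (indicator q), 0)" for q
  show ?thesis
  proof (rule that[OF I(1), of "real n * C" f])
    show "real n * C \<ge> 0" using I(3) by simp
    fix v :: "'a sobolev" assume v: "v \<in> H1"
    let ?w = "\<lambda>x. val v x * val v x"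
    have sw: "square_integrable ?w" "norm (class_of ?w) \<le> S * norm v * norm v"
      using H1_product[OF dim v v] by (auto simp: S_def)
    have fq: "(LINT y|lborel. indicator q y * val v y) = f q \<bullet> v" if q: "q \<in> I" for q
    proof -
      have "f q \<bullet> v = fst v \<bullet> class_of (indicator q)" by (simp add: f_def inner_prod_def inner_commute)
      also have "\<dots> = (LINT y|lborel. val v y \<bullet> indicator q y)"
        using I(2)[OF q] by (simp add: inner_class_of square_integrable_indicator val_def)
      finally show ?thesis by (simp add: mult.commute)
    qed
    let ?\<Sigma> = "\<Sum>q\<in>I. (f q \<bullet> v)\<^sup>2"
    have iw: "integrable lborel (\<lambda>x. indicator (cball 0 (real n)) x * ?w x)"
      using integrable_mult_indicator[of "cball 0 (real n)" lborel ?w] integrable_inner_square_integrable[OF val_square_integrable(1) val_square_integrable(1), of v v]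
      by simp
    have "ennreal (LINT x|lborel. indicator (cball 0 (real n)) x * ?w x)
        = (\<integral>\<^sup>+x. ennreal (indicator (cball 0 (real n)) x * ?w x) \<partial>lborel)"
      by (rule nn_integral_eq_integral[symmetric, OF iw]) auto
    also have "\<dots> = (\<integral>\<^sup>+x. indicator (cball 0 (real n)) x * ennreal ((val v x)\<^sup>2) \<partial>lborel)"
      by (intro nn_integral_cong) (simp add: indicator_def power2_eq_square)
    also have "\<dots> \<le> ennreal (\<epsilon> / (2 * (real n + 1)) * (norm (snd v))\<^sup>2 + C * (\<Sum>q\<in>I. (LINT y|lborel. indicator q y * val v y)\<^sup>2))"
      using v by (intro bd val_square_integrable H10_translation_bound[of v UNIV]) (simp add: H1_eq_H10)
    also have "\<dots> = ennreal (\<epsilon> / (2 * (real n + 1)) * (norm (snd v))\<^sup>2 + C * ?\<Sigma>)" by (simp add: fq)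
    finally have loc: "(LINT x|lborel. indicator (cball 0 (real n)) x * ?w x)
        \<le> \<epsilon> / (2 * (real n + 1)) * (norm (snd v))\<^sup>2 + C * ?\<Sigma>"
      using \<epsilon> I(3) by (subst (asm) ennreal_le_iff) (auto intro!: add_nonneg_nonneg mult_nonneg_nonneg sum_nonneg)
    have "class_of (k n) \<bullet> class_of ?w = (LINT x|lborel. k n x * ?w x)"
      by (simp add: inner_class_of_class_of[OF k sw(1)])
    also have "\<dots> \<le> (LINT x|lborel. real n * (indicator (cball 0 (real n)) x * ?w x))"
    proof (rule integral_mono)
      show "integrable lborel (\<lambda>x. k n x * ?w x)" using integrable_inner_square_integrable[OF k sw(1), of n] by simp
      show "integrable lborel (\<lambda>x. real n * (indicator (cball 0 (real n)) x * ?w x))" using iw by (rule integrable_mult_right)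
      show "k n x * ?w x \<le> real n * (indicator (cball 0 (real n)) x * ?w x)" for x
        by (auto simp: k_def indicator_def intro!: mult_right_mono)
    qed
    also have "\<dots> = real n * (LINT x|lborel. indicator (cball 0 (real n)) x * ?w x)" by simp
    also have "\<dots> \<le> real n * (\<epsilon> / (2 * (real n + 1)) * (norm (snd v))\<^sup>2 + C * ?\<Sigma>)"
      by (intro mult_left_mono loc) simp
    also have "\<dots> = real n / (real n + 1) * (\<epsilon> / 2 * (norm (snd v))\<^sup>2) + real n * C * ?\<Sigma>"
      by (simp add: field_simps)
    also have "\<dots> \<le> 1 * (\<epsilon> / 2 * (norm v)\<^sup>2) + real n * C * ?\<Sigma>"
      using norm_snd_le[of "snd v" "fst v"] \<epsilon>
      by (intro add_right_mono mult_mono power_mono) auto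
    finally have main: "class_of (k n) \<bullet> class_of ?w \<le> \<epsilon> / 2 * (norm v)\<^sup>2 + real n * C * ?\<Sigma>" by simp
    have "(class_of h - class_of (k n)) \<bullet> class_of ?w \<le> norm (class_of h - class_of (k n)) * norm (class_of ?w)"
      by (rule norm_cauchy_schwarz)
    also have "\<dots> \<le> \<delta> * (S * norm v * norm v)"
      using n \<delta> by (intro mult_mono sw(2)) (auto simp: norm_minus_commute)
    also have "\<dots> = (S / (S + 1)) * (\<epsilon> / 2 * (norm v)\<^sup>2)" using S by (simp add: \<delta>_def power2_eq_square algebra_simps)
    also have "\<dots> \<le> 1 * (\<epsilon> / 2 * (norm v)\<^sup>2)"
      using S \<epsilon> by (intro mult_right_mono) auto
    finally have rest: "(class_of h - class_of (k n)) \<bullet> class_of ?w \<le> \<epsilon> / 2 * (norm v)\<^sup>2" by simp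
    have "(norm (sobolev_product U v))\<^sup>2 = sobolev_product U U \<bullet> sobolev_product v v"
      unfolding power2_norm_eq_inner by (rule sobolev_product_inner_sym[OF dim])
    also have "\<dots> = class_of h \<bullet> class_of ?w"
      by (simp add: sobolev_product_H1[OF dim] U v h_def[abs_def])
    also have "\<dots> = (class_of h - class_of (k n)) \<bullet> class_of ?w + class_of (k n) \<bullet> class_of ?w" by (simp add: inner_diff_left)
    also have "\<dots> \<le> \<epsilon> * (norm v)\<^sup>2 + real n * C * ?\<Sigma>" using main rest by simp
    finally show "(norm (sobolev_product U v))\<^sup>2 \<le> \<epsilon> * (norm v)\<^sup>2 + real n * C * ?\<Sigma>" .
  qed
qed

locale scalar_ground_state =
  fixes \<Omega> :: "'a::euclidean_space set" and lam :: real and U :: "'a sobolev"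
  assumes dim: "DIM('a) \<le> 3" and \<Omega>: "open \<Omega>" "\<Omega> \<noteq> {}" and lam: "lam > 0"
    and ground: "least_energy_positive_solution \<Omega> lam U" and nondeg: "nondegenerate \<Omega> lam U"
begin

abbreviation "H \<equiv> H_space \<Omega>"
abbreviation "B \<equiv> sobolev_form lam :: 'a sobolev \<Rightarrow> 'a sobolev \<Rightarrow> real"
abbreviation "\<beta> \<equiv> sobolev_product :: 'a sobolev \<Rightarrow> 'a sobolev \<Rightarrow> ('a, real) L2"

sublocale B: bounded_bilinear B by (rule bounded_bilinear_sobolev_form)
sublocale \<beta>: bounded_bilinear \<beta> by (rule bounded_bilinear_sobolev_product[OF dim])

lemmas B_sym = sobolev_form_sym[of lam]
lemmas \<beta>_sym = sobolev_product_sym[OF dim]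
lemmas \<beta>_inner_sym = sobolev_product_inner_sym[OF dim]

lemma H_H10: "u \<in> H \<Longrightarrow> u \<in> H10 \<Omega>" using H_space_subset_H10 by blast
lemma H_H1: "u \<in> H \<Longrightarrow> u \<in> H1" using H_H10 H10_subset_H1 by blast

lemma U_in: "U \<in> H" and U_pos: "AE x in lborel. x \<in> \<Omega> \<longrightarrow> val U x > 0"
  using ground by (auto simp: least_energy_positive_solution_def scalar_solution_def pos_on_def)

text \<open>Weak solutions are tested with all test functions on \<Omega>, so the Euler equation
  holds on \<open>H10 \<Omega>\<close> even when H is the radial space.\<close>

lemma euler_H10: "w \<in> H10 \<Omega> \<Longrightarrow> B U w = \<beta> U U \<bullet> \<beta> U w"
proof -
  have "weak_solution \<Omega> lam U (\<lambda>x. (val U x) ^ 3)"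
    using ground by (simp add: least_energy_positive_solution_def scalar_solution_def)
  then show "w \<in> H10 \<Omega> \<Longrightarrow> B U w = \<beta> U U \<bullet> \<beta> U w"
    using weak_solution_iff[OF dim \<Omega>(1) H_H10 H_H10 H_H10 H_H10, OF U_in U_in U_in U_in, of "\<lambda>x. (val U x) ^ 3" 1 lam]
    by (simp add: power3_eq_cube)
qed

lemma B_lower: "min 1 lam * (norm u)\<^sup>2 \<le> B u u"
  by (rule sobolev_form_lower_bound)

lemma B_pos: "u \<noteq> 0 \<Longrightarrow> B u u > 0"
  using B_lower[of u] lam by (smt (verit) mult_pos_pos zero_less_norm_iff zero_less_power)

lemma U_nonzero: "U \<noteq> 0"
proof
  assume "U = 0"
  then have "AE x in lborel. val U x = 0" using fun_of_zero[where 'a = 'a and 'b = real] by (simp add: val_def)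
  then have "AE x in lborel. x \<notin> \<Omega>" using U_pos by eventually_elim auto
  with not_AE_outside_open[OF \<Omega>] show False ..
qed

lemma set_integral_form:
  assumes "u \<in> H10 \<Omega>"
  shows "(LINT x:\<Omega>|lborel. ((norm (wgrad u x))\<^sup>2 + lam * (val u x)\<^sup>2)) = B u u"
  using sobolev_form_integral[OF dim \<Omega>(1) assms, of u lam]
  by (simp add: power2_norm_eq_inner power2_eq_square[of "val u _"] mult.assoc)

lemma set_integral_fourth_power:
  assumes "u \<in> H10 \<Omega>"
  shows "(LINT x:\<Omega>|lborel. (val u x) ^ 4) = \<beta> u u \<bullet> \<beta> u u"
  using sobolev_product_integral[OF dim \<Omega>(1) assms assms assms assms] by (simp add: power4_eq_xxxx)

text \<open>Four times the energy of the multiple of w on the Nehari manifold is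
  \<open>(B w w)\<^sup>2 / (\<beta> w w \<bullet> \<beta> w w)\<close>.\<close>

lemma ground_state_bound:
  assumes w: "w \<in> H"
  shows "B U U * (\<beta> w w \<bullet> \<beta> w w) \<le> (B w w)\<^sup>2"
proof (cases "\<beta> w w \<bullet> \<beta> w w = 0")
  case False
  then have p: "\<beta> w w \<bullet> \<beta> w w > 0" by simp
  have w0: "w \<noteq> 0"
  proof
    assume "w = 0"
    then have "\<beta> w w = 0" by (simp only: \<beta>.zero_left)
    with False show False by simp
  qed
  \<comment> \<open>The square of the factor that moves w onto the Nehari manifold.\<close>
  define q where "q = B w w / (\<beta> w w \<bullet> \<beta> w w)"
  define v where "v = sqrt q *\<^sub>R w"
  have q: "q > 0" using p B_pos[OF w0] by (simp add: q_def)
  have v: "v \<in> H" unfolding v_def by (rule subspace_scale[OF subspace_H_space w])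
  have Bv: "B v v = q * B w w" using q by (simp add: v_def B.scaleR_left B.scaleR_right flip: mult.assoc)
  have "\<beta> v v \<bullet> \<beta> v v = q * (q * (\<beta> w w \<bullet> \<beta> w w))"
  proof -
    have "\<beta> v v = q *\<^sub>R \<beta> w w" using q by (simp add: v_def \<beta>.scaleR_left \<beta>.scaleR_right)
    then show ?thesis by simp
  qed
  also have "\<dots> = q * B w w" using p by (simp add: q_def)
  finally have \<beta>v: "\<beta> v v \<bullet> \<beta> v v = B v v" by (simp add: Bv)
  have "v \<in> nehari_set \<Omega> lam"
    using v w0 q by (simp add: nehari_set_def set_integral_form set_integral_fourth_power H_H10 \<beta>v) (simp add: v_def)
  then have "scalar_energy \<Omega> lam U \<le> scalar_energy \<Omega> lam v"
    using ground by (simp add: least_energy_positive_solution_def)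
  then have "B U U \<le> B v v"
    using euler_H10[OF H_H10[OF U_in]]
    by (simp add: scalar_energy_def set_integral_form set_integral_fourth_power H_H10[OF U_in] H_H10[OF v] \<beta>v)
  then have "B U U * (\<beta> w w \<bullet> \<beta> w w) \<le> B v v * (\<beta> w w \<bullet> \<beta> w w)" using p by (intro mult_right_mono) auto
  also have "\<dots> = (B w w)\<^sup>2" using p by (simp add: Bv q_def power2_eq_square)
  finally show ?thesis .
qed simp

text \<open>\<open>ground_state_bound\<close> is an equality at U. At \<open>U + t v\<close> with v
  orthogonal to U the terms without t cancel and linear ones are absent, so \<open>t\<^sup>2\<close>
  can be divided out; as t decreases to 0 there remains
  \<open>2 B U U (B v v - 3 |\<beta> U v|\<^sup>2) \<ge> 0\<close>.\<close>

lemma second_variation_nonneg: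
  assumes v: "v \<in> H" and 0: "B U v = 0"
  shows "3 * (norm (\<beta> U v))\<^sup>2 \<le> B v v"
proof -
  define b where "b = B U U"
  define s where "s = (norm (\<beta> U v))\<^sup>2"
  define c3 where "c3 = \<beta> U v \<bullet> \<beta> v v"
  define c4 where "c4 = \<beta> v v \<bullet> \<beta> v v"
  have b: "b > 0" unfolding b_def by (rule B_pos[OF U_nonzero])
  have bb: "\<beta> U U \<bullet> \<beta> U U = b" using euler_H10[OF H_H10[OF U_in]] by (simp add: b_def)
  have XY: "\<beta> U U \<bullet> \<beta> U v = 0" using euler_H10[OF H_H10[OF v]] 0 by simp
  have XZ: "\<beta> U U \<bullet> \<beta> v v = s" unfolding s_def power2_norm_eq_inner by (rule \<beta>_inner_sym)
  have YY: "\<beta> U v \<bullet> \<beta> U v = s" by (simp add: s_def power2_norm_eq_inner)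
  have YX: "\<beta> U v \<bullet> \<beta> U U = 0" and ZX: "\<beta> v v \<bullet> \<beta> U U = s" and ZY: "\<beta> v v \<bullet> \<beta> U v = c3"
    unfolding c3_def by (subst inner_commute, fact XY XZ refl)+
  have pos: "0 \<le> b * (2 * (B v v - 3 * s)) + (- 4 * b * c3) * t + ((B v v)\<^sup>2 - b * c4) * t\<^sup>2" if t: "t > 0" for t
  proof -
    let ?w = "U + t *\<^sub>R v"
    have w: "?w \<in> H" by (intro subspace_add[OF subspace_H_space] subspace_scale[OF subspace_H_space] U_in v)
    have Bw: "B ?w ?w = b + t\<^sup>2 * B v v"
      unfolding B.add_left B.add_right B.scaleR_left B.scaleR_right B_sym[of v U] 0 by (simp add: b_def power2_eq_square)
    have "\<beta> ?w ?w = \<beta> U U + (2 * t) *\<^sub>R \<beta> U v + t\<^sup>2 *\<^sub>R \<beta> v v"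
      unfolding \<beta>.add_left \<beta>.add_right \<beta>.scaleR_left \<beta>.scaleR_right \<beta>_sym[of v U]
      by (simp only: power2_eq_square mult_2 scaleR_left_distrib scaleR_right_distrib scaleR_scaleR add.assoc)
    then have "\<beta> ?w ?w \<bullet> \<beta> ?w ?w = b + 6 * s * t\<^sup>2 + 4 * c3 * t ^ 3 + c4 * t ^ 4"
      by (simp add: inner_add_left inner_add_right bb XY XZ YY YX ZX ZY c3_def[symmetric] c4_def[symmetric])
        (simp add: power2_eq_square power3_eq_cube power4_eq_xxxx algebra_simps)
    then have "b * (b + 6 * s * t\<^sup>2 + 4 * c3 * t ^ 3 + c4 * t ^ 4) \<le> (b + t\<^sup>2 * B v v)\<^sup>2"
      using ground_state_bound[OF w] unfolding Bw by (simp add: b_def)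
    then have "0 \<le> t\<^sup>2 * (b * (2 * (B v v - 3 * s)) + (- 4 * b * c3) * t + ((B v v)\<^sup>2 - b * c4) * t\<^sup>2)"
      by (simp add: power2_eq_square power3_eq_cube power4_eq_xxxx algebra_simps)
    then show ?thesis using t by (simp add: zero_le_mult_iff)
  qed
  have "0 \<le> b * (2 * (B v v - 3 * s))"
  proof (rule tendsto_lowerbound)
    show "((\<lambda>t. b * (2 * (B v v - 3 * s)) + (- 4 * b * c3) * t + ((B v v)\<^sup>2 - b * c4) * t\<^sup>2)
        \<longlongrightarrow> b * (2 * (B v v - 3 * s))) (at_right 0)"
      by (auto intro!: tendsto_eq_intros)
    show "\<forall>\<^sub>F t in at_right 0. 0 \<le> b * (2 * (B v v - 3 * s)) + (- 4 * b * c3) * t + ((B v v)\<^sup>2 - b * c4) * t\<^sup>2"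
      using pos by (auto simp: eventually_at_right_field intro!: exI[of _ 1])
  qed simp
  then show ?thesis using b by (simp add: zero_le_mult_iff s_def)
qed

text \<open>The hypothesis tests with H only, whereas nondegeneracy speaks of solutions tested with
  all test functions; in the radial case \<open>symmetric_criticality\<close> bridges the
  difference, otherwise H is \<open>H10 \<Omega>\<close>.\<close>

lemma linearized_kernel:
  assumes v: "v \<in> H" and crit: "\<And>w. w \<in> H \<Longrightarrow> B v w = 3 * (\<beta> U U \<bullet> \<beta> v w)"
  shows "v = 0"
proof -
  have "B v w = 3 * (\<beta> U U \<bullet> \<beta> v w)" if w: "w \<in> H10 \<Omega>" for w
  proof (cases "\<Omega> = UNIV")
    case True
    show ?thesis
      using symmetric_criticality[OF dim, of v U lam 3 w] v U_in crit w H10_subset_H1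
      by (auto simp: H_space_def True)
  next
    case False
    with w crit show ?thesis by (simp add: H_space_def)
  qed
  then have "weak_solution \<Omega> lam v (\<lambda>x. 3 * (val U x)\<^sup>2 * val v x)"
    by (subst weak_solution_iff[OF dim \<Omega>(1) H_H10 H_H10 H_H10 H_H10, OF v U_in U_in v])
      (auto simp: power2_eq_square)
  with nondeg v show ?thesis by (auto simp: nondegenerate_def)
qed

lemma linearization_coercive:
  "\<exists>\<kappa>>0. \<forall>w\<in>H. B U w = 0 \<longrightarrow> \<kappa> * (norm w)\<^sup>2 \<le> B w w - 3 * (norm (\<beta> U w))\<^sup>2"
proof -
  define S where "S = {w\<in>H. B U w = 0}"
  define Q where "Q v w = B v w + (- 3) * (\<beta> U v \<bullet> \<beta> U w)" for v w
  define m where "m = min 1 lam"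
  have m: "m > 0" using lam by (simp add: m_def)
  have S: "subspace S" "closed S"
  proof -
    show "subspace S" using subspace_H_space[of \<Omega>] unfolding subspace_def S_def
      by (simp add: Ball_def B.zero_right B.add_right B.scaleR_right del: split_paired_All)
    have "closed (H \<inter> {w. B U w = 0})"
      by (intro closed_Int closed_H_space closed_Collect_eq linear_continuous_on B.bounded_linear_right continuous_on_const)
    then show "closed S" by (simp add: S_def Collect_conj_eq)
  qed
  have Q: "bounded_bilinear Q" unfolding Q_def
    by (intro bounded_bilinear_linear_combination B.bounded_bilinear_axioms
        bounded_bilinear.comp[OF bounded_bilinear_inner] \<beta>.bounded_linear_right)
  have projection: "w - (B U w / B U U) *\<^sub>R U \<in> S" if "w \<in> H" for w
    using that B_pos[OF U_nonzero] subspace_diff[OF subspace_H_space that subspace_scale[OF subspace_H_space U_in]]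
    by (simp add: S_def B.diff_right B.scaleR_right)
  interpret Q: bounded_bilinear Q by (rule Q)
  \<comment> \<open>One sixth: multiplied by the 3 in \<open>Q\<close> it uses up half of m and
    leaves m / 2 for the Garding inequality.\<close>
  obtain I :: "'a set set" and f C where I: "finite I" "C \<ge> 0"
    "\<And>v. v \<in> H1 \<Longrightarrow> (norm (\<beta> U v))\<^sup>2 \<le> m / 6 * (norm v)\<^sup>2 + C * (\<Sum>q\<in>I. (f q \<bullet> v)\<^sup>2)"
    by (rule potential_finite_rank_bound[OF dim H_H1[OF U_in], of "m / 6"]) (use m in auto)
  have "\<exists>\<kappa>>0. \<forall>v\<in>S. \<kappa> * (norm v)\<^sup>2 \<le> Q v v"
  proof (rule coercive_if_nonnegative[OF S Q])
    show "Q u v = Q v u" for u v by (simp add: Q_def B_sym[of u v] inner_commute)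
    show "0 \<le> Q v v" if "v \<in> S" for v
      using second_variation_nonneg[of v] that by (simp add: Q_def S_def power2_norm_eq_inner)
    show "v = 0" if v: "v \<in> S" and Qv: "\<And>w. w \<in> S \<Longrightarrow> Q v w = 0" for v
    \<comment> \<open>It suffices to be in the kernel relative to the complement of U:
      \<open>Q v U = 0\<close> by the Euler equation, so the relation extends to all of H through
      the splitting of w along U.\<close>
    proof (rule linearized_kernel)
      show "v \<in> H" using v by (simp add: S_def)
      fix w assume w: "w \<in> H"
      have "Q v U = B v U - 3 * (\<beta> U U \<bullet> \<beta> U v)" by (simp add: Q_def inner_commute)
      also have "\<dots> = 0" using euler_H10[OF H_H10, of v] v by (simp add: S_def B_sym[of v U])
      finally have "Q v U = 0" .
      then have "Q v w = 0"
        using Qv[OF projection[OF w]] unfolding Q.diff_right Q.scaleR_right by simp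
      moreover have "\<beta> U v \<bullet> \<beta> U w = \<beta> U U \<bullet> \<beta> v w" by (rule \<beta>_inner_sym)
      ultimately show "B v w = 3 * (\<beta> U U \<bullet> \<beta> v w)" by (simp add: Q_def)
    qed
    show "m / 2 > 0" using m by simp
    show "3 * C \<ge> 0" using I(2) by simp
    show "finite I" by (rule I)
    show "m / 2 * (norm v)\<^sup>2 \<le> Q v v + 3 * C * (\<Sum>q\<in>I. (f q \<bullet> v)\<^sup>2)" if "v \<in> S" for v
    proof -
      have "m * (norm v)\<^sup>2 \<le> B v v" unfolding m_def by (rule B_lower)
      moreover have "(norm (\<beta> U v))\<^sup>2 \<le> m / 6 * (norm v)\<^sup>2 + C * (\<Sum>q\<in>I. (f q \<bullet> v)\<^sup>2)"
        using that by (intro I(3) H_H1) (simp add: S_def)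
      ultimately show ?thesis by (simp add: Q_def power2_norm_eq_inner)
    qed
  qed
  then show ?thesis by (auto simp: Q_def S_def power2_norm_eq_inner)
qed

text \<open>Testing row i with U itself turns the equation for \<open>c $ i *\<^sub>R U\<close> into
  an identity of numbers in which \<open>c $ i * B U U\<close> cancels. The sign of
  \<open>c $ i\<close> is that of the quotient of two functions positive on \<Omega>, which is not a
  null set.\<close>

lemma synchronized_solution:
  fixes A :: "real ^ 'n ^ 'n"
  assumes sol: "positive_vector_solution \<Omega> lam A (vec_mult c U)"
  shows "c $ i > 0" "(\<Sum>j\<in>UNIV. A $ i $ j * (c $ j)\<^sup>2) = 1"
proof -
  have pos: "AE x in lborel. x \<in> \<Omega> \<longrightarrow> val (c $ i *\<^sub>R U) x > 0"
    using sol by (simp add: positive_vector_solution_def vec_mult_def pos_on_def)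
  show c: "c $ i > 0"
  proof (rule ccontr)
    assume "\<not> c $ i > 0"
    have "AE x in lborel. x \<notin> \<Omega>"
      using pos U_pos val_scaleR[of "c $ i" U]
      by eventually_elim (use \<open>\<not> c $ i > 0\<close> in \<open>auto simp: zero_less_mult_iff\<close>)
    with not_AE_outside_open[OF \<Omega>] show False ..
  qed
  let ?f = "\<lambda>x. \<Sum>j\<in>UNIV. A $ i $ j * val (c $ i *\<^sub>R U) x * (val (c $ j *\<^sub>R U) x)\<^sup>2"
  let ?r = "c $ i * (\<Sum>j\<in>UNIV. A $ i $ j * (c $ j)\<^sup>2)"
  have "AE x in lborel. \<forall>j. val (c $ j *\<^sub>R U) x = c $ j * val U x"
    by (simp add: AE_all_countable val_scaleR)
  then have f: "AE x in lborel. ?f x = ?r * (val U x * val U x * val U x)"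
    by eventually_elim (simp add: sum_distrib_left sum_distrib_right power2_eq_square mult_ac)
  have "weak_solution \<Omega> lam (c $ i *\<^sub>R U) ?f"
    using sol by (simp add: positive_vector_solution_def vec_mult_def)
  then have "B (c $ i *\<^sub>R U) U = ?r * (\<beta> U U \<bullet> \<beta> U U)"
    using weak_solution_iff[OF dim \<Omega>(1) H_H10 H_H10 H_H10 H_H10, OF subspace_scale[OF subspace_H_space U_in] U_in U_in U_in _ f, of lam]
      H_H10[OF U_in] by auto
  then have "c $ i * B U U = ?r * B U U" using euler_H10[OF H_H10[OF U_in]] by (simp add: B.scaleR_left)
  then show "(\<Sum>j\<in>UNIV. A $ i $ j * (c $ j)\<^sup>2) = 1" using c B_pos[OF U_nonzero] by simp
qed

end

text \<open>X need not be a neighbourhood of u. Restricted to the line through u in direction h,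
  which stays in X, both derivatives become derivatives on the reals, and those are unique.\<close>

lemma derivative_within_subspace_unique:
  fixes f :: "'e::real_normed_vector \<Rightarrow> 'f::real_normed_vector"
  assumes X: "subspace X" "u \<in> X" "h \<in> X"
    and D: "(f has_derivative D) (at u within X)" "(f has_derivative D') (at u within X)"
  shows "D h = D' h"
proof -
  let ?l = "\<lambda>t::real. u + t *\<^sub>R h"
  have l: "(?l has_derivative (\<lambda>t. t *\<^sub>R h)) (at 0)" by (auto intro!: derivative_eq_intros)
  have sub: "range ?l \<subseteq> X" using X by (auto intro!: subspace_add subspace_scale)
  have "((\<lambda>t. f (?l t)) has_derivative (\<lambda>t. E (t *\<^sub>R h))) (at 0)" if E: "(f has_derivative E) (at u within X)" for E
  proof -
    have "(f has_derivative E) (at (?l 0) within range ?l)" using has_derivative_subset[OF E sub] by simp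
    from has_derivative_in_compose[OF l this] show ?thesis by simp
  qed
  from has_derivative_unique[OF this[OF D(1)] this[OF D(2)]] have "(\<lambda>t::real. D (t *\<^sub>R h)) = (\<lambda>t. D' (t *\<^sub>R h))" .
  from fun_cong[OF this, of 1] show ?thesis by simp
qed

theorem theorem4p4:
  fixes \<Omega> :: "'a::euclidean_space set" and lam :: real
    and A :: "real ^ 'n ^ 'n" and c :: "real ^ 'n" and U :: "'a sobolev"
  assumes "DIM('a) \<le> 3"
    and "open \<Omega>" and "connected \<Omega>" and "\<Omega> \<noteq> {}"
    and "lam > 0"
    and "\<And>i j. A $ i $ j = A $ j $ i" and "\<And>i j. 0 \<le> A $ i $ j"
    and "least_energy_positive_solution \<Omega> lam U"
    and "positive_vector_solution \<Omega> lam A (vec_mult c U)"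
    and "invertible A"
    and "nondegenerate \<Omega> lam U"
  shows "\<exists>V. openin (top_of_set (M_set \<Omega> lam A)) V \<and> vec_mult c U \<in> V \<and>
           smooth_submanifold_of_codim CARD('n) (H_vec \<Omega>) V \<and>
           strict_local_min_on (I_fun \<Omega> lam A) V (vec_mult c U)"
proof -
  interpret S: scalar_ground_state \<Omega> lam U using assms by unfold_locales
  obtain \<kappa> where \<kappa>: "\<kappa> > 0"
    "\<And>w. w \<in> H_space \<Omega> \<Longrightarrow> S.B U w = 0 \<Longrightarrow> \<kappa> * (norm w)\<^sup>2 \<le> S.B w w - 3 * (norm (S.\<beta> U w))\<^sup>2"
    using S.linearization_coercive by metis
  interpret G: coupled_ground_state "H_space \<Omega>" S.B S.\<beta> U \<kappa> A c
  proof (rule coupled_ground_state.intro)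
    show "subspace (H_space \<Omega>)" by (rule subspace_H_space)
    show "U \<in> H_space \<Omega>" by (rule S.U_in)
    show "bounded_bilinear S.B" by (rule bounded_bilinear_sobolev_form)
    show "bounded_bilinear S.\<beta>" by (rule bounded_bilinear_sobolev_product[OF assms(1)])
    show "S.B u v = S.B v u" for u v by (rule S.B_sym)
    show "S.\<beta> u v = S.\<beta> v u" for u v by (rule S.\<beta>_sym)
    show "S.\<beta> u v \<bullet> S.\<beta> w z = S.\<beta> u w \<bullet> S.\<beta> v z" for u v w z by (rule S.\<beta>_inner_sym)
    show "S.B U U > 0" by (rule S.B_pos[OF S.U_nonzero])
    show "S.B U w = S.\<beta> U U \<bullet> S.\<beta> U w" if "w \<in> H_space \<Omega>" for w by (rule S.euler_H10[OF S.H_H10[OF that]])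
    show "c $ i > 0" "(\<Sum>j\<in>UNIV. A $ i $ j * (c $ j)\<^sup>2) = 1" for i
      using S.synchronized_solution[OF assms(9)] by auto
  qed (use assms \<kappa> in auto)
  have Hn: "G.Hn = H_vec \<Omega>" by (simp add: G.Hn_def H_vec_def)
  have p: "G.p = vec_mult c U" by (simp add: G.p_def vec_mult_def)
  \<comment> \<open>The agreement is claimed on \<open>H_vec \<Omega>\<close> only: there the
    projection inside \<beta> is the identity, and the components vanish outside \<Omega>.\<close>
  have I: "I_fun \<Omega> lam A u = G.energy u" if u: "u \<in> H_vec \<Omega>" for u
  proof -
    have ui: "u $ i \<in> H10 \<Omega>" for i using u by (auto simp: H_vec_def intro: S.H_H10)
    have int: "integrable lborel (\<lambda>x. val (u $ i) x * val (u $ i) x * val (u $ j) x * val (u $ j) x)" for i j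
      by (intro integrable_sobolev_product assms(1) in_H1[OF assms(1,2)] ui)
    have si: "set_integrable lborel \<Omega> (\<lambda>x. A $ i $ j * (val (u $ i) x)\<^sup>2 * (val (u $ j) x)\<^sup>2)" for i j
    proof -
      have "integrable lborel (\<lambda>x. A $ i $ j * (val (u $ i) x * val (u $ i) x * val (u $ j) x * val (u $ j) x))"
        by (rule integrable_mult_right[OF int])
      then have "integrable lborel (\<lambda>x. A $ i $ j * (val (u $ i) x)\<^sup>2 * (val (u $ j) x)\<^sup>2)"
        by (simp add: power2_eq_square mult_ac)
      then show ?thesis unfolding set_integrable_def using assms(2) by (intro integrable_mult_indicator) auto
    qed
    have "(LINT x:\<Omega>|lborel. (\<Sum>i\<in>UNIV. \<Sum>j\<in>UNIV. A $ i $ j * (val (u $ i) x)\<^sup>2 * (val (u $ j) x)\<^sup>2))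
        = (\<Sum>i\<in>UNIV. \<Sum>j\<in>UNIV. LINT x:\<Omega>|lborel. A $ i $ j * (val (u $ i) x)\<^sup>2 * (val (u $ j) x)\<^sup>2)"
      using si unfolding set_lebesgue_integral_def set_integrable_def scaleR_sum_right
      by (simp only: Bochner_Integration.integral_sum Bochner_Integration.integrable_sum)
    also have "\<dots> = (\<Sum>i\<in>UNIV. \<Sum>j\<in>UNIV. A $ i $ j * (S.\<beta> (u $ i) (u $ i) \<bullet> S.\<beta> (u $ j) (u $ j)))"
    proof (intro sum.cong refl)
      fix i j
      have "(LINT x:\<Omega>|lborel. A $ i $ j * (val (u $ i) x)\<^sup>2 * (val (u $ j) x)\<^sup>2)
          = (LINT x:\<Omega>|lborel. A $ i $ j * (val (u $ i) x * val (u $ i) x * val (u $ j) x * val (u $ j) x))"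
        by (simp add: power2_eq_square mult_ac)
      also have "\<dots> = A $ i $ j * (S.\<beta> (u $ i) (u $ i) \<bullet> S.\<beta> (u $ j) (u $ j))"
        by (simp add: sobolev_product_integral[OF assms(1,2) ui ui ui ui])
      finally show "(LINT x:\<Omega>|lborel. A $ i $ j * (val (u $ i) x)\<^sup>2 * (val (u $ j) x)\<^sup>2)
          = A $ i $ j * (S.\<beta> (u $ i) (u $ i) \<bullet> S.\<beta> (u $ j) (u $ j))" .
    qed
    finally show ?thesis by (simp add: I_fun_def G.energy_def S.set_integral_form[OF ui])
  qed
  \<comment> \<open>Since the two functionals are known to agree on \<open>H_vec \<Omega>\<close>
    only, their derivatives are compared on directions of that space, and
    \<open>axis l (u $ l)\<close> is one of them.\<close>
  have J: "J_fun \<Omega> lam A l u = G.constraint l u" if u: "u \<in> H_vec \<Omega>" for l u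
  proof -
    obtain D where D: "(G.energy has_derivative D) (at u)" "\<And>l. D (axis l (u $ l)) = G.constraint l u"
      using G.energy_has_derivative by metis
    have "(I_fun \<Omega> lam A has_derivative D) (at u within H_vec \<Omega>)"
      by (rule has_derivative_transform[OF u _ has_derivative_at_withinI[OF D(1)]]) (rule I)
    moreover from this have "(I_fun \<Omega> lam A has_derivative frechet_derivative (I_fun \<Omega> lam A) (at u within H_vec \<Omega>)) (at u within H_vec \<Omega>)"
      unfolding frechet_derivative_works[symmetric] differentiable_def by blast
    moreover have "axis l (u $ l) \<in> H_vec \<Omega>"
      using u subspace_0[OF subspace_H_space[of \<Omega>]] by (auto simp: H_vec_def axis_def)
    ultimately show ?thesis
      unfolding J_fun_def D(2)[symmetric]
      by (intro derivative_within_subspace_unique[OF G.subspace_Hn[unfolded Hn] u])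
  qed
  have M: "G.M = M_set \<Omega> lam A" unfolding G.M_def M_set_def Hn using J by auto
  obtain V where V: "openin (top_of_set G.M) V" "G.p \<in> V" "smooth_submanifold_of_codim CARD('n) G.Hn V"
    "strict_local_min_on G.energy V G.p"
    using G.manifold_and_strict_local_min by (elim exE conjE)
  have "V \<subseteq> H_vec \<Omega>" using openin_imp_subset[OF V(1)] by (auto simp: G.M_def Hn)
  then have "I_fun \<Omega> lam A u = G.energy u" if "u \<in> V" for u using I that by blast
  then have "strict_local_min_on (I_fun \<Omega> lam A) V G.p"
    using V(2,4) by (simp add: strict_local_min_on_def)
  with V show ?thesis unfolding M Hn p by blast
qed

end
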